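(* Let $E$ be an admissible sequentially complete complex locally convex Hausdorff space. Then the canonical (restriction) map $$\mathcal{R}_{\mathbb{R}}\colon\mathcal{O}^{exp}(\overline{\mathbb{C}}\setminus\overline{\mathbb{R}},E)/\mathcal{O}^{exp}(\overline{\mathbb{C}}\setminus\{\pm\infty\},E)\to\mathcal{B}(\mathbb{R},E),\quad[F]\mapsto[F],$$ and the asymptotic Fourier transform $$\mathcal{F}^{\mathcal{B}}_{\mathbb{R}}\colon\mathcal{B}(\mathbb{R},E)\to\mathcal{O}^{exp}(\overline{\mathbb{C}}\setminus\overline{\mathbb{R}},E)/\bigl(\mathcal{O}^{exp}(\overline{\mathbb{C}},E)\oplus\mathcal{FO}_{\{\pm\infty\}}(E)\bigr),\quad\mathcal{F}^{\mathcal{B}}_{\mathbb{R}}(f):=[(\mathcal{F}_{\overline{\mathbb{R}}}\circ\mathcal{R}_{\mathbb{R}}^{-1})(f)],$$ are linear isomorphisms.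
   Context: $\mathbb{N}=\{1,2,\dots\}$, $\overline{\mathbb{R}}:=\mathbb{R}\cup\{\pm\infty\}$, $\overline{\mathbb{C}}:=\overline{\mathbb{R}}+i\mathbb{R}$, $\mathbb{H}:=\{z\in\mathbb{C}\mid\operatorname{Im}z>0\}$. $E$ carries a directed system of seminorms $(p_\alpha)_{\alpha\in\mathfrak{A}}$ generating its topology. $\mathcal{O}(\Omega,E)$ and $\mathcal{C}^\infty(\Omega,E)$ are the spaces of $E$-valued holomorphic resp. infinitely continuously partially differentiable functions on open $\Omega\subset\mathbb{C}=\mathbb{R}^2$. Put $d(z,M):=\inf_{w\in M}|z-w|$, $d(z,\emptyset):=\infty$. For compact $K\subset\overline{\mathbb{R}}$ and $c>0$, $U_{1/c}(K)$ is the union of $\{z\in\mathbb{C}\mid d(z,K\cap\mathbb{C})<c\}$ with the strip $]1/c,\infty[\,+\,i\,]-c,c[$ if $\infty\in K$ and with the strip $]-\infty,-1/c[\,+\,i\,]-c,c[$ if $-\infty\in K$. For $n\in\mathbb{N}$ put $S_n(K):=(\mathbb{C}\setminus\overline{U_n(K)})\cap\{z\mid|\operatorname{Im}z|<n\}$ ($U_n(K)$ is $U_{1/c}(K)$ with $c=1/n$). $\mathcal{O}^{exp}(\overline{\mathbb{C}}\setminus K,E)$ is the space of all $f\in\mathcal{O}(\mathbb{C}\setminus K,E)$ with $\sup_{z\in S_n(K)}p_\alpha(f(z))e^{-\frac1n|\operatorname{Re}z|}<\infty$ for all $n\in\mathbb{N}$, $\alpha\in\mathfrak{A}$; $bv_K(E):=\mathcal{O}^{exp}(\overline{\mathbb{C}}\setminus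 K,E)/\mathcal{O}^{exp}(\overline{\mathbb{C}},E)$. $\mathcal{E}^{exp}(\overline{\mathbb{C}}\setminus K,E)$ is the space of all $f\in\mathcal{C}^\infty(\mathbb{C}\setminus K,E)$ with $\sup_{z\in S_n(K),\,|\beta|\le m}p_\alpha(\partial^\beta f(z))e^{-\frac1n|\operatorname{Re}z|}<\infty$ for all $n\in\mathbb{N}$, $m\in\mathbb{N}_0$, $\alpha\in\mathfrak{A}$ (conditions over empty sets are void). $E$ is admissible if the Cauchy-Riemann operator $\overline{\partial}\colon\mathcal{E}^{exp}(\overline{\mathbb{C}}\setminus K,E)\to\mathcal{E}^{exp}(\overline{\mathbb{C}}\setminus K,E)$ is surjective for every compact $K\subset\overline{\mathbb{R}}$. $\mathcal{B}(\mathbb{R},E):=\mathcal{O}(\mathbb{C}\setminus\mathbb{R},E)/\mathcal{O}(\mathbb{C},E)$. $\mathcal{FO}_{\{\infty\}}(E)$ is the space of all $f\in\mathcal{O}(-\mathbb{H},E)$ with $\sup_{\operatorname{Im}z\le-\frac1k}p_\alpha(f(z))e^{-\frac1k|z|+k|\operatorname{Im}z|}<\infty$ for all $k,\alpha$; $\mathcal{FO}_{\{-\infty\}}(E)$ is the space of all $f\in\mathcal{O}(\mathbb{H},E)$ with $\sup_{\operatorname{Im}z\ge\frac1k}p_\alpha(f(z))e^{-\frac1k|z|+k|\operatorname{Im}z|}<\infty$ for all $k,\alpha$. $\mathcal{FO}_{\{\pm\infty\}}(E):=\mathcal{FO}_{\{-\infty\}}(E)\oplus\mathcal{FO}_{\{\infty\}}(E)$,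 where $f+g$ is the function equal to $f$ on $\mathbb{H}$ and $g$ on $-\mathbb{H}$; this is regarded as a subspace of $\mathcal{O}^{exp}(\overline{\mathbb{C}}\setminus\overline{\mathbb{R}},E)$. Fourier transform on $bv_{\overline{\mathbb{R}}}(E)$: $\mathcal{P}_*(\overline{\mathbb{R}})$ is the inductive limit over $n\in\mathbb{N}$ (with restrictions as linking maps) of the Banach spaces of functions $\varphi$ holomorphic on $U_n(\overline{\mathbb{R}})=\{|\operatorname{Im}z|<\frac1n\}$, continuous on its closure, with $\sup_{z\in\overline{U_n(\overline{\mathbb{R}})}}|\varphi(z)|e^{\frac1n|\operatorname{Re}z|}<\infty$. $\mathcal{F}\varphi(\zeta):=\int_{\mathbb{R}}\varphi(x)e^{-ix\zeta}dx$ is a topological automorphism of $\mathcal{P}_*(\overline{\mathbb{R}})$. For $T\in L_b(\mathcal{P}_*(\overline{\mathbb{R}}),E)$ (continuous linear maps, topology of uniform convergence on bounded sets) put $\mathcal{F}_\star(T)(\varphi):=T(\mathcal{F}\varphi)$. For $E$ sequentially complete, the map $\mathscr{H}_{\overline{\mathbb{R}}}\colon bv_{\overline{\mathbb{R}}}(E)\to L_b(\mathcal{P}_*(\overline{\mathbb{R}}),E)$, $\mathscr{H}_{\overline{\mathbb{R}}}([F])(\varphi):=\int_\gamma F(\zeta)\varphi(\zeta)d\zeta$ (Pettis integral; $\gamma$ is the boundary of $\{|\operatorname{Im}z|<c\}$ with clockwise orientation, i.e. $\operatorname{Im}=c$ from left to right and $\operatorname{Im}=-c$ from right to left, $0<c<\frac1n$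 where $\varphi$ belongs to the $n$-th step) is a topological isomorphism with inverse $T\mapsto[z\mapsto\frac{i}{2\pi}\langle T,\frac{e^{-(z-\cdot)^2}}{z-\cdot}\rangle]$. Then $\mathcal{F}_{\overline{\mathbb{R}}}:=\mathscr{H}_{\overline{\mathbb{R}}}^{-1}\circ\mathcal{F}_\star\circ\mathscr{H}_{\overline{\mathbb{R}}}\colon bv_{\overline{\mathbb{R}}}(E)\to bv_{\overline{\mathbb{R}}}(E)$. In the definition of $\mathcal{F}^{\mathcal{B}}_{\mathbb{R}}(f)$ one takes any $G\in\mathcal{O}^{exp}(\overline{\mathbb{C}}\setminus\overline{\mathbb{R}},E)$ representing $\mathcal{R}_{\mathbb{R}}^{-1}(f)$, and the class of any representative of $\mathcal{F}_{\overline{\mathbb{R}}}([G])$ in the stated quotient. *)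

theory Defs
  imports "HOL-Analysis.Analysis" "HOL-Library.Function_Algebras"
begin

section \<open>Complex locally convex Hausdorff spaces\<close>

text \<open>
  The topology of \<open>E\<close> is the one of the type class (Hausdorff by \<open>t2_space\<close>); the locale requires
  it to be generated by the directed system \<open>p\<close> of seminorms. Continuity of the addition, which
  follows from this, is part of the type class only to make the library's limit rules applicable.
\<close>

definition seminorm_on_lcs :: "(complex \<Rightarrow> 'e \<Rightarrow> 'e::ab_group_add) \<Rightarrow> ('e \<Rightarrow> real) \<Rightarrow> bool" where
  "seminorm_on_lcs sc q \<longleftrightarrow>
     (\<forall>x y. q (x + y) \<le> q x + q y) \<and> (\<forall>c x. q (sc c x) = cmod c * q x)"

locale lcs = vector_space sc
  for sc :: "complex \<Rightarrow> 'e::{t2_space,topological_ab_group_add} \<Rightarrow> 'e" +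
  fixes p :: "'i \<Rightarrow> 'e \<Rightarrow> real"
  assumes seminorms: "seminorm_on_lcs sc (p i)"
    and directed: "\<exists>k C. \<forall>x. p i x \<le> C * p k x \<and> p j x \<le> C * p k x"
    and generates_topology: "open U \<longleftrightarrow> (\<forall>x\<in>U. \<exists>i. \<exists>\<epsilon>>0. {y. p i (y - x) < \<epsilon>} \<subseteq> U)"

definition seq_complete_lcs ::
    "('i \<Rightarrow> 'e::{t2_space,topological_ab_group_add} \<Rightarrow> real) \<Rightarrow> bool" where
  "seq_complete_lcs p \<longleftrightarrow>
     (\<forall>X :: nat \<Rightarrow> 'e.
        (\<forall>i. \<forall>\<epsilon>>0. \<exists>N. \<forall>m\<ge>N. \<forall>n\<ge>N. p i (X m - X n) < \<epsilon>) \<longrightarrow> convergent X)"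

section \<open>Functions on open subsets of the complex plane\<close>

text \<open>
  A function on \<open>\<Omega>\<close> is represented by the total function that vanishes off \<open>\<Omega>\<close>. Sums of functions
  are the pointwise ones, and restriction is multiplication by the indicator function.
\<close>

definition restr :: "complex set \<Rightarrow> (complex \<Rightarrow> 'e::zero) \<Rightarrow> complex \<Rightarrow> 'e" where
  "restr \<Omega> f = (\<lambda>z. if z \<in> \<Omega> then f z else 0)"

definition hol_space ::
    "(complex \<Rightarrow> 'e \<Rightarrow> 'e::{t2_space,topological_ab_group_add}) \<Rightarrow> complex set
      \<Rightarrow> (complex \<Rightarrow> 'e) set" where
  "hol_space sc \<Omega> =
     {f. (\<forall>z\<in>\<Omega>. \<exists>D. ((\<lambda>w. sc (1 / (w - z)) (f w - f z)) \<longlongrightarrow> D) (at z)) \<and> (\<forall>z. z \<notin> \<Omega> \<longrightarrow> f z = 0)}"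

text \<open>Derivative at \<open>z\<close> in the real direction \<open>v\<close>, used for \<open>v = 1\<close> and \<open>v = \<i>\<close>.\<close>

definition has_partial_deriv ::
    "(complex \<Rightarrow> 'e \<Rightarrow> 'e::{t2_space,topological_ab_group_add}) \<Rightarrow> complex \<Rightarrow> (complex \<Rightarrow> 'e)
      \<Rightarrow> complex \<Rightarrow> 'e \<Rightarrow> bool" where
  "has_partial_deriv sc v f z D \<longleftrightarrow>
     ((\<lambda>h::real. sc (1 / complex_of_real h) (f (z + complex_of_real h * v) - f z)) \<longlongrightarrow> D) (at 0)"

definition partial_deriv ::
    "(complex \<Rightarrow> 'e \<Rightarrow> 'e::{t2_space,topological_ab_group_add}) \<Rightarrow> complex \<Rightarrow> (complex \<Rightarrow> 'e)
      \<Rightarrow> complex \<Rightarrow> 'e" where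
  "partial_deriv sc v f z = (THE D. has_partial_deriv sc v f z D)"

primrec Ck_on ::
    "(complex \<Rightarrow> 'e \<Rightarrow> 'e::{t2_space,topological_ab_group_add}) \<Rightarrow> nat \<Rightarrow> complex set
      \<Rightarrow> (complex \<Rightarrow> 'e) \<Rightarrow> bool" where
  "Ck_on sc 0 \<Omega> f \<longleftrightarrow> continuous_on \<Omega> f"
| "Ck_on sc (Suc k) \<Omega> f \<longleftrightarrow>
     (\<forall>v\<in>{1, \<i>}. (\<forall>z\<in>\<Omega>. \<exists>D. has_partial_deriv sc v f z D) \<and> Ck_on sc k \<Omega> (partial_deriv sc v f))"

definition smooth_space ::
    "(complex \<Rightarrow> 'e \<Rightarrow> 'e::{t2_space,topological_ab_group_add}) \<Rightarrow> complex set
      \<Rightarrow> (complex \<Rightarrow> 'e) set" where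
  "smooth_space sc \<Omega> = {f. (\<forall>k. Ck_on sc k \<Omega> f) \<and> (\<forall>z. z \<notin> \<Omega> \<longrightarrow> f z = 0)}"

definition multi_deriv ::
    "(complex \<Rightarrow> 'e \<Rightarrow> 'e::{t2_space,topological_ab_group_add}) \<Rightarrow> nat \<times> nat \<Rightarrow> (complex \<Rightarrow> 'e)
      \<Rightarrow> complex \<Rightarrow> 'e" where
  "multi_deriv sc \<beta> f =
     (partial_deriv sc 1 ^^ fst \<beta>) ((partial_deriv sc \<i> ^^ snd \<beta>) f)"

definition dbar ::
    "(complex \<Rightarrow> 'e \<Rightarrow> 'e::{t2_space,topological_ab_group_add}) \<Rightarrow> (complex \<Rightarrow> 'e)
      \<Rightarrow> complex \<Rightarrow> 'e" where
  "dbar sc f z = sc (1 / 2) (partial_deriv sc 1 f z + sc \<i> (partial_deriv sc \<i> f z))"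

section \<open>Functions of slow growth\<close>

text \<open>Compact subsets of the extended real line are the compact sets of type \<open>ereal set\<close>.\<close>

definition finite_part :: "ereal set \<Rightarrow> complex set" where
  "finite_part K = {complex_of_real x |x. ereal x \<in> K}"

text \<open>Unlike \<open>infdist\<close>, this distance to the empty set is \<open>\<infinity>\<close>.\<close>

definition edist_set :: "complex \<Rightarrow> complex set \<Rightarrow> ereal" where
  "edist_set z M = (INF w\<in>M. ereal (cmod (z - w)))"

text \<open>The set \<open>U\<^bsub>1/c\<^esub>(K)\<close>; hence \<open>U\<^sub>n(K)\<close> is \<open>nbhd (1 / n) K\<close>.\<close>

definition nbhd :: "real \<Rightarrow> ereal set \<Rightarrow> complex set" where
  "nbhd c K = {z. edist_set z (finite_part K) < ereal c}
     \<union> (if \<infinity> \<in> K then {z. Re z > 1 / c \<and> \<bar>Im z\<bar> < c} else {})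
     \<union> (if -\<infinity> \<in> K then {z. Re z < - (1 / c) \<and> \<bar>Im z\<bar> < c} else {})"

definition S_set :: "nat \<Rightarrow> ereal set \<Rightarrow> complex set" where
  "S_set n K = (- closure (nbhd (1 / real n) K)) \<inter> {z. \<bar>Im z\<bar> < real n}"

text \<open>The space \<open>\<O>\<^sup>e\<^sup>x\<^sup>p\<close> of functions on the complement of \<open>K\<close>.\<close>

definition Oexp ::
    "(complex \<Rightarrow> 'e \<Rightarrow> 'e::{t2_space,topological_ab_group_add}) \<Rightarrow> ('i \<Rightarrow> 'e \<Rightarrow> real)
      \<Rightarrow> ereal set \<Rightarrow> (complex \<Rightarrow> 'e) set" where
  "Oexp sc p K = {f \<in> hol_space sc (- finite_part K). \<forall>n\<ge>1. \<forall>i.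
     bdd_above ((\<lambda>z. p i (f z) * exp (- (1 / real n) * \<bar>Re z\<bar>)) ` S_set n K)}"

definition Eexp ::
    "(complex \<Rightarrow> 'e \<Rightarrow> 'e::{t2_space,topological_ab_group_add}) \<Rightarrow> ('i \<Rightarrow> 'e \<Rightarrow> real)
      \<Rightarrow> ereal set \<Rightarrow> (complex \<Rightarrow> 'e) set" where
  "Eexp sc p K = {f \<in> smooth_space sc (- finite_part K). \<forall>n\<ge>1. \<forall>m i.
     bdd_above ((\<lambda>(z, \<beta>). p i (multi_deriv sc \<beta> f z) * exp (- (1 / real n) * \<bar>Re z\<bar>))
       ` (S_set n K \<times> {\<beta>. fst \<beta> + snd \<beta> \<le> m}))}"

definition admissible ::
    "(complex \<Rightarrow> 'e \<Rightarrow> 'e::{t2_space,topological_ab_group_add}) \<Rightarrow> ('i \<Rightarrow> 'e \<Rightarrow> real)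
      \<Rightarrow> bool" where
  "admissible sc p \<longleftrightarrow> (\<forall>K. compact K \<longrightarrow>
     (\<forall>g\<in>Eexp sc p K. \<exists>f\<in>Eexp sc p K. \<forall>z\<in>- finite_part K. dbar sc f z = g z))"

text \<open>The set \<open>FO_pm\<close> consists of the functions equal to \<open>f\<close> on the upper and to \<open>g\<close> on the lower
  half-plane, because \<open>f\<close> and \<open>g\<close> vanish off their domains.\<close>

definition FO_pinf ::
    "(complex \<Rightarrow> 'e \<Rightarrow> 'e::{t2_space,topological_ab_group_add}) \<Rightarrow> ('i \<Rightarrow> 'e \<Rightarrow> real)
      \<Rightarrow> (complex \<Rightarrow> 'e) set" where
  "FO_pinf sc p = {f \<in> hol_space sc {z. Im z < 0}. \<forall>k\<ge>1::nat. \<forall>i.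
     bdd_above ((\<lambda>z. p i (f z) * exp (- (1 / real k) * cmod z + real k * \<bar>Im z\<bar>))
       ` {z. Im z \<le> - (1 / real k)})}"

definition FO_minf ::
    "(complex \<Rightarrow> 'e \<Rightarrow> 'e::{t2_space,topological_ab_group_add}) \<Rightarrow> ('i \<Rightarrow> 'e \<Rightarrow> real)
      \<Rightarrow> (complex \<Rightarrow> 'e) set" where
  "FO_minf sc p = {f \<in> hol_space sc {z. Im z > 0}. \<forall>k\<ge>1::nat. \<forall>i.
     bdd_above ((\<lambda>z. p i (f z) * exp (- (1 / real k) * cmod z + real k * \<bar>Im z\<bar>))
       ` {z. Im z \<ge> 1 / real k})}"

definition FO_pm ::
    "(complex \<Rightarrow> 'e \<Rightarrow> 'e::{t2_space,topological_ab_group_add}) \<Rightarrow> ('i \<Rightarrow> 'e \<Rightarrow> real)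
      \<Rightarrow> (complex \<Rightarrow> 'e) set" where
  "FO_pm sc p = FO_minf sc p + FO_pinf sc p"

section \<open>Quotients of function spaces\<close>

text \<open>The class of \<open>f\<close> modulo \<open>W\<close> is the coset \<open>f +o W\<close>; cosets are added by the sum of sets.\<close>

definition quot_space :: "(complex \<Rightarrow> 'e::ab_group_add) set \<Rightarrow> (complex \<Rightarrow> 'e) set
    \<Rightarrow> (complex \<Rightarrow> 'e) set set" where
  "quot_space V W = (\<lambda>f. f +o W) ` V"

text \<open>Adding \<open>W\<close> matters only for \<open>c = 0\<close>.\<close>

definition coset_scale :: "(complex \<Rightarrow> 'e \<Rightarrow> 'e::ab_group_add) \<Rightarrow> (complex \<Rightarrow> 'e) set
    \<Rightarrow> complex \<Rightarrow> (complex \<Rightarrow> 'e) set \<Rightarrow> (complex \<Rightarrow> 'e) set" where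
  "coset_scale sc W c X = (\<lambda>f z. sc c (f z)) ` X + W"

definition quot_lin_iso :: "(complex \<Rightarrow> 'e \<Rightarrow> 'e::ab_group_add)
    \<Rightarrow> (complex \<Rightarrow> 'e) set \<Rightarrow> (complex \<Rightarrow> 'e) set
    \<Rightarrow> (complex \<Rightarrow> 'e) set \<Rightarrow> (complex \<Rightarrow> 'e) set
    \<Rightarrow> ((complex \<Rightarrow> 'e) set \<Rightarrow> (complex \<Rightarrow> 'e) set) \<Rightarrow> bool" where
  "quot_lin_iso sc V W V' W' \<Phi> \<longleftrightarrow>
     bij_betw \<Phi> (quot_space V W) (quot_space V' W') \<and>
     (\<forall>X\<in>quot_space V W. \<forall>Y\<in>quot_space V W. \<Phi> (X + Y) = \<Phi> X + \<Phi> Y) \<and>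
     (\<forall>c. \<forall>X\<in>quot_space V W. \<Phi> (coset_scale sc W c X) = coset_scale sc W' c (\<Phi> X))"

text \<open>The subspaces that are divided out; \<open>bv\<^sub>K(E)\<close> is a quotient by \<open>Oexp_entire\<close>.\<close>

definition Oexp_entire ::
    "(complex \<Rightarrow> 'e \<Rightarrow> 'e::{t2_space,topological_ab_group_add}) \<Rightarrow> ('i \<Rightarrow> 'e \<Rightarrow> real)
      \<Rightarrow> ereal set \<Rightarrow> (complex \<Rightarrow> 'e) set" where
  "Oexp_entire sc p K = restr (- finite_part K) ` Oexp sc p {}"

definition bv ::
    "(complex \<Rightarrow> 'e \<Rightarrow> 'e::{t2_space,topological_ab_group_add}) \<Rightarrow> ('i \<Rightarrow> 'e \<Rightarrow> real)
      \<Rightarrow> ereal set \<Rightarrow> (complex \<Rightarrow> 'e) set set" where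
  "bv sc p K = quot_space (Oexp sc p K) (Oexp_entire sc p K)"

definition Oexp_pm ::
    "(complex \<Rightarrow> 'e \<Rightarrow> 'e::{t2_space,topological_ab_group_add}) \<Rightarrow> ('i \<Rightarrow> 'e \<Rightarrow> real)
      \<Rightarrow> (complex \<Rightarrow> 'e) set" where
  "Oexp_pm sc p = restr (- finite_part UNIV) ` Oexp sc p {-\<infinity>, \<infinity>}"

definition hol_entire ::
    "(complex \<Rightarrow> 'e \<Rightarrow> 'e::{t2_space,topological_ab_group_add}) \<Rightarrow> (complex \<Rightarrow> 'e) set" where
  "hol_entire sc = restr (- finite_part UNIV) ` hol_space sc UNIV"

section \<open>The inductive limit \<open>\<P>\<^sub>*\<close> and its dual\<close>

definition strip :: "nat \<Rightarrow> complex set" where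
  "strip n = {z. \<bar>Im z\<bar> < 1 / real n}"

text \<open>The functions of the \<open>n\<close>-th step matter only on \<open>closure (strip n)\<close>; their values elsewhere
  are arbitrary and are forgotten in \<open>germ\<close>.\<close>

definition P_step :: "nat \<Rightarrow> (complex \<Rightarrow> complex) set" where
  "P_step n = {\<phi>. \<phi> holomorphic_on strip n \<and> continuous_on (closure (strip n)) \<phi> \<and>
     bdd_above ((\<lambda>z. cmod (\<phi> z) * exp (1 / real n * \<bar>Re z\<bar>)) ` closure (strip n))}"

definition P_norm :: "nat \<Rightarrow> (complex \<Rightarrow> complex) \<Rightarrow> real" where
  "P_norm n \<phi> = (SUP z\<in>closure (strip n). cmod (\<phi> z) * exp (1 / real n * \<bar>Re z\<bar>))"

definition P_funs :: "(complex \<Rightarrow> complex) set" where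
  "P_funs = (\<Union>n\<in>{1..}. P_step n)"

text \<open>Elements of the inductive limit: functions are identified if they agree in some step.\<close>

definition germ :: "(complex \<Rightarrow> complex) \<Rightarrow> (complex \<Rightarrow> complex) set" where
  "germ \<phi> = {\<psi> \<in> P_funs. \<exists>m\<ge>1. \<forall>z\<in>closure (strip m). \<psi> z = \<phi> z}"

definition P_star :: "(complex \<Rightarrow> complex) set set" where
  "P_star = germ ` P_funs"

text \<open>The continuous seminorms of the locally convex inductive limit topology: those whose
  composition with the canonical map of every step is continuous.\<close>

definition P_seminorms :: "((complex \<Rightarrow> complex) set \<Rightarrow> real) set" where
  "P_seminorms = {q.
     (\<forall>\<phi>\<in>P_funs. \<forall>\<psi>\<in>P_funs. q (germ (\<lambda>z. \<phi> z + \<psi> z)) \<le> q (germ \<phi>) + q (germ \<psi>)) \<and>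
     (\<forall>c. \<forall>\<phi>\<in>P_funs. q (germ (\<lambda>z. c * \<phi> z)) = cmod c * q (germ \<phi>)) \<and>
     (\<forall>n\<ge>1. \<exists>C. \<forall>\<phi>\<in>P_step n. q (germ \<phi>) \<le> C * P_norm n \<phi>)}"

text \<open>Continuous linear maps from \<open>P_star\<close> to \<open>E\<close>, extended by \<open>0\<close> off \<open>P_star\<close>.\<close>

definition L_space ::
    "(complex \<Rightarrow> 'e \<Rightarrow> 'e::{t2_space,topological_ab_group_add}) \<Rightarrow> ('i \<Rightarrow> 'e \<Rightarrow> real)
      \<Rightarrow> ((complex \<Rightarrow> complex) set \<Rightarrow> 'e) set" where
  "L_space sc p = {T.
     (\<forall>g. g \<notin> P_star \<longrightarrow> T g = 0) \<and>
     (\<forall>\<phi>\<in>P_funs. \<forall>\<psi>\<in>P_funs. T (germ (\<lambda>z. \<phi> z + \<psi> z)) = T (germ \<phi>) + T (germ \<psi>)) \<and>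
     (\<forall>c. \<forall>\<phi>\<in>P_funs. T (germ (\<lambda>z. c * \<phi> z)) = sc c (T (germ \<phi>))) \<and>
     (\<forall>i. \<exists>q\<in>P_seminorms. \<forall>g\<in>P_star. p i (T g) \<le> q g)}"

definition fourier :: "(complex \<Rightarrow> complex) \<Rightarrow> complex \<Rightarrow> complex" where
  "fourier \<phi> \<zeta> = (LINT x|lborel. \<phi> (complex_of_real x) * exp (- \<i> * complex_of_real x * \<zeta>))"

text \<open>All \<open>\<phi> \<in> g\<close> agree on the real axis, so the union is over one and the same germ.\<close>

definition fourier_P :: "(complex \<Rightarrow> complex) set \<Rightarrow> (complex \<Rightarrow> complex) set" where
  "fourier_P g = (\<Union>\<phi>\<in>g. germ (fourier \<phi>))"

definition fourier_star :: "((complex \<Rightarrow> complex) set \<Rightarrow> 'e::zero)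
    \<Rightarrow> (complex \<Rightarrow> complex) set \<Rightarrow> 'e" where
  "fourier_star T = (\<lambda>g. if g \<in> P_star then T (fourier_P g) else 0)"

section \<open>The Fourier transforms\<close>

definition lcs_dual :: "(complex \<Rightarrow> 'e \<Rightarrow> 'e::{t2_space,topological_ab_group_add})
    \<Rightarrow> ('e \<Rightarrow> complex) set" where
  "lcs_dual sc = {y. (\<forall>u v. y (u + v) = y u + y v) \<and> (\<forall>c u. y (sc c u) = c * y u) \<and>
     continuous_on UNIV y}"

definition has_pettis_integral ::
    "(complex \<Rightarrow> 'e \<Rightarrow> 'e::{t2_space,topological_ab_group_add}) \<Rightarrow> 'a measure \<Rightarrow> ('a \<Rightarrow> 'e)
      \<Rightarrow> 'e \<Rightarrow> bool" where
  "has_pettis_integral sc M g I \<longleftrightarrow>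
     (\<forall>y\<in>lcs_dual sc. integrable M (\<lambda>x. y (g x)) \<and> y I = (LINT x|M. y (g x)))"

text \<open>Integral of \<open>F \<phi>\<close> over the boundary of the strip of half-width \<open>c\<close>, the upper line being
  traversed from left to right and the lower one from right to left.\<close>

definition has_gamma_integral ::
    "(complex \<Rightarrow> 'e \<Rightarrow> 'e::{t2_space,topological_ab_group_add}) \<Rightarrow> (complex \<Rightarrow> 'e)
      \<Rightarrow> (complex \<Rightarrow> complex) \<Rightarrow> real \<Rightarrow> 'e \<Rightarrow> bool" where
  "has_gamma_integral sc F \<phi> c I \<longleftrightarrow>
     (\<exists>a b. has_pettis_integral sc lborel (\<lambda>t. sc (\<phi> (Complex t c)) (F (Complex t c))) a \<and>
            has_pettis_integral sc lborel (\<lambda>t. sc (\<phi> (Complex t (- c))) (F (Complex t (- c)))) b \<and>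
            I = a - b)"

text \<open>The map \<open>\<H>\<close>: the integral does not depend on the representatives \<open>F\<close> and \<open>\<phi>\<close> and on \<open>c\<close>.\<close>

definition H_map ::
    "(complex \<Rightarrow> 'e \<Rightarrow> 'e::{t2_space,topological_ab_group_add}) \<Rightarrow> (complex \<Rightarrow> 'e) set
      \<Rightarrow> (complex \<Rightarrow> complex) set \<Rightarrow> 'e" where
  "H_map sc X = (\<lambda>g. if g \<in> P_star then
     (THE I. \<forall>F\<in>X. \<forall>n\<ge>1. \<forall>\<phi>\<in>g \<inter> P_step n. \<forall>c. 0 < c \<and> c < 1 / real n \<longrightarrow>
        has_gamma_integral sc F \<phi> c I) else 0)"

definition H_inv ::
    "(complex \<Rightarrow> 'e \<Rightarrow> 'e::{t2_space,topological_ab_group_add}) \<Rightarrow> ('i \<Rightarrow> 'e \<Rightarrow> real)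
      \<Rightarrow> ((complex \<Rightarrow> complex) set \<Rightarrow> 'e) \<Rightarrow> (complex \<Rightarrow> 'e) set" where
  "H_inv sc p = restrict (the_inv_into (bv sc p UNIV) (H_map sc)) (L_space sc p)"

definition fourier_bv ::
    "(complex \<Rightarrow> 'e \<Rightarrow> 'e::{t2_space,topological_ab_group_add}) \<Rightarrow> ('i \<Rightarrow> 'e \<Rightarrow> real)
      \<Rightarrow> (complex \<Rightarrow> 'e) set \<Rightarrow> (complex \<Rightarrow> 'e) set" where
  "fourier_bv sc p X = H_inv sc p (fourier_star (H_map sc X))"

text \<open>The next two maps are given on representatives: the value is the union of the resulting
  classes over all representatives, which is one class if and only if they all coincide.\<close>

definition R_map ::
    "(complex \<Rightarrow> 'e \<Rightarrow> 'e::{t2_space,topological_ab_group_add}) \<Rightarrow> (complex \<Rightarrow> 'e) set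
      \<Rightarrow> (complex \<Rightarrow> 'e) set" where
  "R_map sc X = (\<Union>F\<in>X. F +o hol_entire sc)"

definition R_inv ::
    "(complex \<Rightarrow> 'e \<Rightarrow> 'e::{t2_space,topological_ab_group_add}) \<Rightarrow> ('i \<Rightarrow> 'e \<Rightarrow> real)
      \<Rightarrow> (complex \<Rightarrow> 'e) set \<Rightarrow> (complex \<Rightarrow> 'e) set" where
  "R_inv sc p = the_inv_into (quot_space (Oexp sc p UNIV) (Oexp_pm sc p)) (R_map sc)"

definition fourier_B ::
    "(complex \<Rightarrow> 'e \<Rightarrow> 'e::{t2_space,topological_ab_group_add}) \<Rightarrow> ('i \<Rightarrow> 'e \<Rightarrow> real)
      \<Rightarrow> (complex \<Rightarrow> 'e) set \<Rightarrow> (complex \<Rightarrow> 'e) set" where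
  "fourier_B sc p f = (\<Union>G\<in>R_inv sc p f. \<Union>H\<in>fourier_bv sc p (G +o Oexp_entire sc p UNIV).
     H +o (Oexp_entire sc p UNIV + FO_pm sc p))"

end

theory Submission
  imports Defs "HOL-Complex_Analysis.Complex_Analysis" "HOL-Real_Asymp.Real_Asymp" "HOL-Probability.Characteristic_Functions"
begin

text \<open>
  Surjectivity of \<open>\<R>\<^sub>\<real>\<close>: given \<open>f\<close> holomorphic off \<open>\<real>\<close>, multiply by a smooth \<open>\<chi>\<close> that is \<open>1\<close> near \<open>\<real>\<close> and whose
  support meets every \<open>S\<^sub>n(\<real>)\<close> in a bounded set, solve \<open>dbar u = f dbar \<chi>\<close> in \<open>\<E>\<^sup>e\<^sup>x\<^sup>p\<close> off \<open>\<plusminus>\<infinity>\<close>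
  by admissibility, and take \<open>\<chi> f - u\<close>.

  For the transform, a cut-off \<open>\<sigma>\<close> with \<open>\<sigma>(z) + \<sigma>(-z) = 1\<close>, decaying faster than every exponential
  at one end of a strip, splits the boundary integral of \<open>F(w) exp(-i w \<zeta>)\<close> into a part that converges for
  \<open>Im \<zeta> < 0\<close> and one that converges for \<open>Im \<zeta> > 0\<close>; together they form a representative \<open>Phi F\<close> of the transform
  of \<open>[F]\<close>. Fubini gives that \<open>Phi (Phi F)\<close> is a nonzero multiple of \<open>z \<mapsto> - F(-z)\<close> modulo \<open>\<O>\<^sup>e\<^sup>x\<^sup>p\<close> of the
  extended plane. So everything reduces to \<open>Phi\<close> exchanging the functions that extend across \<open>\<real>\<close> with the
  functions of \<open>FO\<close>: for the former the lines can be bent to start at a real point, and for the latter the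
  integral can be rotated to a half-line on which \<open>exp(-i w \<zeta>)\<close> is dominated for all \<open>\<zeta>\<close>.
\<close>

text \<open>The kernel \<open>exp (- \<i> * w * \<zeta>)\<close> is no test function: for non-real
  \<open>\<zeta>\<close> it explodes at one end of the strip, and \<open>F\<close> may grow as well.
  A partition of the two ends that is merely smooth would tie the integral to fixed lines. One that
  is holomorphic in the strip lets the lines approach the real axis, and only this makes the growth
  of the transform in \<open>Re \<zeta>\<close> slower than every exponential. The logistic function
  of \<open>2 sinh (z / 2)\<close> is such a partition: \<open>sinh\<close> is odd, and its
  exponential growth makes the decay at the left end doubly exponential.

  Since \<open>E\<close> is only sequentially complete, limits in \<open>E\<close> are taken along
  one sequence: Riemann sums for integrals, a sequence of difference quotients for derivatives.
  Everything else is scalar and returns to \<open>E\<close> by Hahn-Banach.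

  Rules for \<open>Phi\<close> hold only modulo \<open>Oexp_0\<close> and are proved by pairing with
  test functions, because a function of slow growth whose functional vanishes extends to the plane.
  The Cauchy kernel carries a Gaussian factor in order to be such a test function.\<close>

abbreviation cor :: "real \<Rightarrow> complex" where
  "cor \<equiv> of_real"

abbreviation growth :: "real \<Rightarrow> complex \<Rightarrow> real" where
  "growth a z \<equiv> exp (a * \<bar>Re z\<bar>)"

abbreviation off_real :: "complex set" where
  "off_real \<equiv> {z. Im z \<noteq> 0}"

section \<open>Hahn--Banach for seminorms\<close>

text \<open>Sublinearity over the real scalars inside the complex ones. Homogeneity is asked as one
  inequality, the form that an infimum of such functionals inherits directly; equality follows by
  scaling back with \<open>1 / t\<close>.\<close>

definition sublinear_fun :: "(complex \<Rightarrow> 'e \<Rightarrow> 'e::ab_group_add) \<Rightarrow> ('e \<Rightarrow> real) \<Rightarrow> bool" where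
  "sublinear_fun sc q \<longleftrightarrow> (\<forall>x y. q (x + y) \<le> q x + q y) \<and>
     (\<forall>t>0. \<forall>x. q (sc (cor t) x) \<le> t * q x)"

lemma le_INF_add_INF:
  fixes f :: "'a \<Rightarrow> real" and g :: "'b \<Rightarrow> real"
  assumes "A \<noteq> {}" "B \<noteq> {}" "\<And>a b. a \<in> A \<Longrightarrow> b \<in> B \<Longrightarrow> m \<le> f a + g b"
  shows "m \<le> (INF a\<in>A. f a) + (INF b\<in>B. g b)"
proof -
  have "m - (INF b\<in>B. g b) \<le> f a" if "a \<in> A" for a
  proof -
    have "m - f a \<le> (INF b\<in>B. g b)" using assms(2) assms(3)[OF that] by (intro cINF_greatest) (auto simp: algebra_simps)
    thus ?thesis by simp
  qed
  hence "m - (INF b\<in>B. g b) \<le> (INF a\<in>A. f a)" using assms(1) by (intro cINF_greatest)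
  thus ?thesis by simp
qed

context lcs
begin

abbreviation Oexp_R :: "(complex \<Rightarrow> 'e) set" where
  "Oexp_R \<equiv> Oexp sc p UNIV"

abbreviation Oexp_0 :: "(complex \<Rightarrow> 'e) set" where
  "Oexp_0 \<equiv> Oexp_entire sc p UNIV"

lemma sublinear_scale:
  assumes q: "sublinear_fun sc q" and t: "t > 0"
  shows "q (sc (cor t) x) = t * q x"
proof (rule antisym)
  show "q (sc (cor t) x) \<le> t * q x" using q t by (simp add: sublinear_fun_def)
  have "q (sc (cor (1/t)) (sc (cor t) x)) \<le> (1/t) * q (sc (cor t) x)"
    using q t unfolding sublinear_fun_def by (metis zero_less_divide_1_iff)
  moreover have "sc (cor (1/t)) (sc (cor t) x) = x" using t by simp
  ultimately show "t * q x \<le> q (sc (cor t) x)" using t by (simp add: field_simps)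
qed

lemma sublinear_zero:
  assumes q: "sublinear_fun sc q"
  shows "q 0 = 0" using sublinear_scale[OF q, of 2 0] by simp

lemma sublinear_lower:
  assumes q: "sublinear_fun sc q"
  shows "- q (- x) \<le> q x"
proof -
  have "q (x + - x) \<le> q x + q (- x)" using q unfolding sublinear_fun_def by blast
  thus ?thesis using sublinear_zero[OF q] by simp
qed

text \<open>Zorn's lemma for the reversed pointwise order. A chain is bounded by its pointwise
  infimum, which is finite because \<open>- p0 (- x) \<le> q x\<close> for every sublinear
  \<open>q\<close> below \<open>p0\<close>.\<close>

lemma minimal_sublinear_exists:
  assumes p0: "sublinear_fun sc p0"
  shows "\<exists>l. sublinear_fun sc l \<and> (\<forall>x. l x \<le> p0 x) \<and>
    (\<forall>q. sublinear_fun sc q \<and> (\<forall>x. q x \<le> l x) \<longrightarrow> q = l)"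
proof -
  define A where "A = {q. sublinear_fun sc q \<and> (\<forall>x. q x \<le> p0 x)}"
  define P where "P = (\<lambda>f g :: 'e \<Rightarrow> real. \<forall>x. g x \<le> f x)"
  have po: "partial_order_on A (relation_of P A)"
  proof (rule partial_order_on_relation_ofI)
    show "P a c" if "P a b" "P b c" for a b c using that unfolding P_def by (meson order_trans)
    show "a = b" if "P a b" "P b a" for a b using that unfolding P_def by (simp add: fun_eq_iff antisym)
  qed (auto simp: P_def)
  have "\<exists>u\<in>A. \<forall>a\<in>C. P a u" if C: "C \<in> Chains (relation_of P A)" for C
  proof (cases "C = {}")
    case True
    thus ?thesis using p0 by (auto simp: A_def)
  next
    case False
    have CA: "q \<in> A" if "q \<in> C" for q using C that unfolding Chains_def relation_of_def by auto
    have ch: "P a b \<or> P b a" if "a \<in> C" "b \<in> C" for a b using C that unfolding Chains_def relation_of_def by auto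
    define u where "u x = (INF q\<in>C. q x)" for x
    have bd: "bdd_below ((\<lambda>q. q x) ` C)" for x
    proof (rule bdd_belowI2)
      fix q assume "q \<in> C"
      hence "q \<in> A" by (rule CA)
      thus "- p0 (- x) \<le> q x" unfolding A_def using sublinear_lower[of q x] by (smt (verit) mem_Collect_eq)
    qed
    have le: "u x \<le> q x" if "q \<in> C" for q x unfolding u_def by (rule cINF_lower[OF bd that])
    have "sublinear_fun sc u" unfolding sublinear_fun_def
    proof (intro conjI allI impI)
      fix x y
      show "u (x + y) \<le> u x + u y" unfolding u_def[of x] u_def[of y]
      proof (rule le_INF_add_INF[OF False False])
        fix a b assume ab: "a \<in> C" "b \<in> C"
        \<comment> \<open>Of two members of a chain the smaller one serves for both arguments at
          once, so its own subadditivity can be used.\<close>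
        obtain q where q: "q \<in> C" "q x \<le> a x" "q y \<le> b y" using ch[OF ab] ab unfolding P_def by (metis order_refl)
        have "u (x + y) \<le> q (x + y)" by (rule le[OF q(1)])
        also have "\<dots> \<le> q x + q y" using CA[OF q(1)] by (simp add: A_def sublinear_fun_def)
        finally show "u (x + y) \<le> a x + b y" using q by linarith
      qed
    next
      fix t :: real and x assume t: "t > 0"
      have "u (sc (cor t) x) / t \<le> u x" unfolding u_def[of x]
      proof (rule cINF_greatest[OF False])
        fix q assume q: "q \<in> C"
        have "u (sc (cor t) x) \<le> q (sc (cor t) x)" by (rule le[OF q])
        also have "\<dots> \<le> t * q x" using CA[OF q] t by (simp add: A_def sublinear_fun_def)
        finally show "u (sc (cor t) x) / t \<le> q x" using t by (simp add: field_simps)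
      qed
      thus "u (sc (cor t) x) \<le> t * u x" using t by (simp add: field_simps)
    qed
    moreover have "u x \<le> p0 x" for x
    proof -
      obtain q where "q \<in> C" using False by auto
      thus ?thesis using le[of q x] CA[of q] by (auto simp: A_def intro: order_trans)
    qed
    ultimately show ?thesis using le by (auto simp: A_def P_def)
  qed
  from predicate_Zorn[OF po this] obtain m where "m \<in> A" "\<forall>a\<in>A. P m a \<longrightarrow> a = m" by blast
  thus ?thesis
  proof (intro exI[of _ m] conjI allI impI)
    fix q assume q: "sublinear_fun sc q \<and> (\<forall>x. q x \<le> m x)"
    have "q x \<le> p0 x" for x using q \<open>m \<in> A\<close> order_trans[of "q x" "m x" "p0 x"] by (auto simp: A_def)
    thus "q = m" using q \<open>\<forall>a\<in>A. P m a \<longrightarrow> a = m\<close> by (auto simp: A_def P_def)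
  qed (use \<open>m \<in> A\<close> in \<open>auto simp: A_def\<close>)
qed

text \<open>The classical lowering of \<open>q\<close> in one direction. It is used twice: to force
  a minimal functional to be odd, and to start below \<open>p i\<close> with the value at
  \<open>x0\<close> already prescribed.\<close>

lemma sublinear_descent:
  assumes q: "sublinear_fun sc q"
  shows "\<exists>q'. sublinear_fun sc q' \<and> (\<forall>x. q' x \<le> q x) \<and> q' (- x0) \<le> - q x0"
proof -
  define f where "f x t = q (x + sc (cor t) x0) - t * q x0" for x t
  define q' where "q' x = (INF t\<in>{0..}. f x t)" for x
  have sc0: "q (sc (cor t) x) = t * q x" if "t \<ge> 0" for t x
    using sublinear_scale[OF q] sublinear_zero[OF q] that by (cases "t = 0") auto
  have add: "q (x + y) \<le> q x + q y" for x y using q by (simp add: sublinear_fun_def)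
  have bd: "bdd_below (f x ` {0..})" for x
  proof (rule bdd_belowI2)
    fix t :: real assume "t \<in> {0..}"
    thus "- q (- x) \<le> f x t" using add[of "x + sc (cor t) x0" "- x"] sc0[of t x0] by (simp add: f_def)
  qed
  have le: "q' x \<le> f x t" if "t \<ge> 0" for x t unfolding q'_def using that by (intro cINF_lower[OF bd]) auto
  have "sublinear_fun sc q'" unfolding sublinear_fun_def
  proof (intro conjI allI impI)
    fix x y
    show "q' (x + y) \<le> q' x + q' y" unfolding q'_def[of x] q'_def[of y]
    proof (rule le_INF_add_INF)
      fix s t :: real assume st: "s \<in> {0..}" "t \<in> {0..}"
      have "q' (x + y) \<le> f (x + y) (s + t)" using st by (intro le) auto
      also have "\<dots> \<le> f x s + f y t" using add[of "x + sc (cor s) x0" "y + sc (cor t) x0"]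
        by (simp add: f_def algebra_simps scale_left_distrib)
      finally show "q' (x + y) \<le> f x s + f y t" .
    qed auto
  next
    fix t :: real and x assume t: "t > 0"
    have "q' (sc (cor t) x) / t \<le> q' x" unfolding q'_def[of x]
    proof (rule cINF_greatest)
      fix s :: real assume s: "s \<in> {0..}"
      have "q' (sc (cor t) x) \<le> f (sc (cor t) x) (t * s)" using s t by (intro le) auto
      also have "\<dots> = q (sc (cor t) (x + sc (cor s) x0)) - t * s * q x0" by (simp add: f_def scale_right_distrib)
      also have "\<dots> = t * f x s" unfolding sc0[OF less_imp_le[OF t]] by (simp add: f_def right_diff_distrib)
      finally show "q' (sc (cor t) x) / t \<le> f x s" using t by (simp add: field_simps)
    qed auto
    thus "q' (sc (cor t) x) \<le> t * q' x" using t by (simp add: field_simps)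
  qed
  moreover have "q' x \<le> q x" for x using le[of 0 x] by (simp add: f_def)
  moreover have "q' (- x0) \<le> - q x0" using le[of 1 "- x0"] sublinear_zero[OF q] by (simp add: f_def)
  ultimately show ?thesis by blast
qed

text \<open>By minimality the lowering at any point changes nothing, so \<open>l\<close> is odd; an
  odd subadditive function is additive.\<close>

lemma minimal_sublinear_odd:
  assumes l: "sublinear_fun sc l"
    and min: "\<And>q. sublinear_fun sc q \<Longrightarrow> (\<And>x. q x \<le> l x) \<Longrightarrow> q = l"
  shows "l (- x) = - l x" and "l (x + y) = l x + l y"
proof -
  have odd: "l (- x) = - l x" for x
  proof -
    obtain q' where q': "sublinear_fun sc q'" "\<And>x. q' x \<le> l x" "q' (- x) \<le> - l x" using sublinear_descent[OF l, of x] by blast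
    hence "l (- x) \<le> - l x" using min by metis
    thus ?thesis using sublinear_lower[OF l, of x] by linarith
  qed
  thus "l (- x) = - l x" .
  have add: "l (x + y) \<le> l x + l y" for x y using l by (simp add: sublinear_fun_def)
  show "l (x + y) = l x + l y" using add[of x y] add[of "- x" "- y"] odd[of x] odd[of y] odd[of "x + y"] by simp
qed

section \<open>Seminorms, limits and the dual of \<open>E\<close>\<close>

lemma seminorm_add: "p i (x + y) \<le> p i x + p i y"
  and seminorm_scale: "p i (sc c x) = cmod c * p i x" using seminorms[of i] by (auto simp: seminorm_on_lcs_def)

lemma seminorm_zero [simp]: "p i 0 = 0" using seminorm_scale[of i 0 0] by simp

lemma seminorm_minus [simp]: "p i (- x) = p i x" using seminorm_scale[of i "- 1" x] by simp

lemma seminorm_diff: "p i (x - y) \<le> p i x + p i y" using seminorm_add[of i x "- y"] by simp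

lemma seminorm_nonneg [simp]: "0 \<le> p i x" using seminorm_diff[of i x x] by simp

lemma seminorm_swap: "p i (x - y) = p i (y - x)" using seminorm_minus[of i "x - y"] by simp

lemma seminorm_rev_triangle: "\<bar>p i x - p i y\<bar> \<le> p i (x - y)"
  using seminorm_add[of i y "x - y"] seminorm_add[of i x "y - x"] seminorm_swap[of i x y] by simp

text \<open>Seminorm balls are open by the triangle inequality, and every open set contains one
  around each of its points.\<close>

lemma tendsto_iff_seminorms:
  "(f \<longlongrightarrow> l) F \<longleftrightarrow> (\<forall>i. ((\<lambda>x. p i (f x - l)) \<longlongrightarrow> 0) F)"
proof
  assume f: "(f \<longlongrightarrow> l) F"
  show "\<forall>i. ((\<lambda>x. p i (f x - l)) \<longlongrightarrow> 0) F"
  proof (intro allI tendstoI)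
    fix i and e :: real assume e: "e > 0"
    define U where "U = {y. p i (y - l) < e}"
    have "open U" unfolding generates_topology
    proof
      fix x assume x: "x \<in> U"
      have "{y. p i (y - x) < e - p i (x - l)} \<subseteq> U"
      proof
        fix y assume "y \<in> {y. p i (y - x) < e - p i (x - l)}"
        thus "y \<in> U" using seminorm_add[of i "y - x" "x - l"] by (simp add: U_def)
      qed
      moreover have "e - p i (x - l) > 0" using x by (simp add: U_def)
      ultimately show "\<exists>i. \<exists>\<epsilon>>0. {y. p i (y - x) < \<epsilon>} \<subseteq> U" by blast
    qed
    moreover have "l \<in> U" using e by (simp add: U_def)
    ultimately have "eventually (\<lambda>x. f x \<in> U) F" using f topological_tendstoD by blast
    thus "\<forall>\<^sub>F x in F. dist (p i (f x - l)) 0 < e" by (simp add: U_def)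
  qed
next
  assume f: "\<forall>i. ((\<lambda>x. p i (f x - l)) \<longlongrightarrow> 0) F"
  show "(f \<longlongrightarrow> l) F"
  proof (rule topological_tendstoI)
    fix U assume "open U" "l \<in> U"
    then obtain i e where e: "e > 0" "{y. p i (y - l) < e} \<subseteq> U" using generates_topology by meson
    have "eventually (\<lambda>x. dist (p i (f x - l)) 0 < e) F" using f e(1) tendstoD by blast
    thus "eventually (\<lambda>x. f x \<in> U) F" by eventually_elim (use e(2) in auto)
  qed
qed

lemma tendsto_seminorm:
  assumes "(f \<longlongrightarrow> l) F"
  shows "((\<lambda>x. p i (f x)) \<longlongrightarrow> p i l) F"
proof -
  have "((\<lambda>x. p i (f x - l)) \<longlongrightarrow> 0) F" using assms tendsto_iff_seminorms by blast
  hence "((\<lambda>x. p i (f x) - p i l) \<longlongrightarrow> 0) F"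
    by (rule tendsto_0_le[where K = 1]) (auto intro!: always_eventually seminorm_rev_triangle)
  thus ?thesis by (simp add: LIM_zero_iff)
qed

lemma continuous_on_seminorm:
  "continuous_on S f \<Longrightarrow> continuous_on S (\<lambda>x. p i (f x))" unfolding continuous_on_def using tendsto_seminorm by blast

lemma tendsto_scale_lcs:
  assumes c: "(c \<longlongrightarrow> c0) F" and f: "(f \<longlongrightarrow> l) F"
  shows "((\<lambda>x. sc (c x) (f x)) \<longlongrightarrow> sc c0 l) F" unfolding tendsto_iff_seminorms
proof
  fix i
  have f': "((\<lambda>x. p i (f x - l)) \<longlongrightarrow> 0) F" using f tendsto_iff_seminorms by blast
  have "((\<lambda>x. cmod (c x) * p i (f x - l) + cmod (c x - c0) * p i l) \<longlongrightarrow> cmod c0 * 0 + cmod (c0 - c0) * p i l) F"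
    by (intro tendsto_intros c f')
  hence lim: "((\<lambda>x. cmod (c x) * p i (f x - l) + cmod (c x - c0) * p i l) \<longlongrightarrow> 0) F" by simp
  show "((\<lambda>x. p i (sc (c x) (f x) - sc c0 l)) \<longlongrightarrow> 0) F"
  proof (rule tendsto_0_le[OF lim, where K = 1])
    have "p i (sc (c x) (f x) - sc c0 l) \<le> cmod (c x) * p i (f x - l) + cmod (c x - c0) * p i l" for x
    proof -
      have "sc (c x) (f x) - sc c0 l = sc (c x) (f x - l) + sc (c x - c0) l" by (simp add: scale_right_diff_distrib scale_left_diff_distrib)
      thus ?thesis using seminorm_add[of i "sc (c x) (f x - l)" "sc (c x - c0) l"] by (simp add: seminorm_scale)
    qed
    thus "\<forall>\<^sub>F x in F. norm (p i (sc (c x) (f x) - sc c0 l)) \<le> norm (cmod (c x) * p i (f x - l) + cmod (c x - c0) * p i l) * 1"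
      by (intro always_eventually) (simp add: abs_of_nonneg)
  qed
qed

lemma continuous_on_scale_lcs:
  "continuous_on S c \<Longrightarrow> continuous_on S f \<Longrightarrow> continuous_on S (\<lambda>x. sc (c x) (f x))"
  unfolding continuous_on_def using tendsto_scale_lcs by blast

lemma dualI:
  assumes "\<And>u v. y (u + v) = y u + y v" "\<And>c u. y (sc c u) = c * y u"
    "\<And>x. cmod (y x) \<le> C * p i x"
  shows "y \<in> lcs_dual sc" unfolding lcs_dual_def
proof (safe intro!: assms)
  have diff: "y (u - v) = y u - y v" for u v using assms(1)[of u "- v"] assms(2)[of "- 1" v] by simp
  show "continuous_on UNIV y" unfolding continuous_on_def
  proof
    fix x
    have "((\<lambda>x'. p i (x' - x)) \<longlongrightarrow> 0) (at x within UNIV)"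
      using tendsto_iff_seminorms[of "\<lambda>x. x" x "at x within UNIV"] by (auto intro: tendsto_ident_at)
    hence "((\<lambda>x'. y x' - y x) \<longlongrightarrow> 0) (at x within UNIV)" by (rule tendsto_0_le[where K = C])
        (use assms(3) in \<open>auto simp: diff[symmetric] mult.commute intro!: always_eventually\<close>)
    thus "(y \<longlongrightarrow> y x) (at x within UNIV)" by (simp add: LIM_zero_iff)
  qed
qed

lemma
  assumes y: "y \<in> lcs_dual sc"
  shows dual_add: "y (u + v) = y u + y v"
    and dual_scale: "y (sc c u) = c * y u"
    and dual_cont: "continuous_on UNIV y"
    and dual_zero: "y 0 = 0"
    and dual_minus: "y (- u) = - y u"
    and dual_diff: "y (u - v) = y u - y v"
proof -
  show add: "y (u + v) = y u + y v" and scale: "y (sc c u) = c * y u" and "continuous_on UNIV y" for u v c using y by (auto simp: lcs_dual_def)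
  show "y 0 = 0" using scale[of 0 0] by simp
  show minus: "y (- u) = - y u" for u using scale[of "- 1" u] by simp
  show "y (u - v) = y u - y v" using add[of u "- v"] minus[of v] by simp
qed

lemma dual_tendsto:
  "y \<in> lcs_dual sc \<Longrightarrow> (f \<longlongrightarrow> l) F \<Longrightarrow> ((\<lambda>x. y (f x)) \<longlongrightarrow> y l) F"
  using continuous_on_tendsto_compose[OF dual_cont] by (simp add: always_eventually)

lemma dual_continuous_on:
  "y \<in> lcs_dual sc \<Longrightarrow> continuous_on S f \<Longrightarrow> continuous_on S (\<lambda>x. y (f x))"
  unfolding continuous_on_def using dual_tendsto by blast

text \<open>The preimage of the unit disc contains a ball of some seminorm, and rescaling
  \<open>x\<close> into it gives the constant \<open>2 / e\<close>. Vectors with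
  \<open>p i x = 0\<close> stay in the ball under every rescaling, so \<open>y\<close> vanishes on
  them.\<close>

lemma dual_bounded:
  assumes y: "y \<in> lcs_dual sc"
  shows "\<exists>i C. C \<ge> 0 \<and> (\<forall>x. cmod (y x) \<le> C * p i x)"
proof -
  have "open (y -` ball 0 1)" using dual_cont[OF y] by (intro open_vimage) auto
  moreover have "0 \<in> y -` ball 0 1" using dual_zero[OF y] by simp
  ultimately obtain i e where e: "e > 0" "{x. p i (x - 0) < e} \<subseteq> y -` ball 0 1" using generates_topology by meson
  have "cmod (y x) \<le> (2 / e) * p i x" for x
  proof -
    have *: "cmod (y x) < r * (2 / e)" if r: "r \<ge> p i x" "r > 0" for r
    proof -
      have "p i (sc (cor (e / (2 * r))) x) < e" using r e(1) by (simp add: seminorm_scale abs_of_pos norm_divide norm_mult field_simps)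
      hence "cmod (y (sc (cor (e / (2 * r))) x)) < 1" using e(2) by auto
      thus ?thesis using r e(1) by (simp add: dual_scale[OF y] norm_mult norm_divide field_simps)
    qed
    show ?thesis
    proof (cases "p i x = 0")
      case False
      hence "p i x > 0" using seminorm_nonneg[of i x] by linarith
      thus ?thesis using *[of "p i x"] by (simp add: mult.commute)
    next
      case True
      have small: "cmod (y x) \<le> d" if d: "d > 0" for d
      proof -
        have "d * e / 2 > 0" using d e(1) by simp
        hence "cmod (y x) < d * e / 2 * (2 / e)" using True by (intro *) auto
        also have "\<dots> = d" using e(1) by (simp add: field_simps)
        finally show ?thesis by simp
      qed
      have "cmod (y x) \<le> 0" using small[of "cmod (y x) / 2"] by (cases "y x = 0") auto
      thus ?thesis using True by simp
    qed
  qed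
  thus ?thesis using e(1) by (intro exI[of _ i] exI[of _ "2 / e"]) auto
qed

text \<open>The polar of the unit ball of \<open>p i\<close>.\<close>

definition dual_ball :: "'i \<Rightarrow> ('e \<Rightarrow> complex) set" where
  "dual_ball i = {y \<in> lcs_dual sc. \<forall>x. cmod (y x) \<le> p i x}"

text \<open>A real functional below \<open>p i\<close> with value \<open>p i x0\<close> at
  \<open>x0\<close> is obtained as a minimal sublinear functional;
  \<open>l x - \<i> * l (\<i> x)\<close> is its complex linear version.\<close>

lemma hahn_banach:
  "\<exists>y\<in>dual_ball i. cmod (y x0) = p i x0"
proof -
  have "sublinear_fun sc (p i)" by (simp add: sublinear_fun_def seminorm_add seminorm_scale)
  then obtain q where q: "sublinear_fun sc q" "\<And>x. q x \<le> p i x" "q (- x0) \<le> - p i x0" using sublinear_descent by blast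
  then obtain l where l: "sublinear_fun sc l" "\<And>x. l x \<le> q x"
      "\<And>q. sublinear_fun sc q \<Longrightarrow> (\<And>x. q x \<le> l x) \<Longrightarrow> q = l"
    using minimal_sublinear_exists[OF q(1)] by blast
  have minus: "l (- x) = - l x" and add: "l (x + x') = l x + l x'" for x x' using minimal_sublinear_odd[OF l(1,3)] by auto
  have lp: "l x \<le> p i x" for x using l(2)[of x] q(2)[of x] by linarith
  have lx0: "l x0 = p i x0" using l(2)[of "- x0"] q(3) minus[of x0] lp[of x0] by linarith
  have scale_r: "l (sc (cor r) x) = r * l x" for r x
  proof -
    consider "r > 0" | "r = 0" | "r < 0" by linarith
    thus ?thesis
    proof cases
      case 3
      hence "l (sc (cor (- r)) x) = (- r) * l x" using sublinear_scale[OF l(1), of "- r" x] by linarith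
      moreover have "sc (cor (- r)) x = - sc (cor r) x" by simp
      ultimately show ?thesis using minus[of "sc (cor r) x"] by (simp del: scale_minus_left)
    qed (use sublinear_scale[OF l(1)] sublinear_zero[OF l(1)] in auto)
  qed
  define y where "y x = Complex (l x) (- l (sc \<i> x))" for x
  have yadd: "y (u + v) = y u + y v" for u v by (simp add: y_def add scale_right_distrib complex_eq_iff)
  have yscale: "y (sc c u) = c * y u" for c u
  proof -
    have 1: "sc c u = sc (cor (Re c)) u + sc (cor (Im c)) (sc \<i> u)"
      by (simp add: scale_left_distrib[symmetric] complex_eq mult.commute)
    have 2: "sc \<i> (sc c u) = sc (cor (Re c)) (sc \<i> u) + sc (cor (- Im c)) u"
      by (simp add: 1 scale_right_distrib mult.commute)
    have "l (sc c u) = Re c * l u + Im c * l (sc \<i> u)" by (simp add: 1 add scale_r del: scale_scale)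
    moreover have "l (sc \<i> (sc c u)) = Re c * l (sc \<i> u) - Im c * l u" unfolding 2 add scale_r by simp
    ultimately show ?thesis by (simp add: y_def complex_eq_iff algebra_simps)
  qed
  have bound: "cmod (y x) \<le> p i x" for x
  proof (cases "y x = 0")
    case False
    \<comment> \<open>Multiplying \<open>x\<close> by a unit factor makes \<open>y\<close> real and
      nonnegative there, so the bound of the real part \<open>l\<close> bounds the modulus.\<close>
    define c where "c = cnj (y x) / cmod (y x)"
    have c: "cmod c = 1" using False by (simp add: c_def norm_divide)
    have "y (sc c x) = cor (cmod (y x))"
    proof -
      have "cnj (y x) * y x = cor (cmod (y x)) * cor (cmod (y x))"
        using complex_norm_square[of "y x"] by (simp add: power2_eq_square mult.commute)
      thus ?thesis using False by (simp add: yscale c_def)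
    qed
    hence "cmod (y x) = l (sc c x)" by (simp add: y_def complex_eq_iff)
    also have "\<dots> \<le> p i x" using lp[of "sc c x"] c by (simp add: seminorm_scale)
    finally show ?thesis .
  qed simp
  have "y \<in> dual_ball i" using dualI[of y 1 i, OF yadd yscale] bound by (simp add: dual_ball_def)
  moreover have "p i x0 \<le> cmod (y x0)" using complex_Re_le_cmod[of "y x0"] lx0 by (simp add: y_def)
  ultimately show ?thesis using bound[of x0] by (intro bexI[of _ y]) auto
qed

lemma dual_ballD:
  assumes "y \<in> dual_ball i"
  shows "y \<in> lcs_dual sc" "cmod (y x) \<le> p i x" using assms by (auto simp: dual_ball_def)

text \<open>Together with \<open>dual_separates\<close> this carries scalar complex analysis over to
  \<open>E\<close>: an estimate uniform over the polar is an estimate of the seminorm.\<close>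

lemma seminorm_le_dual:
  assumes "\<And>y. y \<in> dual_ball i \<Longrightarrow> cmod (y a) \<le> M"
  shows "p i a \<le> M" using hahn_banach[of i a] assms by metis

text \<open>The constant sequence \<open>0\<close> converges to \<open>a\<close> too, and limits are
  unique in a Hausdorff space.\<close>

lemma seminorms_separate:
  assumes "\<And>i. p i a = 0"
  shows "a = 0"
proof -
  have "((\<lambda>n::nat. 0) \<longlongrightarrow> a) sequentially" unfolding tendsto_iff_seminorms using assms by simp
  thus ?thesis using LIMSEQ_unique tendsto_const by blast
qed

lemma dual_separates:
  assumes "\<And>y. y \<in> lcs_dual sc \<Longrightarrow> y a = y b"
  shows "a = b"
proof -
  have "p i (a - b) \<le> 0" for i by (rule seminorm_le_dual) (simp add: dual_ballD(1) dual_diff assms)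
  hence "a - b = 0" by (intro seminorms_separate) (simp add: antisym)
  thus ?thesis by simp
qed

end

section \<open>Parameter integrals\<close>

lemma has_bochner_integral_exp_abs:
  fixes d :: real
  assumes d: "d > 0"
  shows "has_bochner_integral lborel (\<lambda>t. exp (- d * \<bar>t\<bar>)) (2 / d)"
proof -
  have "has_bochner_integral lborel (\<lambda>t. indicator {0..} t *\<^sub>R exp (- d * \<bar>t\<bar>)) (1 / d)"
  proof (rule has_bochner_integral_nn_integral)
    have "(\<integral>\<^sup>+ t. ennreal (exp (- d * t)) * indicator {0..} t \<partial>lborel) = ennreal (0 - (- exp (- d * 0) / d))"
    proof (rule nn_integral_FTC_atLeast)
      have "filterlim (\<lambda>x. - d * x) at_bot at_top"
        using d by (intro filterlim_tendsto_neg_mult_at_bot[OF tendsto_const]) (auto simp: filterlim_ident)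
      hence "((\<lambda>x. - exp (- d * x) / d) \<longlongrightarrow> - 0 / d) at_top"
        by (intro tendsto_intros filterlim_compose[OF exp_at_bot]) (use d in auto)
      thus "((\<lambda>x. - exp (- d * x) / d) \<longlongrightarrow> 0) at_top" by simp
    qed (use d in \<open>auto intro!: derivative_eq_intros\<close>)
    also have "(\<integral>\<^sup>+ t. ennreal (exp (- d * t)) * indicator {0..} t \<partial>lborel) =
        (\<integral>\<^sup>+ t. ennreal (indicator {0..} t *\<^sub>R exp (- d * \<bar>t\<bar>)) \<partial>lborel)"
      by (intro nn_integral_cong) (auto split: split_indicator)
    finally show "(\<integral>\<^sup>+ t. ennreal (indicator {0..} t *\<^sub>R exp (- d * \<bar>t\<bar>)) \<partial>lborel) = ennreal (1 / d)" by simp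
  qed (use d in \<open>auto intro!: AE_I2\<close>)
  from has_bochner_integral_even_function[OF this] show ?thesis by simp
qed

text \<open>That the value does not depend on \<open>x\<close> makes estimates with kernels centred
  at \<open>Re z\<close> uniform in \<open>z\<close>.\<close>

lemma has_bochner_integral_exp_abs_shift:
  fixes d x :: real
  assumes d: "d > 0"
  shows "has_bochner_integral lborel (\<lambda>t. exp (- d * \<bar>t - x\<bar>)) (2 / d)"
proof -
  have "has_bochner_integral lborel (\<lambda>t. exp (- d * \<bar>(- x) + 1 * t\<bar>)) (inverse \<bar>1\<bar> *\<^sub>R (2 / d))"
    using has_bochner_integral_exp_abs[OF d] lborel_has_bochner_integral_real_affine_iff[of 1 "\<lambda>t. exp (- d * \<bar>t\<bar>)" "2 / d" "- x"]
    by simp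
  thus ?thesis by (simp add: algebra_simps)
qed

lemma integrable_exp_abs: "(d::real) > 0 \<Longrightarrow> integrable lborel (\<lambda>t. exp (- d * \<bar>t\<bar>))"
  and integral_exp_abs: "(d::real) > 0 \<Longrightarrow> (LINT t|lborel. exp (- d * \<bar>t\<bar>)) = 2 / d"
  and integrable_exp_abs_shift: "(d::real) > 0 \<Longrightarrow> integrable lborel (\<lambda>t. exp (- d * \<bar>t - x\<bar>))"
  and integral_exp_abs_shift: "(d::real) > 0 \<Longrightarrow> (LINT t|lborel. exp (- d * \<bar>t - x\<bar>)) = 2 / d"
  using has_bochner_integral_exp_abs has_bochner_integral_exp_abs_shift[of d x] by (auto simp: has_bochner_integral_iff)

lemma integrable_if_exp_bound:
  fixes f :: "real \<Rightarrow> 'b::{banach, second_countable_topology}"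
  assumes "f \<in> borel_measurable lborel" "d > 0" "\<And>t. norm (f t) \<le> C * exp (- d * \<bar>t\<bar>)"
  shows "integrable lborel f"
proof (rule Bochner_Integration.integrable_bound)
  show "integrable lborel (\<lambda>t. C * exp (- d * \<bar>t\<bar>))" using integrable_exp_abs[OF assms(2)] by simp
  show "AE t in lborel. norm (f t) \<le> norm (C * exp (- d * \<bar>t\<bar>))" using assms(3) by (intro AE_I2) (smt (verit) real_norm_def)
qed (use assms in auto)

lemma borel_measurable_finite_exceptions:
  fixes f :: "real \<Rightarrow> 'b::topological_space"
  assumes "finite S" "continuous_on (- S) f"
  shows "f \<in> borel_measurable lborel" using borel_measurable_continuous_countable_exceptions[OF countable_finite[OF assms(1)] assms(2)] by simp

section \<open>Cauchy estimates and holomorphic parameter integrals\<close>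

lemma deriv_bound_ball:
  assumes f: "f holomorphic_on ball z r" and M: "\<And>w. w \<in> ball z r \<Longrightarrow> cmod (f w) \<le> M"
    and r: "r > 0" and w: "w \<in> ball z (r / 2)"
  shows "cmod (deriv f w) \<le> 4 * M / r"
proof -
  have sub: "cball w (r / 4) \<subseteq> ball z r"
  proof
    fix u assume "u \<in> cball w (r / 4)"
    thus "u \<in> ball z r" using w r dist_triangle[of z u w] by (simp add: dist_commute)
  qed
  have "cmod ((deriv ^^ 1) f w) \<le> fact 1 * M / (r / 4) ^ 1"
  proof (rule Cauchy_inequality)
    show "f holomorphic_on ball w (r / 4)" using f sub by (meson ball_subset_cball holomorphic_on_subset order_trans)
    show "continuous_on (cball w (r / 4)) f" using f sub by (meson holomorphic_on_imp_continuous_on holomorphic_on_subset)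
    show "cmod (f x) \<le> M" if "cmod (w - x) = r / 4" for x using that sub by (intro M) (auto simp: dist_norm subset_iff)
  qed (use r in auto)
  thus ?thesis by (simp add: field_simps)
qed

lemma lipschitz_ball:
  assumes f: "f holomorphic_on ball z r" and M: "\<And>w. w \<in> ball z r \<Longrightarrow> cmod (f w) \<le> M"
    and r: "r > 0" and w: "w \<in> ball z (r / 2)" and v: "v \<in> ball z (r / 2)"
  shows "cmod (f w - f v) \<le> 4 * M / r * cmod (w - v)"
proof (rule field_differentiable_bound[where S = "ball z (r / 2)" and f' = "deriv f"])
  show "(f has_field_derivative deriv f u) (at u within ball z (r / 2))" if "u \<in> ball z (r / 2)" for u
    using f that r holomorphic_derivI[OF f open_ball, of u "ball z (r/2)"] by auto
  show "cmod (deriv f u) \<le> 4 * M / r" if "u \<in> ball z (r / 2)" for u using deriv_bound_ball[OF f M r that] .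
qed (use w v in auto)

text \<open>Dominated convergence along sequences. The hypothesis dominates the functions
  themselves; the Cauchy estimate turns this into the bound \<open>4 * g t / r\<close> for the
  difference quotients on the ball of half the radius.\<close>

lemma holomorphic_lebesgue_integral:
  fixes f :: "'a \<Rightarrow> complex \<Rightarrow> complex"
  assumes op: "open \<Omega>" and hol: "\<And>t. t \<in> space M \<Longrightarrow> f t holomorphic_on \<Omega>"
    and meas: "\<And>z. z \<in> \<Omega> \<Longrightarrow> (\<lambda>t. f t z) \<in> borel_measurable M"
    and dom: "\<And>z. z \<in> \<Omega> \<Longrightarrow> \<exists>r>0. \<exists>g. integrable M g \<and> (\<forall>w\<in>ball z r. \<forall>t\<in>space M. cmod (f t w) \<le> g t)"
  shows "(\<lambda>z. LINT t|M. f t z) holomorphic_on \<Omega>"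
proof -
  have "\<exists>D. ((\<lambda>z. LINT t|M. f t z) has_field_derivative D) (at z)" if z: "z \<in> \<Omega>" for z
  proof -
    obtain r0 g where r0: "r0 > 0" "integrable M g" "\<And>w t. w \<in> ball z r0 \<Longrightarrow> t \<in> space M \<Longrightarrow> cmod (f t w) \<le> g t"
      using dom[OF z] by blast
    obtain r1 where r1: "r1 > 0" "ball z r1 \<subseteq> \<Omega>" using op z openE by blast
    define r where "r = min r0 r1"
    have r: "r > 0" "ball z r \<subseteq> \<Omega>" and g: "\<And>w t. w \<in> ball z r \<Longrightarrow> t \<in> space M \<Longrightarrow> cmod (f t w) \<le> g t"
      using r0 r1 by (auto simp: r_def)
    have int: "integrable M (\<lambda>t. f t w)" if "w \<in> ball z r" for w
    proof (rule Bochner_Integration.integrable_bound[OF r0(2)])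
      show "AE t in M. cmod (f t w) \<le> norm (g t)" using g[OF that] by (intro AE_I2) (smt (verit) real_norm_def)
    qed (use meas that r in auto)
    have lim: "(\<lambda>n. ((LINT t|M. f t (X n)) - (LINT t|M. f t z)) / (X n - z)) \<longlonglongrightarrow> (LINT t|M. deriv (f t) z)"
      if X: "\<And>n. X n \<in> ball z (r / 2) - {z}" "X \<longlonglongrightarrow> z" for X
    proof -
      have XB: "X n \<in> ball z r" "X n \<in> ball z (r / 2)" "X n \<in> \<Omega>" for n using X(1)[of n] r by auto
      have eq: "((LINT t|M. f t (X n)) - (LINT t|M. f t z)) / (X n - z) = (LINT t|M. (f t (X n) - f t z) / (X n - z))" for n
        using int[of "X n"] int[of z] XB[of n] r by (simp add: Bochner_Integration.integral_diff)
      have "(\<lambda>n. LINT t|M. (f t (X n) - f t z) / (X n - z)) \<longlonglongrightarrow> (LINT t|M. deriv (f t) z)"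
      proof (rule integral_dominated_convergence[where w = "\<lambda>t. 4 * g t / r"])
        show meas': "(\<lambda>t. (f t (X n) - f t z) / (X n - z)) \<in> borel_measurable M" for n using meas[OF XB(3)[of n]] meas[OF z] by measurable
        have lim: "(\<lambda>n. (f t (X n) - f t z) / (X n - z)) \<longlonglongrightarrow> deriv (f t) z" if t: "t \<in> space M" for t
        proof -
          have "(f t has_field_derivative deriv (f t) z) (at z)" using holomorphic_derivI[OF hol[OF t] op z] .
          hence "((\<lambda>w. (f t w - f t z) / (w - z)) \<longlongrightarrow> deriv (f t) z) (at z)" by (simp add: has_field_derivative_iff)
          moreover have "filterlim X (at z) sequentially" using X by (auto simp: filterlim_at intro!: always_eventually)
          ultimately show ?thesis by (rule filterlim_compose)
        qed
        thus "AE t in M. (\<lambda>n. (f t (X n) - f t z) / (X n - z)) \<longlonglongrightarrow> deriv (f t) z" by auto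
        \<comment> \<open>The derivative is measurable in \<open>t\<close> as a limit of measurable
          difference quotients.\<close>
        show "(\<lambda>t. deriv (f t) z) \<in> borel_measurable M" by (rule borel_measurable_LIMSEQ_metric[OF meas' lim])
        show "integrable M (\<lambda>t. 4 * g t / r)" using r0(2) by auto
        show "AE t in M. norm ((f t (X n) - f t z) / (X n - z)) \<le> 4 * g t / r" for n
        proof (intro AE_I2)
          fix t assume t: "t \<in> space M"
          have "cmod (f t (X n) - f t z) \<le> 4 * g t / r * cmod (X n - z)" using hol[OF t] r g t XB(2)[of n]
            by (intro lipschitz_ball[where z = z and r = r]) (auto intro: holomorphic_on_subset)
          thus "norm ((f t (X n) - f t z) / (X n - z)) \<le> 4 * g t / r" using X(1)[of n] by (simp add: norm_divide divide_le_eq)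
        qed
      qed
      thus ?thesis unfolding eq .
    qed
    have "((\<lambda>w. ((LINT t|M. f t w) - (LINT t|M. f t z)) / (w - z)) \<longlongrightarrow> (LINT t|M. deriv (f t) z)) (at z)"
      unfolding tendsto_at_iff_sequentially
    proof (intro allI impI)
      fix X assume X: "\<forall>i. X i \<in> UNIV - {z}" "X \<longlonglongrightarrow> z"
      obtain N where N: "\<And>n. n \<ge> N \<Longrightarrow> X n \<in> ball z (r / 2)"
        using X(2) r(1) unfolding lim_sequentially by (metis half_gt_zero mem_ball dist_commute)
      have "(\<lambda>n. ((LINT t|M. f t (X (n + N))) - (LINT t|M. f t z)) / (X (n + N) - z)) \<longlonglongrightarrow> (LINT t|M. deriv (f t) z)"
        using X N by (intro lim LIMSEQ_ignore_initial_segment) auto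
      thus "((\<lambda>w. ((LINT t|M. f t w) - (LINT t|M. f t z)) / (w - z)) \<circ> X) \<longlonglongrightarrow> (LINT t|M. deriv (f t) z)"
        unfolding o_def by (rule LIMSEQ_offset)
    qed
    thus ?thesis by (auto simp: has_field_derivative_iff)
  qed
  thus ?thesis using op by (auto simp: holomorphic_on_open)
qed

section \<open>Pettis integrals and vector-valued holomorphy\<close>

context lcs
begin

text \<open>A total operator; its value is meaningful as soon as the integral exists, which holds
  for \<open>decaying\<close> functions.\<close>

definition pint :: "(real \<Rightarrow> 'e) \<Rightarrow> 'e" where
  "pint g = (THE I. has_pettis_integral sc lborel g I)"

lemma pettis_unique:
  "has_pettis_integral sc M g I \<Longrightarrow> has_pettis_integral sc M g J \<Longrightarrow> I = J"
  unfolding has_pettis_integral_def by (rule dual_separates) metis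

lemma pint_eq: "has_pettis_integral sc lborel g I \<Longrightarrow> pint g = I" unfolding pint_def using pettis_unique by blast

definition decaying :: "(real \<Rightarrow> 'e) \<Rightarrow> bool" where
  "decaying g \<longleftrightarrow> (\<exists>S. finite S \<and> continuous_on (- S) g) \<and>
     (\<forall>i. \<exists>C. \<exists>d>0. \<forall>t. p i (g t) \<le> C * exp (- d * \<bar>t\<bar>))"

lemma pettis_bound:
  assumes g: "has_pettis_integral sc M g I" and G: "integrable M G" "\<And>t. p i (g t) \<le> G t"
  shows "p i I \<le> (LINT t|M. G t)"
proof (rule seminorm_le_dual)
  fix y assume y: "y \<in> dual_ball i"
  have "cmod (y I) = cmod (LINT t|M. y (g t))" using g dual_ballD(1)[OF y] by (simp add: has_pettis_integral_def)
  also have "\<dots> \<le> (LINT t|M. G t)" using g dual_ballD[OF y] G order_trans by (intro order_trans[OF integral_norm_bound] integral_mono)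
      (fastforce simp: has_pettis_integral_def)+
  finally show "cmod (y I) \<le> (LINT t|M. G t)" .
qed

lemma hol_space_continuous_on:
  assumes f: "f \<in> hol_space sc \<Omega>" and op: "open \<Omega>"
  shows "continuous_on \<Omega> f"
proof -
  have "(f \<longlongrightarrow> f z) (at z)" if z: "z \<in> \<Omega>" for z
  proof -
    obtain D where "((\<lambda>w. sc (1 / (w - z)) (f w - f z)) \<longlongrightarrow> D) (at z)" using f z unfolding hol_space_def by blast
    hence "((\<lambda>w. sc (w - z) (sc (1 / (w - z)) (f w - f z))) \<longlongrightarrow> sc (z - z) D) (at z)"
      by (intro tendsto_scale_lcs tendsto_intros)
    hence lim: "((\<lambda>w. sc (w - z) (sc (1 / (w - z)) (f w - f z)) + f z) \<longlongrightarrow> 0 + f z) (at z)"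
      by (intro tendsto_intros) simp
    have "((\<lambda>w. f w) \<longlongrightarrow> 0 + f z) (at z)"
      by (rule Lim_transform_eventually[OF lim]) (auto simp: eventually_at intro!: exI[of _ 1])
    thus ?thesis by simp
  qed
  thus ?thesis by (auto simp: continuous_on_def intro: tendsto_within_subset)
qed

lemma hol_space_dual:
  assumes f: "f \<in> hol_space sc \<Omega>" and op: "open \<Omega>" and y: "y \<in> lcs_dual sc"
  shows "(\<lambda>z. y (f z)) holomorphic_on \<Omega>"
proof -
  have "\<exists>D. ((\<lambda>z. y (f z)) has_field_derivative D) (at z)" if z: "z \<in> \<Omega>" for z
  proof -
    obtain D where "((\<lambda>w. sc (1 / (w - z)) (f w - f z)) \<longlongrightarrow> D) (at z)" using f z unfolding hol_space_def by blast
    from dual_tendsto[OF y this] show ?thesis by (auto simp: dual_scale[OF y] dual_diff[OF y] has_field_derivative_iff)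
  qed
  thus ?thesis using op by (auto simp: holomorphic_on_open)
qed

end

locale sc_lcs = lcs sc p
  for sc :: "complex \<Rightarrow> 'e::{t2_space,topological_ab_group_add} \<Rightarrow> 'e" and p :: "'i \<Rightarrow> 'e \<Rightarrow> real" +
  assumes seq_complete: "seq_complete_lcs p"
begin

lemma convergentI_Cauchy:
  assumes "\<And>i e. e > 0 \<Longrightarrow> \<exists>N. \<forall>m\<ge>N. \<forall>n\<ge>N. p i (X m - X n) < e"
  shows "convergent X" using seq_complete assms unfolding seq_complete_lcs_def by simp

text \<open>The integral is the limit of a single sequence of Riemann sums. Their Cauchy property is
  read off from step functions: \<open>y (R N)\<close> is the integral of \<open>y (u N t)\<close>,
  and \<open>E i N\<close> bounds its error for all \<open>y\<close> in the polar
  simultaneously.\<close>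

lemma pettis_exists:
  assumes g: "decaying g"
  shows "\<exists>I. has_pettis_integral sc lborel g I"
proof -
  obtain S where S: "finite S" "continuous_on (- S) g" using g by (auto simp: decaying_def)
  obtain C d where Cd: "\<And>i. d i > 0" "\<And>i t. p i (g t) \<le> C i * exp (- d i * \<bar>t\<bar>)" using g unfolding decaying_def by metis
  have C0: "C i \<ge> 0" for i using order_trans[OF seminorm_nonneg Cd(2)[of i 0]] by simp
  \<comment> \<open>Indices of the nodes \<open>k / N\<close> from \<open>- N\<close> to
    \<open>N\<close>: the mesh shrinks while the window grows.\<close>
  define K where "K N = {- int (N * N)..<int (N * N)}" for N :: nat
  define u where "u N t = (if \<lfloor>real N * t\<rfloor> \<in> K N then g (of_int \<lfloor>real N * t\<rfloor> / real N) else 0)" for N :: nat and t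
  define R where "R N = (\<Sum>k\<in>K N. sc (cor (1 / real N)) (g (of_int k / real N)))" for N :: nat
  define E where "E i N = (LINT t|lborel. p i (u N t - g t))" for i and N :: nat
  have sum_u: "y (u N t) = (\<Sum>k\<in>K N. indicator {of_int k / real N..<(of_int k + 1) / real N} t *\<^sub>R y (g (of_int k / real N)))"
    if N: "N > 0" and y: "y \<in> lcs_dual sc" for y N t
  proof -
    have "indicator {of_int k / real N..<(of_int k + 1) / real N} t = (if k = \<lfloor>real N * t\<rfloor> then 1 else (0::real))" for k
    proof -
      have "t \<in> {of_int k / real N..<(of_int k + 1) / real N} \<longleftrightarrow> \<lfloor>real N * t\<rfloor> = k"
        unfolding floor_eq_iff using N by (auto simp: field_simps)
      thus ?thesis by (auto simp: indicator_def)
    qed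
    hence "(\<Sum>k\<in>K N. indicator {of_int k / real N..<(of_int k + 1) / real N} t *\<^sub>R y (g (of_int k / real N)))
      = (\<Sum>k\<in>K N. if k = \<lfloor>real N * t\<rfloor> then y (g (of_int k / real N)) else 0)" by (intro sum.cong) auto
    also have "\<dots> = y (u N t)" by (simp add: u_def K_def dual_zero[OF y])
    finally show ?thesis by simp
  qed
  have y_sum: "y (sum h A) = (\<Sum>k\<in>A. y (h k))" if "y \<in> lcs_dual sc" for y and h :: "int \<Rightarrow> 'e" and A
    by (induction A rule: infinite_finite_induct) (auto simp: dual_zero dual_add that)
  have int_u: "has_bochner_integral lborel (\<lambda>t. y (u N t)) (y (R N))"
    if N: "N > 0" and y: "y \<in> lcs_dual sc" for y N
  proof -
    have "has_bochner_integral lborel (\<lambda>t. \<Sum>k\<in>K N. indicator {of_int k / real N..<(of_int k + 1) / real N} t *\<^sub>R y (g (of_int k / real N)))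
        (\<Sum>k\<in>K N. (1 / real N) *\<^sub>R y (g (of_int k / real N)))"
    proof (intro has_bochner_integral_sum has_bochner_integral_scaleR_left)
      fix k
      have le: "of_int k / real N \<le> (of_int k + 1) / real N" using N by (simp add: divide_right_mono)
      have "has_bochner_integral lborel (indicator {of_int k / real N..<(of_int k + 1) / real N} :: real \<Rightarrow> real)
          (measure lborel {of_int k / real N..<(of_int k + 1) / real N})" using le by (intro has_bochner_integral_real_indicator) auto
      also have "measure lborel {of_int k / real N..<(of_int k + 1) / real N} = 1 / real N" using le by (simp add: diff_divide_distrib[symmetric])
      finally show "has_bochner_integral lborel (indicator {of_int k / real N..<(of_int k + 1) / real N}) (1 / real N)" .
    qed
    also have "(\<Sum>k\<in>K N. (1 / real N) *\<^sub>R y (g (of_int k / real N))) = y (R N)"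
      by (simp add: R_def y_sum[OF y] dual_scale[OF y] scaleR_conv_of_real)
    finally show ?thesis using sum_u[OF N y] by simp
  qed
  have meas: "(\<lambda>t. p i (u N t - g t)) \<in> borel_measurable lborel" for i N
  proof -
    have "(\<lambda>t. (\<lambda>k t. p i ((if k \<in> K N then g (of_int k / real N) else 0) - g t)) \<lfloor>real N * t\<rfloor> t) \<in> borel_measurable lborel"
    proof (rule measurable_compose_countable[where f = "\<lambda>k t. p i ((if k \<in> K N then g (of_int k / real N) else 0) - g t)"])
      show "(\<lambda>t. p i ((if k \<in> K N then g (of_int k / real N) else 0) - g t)) \<in> borel_measurable lborel" for k
        by (rule borel_measurable_finite_exceptions[OF S(1)]) (intro continuous_on_seminorm continuous_intros S(2))
    qed measurable
    thus ?thesis by (simp add: u_def)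
  qed
  \<comment> \<open>The node to the left of \<open>t\<close> is at distance at most
    \<open>1\<close>, which costs the factor \<open>exp (d i)\<close> in the decay.\<close>
  have bound: "p i (u N t - g t) \<le> C i * (exp (d i) + 1) * exp (- d i * \<bar>t\<bar>)" if N: "N > 0" for i N t
  proof -
    have "p i (u N t) \<le> C i * exp (d i) * exp (- d i * \<bar>t\<bar>)"
    proof (cases "\<lfloor>real N * t\<rfloor> \<in> K N")
      case True
      define s where "s = of_int \<lfloor>real N * t\<rfloor> / real N"
      have "s \<le> t" "t \<le> s + 1 / real N" using N of_int_floor_le[of "real N * t"] real_of_int_floor_add_one_ge[of "real N * t"]
        by (auto simp: s_def field_simps)
      moreover have "1 / real N \<le> 1" using N by simp
      ultimately have "\<bar>t\<bar> \<le> \<bar>s\<bar> + 1" by linarith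
      hence "d i * \<bar>t\<bar> \<le> d i * (\<bar>s\<bar> + 1)" using Cd(1)[of i] by simp
      hence "- d i * \<bar>s\<bar> \<le> d i + - d i * \<bar>t\<bar>" by (simp add: algebra_simps)
      hence "C i * exp (- d i * \<bar>s\<bar>) \<le> C i * exp (d i + - d i * \<bar>t\<bar>)" using C0 by (intro mult_left_mono) auto
      hence "C i * exp (- d i * \<bar>s\<bar>) \<le> C i * exp (d i) * exp (- d i * \<bar>t\<bar>)" by (simp only: exp_add mult.assoc)
      thus ?thesis using True Cd(2)[of i s] by (simp add: u_def s_def)
    next
      case False
      thus ?thesis using C0[of i] by (simp add: u_def)
    qed
    thus ?thesis using Cd(2)[of i t] seminorm_diff[of i "u N t" "g t"] by (simp add: algebra_simps)
  qed
  have int_E: "integrable lborel (\<lambda>t. p i (u N t - g t))" if N: "N > 0" for i N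
  proof (rule integrable_if_exp_bound[OF meas Cd(1)])
    show "norm (p i (u N t - g t)) \<le> C i * (exp (d i) + 1) * exp (- d i * \<bar>t\<bar>)" for t using bound[OF N] by simp
  qed
  have E_lim: "E i \<longlonglongrightarrow> 0" for i
  proof -
    \<comment> \<open>The index is shifted by one to avoid the mesh \<open>1 / 0\<close>.\<close>
    have "(\<lambda>N. LINT t|lborel. p i (u (Suc N) t - g t)) \<longlonglongrightarrow> (LINT t::real|lborel. (0::real))"
    proof (rule integral_dominated_convergence[where w = "\<lambda>t. C i * (exp (d i) + 1) * exp (- d i * \<bar>t\<bar>)" and f = "\<lambda>t. 0"])
      show "integrable lborel (\<lambda>t. C i * (exp (d i) + 1) * exp (- d i * \<bar>t\<bar>))" using integrable_exp_abs[OF Cd(1)] by simp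
      show "AE t in lborel. norm (p i (u (Suc N) t - g t)) \<le> C i * (exp (d i) + 1) * exp (- d i * \<bar>t\<bar>)" for N
        using bound by (intro AE_I2) simp
      have "AE t in lborel. t \<notin> S" using S(1) by (intro AE_not_in) (simp add: finite_imp_null_set_lborel)
      thus "AE t in lborel. (\<lambda>N. p i (u (Suc N) t - g t)) \<longlonglongrightarrow> 0"
      proof eventually_elim
        fix t assume t: "t \<notin> S"
        define s where "s N = of_int \<lfloor>real (Suc N) * t\<rfloor> / real (Suc N)" for N
        have s_bd: "t - 1 / real (Suc N) \<le> s N" "s N \<le> t" for N
        proof -
          define M where "M = real (Suc N)"
          have M: "M > 0" by (simp add: M_def)
          have "(M * t - 1) / M \<le> of_int \<lfloor>M * t\<rfloor> / M" "of_int \<lfloor>M * t\<rfloor> / M \<le> (M * t) / M"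
            using M of_int_floor_le[of "M * t"] real_of_int_floor_add_one_ge[of "M * t"] by (intro divide_right_mono; simp)+
          thus "t - 1 / real (Suc N) \<le> s N" "s N \<le> t" using M unfolding s_def M_def[symmetric] by (simp_all add: diff_divide_distrib)
        qed
        have "s \<longlonglongrightarrow> t"
        proof (rule tendsto_sandwich[where h = "\<lambda>_. t"])
          show "(\<lambda>N. t - 1 / real (Suc N)) \<longlonglongrightarrow> t"
            using tendsto_diff[OF tendsto_const[of t] LIMSEQ_Suc[OF lim_1_over_n]] by simp
        qed (use s_bd in \<open>auto intro!: always_eventually\<close>)
        moreover have "isCont g t" using S t by (simp add: continuous_on_eq_continuous_at open_Compl finite_imp_closed)
        ultimately have gs: "(\<lambda>N. g (s N)) \<longlonglongrightarrow> g t" using isCont_tendsto_compose by blast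
        have "eventually (\<lambda>N. \<lfloor>real (Suc N) * t\<rfloor> \<in> K (Suc N)) sequentially"
        proof -
          obtain N0 :: nat where N0: "\<bar>t\<bar> < real N0" using reals_Archimedean2 by blast
          have "\<lfloor>real (Suc N) * t\<rfloor> \<in> K (Suc N)" if "N \<ge> N0" for N
          proof -
            have "\<bar>t\<bar> < real (Suc N)" using N0 that by simp
            hence "\<bar>real (Suc N) * t\<bar> < real (Suc N) * real (Suc N)" by (simp only: abs_mult) (simp add: mult_strict_left_mono)
            hence "- (real (Suc N) * real (Suc N)) \<le> real (Suc N) * t" "real (Suc N) * t < real (Suc N) * real (Suc N)" by linarith+
            thus ?thesis unfolding K_def by (simp add: le_floor_iff floor_less_iff del: of_nat_Suc mult_Suc mult_Suc_right)
          qed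
          thus ?thesis unfolding eventually_sequentially by blast
        qed
        hence "eventually (\<lambda>N. g (s N) = u (Suc N) t) sequentially" by eventually_elim (auto simp: u_def s_def)
        hence "(\<lambda>N. u (Suc N) t) \<longlonglongrightarrow> g t" by (rule Lim_transform_eventually[OF gs])
        thus "(\<lambda>N. p i (u (Suc N) t - g t)) \<longlonglongrightarrow> 0" by (rule iffD1[OF tendsto_iff_seminorms, rule_format])
      qed
    qed (use meas in auto)
    hence "(\<lambda>N. E i (Suc N)) \<longlonglongrightarrow> 0" by (simp add: E_def)
    thus ?thesis by (rule LIMSEQ_imp_Suc)
  qed
  have S_meas: "(\<lambda>t. y (g t)) \<in> borel_measurable lborel" if "y \<in> lcs_dual sc" for y
    by (rule borel_measurable_finite_exceptions[OF S(1)]) (intro dual_continuous_on that S(2))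
  have int_g: "integrable lborel (\<lambda>t. y (g t))" if y: "y \<in> lcs_dual sc" for y
  proof -
    obtain i B where B: "B \<ge> 0" "\<And>x. cmod (y x) \<le> B * p i x" using dual_bounded[OF y] by blast
    show ?thesis
    proof (rule integrable_if_exp_bound[OF S_meas[OF y] Cd(1)[of i]])
      show "cmod (y (g t)) \<le> B * C i * exp (- d i * \<bar>t\<bar>)" for t using B(2)[of "g t"] mult_left_mono[OF Cd(2)[of i t] B(1)] by simp
    qed
  qed
  have est: "cmod (y (R N) - (LINT t|lborel. y (g t))) \<le> B * E i N"
    if y: "y \<in> lcs_dual sc" and B: "\<And>x. cmod (y x) \<le> B * p i x" and N: "N > 0" for y B i N
  proof -
    have "y (R N) - (LINT t|lborel. y (g t)) = (LINT t|lborel. y (u N t) - y (g t))"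
      using int_u[OF N y] int_g[OF y] by (simp add: has_bochner_integral_iff)
    also have "cmod \<dots> \<le> (LINT t|lborel. cmod (y (u N t) - y (g t)))" by (rule integral_norm_bound)
    also have "\<dots> \<le> (LINT t|lborel. B * p i (u N t - g t))"
    proof (rule integral_mono)
      show "integrable lborel (\<lambda>t. cmod (y (u N t) - y (g t)))" using int_u[OF N y] int_g[OF y]
        by (intro integrable_norm Bochner_Integration.integrable_diff) (simp_all add: has_bochner_integral_iff)
      show "cmod (y (u N t) - y (g t)) \<le> B * p i (u N t - g t)" for t using B[of "u N t - g t"] by (simp add: dual_diff[OF y])
    qed (use int_E[OF N] in simp)
    finally show ?thesis by (simp add: E_def)
  qed
  have "convergent (\<lambda>N. R (Suc N))"
  proof -
    have diff: "p i (R M - R N) \<le> E i M + E i N" if "M > 0" "N > 0" for i M N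
    proof (rule seminorm_le_dual)
      fix y assume y: "y \<in> dual_ball i"
      note y' = dual_ballD[OF y]
      show "cmod (y (R M - R N)) \<le> E i M + E i N" using est[OF y'(1), of 1 i M] est[OF y'(1), of 1 i N] y'(2) that
          norm_triangle_ineq4[of "y (R M) - (LINT t|lborel. y (g t))" "y (R N) - (LINT t|lborel. y (g t))"] by (simp add: dual_diff[OF y'(1)])
    qed
    have "\<exists>N0. \<forall>m\<ge>N0. \<forall>n\<ge>N0. p i (R (Suc m) - R (Suc n)) < e" if e: "e > 0" for i and e :: real
    proof -
      obtain N0 where N0: "\<And>n. n \<ge> N0 \<Longrightarrow> \<bar>E i n\<bar> < e / 2"
        using E_lim[of i] e unfolding lim_sequentially dist_real_def by (metis diff_0_right half_gt_zero)
      show ?thesis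
      proof (intro exI allI impI)
        fix m n assume "N0 \<le> m" "N0 \<le> n"
        thus "p i (R (Suc m) - R (Suc n)) < e" using diff[of "Suc m" "Suc n" i] N0[of "Suc m"] N0[of "Suc n"] by auto
      qed
    qed
    thus ?thesis by (rule convergentI_Cauchy)
  qed
  then obtain I where I: "(\<lambda>N. R (Suc N)) \<longlonglongrightarrow> I" by (auto simp: convergent_def)
  have "y I = (LINT t|lborel. y (g t))" if y: "y \<in> lcs_dual sc" for y
  proof -
    obtain i B where B: "\<And>x. cmod (y x) \<le> B * p i x" using dual_bounded[OF y] by blast
    have "(\<lambda>N. y (R (Suc N)) - (LINT t|lborel. y (g t))) \<longlonglongrightarrow> 0"
    proof (rule tendsto_0_le[where K = 1])
      show "(\<lambda>N. B * E i (Suc N)) \<longlonglongrightarrow> 0" using tendsto_mult_right_zero[OF LIMSEQ_Suc[OF E_lim[of i]]] by simp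
      show "\<forall>\<^sub>F N in sequentially. cmod (y (R (Suc N)) - (LINT t|lborel. y (g t))) \<le> norm (B * E i (Suc N)) * 1"
        using est[OF y B] by (intro always_eventually allI) (smt (verit) mult.right_neutral real_norm_def zero_less_Suc)
    qed
    hence "(\<lambda>N. y (R (Suc N))) \<longlonglongrightarrow> (LINT t|lborel. y (g t))" by (simp add: LIM_zero_iff)
    thus ?thesis using dual_tendsto[OF y I] LIMSEQ_unique by blast
  qed
  thus ?thesis using int_g by (auto simp: has_pettis_integral_def)
qed

lemma has_pettis_pint: "decaying g \<Longrightarrow> has_pettis_integral sc lborel g (pint g)" using pettis_exists pint_eq by blast

lemma dual_pint:
  assumes "decaying g" "y \<in> lcs_dual sc"
  shows "y (pint g) = (LINT t|lborel. y (g t))" "integrable lborel (\<lambda>t. y (g t))"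
  using has_pettis_pint[OF assms(1)] assms(2) by (auto simp: has_pettis_integral_def)

lemma pint_bound:
  assumes "decaying g" "integrable lborel G" "\<And>t. p i (g t) \<le> G t"
  shows "p i (pint g) \<le> (LINT t|lborel. G t)" using pettis_bound[OF has_pettis_pint] assms by blast

lemma pint_bound_exp:
  assumes "decaying g" "d > 0" "\<And>t. p i (g t) \<le> C * exp (- d * \<bar>t - x\<bar>)"
  shows "p i (pint g) \<le> C * (2 / d)"
proof -
  have "integrable lborel (\<lambda>t. C * exp (- d * \<bar>t - x\<bar>))" using integrable_exp_abs_shift[OF assms(2), of x] by simp
  from pint_bound[OF assms(1) this assms(3)] show ?thesis using integral_exp_abs_shift[OF assms(2), of x] by simp
qed

text \<open>The Cauchy estimates bound the difference quotients of \<open>y \<circ> f\<close> uniformly for \<open>y\<close> in the polar of a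
  ball, so those of \<open>f\<close> form a Cauchy net; sequential completeness suffices because the limit is
  found along one sequence.\<close>

lemma weakly_holomorphic_differentiable:
  assumes op: "open \<Omega>" and hol: "\<And>y. y \<in> lcs_dual sc \<Longrightarrow> (\<lambda>z. y (f z)) holomorphic_on \<Omega>"
    and bd: "\<And>i z. z \<in> \<Omega> \<Longrightarrow> \<exists>r>0. \<exists>M. \<forall>w\<in>ball z r. p i (f w) \<le> M"
    and z: "z \<in> \<Omega>"
  shows "\<exists>D. ((\<lambda>w. sc (1 / (w - z)) (f w - f z)) \<longlongrightarrow> D) (at z)"
proof -
  define Q where "Q w = sc (1 / (w - z)) (f w - f z)" for w
  have "\<exists>r>0. \<exists>K. \<forall>v\<in>ball z r - {z}. \<forall>w\<in>ball z r - {z}. p i (Q v - Q w) \<le> K * cmod (v - w)" for i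
  proof -
    obtain r0 M where r0: "r0 > 0" "\<And>w. w \<in> ball z r0 \<Longrightarrow> p i (f w) \<le> M" using bd[OF z] by blast
    obtain r1 where r1: "r1 > 0" "ball z r1 \<subseteq> \<Omega>" using op z openE by blast
    define r where "r = min r0 r1"
    have r: "r > 0" "ball z r \<subseteq> \<Omega>" "\<And>w. w \<in> ball z r \<Longrightarrow> p i (f w) \<le> M" using r0 r1 by (auto simp: r_def)
    have "p i (Q v - Q w) \<le> 4 * (4 * M / r) / (r / 2) * cmod (v - w)"
      if v: "v \<in> ball z (r / 4) - {z}" and w: "w \<in> ball z (r / 4) - {z}" for v w
    proof (rule seminorm_le_dual)
      fix y assume y: "y \<in> dual_ball i"
      note y' = dual_ballD[OF y]
      define F where "F = (\<lambda>w. y (f w))"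
      \<comment> \<open>The difference quotient of \<open>F\<close>, completed at \<open>z\<close>
        by the derivative, is holomorphic. Cauchy's estimate is applied to \<open>F\<close> and then
        to \<open>q\<close>, whence the nested constant.\<close>
      define q where "q = (\<lambda>w. if w = z then deriv F z else (F w - F z) / (w - z))"
      have F: "F holomorphic_on ball z r" unfolding F_def using hol[OF y'(1)] r(2) by (rule holomorphic_on_subset)
      have FM: "cmod (F w) \<le> M" if "w \<in> ball z r" for w using y'(2)[of "f w"] r(3)[OF that] by (simp add: F_def)
      have q: "q holomorphic_on ball z (r / 2)" unfolding q_def using r(1) by (intro pole_lemma_open holomorphic_on_subset[OF F]) auto
      have "cmod (q u) \<le> 4 * M / r" if u: "u \<in> ball z (r / 2)" for u
      proof (cases "u = z")
        case True
        thus ?thesis using deriv_bound_ball[OF F FM r(1)] u by (auto simp: q_def)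
      next
        case False
        have "cmod (F u - F z) \<le> 4 * M / r * cmod (u - z)" using lipschitz_ball[OF F FM r(1) u] r(1) by simp
        thus ?thesis using False by (simp add: q_def norm_divide divide_le_eq)
      qed
      hence "cmod (q v - q w) \<le> 4 * (4 * M / r) / (r / 2) * cmod (v - w)" using v w r(1) by (intro lipschitz_ball[OF q]) auto
      moreover have "y (Q v - Q w) = q v - q w" using v w by (simp add: Q_def q_def F_def dual_diff[OF y'(1)] dual_scale[OF y'(1)])
      ultimately show "cmod (y (Q v - Q w)) \<le> 4 * (4 * M / r) / (r / 2) * cmod (v - w)" by simp
    qed
    hence "\<forall>v\<in>ball z (r / 4) - {z}. \<forall>w\<in>ball z (r / 4) - {z}.
        p i (Q v - Q w) \<le> 4 * (4 * M / r) / (r / 2) * cmod (v - w)" by blast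
    moreover have "r / 4 > 0" using r(1) by simp
    ultimately show ?thesis by blast
  qed
  then obtain r K where rK: "\<And>i. r i > 0"
      "\<And>i v w. v \<in> ball z (r i) - {z} \<Longrightarrow> w \<in> ball z (r i) - {z} \<Longrightarrow> p i (Q v - Q w) \<le> K i * cmod (v - w)"
    by metis
  have K': "p i (Q v - Q w) \<le> \<bar>K i\<bar> * cmod (v - w)" if "v \<in> ball z (r i) - {z}" "w \<in> ball z (r i) - {z}" for i v w
    using rK(2)[OF that] mult_right_mono[OF abs_ge_self[of "K i"], of "cmod (v - w)"] by simp
  define x where "x n = z + cor (1 / real (Suc n))" for n
  have x_lim: "x \<longlonglongrightarrow> z"
  proof -
    have "(\<lambda>n. z + cor (1 / real (Suc n))) \<longlonglongrightarrow> z + cor 0"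
      by (intro tendsto_intros LIMSEQ_Suc[OF lim_1_over_n])
    thus ?thesis by (simp add: x_def[abs_def])
  qed
  have x_ne: "x n \<noteq> z" for n by (simp add: x_def del: of_nat_Suc)
  have ev: "\<exists>N. \<forall>n\<ge>N. x n \<in> ball z e - {z}" if "e > 0" for e
    using x_lim that x_ne unfolding lim_sequentially by (auto simp: dist_commute)
  have "convergent (\<lambda>n. Q (x n))"
  proof -
    have "\<exists>N. \<forall>m\<ge>N. \<forall>n\<ge>N. p i (Q (x m) - Q (x n)) < e" if e: "e > 0" for i and e :: real
    proof -
      \<comment> \<open>On this radius the Lipschitz bound keeps any two quotients closer than
        \<open>e\<close>; \<open>\<bar>K i\<bar> + 1\<close> prevents a vanishing
        denominator.\<close>
      define s where "s = min (r i) (e / (2 * (\<bar>K i\<bar> + 1)))"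
      have s: "s > 0" using rK(1) e by (simp add: s_def)
      obtain N where N: "\<And>n. n \<ge> N \<Longrightarrow> x n \<in> ball z s - {z}" using ev[OF s] by blast
      have "p i (Q (x m) - Q (x n)) < e" if mn: "m \<ge> N" "n \<ge> N" for m n
      proof -
        have "cmod (x m - x n) \<le> 2 * s"
          using N[OF mn(1)] N[OF mn(2)] norm_triangle_ineq4[of "x m - z" "x n - z"] by (simp add: dist_norm norm_minus_commute)
        hence "p i (Q (x m) - Q (x n)) \<le> \<bar>K i\<bar> * (2 * s)"
          using K'[of "x m" i "x n"] N[OF mn(1)] N[OF mn(2)] by (smt (verit) Diff_iff mem_ball mult_left_mono s_def abs_ge_zero)
        also have "\<dots> < (\<bar>K i\<bar> + 1) * (2 * s)" using s by (intro mult_strict_right_mono) auto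
        also have "\<dots> \<le> (\<bar>K i\<bar> + 1) * (2 * (e / (2 * (\<bar>K i\<bar> + 1))))" by (intro mult_left_mono) (auto simp: s_def)
        also have "\<dots> = e" by (simp add: field_simps add_nonneg_eq_0_iff)
        finally show ?thesis .
      qed
      thus ?thesis by blast
    qed
    thus ?thesis by (rule convergentI_Cauchy)
  qed
  then obtain D where D: "(\<lambda>n. Q (x n)) \<longlonglongrightarrow> D" by (auto simp: convergent_def)
  have "(Q \<longlongrightarrow> D) (at z)" unfolding tendsto_iff_seminorms
  proof
    fix i
    \<comment> \<open>The Lipschitz bound passes to the limit along \<open>x n\<close>. This
      upgrades convergence along the sequence to convergence of all quotients at
      \<open>z\<close>.\<close>
    have le: "p i (Q w - D) \<le> \<bar>K i\<bar> * cmod (w - z)" if w: "w \<in> ball z (r i) - {z}" for w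
    proof (rule tendsto_le[OF _ _ ])
      show "(\<lambda>n. p i (Q w - Q (x n))) \<longlonglongrightarrow> p i (Q w - D)" by (intro tendsto_seminorm tendsto_intros D)
      show "(\<lambda>n. \<bar>K i\<bar> * cmod (w - x n)) \<longlonglongrightarrow> \<bar>K i\<bar> * cmod (w - z)" by (intro tendsto_intros x_lim)
      obtain N where "\<And>n. n \<ge> N \<Longrightarrow> x n \<in> ball z (r i) - {z}" using ev[OF rK(1)] by blast
      thus "\<forall>\<^sub>F n in sequentially. p i (Q w - Q (x n)) \<le> \<bar>K i\<bar> * cmod (w - x n)"
        unfolding eventually_sequentially using K' w by blast
    qed simp
    have "((\<lambda>w. \<bar>K i\<bar> * cmod (w - z)) \<longlongrightarrow> \<bar>K i\<bar> * cmod (z - z)) (at z)" by (intro tendsto_intros)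
    hence lim0: "((\<lambda>w. \<bar>K i\<bar> * cmod (w - z)) \<longlongrightarrow> 0) (at z)" by simp
    show "((\<lambda>w. p i (Q w - D)) \<longlongrightarrow> 0) (at z)"
    proof (rule tendsto_0_le[OF lim0, where K = 1])
      show "\<forall>\<^sub>F w in at z. norm (p i (Q w - D)) \<le> norm (\<bar>K i\<bar> * cmod (w - z)) * 1"
        unfolding eventually_at using le rK(1)[of i] by (intro exI[of _ "r i"]) (auto simp: dist_commute)
    qed
  qed
  thus ?thesis unfolding Q_def by blast
qed

lemma hol_space_weakI:
  assumes "open \<Omega>" "\<And>y. y \<in> lcs_dual sc \<Longrightarrow> (\<lambda>z. y (f z)) holomorphic_on \<Omega>"
    and "\<And>i z. z \<in> \<Omega> \<Longrightarrow> \<exists>r>0. \<exists>M. \<forall>w\<in>ball z r. p i (f w) \<le> M"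
    and "\<And>z. z \<notin> \<Omega> \<Longrightarrow> f z = 0"
  shows "f \<in> hol_space sc \<Omega>" unfolding hol_space_def using weakly_holomorphic_differentiable[OF assms(1-3)] assms(4) by auto

lemma locally_bounded_if_continuous:
  assumes "open \<Omega>" "continuous_on \<Omega> f" "z \<in> \<Omega>"
  shows "\<exists>r>0. \<exists>M. \<forall>w\<in>ball z r. p i (f w) \<le> M"
proof -
  have "isCont (\<lambda>w. p i (f w)) z" using continuous_on_seminorm[OF assms(2)] assms(1,3) continuous_on_eq_continuous_at by blast
  then obtain r where "r > 0" "\<And>w. dist w z < r \<Longrightarrow> dist (p i (f w)) (p i (f z)) < 1"
    unfolding continuous_at_eps_delta by (metis zero_less_one)
  thus ?thesis by (intro exI[of _ r] conjI exI[of _ "p i (f z) + 1"]) (fastforce simp: dist_commute dist_real_def)+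
qed

text \<open>The form in which the vector-valued integrals with a complex parameter occur: a scalar
  kernel, holomorphic in the parameter, times a fixed vector function. Existence and holomorphy
  follow from one locally uniform exponential bound.\<close>

lemma hol_space_kernel_integral:
  fixes k :: "real \<Rightarrow> complex \<Rightarrow> complex" and a :: "real \<Rightarrow> 'e"
  assumes op: "open \<Omega>" and S: "finite S" "continuous_on (- S) a"
    and k_cont: "\<And>z. z \<in> \<Omega> \<Longrightarrow> continuous_on (- S) (\<lambda>t. k t z)"
    and k_hol: "\<And>t. k t holomorphic_on \<Omega>"
    and dom: "\<And>z i. z \<in> \<Omega> \<Longrightarrow> \<exists>r>0. \<exists>C. \<exists>d>0. \<forall>w\<in>ball z r. \<forall>t. cmod (k t w) * p i (a t) \<le> C * exp (- d * \<bar>t\<bar>)"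
  shows "\<And>z. z \<in> \<Omega> \<Longrightarrow> decaying (\<lambda>t. sc (k t z) (a t))"
    and "restr \<Omega> (\<lambda>z. pint (\<lambda>t. sc (k t z) (a t))) \<in> hol_space sc \<Omega>"
proof -
  show dec: "decaying (\<lambda>t. sc (k t z) (a t))" if z: "z \<in> \<Omega>" for z unfolding decaying_def
  proof (intro conjI allI)
    show "\<exists>S. finite S \<and> continuous_on (- S) (\<lambda>t. sc (k t z) (a t))"
      using continuous_on_scale_lcs[OF k_cont[OF z] S(2)] S(1) by blast
    show "\<exists>C. \<exists>d>0. \<forall>t. p i (sc (k t z) (a t)) \<le> C * exp (- d * \<bar>t\<bar>)" for i
    proof -
      obtain r C d where "r > 0" "d > 0" "\<forall>w\<in>ball z r. \<forall>t. cmod (k t w) * p i (a t) \<le> C * exp (- d * \<bar>t\<bar>)"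
        using dom[OF z, of i] by blast
      hence "\<forall>t. cmod (k t z) * p i (a t) \<le> C * exp (- d * \<bar>t\<bar>)" by simp
      thus ?thesis using \<open>d > 0\<close> unfolding seminorm_scale by blast
    qed
  qed
  have y_hol: "(\<lambda>z. LINT t|lborel. k t z * y (a t)) holomorphic_on \<Omega>" if y: "y \<in> lcs_dual sc" for y
  proof (rule holomorphic_lebesgue_integral[OF op])
    show "(\<lambda>z. k t z * y (a t)) holomorphic_on \<Omega>" for t by (intro holomorphic_intros k_hol)
    show "(\<lambda>t. k t z * y (a t)) \<in> borel_measurable lborel" if "z \<in> \<Omega>" for z
      by (rule borel_measurable_finite_exceptions[OF S(1)]) (intro continuous_intros k_cont that dual_continuous_on y S(2))
    obtain i B where B: "B \<ge> 0" "\<And>x. cmod (y x) \<le> B * p i x" using dual_bounded[OF y] by blast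
    fix z assume z: "z \<in> \<Omega>"
    obtain r C d where rCd: "r > 0" "d > 0" "\<And>w t. w \<in> ball z r \<Longrightarrow> cmod (k t w) * p i (a t) \<le> C * exp (- d * \<bar>t\<bar>)"
      using dom[OF z, of i] by blast
    have "cmod (k t w * y (a t)) \<le> B * C * exp (- d * \<bar>t\<bar>)" if "w \<in> ball z r" for w t
    proof -
      have "cmod (k t w * y (a t)) \<le> cmod (k t w) * (B * p i (a t))" using B(2)[of "a t"] by (simp add: norm_mult mult_left_mono)
      also have "\<dots> = B * (cmod (k t w) * p i (a t))" by simp
      also have "\<dots> \<le> B * (C * exp (- d * \<bar>t\<bar>))" using rCd(3)[OF that] B(1) by (rule mult_left_mono)
      finally show ?thesis by (simp add: mult.assoc)
    qed
    moreover have "integrable lborel (\<lambda>t. B * C * exp (- d * \<bar>t\<bar>))" using integrable_exp_abs[OF rCd(2)] by simp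
    ultimately show "\<exists>r>0. \<exists>g. integrable lborel g \<and> (\<forall>w\<in>ball z r. \<forall>t\<in>space lborel. cmod (k t w * y (a t)) \<le> g t)"
      using rCd(1) by blast
  qed
  show "restr \<Omega> (\<lambda>z. pint (\<lambda>t. sc (k t z) (a t))) \<in> hol_space sc \<Omega>"
  proof (rule hol_space_weakI[OF op])
    fix y assume y: "y \<in> lcs_dual sc"
    show "(\<lambda>z. y (restr \<Omega> (\<lambda>z. pint (\<lambda>t. sc (k t z) (a t))) z)) holomorphic_on \<Omega>"
      by (rule holomorphic_transform[OF y_hol[OF y]]) (simp add: restr_def dual_pint(1)[OF dec y] dual_scale[OF y])
  next
    fix i z assume z: "z \<in> \<Omega>"
    obtain r0 C d where r0: "r0 > 0" "d > 0" "\<And>w t. w \<in> ball z r0 \<Longrightarrow> cmod (k t w) * p i (a t) \<le> C * exp (- d * \<bar>t\<bar>)"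
      using dom[OF z, of i] by blast
    obtain r1 where r1: "r1 > 0" "ball z r1 \<subseteq> \<Omega>" using op z openE by blast
    have "p i (restr \<Omega> (\<lambda>z. pint (\<lambda>t. sc (k t z) (a t))) w) \<le> C * (2 / d)" if w: "w \<in> ball z (min r0 r1)" for w
    proof -
      have w': "w \<in> \<Omega>" "w \<in> ball z r0" using w r1 by auto
      show ?thesis using pint_bound_exp[OF dec[OF w'(1)] r0(2), of i C 0] r0(3)[OF w'(2)] w'(1) by (simp add: restr_def seminorm_scale)
    qed
    thus "\<exists>r>0. \<exists>M. \<forall>w\<in>ball z r. p i (restr \<Omega> (\<lambda>z. pint (\<lambda>t. sc (k t z) (a t))) w) \<le> M"
      using r0(1) r1(1) by (intro exI[of _ "min r0 r1"] conjI exI[of _ "C * (2 / d)"]) auto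
  qed (simp add: restr_def)
qed

end

section \<open>Integrals along horizontal lines\<close>

definition line_int :: "real \<Rightarrow> (complex \<Rightarrow> complex) \<Rightarrow> complex" where
  "line_int c u = (LINT t|lborel. u (Complex t c))"

lemma cmod_exp_fourier: "cmod (exp (- \<i> * z * w)) = exp (Re z * Im w + Im z * Re w)" by simp

lemma gauss_le_exp: "exp (- (x\<^sup>2)) \<le> exp (a\<^sup>2 / 4) * exp (- a * \<bar>x\<bar>)" for a x :: real
proof -
  have "0 \<le> (\<bar>x\<bar> - a / 2)\<^sup>2" by simp
  hence "- (x\<^sup>2) \<le> a\<^sup>2 / 4 + - a * \<bar>x\<bar>" by (simp add: power2_diff field_simps power2_eq_square)
  thus ?thesis by (simp add: exp_add[symmetric])
qed

lemma cmod_gauss: "cmod (exp (- (w\<^sup>2))) = exp ((Im w)\<^sup>2 - (Re w)\<^sup>2)" by (simp add: power2_eq_square)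

lemma continuous_on_Complex_line [continuous_intros]:
  "continuous_on S f \<Longrightarrow> continuous_on S g \<Longrightarrow> continuous_on S (\<lambda>t. Complex (f t) (g t))"
  unfolding Complex_eq by (intro continuous_intros)

lemma line_continuous:
  assumes "continuous_on \<Omega> u" "\<And>z. Im z = c \<Longrightarrow> z \<in> \<Omega>"
  shows "continuous_on UNIV (\<lambda>t. u (Complex t c))" by (rule continuous_on_compose2[OF assms(1)]) (auto intro!: continuous_intros assms(2))

lemma line_integrable:
  assumes "continuous_on \<Omega> u" "\<And>z. Im z = c \<Longrightarrow> z \<in> \<Omega>" "d > 0"
    "\<And>z. Im z = c \<Longrightarrow> cmod (u z) \<le> B * growth (- d) z"
  shows "integrable lborel (\<lambda>t. u (Complex t c))"
proof (rule integrable_if_exp_bound[OF _ assms(3)])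
  show "cmod (u (Complex t c)) \<le> B * exp (- d * \<bar>t\<bar>)" for t using assms(4)[of "Complex t c"] by simp
qed (use line_continuous[OF assms(1,2)] in \<open>simp add: borel_measurable_continuous_onI\<close>)

lemma integral_trunc_tendsto:
  fixes f :: "real \<Rightarrow> complex"
  assumes f: "integrable lborel f"
  shows "(\<lambda>n. LINT t|lborel. indicator {- real n..real n} t *\<^sub>R f t) \<longlonglongrightarrow> (LINT t|lborel. f t)"
proof (rule integral_dominated_convergence[where w = "\<lambda>t. norm (f t)"])
  show "AE t in lborel. (\<lambda>n. indicator {- real n..real n} t *\<^sub>R f t) \<longlonglongrightarrow> f t"
  proof (intro AE_I2)
    fix t :: real
    obtain N :: nat where N: "\<bar>t\<bar> \<le> real N" using real_arch_simple by blast
    have "\<forall>\<^sub>F n in sequentially. f t = indicator {- real n..real n} t *\<^sub>R f t"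
      unfolding eventually_sequentially using N by (intro exI[of _ N]) (auto simp: indicator_def)
    thus "(\<lambda>n. indicator {- real n..real n} t *\<^sub>R f t) \<longlonglongrightarrow> f t"
      by (rule Lim_transform_eventually[OF tendsto_const])
  qed
qed (use f in \<open>auto simp: indicator_def\<close>)

lemma affine_path_integral:
  assumes der: "\<And>z. z \<in> \<Omega> \<Longrightarrow> (P has_field_derivative u z) (at z)"
    and cont: "continuous_on \<Omega> u" and ab: "a \<le> b"
    and path: "\<And>t. a \<le> t \<Longrightarrow> t \<le> b \<Longrightarrow> w0 + cor t * v \<in> \<Omega>"
  shows "(LINT t|lborel. indicator {a..b} t *\<^sub>R (v * u (w0 + cor t * v))) =
    P (w0 + cor b * v) - P (w0 + cor a * v)"
proof (rule integral_FTC_atLeastAtMost[OF ab])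
  fix t assume t: "a \<le> t" "t \<le> b"
  have "((\<lambda>t. w0 + cor t * v) has_vector_derivative v) (at t within {a..b})" by (auto intro!: derivative_eq_intros)
  moreover have "(P has_field_derivative u (w0 + cor t * v)) (at (w0 + cor t * v) within (\<lambda>t. w0 + cor t * v) ` {a..b})"
    using der[OF path[OF t]] has_field_derivative_at_within by blast
  ultimately show "((\<lambda>t. P (w0 + cor t * v)) has_vector_derivative v * u (w0 + cor t * v)) (at t within {a..b})"
    using field_vector_diff_chain_within by (fastforce simp: o_def)
next
  show "continuous_on {a..b} (\<lambda>t. v * u (w0 + cor t * v))"
    by (intro continuous_intros continuous_on_compose2[OF cont]) (auto intro: path)
qed

lemma primitive_bound:
  assumes "\<And>z. z \<in> closed_segment a b \<Longrightarrow> (P has_field_derivative u z) (at z)"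
    and "\<And>z. z \<in> closed_segment a b \<Longrightarrow> cmod (u z) \<le> M"
  shows "cmod (P b - P a) \<le> M * cmod (b - a)" using assms by (intro field_differentiable_bound[of "closed_segment a b" P u])
    (auto intro: has_field_derivative_at_within)

lemma primitive_exists:
  assumes "convex \<Omega>" "open \<Omega>" "u holomorphic_on \<Omega>"
  obtains P where "\<And>z. z \<in> \<Omega> \<Longrightarrow> (P has_field_derivative u z) (at z)"
  using holomorphic_convex_primitive'[OF assms] assms(2) by (metis at_within_open)

lemma line_int_trunc:
  assumes der: "\<And>z. z \<in> \<Omega> \<Longrightarrow> (P has_field_derivative u z) (at z)"
    and cont: "continuous_on \<Omega> u" and line: "\<And>z. Im z = c \<Longrightarrow> z \<in> \<Omega>" and ab: "a \<le> b"
  shows "(LINT t|lborel. indicator {a..b} t *\<^sub>R u (Complex t c)) = P (Complex b c) - P (Complex a c)"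
  using affine_path_integral[OF der cont ab, of "\<i> * c" 1] line by (simp add: Complex_eq add.commute)

lemma vertical_segment:
  assumes "z \<in> closed_segment (Complex x c1) (Complex x c2)" "c1 \<le> c2"
  shows "Re z = x" "c1 \<le> Im z" "Im z \<le> c2" using assms by (auto simp: closed_segment_same_Re closed_segment_eq_real_ivl)

text \<open>Cauchy's theorem for an infinite strip by means of a primitive \<open>P\<close>. Both
  line integrals are limits of differences of \<open>P\<close>, and across the vertical segments at
  \<open>\<plusminus> n\<close> the values of \<open>P\<close> differ by a null sequence because
  \<open>u\<close> decays.\<close>

lemma line_int_shift_le:
  assumes Om: "convex \<Omega>" "open \<Omega>" "u holomorphic_on \<Omega>"
    and sub: "\<And>z. c1 \<le> Im z \<Longrightarrow> Im z \<le> c2 \<Longrightarrow> z \<in> \<Omega>"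
    and d: "d > 0" and dec: "\<And>z. c1 \<le> Im z \<Longrightarrow> Im z \<le> c2 \<Longrightarrow> cmod (u z) \<le> B * growth (- d) z"
    and c: "c1 \<le> c2"
  shows "line_int c1 u = line_int c2 u"
proof -
  obtain P where P: "\<And>z. z \<in> \<Omega> \<Longrightarrow> (P has_field_derivative u z) (at z)" using primitive_exists[OF Om] by blast
  have cont: "continuous_on \<Omega> u" using Om(3) by (rule holomorphic_on_imp_continuous_on)
  have lim: "(\<lambda>n. P (Complex (real n) c) - P (Complex (- real n) c)) \<longlonglongrightarrow> line_int c u" if "c \<in> {c1, c2}" for c
  proof -
    have cc: "c1 \<le> c" "c \<le> c2" using that c by auto
    have "integrable lborel (\<lambda>t. u (Complex t c))" by (rule line_integrable[OF cont _ d]) (use cc sub dec in auto)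
    from integral_trunc_tendsto[OF this] show ?thesis using line_int_trunc[OF P cont, of c] sub cc by (simp add: line_int_def)
  qed
  have small: "(\<lambda>n. P (Complex (s * real n) c2) - P (Complex (s * real n) c1)) \<longlonglongrightarrow> 0" if s: "\<bar>s\<bar> = 1" for s
  proof (rule Lim_null_comparison)
    have "cmod (P (Complex (s * real n) c2) - P (Complex (s * real n) c1)) \<le> B * exp (- d * real n) * cmod (Complex (s * real n) c2 - Complex (s * real n) c1)" for n
    proof (rule primitive_bound)
      fix z assume "z \<in> closed_segment (Complex (s * real n) c1) (Complex (s * real n) c2)"
      from vertical_segment[OF this c] show "(P has_field_derivative u z) (at z)" "cmod (u z) \<le> B * exp (- d * real n)"
        using sub P dec[of z] s by (auto simp: abs_mult)
    qed
    moreover have "cmod (Complex (s * real n) c2 - Complex (s * real n) c1) = c2 - c1" for n using c by (simp add: cmod_def)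
    ultimately show "\<forall>\<^sub>F n in sequentially. cmod (P (Complex (s * real n) c2) - P (Complex (s * real n) c1)) \<le> B * exp (- d * real n) * (c2 - c1)"
      by (intro always_eventually) simp
    have "filterlim (\<lambda>n. - d * real n) at_bot sequentially"
      using d by (intro filterlim_tendsto_neg_mult_at_bot[OF tendsto_const] filterlim_real_sequentially) auto
    hence "(\<lambda>n. B * exp (- d * real n) * (c2 - c1)) \<longlonglongrightarrow> B * 0 * (c2 - c1)"
      by (intro tendsto_intros filterlim_compose[OF exp_at_bot])
    thus "(\<lambda>n. B * exp (- d * real n) * (c2 - c1)) \<longlonglongrightarrow> 0" by simp
  qed
  have "(\<lambda>n. (P (Complex (real n) c2) - P (Complex (- real n) c2)) - (P (Complex (real n) c1) - P (Complex (- real n) c1))) \<longlonglongrightarrow> line_int c2 u - line_int c1 u"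
    by (intro tendsto_diff lim) auto
  moreover have "(\<lambda>n. (P (Complex (1 * real n) c2) - P (Complex (1 * real n) c1)) - (P (Complex ((-1) * real n) c2) - P (Complex ((-1) * real n) c1))) \<longlonglongrightarrow> 0 - 0"
    by (intro tendsto_diff small) auto
  ultimately have "line_int c2 u - line_int c1 u = 0 - 0" by (intro LIMSEQ_unique) (simp_all add: algebra_simps)
  thus ?thesis by simp
qed

lemma line_int_shift:
  assumes Om: "convex \<Omega>" "open \<Omega>" "u holomorphic_on \<Omega>"
    and sub: "\<And>z. min c1 c2 \<le> Im z \<Longrightarrow> Im z \<le> max c1 c2 \<Longrightarrow> z \<in> \<Omega>"
    and d: "d > 0" and dec: "\<And>z. min c1 c2 \<le> Im z \<Longrightarrow> Im z \<le> max c1 c2 \<Longrightarrow> cmod (u z) \<le> B * growth (- d) z"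
  shows "line_int c1 u = line_int c2 u"
proof (cases "c1 \<le> c2")
  case True
  thus ?thesis using line_int_shift_le[OF Om _ d, of c1 c2 B] sub dec by simp
next
  case False
  thus ?thesis using line_int_shift_le[OF Om _ d, of c2 c1 B] sub dec by simp
qed

lemma line_int_translate: "line_int c (\<lambda>w. u (w - z)) = line_int (c - Im z) u"
proof -
  have "line_int (c - Im z) u = (LINT t|lborel. u (Complex (- Re z + 1 * t) (c - Im z)))"
    unfolding line_int_def using lborel_integral_real_affine[of 1 "\<lambda>t. u (Complex t (c - Im z))" "- Re z"] by simp
  also have "\<dots> = line_int c (\<lambda>w. u (w - z))"
    unfolding line_int_def by (intro Bochner_Integration.integral_cong refl arg_cong[where f = u]) (simp add: complex_eq_iff)
  finally show ?thesis by simp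
qed

lemma line_int_reflect: "line_int c (\<lambda>w. u (- w)) = line_int (- c) u"
proof -
  have "line_int (- c) u = (LINT t|lborel. u (Complex (0 + (- 1) * t) (- c)))"
    unfolding line_int_def using lborel_integral_real_affine[of "- 1" "\<lambda>t. u (Complex t (- c))" 0] by simp
  also have "\<dots> = line_int c (\<lambda>w. u (- w))"
    unfolding line_int_def by (intro Bochner_Integration.integral_cong refl arg_cong[where f = u]) (simp add: complex_eq_iff)
  finally show ?thesis by simp
qed

lemma convex_open_halfplanes:
  "convex {z. Im z > a}" "open {z. Im z > a}" "convex {z. Im z < a}" "open {z. Im z < a}"
  "convex {z. a < Im z \<and> Im z < b}" "open {z. a < Im z \<and> Im z < b}"
proof -
  have eq: "{z. a < Im z \<and> Im z < b} = {z. Im z > a} \<inter> {z. Im z < b}" by auto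
  show "convex {z. Im z > a}" "open {z. Im z > a}" "convex {z. Im z < a}" "open {z. Im z < a}"
    by (auto simp: convex_halfspace_Im_gt convex_halfspace_Im_lt open_halfspace_Im_gt open_halfspace_Im_lt)
  show "convex {z. a < Im z \<and> Im z < b}" "open {z. a < Im z \<and> Im z < b}"
    unfolding eq by (auto intro!: convex_Int open_Int simp: convex_halfspace_Im_gt convex_halfspace_Im_lt open_halfspace_Im_gt open_halfspace_Im_lt)
qed

section \<open>A Cauchy formula for strips\<close>

text \<open>The Cauchy kernel damped by a Gaussian. The residue at \<open>0\<close> is still
  \<open>1\<close>, but the function is integrable along horizontal lines and becomes a test
  function when its pole is moved off the strip.\<close>

definition gauss_cauchy :: "complex \<Rightarrow> complex" where
  "gauss_cauchy w = exp (- (w\<^sup>2)) / w"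

text \<open>The value is \<open>2 \<pi> \<i>\<close>, but only \<open>\<kappa> \<noteq> 0\<close> matters.\<close>

definition kappa :: complex where
  "kappa = line_int (- 1) gauss_cauchy - line_int 1 gauss_cauchy"

lemma gauss_cauchy_bound:
  assumes "0 < c" "c \<le> \<bar>Im w\<bar>" "\<bar>Im w\<bar> \<le> C"
  shows "cmod (gauss_cauchy w) \<le> exp (C\<^sup>2 + 1) / c * growth (- 1) w"
proof -
  have "(Im w)\<^sup>2 \<le> C\<^sup>2" using assms(3) by (metis abs_ge_zero power2_abs power_mono)
  moreover have "exp (- ((Re w)\<^sup>2)) \<le> exp 1 * growth (- 1) w" using gauss_le_exp[of "Re w" 1] by (rule order_trans) simp
  ultimately have "cmod (exp (- (w\<^sup>2))) \<le> exp (C\<^sup>2) * (exp 1 * growth (- 1) w)"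
    unfolding cmod_gauss diff_conv_add_uminus exp_add by (intro mult_mono) auto
  moreover have "c \<le> cmod w" using assms abs_Im_le_cmod order_trans by blast
  ultimately have "cmod (exp (- (w\<^sup>2))) / cmod w \<le> exp (C\<^sup>2) * (exp 1 * growth (- 1) w) / c"
    using assms(1) by (intro frac_le) auto
  thus ?thesis by (simp add: gauss_cauchy_def norm_divide exp_add)
qed

lemma gauss_cauchy_shift:
  assumes "c1 * c2 > 0"
  shows "line_int c1 gauss_cauchy = line_int c2 gauss_cauchy"
proof -
  consider "c1 > 0" "c2 > 0" | "c1 < 0" "c2 < 0" using assms by (metis zero_less_mult_iff)
  thus ?thesis
  proof cases
    case 1
    show ?thesis
    proof (rule line_int_shift[OF convex_open_halfplanes(1,2)[of 0]])
      show "gauss_cauchy holomorphic_on {z. Im z > 0}" unfolding gauss_cauchy_def[abs_def] by (intro holomorphic_intros) auto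
      show "cmod (gauss_cauchy z) \<le> exp ((max c1 c2)\<^sup>2 + 1) / min c1 c2 * growth (- 1) z"
        if "min c1 c2 \<le> Im z" "Im z \<le> max c1 c2" for z by (rule gauss_cauchy_bound) (use 1 that in auto)
    qed (use 1 in auto)
  next
    case 2
    show ?thesis
    proof (rule line_int_shift[OF convex_open_halfplanes(3,4)[of 0]])
      show "gauss_cauchy holomorphic_on {z. Im z < 0}" unfolding gauss_cauchy_def[abs_def] by (intro holomorphic_intros) auto
      show "cmod (gauss_cauchy z) \<le> exp ((- min c1 c2)\<^sup>2 + 1) / (- max c1 c2) * growth (- 1) z"
        if "min c1 c2 \<le> Im z" "Im z \<le> max c1 c2" for z by (rule gauss_cauchy_bound) (use 2 that in auto)
    qed (use 2 in auto)
  qed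
qed

lemma kappa_eq: "a < 0 \<Longrightarrow> 0 < b \<Longrightarrow> line_int a gauss_cauchy - line_int b gauss_cauchy = kappa"
  unfolding kappa_def using gauss_cauchy_shift[of a "- 1"] gauss_cauchy_shift[of b 1] by simp

lemma gauss_cauchy_line_integrable:
  assumes "c \<noteq> 0"
  shows "integrable lborel (\<lambda>t. gauss_cauchy (Complex t c))"
proof (rule line_integrable[where \<Omega> = "- {0}" and d = 1])
  show "continuous_on (- {0}) gauss_cauchy" unfolding gauss_cauchy_def[abs_def] by (intro continuous_intros) auto
  show "cmod (gauss_cauchy z) \<le> exp (\<bar>c\<bar>\<^sup>2 + 1) / \<bar>c\<bar> * growth (- 1) z" if "Im z = c" for z
    by (rule gauss_cauchy_bound) (use assms that in auto)
qed (use assms in auto)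

text \<open>Subtracting \<open>q z\<close> times a Gaussian centred at \<open>z\<close> removes the
  pole, so the remaining quotient \<open>r\<close> has equal integrals over both lines. What is left
  is \<open>q z\<close> times the difference of two integrals of \<open>gauss_cauchy\<close> on
  opposite sides of its pole, that is \<open>kappa\<close>.\<close>

lemma strip_cauchy:
  assumes Om: "convex \<Omega>" "open \<Omega>" and hol: "q holomorphic_on \<Omega>"
    and sub: "\<And>w. a \<le> Im w \<Longrightarrow> Im w \<le> b \<Longrightarrow> w \<in> \<Omega>"
    and d: "d > 0" and dec: "\<And>w. a \<le> Im w \<Longrightarrow> Im w \<le> b \<Longrightarrow> cmod (q w) \<le> B * growth (- d) w"
    and z: "a < Im z" "Im z < b"
  shows "line_int a (\<lambda>w. q w / (w - z)) - line_int b (\<lambda>w. q w / (w - z)) = kappa * q z"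
proof -
  define Q where "Q w = q w - q z * exp (- ((w - z)\<^sup>2))" for w
  define r where "r = (\<lambda>w. if w = z then deriv Q z else (Q w - Q z) / (w - z))"
  have Qz: "Q z = 0" by (simp add: Q_def)
  have Qh: "Q holomorphic_on \<Omega>" unfolding Q_def[abs_def] by (intro holomorphic_intros hol)
  have rh: "r holomorphic_on \<Omega>" unfolding r_def using Qh Om(2) by (rule pole_lemma_open)
  define C where "C = max \<bar>a - Im z\<bar> \<bar>b - Im z\<bar>"
  \<comment> \<open>The Gaussian is estimated by the decay rate \<open>1\<close>, so the minimum is
    the rate common to both summands of \<open>Q\<close>.\<close>
  define d' where "d' = min d 1"
  have d': "d' > 0" "d' \<le> d" "d' \<le> 1" using d by (auto simp: d'_def)
  have B0: "B \<ge> 0"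
  proof -
    have "0 \<le> B * growth (- d) z" using dec[of z] z norm_ge_zero order_trans by (meson less_imp_le)
    thus ?thesis by (simp add: zero_le_mult_iff)
  qed
  define B1 where "B1 = cmod (q z) * exp (C\<^sup>2 + 1 + \<bar>Re z\<bar>)"
  have Qdec: "cmod (Q w) \<le> (B + B1) * growth (- d') w" if w: "a \<le> Im w" "Im w \<le> b" for w
  proof -
    have "(Im (w - z))\<^sup>2 \<le> C\<^sup>2"
    proof -
      have "\<bar>Im (w - z)\<bar> \<le> C" using w by (auto simp: C_def)
      thus ?thesis by (metis abs_ge_zero power2_abs power_mono)
    qed
    moreover have "exp (- ((Re (w - z))\<^sup>2)) \<le> exp 1 * exp (- 1 * \<bar>Re (w - z)\<bar>)"
      using gauss_le_exp[of "Re (w - z)" 1] by (rule order_trans) simp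
    ultimately have "cmod (exp (- ((w - z)\<^sup>2))) \<le> exp (C\<^sup>2) * (exp 1 * exp (- 1 * \<bar>Re (w - z)\<bar>))"
      unfolding cmod_gauss diff_conv_add_uminus[of "(Im (w - z))\<^sup>2"] exp_add by (intro mult_mono) auto
    also have "\<dots> = exp (C\<^sup>2 + 1 - \<bar>Re (w - z)\<bar>)" by (simp add: exp_add[symmetric])
    also have "\<dots> \<le> exp (C\<^sup>2 + 1 + \<bar>Re z\<bar> + - d' * \<bar>Re w\<bar>)"
    proof -
      have "d' * \<bar>Re w\<bar> \<le> 1 * \<bar>Re w\<bar>" using d' by (intro mult_right_mono) auto
      thus ?thesis by simp
    qed
    finally have "cmod (q z * exp (- ((w - z)\<^sup>2))) \<le> B1 * growth (- d') w"
      unfolding B1_def exp_add norm_mult mult.assoc by (intro mult_left_mono) auto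
    moreover have "cmod (q w) \<le> B * growth (- d') w"
    proof -
      have "d' * \<bar>Re w\<bar> \<le> d * \<bar>Re w\<bar>" using d' by (intro mult_right_mono) auto
      hence "B * growth (- d) w \<le> B * growth (- d') w" using B0 by (intro mult_left_mono) auto
      thus ?thesis using dec[OF w] by linarith
    qed
    ultimately show ?thesis unfolding Q_def using norm_triangle_ineq4[of "q w" "q z * exp (- ((w - z)\<^sup>2))"] by (simp add: distrib_right)
  qed
  \<comment> \<open>Near \<open>z\<close> division by \<open>w - z\<close> may enlarge the modulus,
    and compactness of a box gives the bound; where \<open>\<bar>Re (w - z)\<bar> > 1\<close> the
    quotient is at most \<open>Q\<close> in modulus.\<close>
  obtain M where M: "\<And>w. a \<le> Im w \<Longrightarrow> Im w \<le> b \<Longrightarrow> \<bar>Re (w - z)\<bar> \<le> 1 \<Longrightarrow> cmod (r w) \<le> M"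
  proof -
    define R where "R = cbox (Complex (Re z - 1) a) (Complex (Re z + 1) b)"
    have "R \<subseteq> \<Omega>" using sub by (auto simp: R_def in_cbox_complex_iff)
    hence "compact (r ` R)" using rh holomorphic_on_imp_continuous_on holomorphic_on_subset by (intro compact_continuous_image) (auto simp: R_def)
    then obtain M where "\<And>x. x \<in> r ` R \<Longrightarrow> norm x \<le> M" by (meson compact_imp_bounded bounded_iff)
    thus thesis by (intro that[of M]) (auto simp: R_def in_cbox_complex_iff abs_le_iff)
  qed
  have M0: "M \<ge> 0" using order_trans[OF norm_ge_zero M[of z]] z by simp
  have rdec: "cmod (r w) \<le> (B + B1 + M * exp (\<bar>Re z\<bar> + 1)) * growth (- d') w" if w: "a \<le> Im w" "Im w \<le> b" for w
  proof (cases "\<bar>Re (w - z)\<bar> \<le> 1")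
    case True
    have "d' * \<bar>Re w\<bar> \<le> 1 * \<bar>Re w\<bar>" using d' by (intro mult_right_mono) auto
    also have "\<dots> \<le> \<bar>Re z\<bar> + 1" using True by auto
    finally have "1 \<le> exp (\<bar>Re z\<bar> + 1 + - d' * \<bar>Re w\<bar>)" by simp
    hence "M * 1 \<le> M * exp (\<bar>Re z\<bar> + 1 + - d' * \<bar>Re w\<bar>)" using M0 by (intro mult_left_mono)
    hence "cmod (r w) \<le> M * exp (\<bar>Re z\<bar> + 1) * growth (- d') w" using M[OF w True] by (simp only: exp_add mult.assoc)
    moreover have "0 \<le> (B + B1) * growth (- d') w" using B0 by (simp add: B1_def)
    ultimately show ?thesis by (simp add: distrib_right)
  next
    case False
    hence "1 \<le> cmod (w - z)" using abs_Re_le_cmod[of "w - z"] by linarith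
    hence "cmod (r w) \<le> cmod (Q w)" using False by (auto simp: r_def Qz norm_divide divide_le_eq mult_le_cancel_left1)
    moreover have "0 \<le> M * exp (\<bar>Re z\<bar> + 1) * growth (- d') w" using M0 by simp
    ultimately show ?thesis using Qdec[OF w] by (simp add: distrib_right)
  qed
  have shift: "line_int a r = line_int b r" by (rule line_int_shift_le[OF Om rh sub d'(1) rdec]) (use z in auto)
  have split: "line_int c (\<lambda>w. q w / (w - z)) = line_int c r + q z * line_int (c - Im z) gauss_cauchy"
    if c: "c \<in> {a, b}" for c
  proof -
    have cab: "a \<le> c" "c \<le> b" "c \<noteq> Im z" using c z by auto
    have "integrable lborel (\<lambda>t. r (Complex t c))" by (rule line_integrable[OF holomorphic_on_imp_continuous_on[OF rh] _ d'(1)])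
        (use cab sub rdec in auto)
    moreover have "integrable lborel (\<lambda>t. gauss_cauchy (Complex t c - z))"
    proof -
      have "integrable lborel (\<lambda>t. gauss_cauchy (Complex (- Re z + 1 * t) (c - Im z)))"
        using cab gauss_cauchy_line_integrable[of "c - Im z"] by (intro lborel_integrable_real_affine) auto
      moreover have "Complex (- Re z + 1 * t) (c - Im z) = Complex t c - z" for t by (simp add: complex_eq_iff)
      ultimately show ?thesis by simp
    qed
    moreover have "q (Complex t c) / (Complex t c - z) = r (Complex t c) + q z * gauss_cauchy (Complex t c - z)" for t
    proof -
      have "Complex t c \<noteq> z" using cab by auto
      thus ?thesis by (simp add: r_def Qz gauss_cauchy_def) (simp add: Q_def diff_divide_distrib)
    qed
    ultimately have "line_int c (\<lambda>w. q w / (w - z)) = line_int c r + q z * line_int c (\<lambda>w. gauss_cauchy (w - z))"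
      by (simp add: line_int_def)
    thus ?thesis by (simp add: line_int_translate)
  qed
  have "line_int a (\<lambda>w. q w / (w - z)) - line_int b (\<lambda>w. q w / (w - z)) =
      q z * (line_int (a - Im z) gauss_cauchy - line_int (b - Im z) gauss_cauchy)" using split[of a] split[of b] shift by (simp add: algebra_simps)
  also have "line_int (a - Im z) gauss_cauchy - line_int (b - Im z) gauss_cauchy = kappa" using z by (intro kappa_eq) auto
  finally show ?thesis by simp
qed

section \<open>A function cutting off one end of the strip of width four\<close>

lemma compact_box: "compact {z. \<bar>Re z\<bar> \<le> a \<and> \<bar>Im z\<bar> \<le> b}"
proof -
  have "{z. \<bar>Re z\<bar> \<le> a \<and> \<bar>Im z\<bar> \<le> b} = cbox (Complex (- a) (- b)) (Complex a b)" by (auto simp: in_cbox_complex_iff)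
  thus ?thesis by (metis compact_cbox)
qed

text \<open>This is \<open>2 sinh (z / 2)\<close>. Halving the argument keeps the sign of the real
  part equal to that of \<open>Re z\<close> as long as \<open>\<bar>Im z\<bar> < pi\<close>, which
  leaves room for the strip of width four.\<close>

definition two_sinh_half :: "complex \<Rightarrow> complex" where
  "two_sinh_half z = exp (z / 2) - exp (- (z / 2))"

lemma two_sinh_half_parts:
  "Re (two_sinh_half z) = (exp (Re z / 2) - exp (- (Re z / 2))) * cos (Im z / 2)"
  "Im (two_sinh_half z) = (exp (Re z / 2) + exp (- (Re z / 2))) * sin (Im z / 2)" by (simp_all add: two_sinh_half_def Re_exp Im_exp algebra_simps)

text \<open>The value off the strip keeps the reflection formula valid everywhere.\<close>

definition cutoff :: "complex \<Rightarrow> complex" where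
  "cutoff z = (if \<bar>Im z\<bar> < 2 then 1 / (1 + exp (- two_sinh_half z)) else 1 / 2)"

text \<open>A zero requires \<open>exp (- w) = - 1\<close> for \<open>w = two_sinh_half z\<close>.
  Then \<open>Re w = 0\<close>, hence \<open>Re z = 0\<close>, and there
  \<open>w = 2 * \<i> * sin (Im z / 2)\<close> has modulus at most \<open>2 < pi\<close>.\<close>

lemma cutoff_denominator:
  assumes z: "\<bar>Im z\<bar> < 2"
  shows "1 + exp (- two_sinh_half z) \<noteq> 0"
proof
  let ?w = "two_sinh_half z"
  assume "1 + exp (- ?w) = 0"
  hence m1: "exp (- ?w) = - 1" by (simp add: add_eq_0_iff)
  hence "exp (- Re ?w) = 1" using norm_exp_eq_Re[of "- ?w"] by simp
  hence "Re ?w = 0" by simp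
  moreover have "cos (Im z / 2) > 0" using z pi_gt3 by (intro cos_gt_zero_pi) auto
  ultimately have "Re z = 0" by (simp add: two_sinh_half_parts)
  hence "\<bar>Im ?w\<bar> \<le> 2 * 1" unfolding two_sinh_half_parts by (simp add: abs_mult)
  hence "cos pi < cos \<bar>Im ?w\<bar>" using pi_gt3 by (intro cos_monotone_0_pi) auto
  moreover have "cos (Im ?w) = - 1" using arg_cong[OF m1, of Re] \<open>Re ?w = 0\<close> by (simp add: Re_exp)
  ultimately show False by simp
qed

lemma cutoff_holomorphic: "A \<subseteq> {z. \<bar>Im z\<bar> < 2} \<Longrightarrow> cutoff holomorphic_on A"
proof (rule holomorphic_transform)
  assume A: "A \<subseteq> {z. \<bar>Im z\<bar> < 2}"
  show "(\<lambda>z. 1 / (1 + exp (- two_sinh_half z))) holomorphic_on A"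
    using A cutoff_denominator unfolding two_sinh_half_def by (intro holomorphic_intros) auto
qed (auto simp: cutoff_def)

lemma continuous_on_cutoff:
  assumes \<gamma>: "continuous_on S \<gamma>" "\<And>t. t \<in> S \<Longrightarrow> \<bar>Im (\<gamma> t)\<bar> = r"
  shows "continuous_on S (\<lambda>t. cutoff (\<gamma> t))"
proof (cases "r < 2")
  case True
  show ?thesis by (rule continuous_on_compose2[OF holomorphic_on_imp_continuous_on[OF cutoff_holomorphic[OF order_refl]] \<gamma>(1)])
      (use True \<gamma>(2) in auto)
next
  case False
  thus ?thesis by (intro continuous_on_eq[OF continuous_on_const[of _ "1 / 2"]]) (simp add: cutoff_def \<gamma>(2))
qed

text \<open>The logistic function has values with sum \<open>1\<close> at opposite arguments, and
  \<open>two_sinh_half\<close> is odd.\<close>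

lemma cutoff_reflect: "cutoff z + cutoff (- z) = 1"
proof (cases "\<bar>Im z\<bar> < 2")
  case True
  define e where "e = exp (- two_sinh_half z)"
  have "two_sinh_half (- z) = - two_sinh_half z" by (simp add: two_sinh_half_def)
  hence "exp (- two_sinh_half (- z)) = 1 / e" by (simp add: e_def exp_minus divide_inverse)
  moreover have "e \<noteq> 0" "1 + e \<noteq> 0" using cutoff_denominator[OF True] by (auto simp: e_def)
  moreover have "1 / (1 + e) + 1 / (1 + 1 / e) = 1" using calculation(2,3) by (simp add: field_simps)
  ultimately show ?thesis using True by (simp add: cutoff_def e_def[symmetric])
qed (simp add: cutoff_def)

text \<open>The decay for \<open>Re z\<close> tending to \<open>-\<infinity>\<close> is doubly
  exponential. The weaker Gaussian bound \<open>exp (- ((Re z)\<^sup>2 / 16))\<close> is extracted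
  from it, and this beats \<open>exp (a * Re z)\<close> for every \<open>a\<close>.\<close>

lemma cutoff_bound:
  assumes a: "a > 0"
  shows "\<exists>B\<ge>0. \<forall>z. \<bar>Im z\<bar> \<le> 1 \<longrightarrow> cmod (cutoff z) \<le> B \<and> cmod (cutoff z) \<le> B * exp (a * Re z)"
proof -
  let ?K = "{z. \<bar>Re z\<bar> \<le> 4 \<and> \<bar>Im z\<bar> \<le> 1}"
  have "bounded (cutoff ` ?K)"
    by (intro compact_imp_bounded compact_continuous_image compact_box holomorphic_on_imp_continuous_on cutoff_holomorphic) auto
  then obtain M where M: "M > 0" "\<And>z. z \<in> ?K \<Longrightarrow> cmod (cutoff z) \<le> M" by (auto simp: bounded_pos)
  \<comment> \<open>The compact middle part contributes \<open>M\<close> and, since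
    \<open>Re z \<ge> - 4\<close> there, the factor \<open>exp (4 * a)\<close>. The factor
    \<open>exp (4 * a\<^sup>2)\<close> comes from completing the square in the Gaussian
    bound.\<close>
  define B where "B = (M + 2) * exp (4 * a + 4 * a\<^sup>2)"
  have B: "c \<le> B * exp s" if "c \<le> (M + 2) * exp r" "r \<le> 4 * a + 4 * a\<^sup>2 + s" for c r s
  proof -
    have "c \<le> (M + 2) * exp (4 * a + 4 * a\<^sup>2 + s)" using that M(1) by (elim order_trans) (intro mult_left_mono, auto)
    thus ?thesis by (simp add: B_def exp_add mult.assoc)
  qed
  have a2: "0 \<le> 4 * a + 4 * a\<^sup>2" using a by simp
  have "cmod (cutoff z) \<le> B * exp 0 \<and> cmod (cutoff z) \<le> B * exp (a * Re z)" if z: "\<bar>Im z\<bar> \<le> 1" for z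
  proof -
    let ?w = "two_sinh_half z"
    have c: "cutoff z = 1 / (1 + exp (- ?w))" using z by (simp add: cutoff_def)
    have "cos (pi / 3) \<le> cos \<bar>Im z / 2\<bar>" using z pi_gt3 by (intro cos_monotone_0_pi_le) auto
    hence cs: "1 / 2 \<le> cos (Im z / 2)" unfolding cos_abs_real cos_60 .
    \<comment> \<open>The quadratic Taylor bound of the exponential, with half of it lost to the
      cosine. The lower bound reaches \<open>1\<close> at \<open>x = 4\<close>, which explains the
      three cases.\<close>
    have S: "x\<^sup>2 / 16 \<le> (exp (x / 2) - exp (- (x / 2))) * cos (Im z / 2)" if x: "x \<ge> 0" for x
    proof -
      have "1 + x / 2 + (x / 2)\<^sup>2 / 2 \<le> exp (x / 2)" using x by (intro exp_lower_Taylor_quadratic) simp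
      moreover have "exp (- (x / 2)) \<le> 1" using x by simp
      moreover have "(x / 2)\<^sup>2 / 2 = x\<^sup>2 / 8" by (simp add: power2_eq_square)
      ultimately have "x\<^sup>2 / 8 \<le> exp (x / 2) - exp (- (x / 2))" using x by linarith
      hence "x\<^sup>2 / 8 * (1 / 2) \<le> (exp (x / 2) - exp (- (x / 2))) * cos (Im z / 2)" using cs x by (intro mult_mono) auto
      thus ?thesis by simp
    qed
    have e1: "2 \<le> exp (1::real)" using exp_ge_add_one_self[of 1] by simp
    have sq: "1 \<le> x\<^sup>2 / 16" if "4 \<le> \<bar>x\<bar>" for x :: real using abs_le_square_iff[of 4 x] that by simp
    consider "\<bar>Re z\<bar> \<le> 4" | "4 \<le> Re z" | "Re z \<le> - 4" by linarith
    thus ?thesis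
    proof cases
      case 1
      have "a * (- 4) \<le> a * Re z" using 1 a by (intro mult_left_mono) auto
      hence "0 \<le> 4 * a + 4 * a\<^sup>2 + a * Re z" using zero_le_power2[of a] by linarith
      thus ?thesis using M(2)[of z] M(1) 1 z a2 by (intro conjI B[of _ 0]) auto
    next
      case 2
      have "1 \<le> Re ?w" using S[of "Re z"] sq[of "Re z"] 2 unfolding two_sinh_half_parts by linarith
      hence "exp 1 * cmod (exp (- ?w)) \<le> 1" unfolding norm_exp_eq_Re exp_add[symmetric] by simp
      moreover have "2 * cmod (exp (- ?w)) \<le> exp 1 * cmod (exp (- ?w))" using e1 by (intro mult_right_mono) auto
      ultimately have "cmod (exp (- ?w)) \<le> 1 / 2" by linarith
      hence "1 / 2 \<le> cmod (1 + exp (- ?w))" using norm_diff_ineq[of 1 "exp (- ?w)"] unfolding norm_one by linarith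
      hence "cmod (cutoff z) \<le> 2" unfolding c norm_divide by (simp add: divide_le_eq)
      moreover have "0 \<le> a * Re z" using 2 a by simp
      ultimately show ?thesis using M(1) a2 by (intro conjI B[of _ 0]) auto
    next
      case 3
      have w: "Re ?w \<le> - ((Re z)\<^sup>2 / 16)" using S[of "- Re z"] 3 unfolding two_sinh_half_parts by (simp add: algebra_simps)
      hence "exp 1 \<le> cmod (exp (- ?w))" using sq[of "Re z"] 3 by simp
      hence "2 \<le> cmod (exp (- ?w))" using e1 by linarith
      hence "cmod (exp (- ?w)) / 2 \<le> cmod (1 + exp (- ?w))"
        using norm_diff_ineq[of "exp (- ?w)" 1] unfolding norm_one add.commute[of "exp (- ?w)" 1] by linarith
      hence "cmod (cutoff z) \<le> 2 / cmod (exp (- ?w))" unfolding c norm_divide norm_one using frac_le[of 1 1 "cmod (exp (- ?w)) / 2"] by simp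
      also have "\<dots> = 2 * exp (Re ?w)" unfolding norm_exp_eq_Re by (simp add: exp_minus divide_inverse)
      also have "\<dots> \<le> (M + 2) * exp (- ((Re z)\<^sup>2 / 16))" using w M(1) by (intro mult_mono) auto
      finally have c2: "cmod (cutoff z) \<le> (M + 2) * exp (- ((Re z)\<^sup>2 / 16))" .
      have "0 \<le> (Re z / 4 + 2 * a)\<^sup>2" by simp
      hence "- ((Re z)\<^sup>2 / 16) \<le> 4 * a\<^sup>2 + a * Re z" by (simp add: power2_eq_square algebra_simps)
      moreover have "0 \<le> (Re z)\<^sup>2 / 16" by simp
      ultimately show ?thesis using a a2 by (intro conjI B[OF c2]) linarith+
    qed
  qed
  moreover have "B \<ge> 0" using M(1) by (simp add: B_def)
  ultimately show ?thesis by auto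
qed

text \<open>The weight of a cut-off transform, \<open>\<eta>\<close> standing for
  \<open>Im \<zeta>\<close> and \<open>\<epsilon>\<close> for the growth of the function. To the
  right the kernel wins since \<open>\<eta> \<le> - \<epsilon> - \<delta>\<close>. To the left the
  cut-off must outweigh kernel and function together, and a rate \<open>a\<close> for that exists
  because \<open>\<eta>\<close> is bounded below.\<close>

lemma cutoff_weight:
  assumes "0 < \<delta>" "0 \<le> \<epsilon>" "0 \<le> N"
  shows "\<exists>B\<ge>0. \<forall>z \<eta>. \<bar>Im z\<bar> \<le> 1 \<longrightarrow> - N \<le> \<eta> \<longrightarrow> \<eta> \<le> - \<epsilon> - \<delta> \<longrightarrow>
    cmod (cutoff z) * exp (\<epsilon> * \<bar>Re z\<bar> + Re z * \<eta>) \<le> B * growth (- \<delta>) z"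
proof -
  define a where "a = \<epsilon> + N + \<delta>"
  have "a > 0" using assms by (simp add: a_def)
  then obtain B where B: "B \<ge> 0" "\<And>z. \<bar>Im z\<bar> \<le> 1 \<Longrightarrow> cmod (cutoff z) \<le> B \<and> cmod (cutoff z) \<le> B * exp (a * Re z)"
    using cutoff_bound by blast
  have "cmod (cutoff z) * exp (\<epsilon> * \<bar>Re z\<bar> + Re z * \<eta>) \<le> B * growth (- \<delta>) z"
    if z: "\<bar>Im z\<bar> \<le> 1" "- N \<le> \<eta>" "\<eta> \<le> - \<epsilon> - \<delta>" for z \<eta>
  proof (cases "Re z \<ge> 0")
    case True
    have "\<epsilon> * \<bar>Re z\<bar> + Re z * \<eta> = Re z * (\<epsilon> + \<eta>)" using True by (simp add: algebra_simps)
    also have "\<dots> \<le> Re z * (- \<delta>)" using True z by (intro mult_left_mono) auto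
    finally have "\<epsilon> * \<bar>Re z\<bar> + Re z * \<eta> \<le> - \<delta> * \<bar>Re z\<bar>" using True by (simp add: mult.commute)
    thus ?thesis using B(1) B(2)[OF z(1)] by (intro mult_mono) auto
  next
    case False
    have "cmod (cutoff z) * exp (\<epsilon> * \<bar>Re z\<bar> + Re z * \<eta>) \<le> B * exp (a * Re z) * exp (\<epsilon> * \<bar>Re z\<bar> + Re z * \<eta>)"
      using B(2)[OF z(1)] by (intro mult_right_mono) auto
    also have "\<dots> = B * exp (- \<delta> * \<bar>Re z\<bar> + Re z * (N + \<eta>))"
      using False by (simp add: a_def mult.assoc exp_add[symmetric]) (simp add: algebra_simps)
    also have "\<dots> \<le> B * growth (- \<delta>) z" using B(1) z False by (intro mult_left_mono) (auto simp: mult_nonpos_nonneg)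
    finally show ?thesis .
  qed
  thus ?thesis using B(1) by blast
qed

section \<open>The Fourier transform on \<open>P_star\<close>\<close>

lemma closure_slab:
  assumes r: "r > 0"
  shows "closure {z. \<bar>Im z\<bar> < r} = {z. \<bar>Im z\<bar> \<le> r}"
proof
  have "closed {z. \<bar>Im z\<bar> \<le> r}" by (intro closed_Collect_le continuous_intros)
  thus "closure {z. \<bar>Im z\<bar> < r} \<subseteq> {z. \<bar>Im z\<bar> \<le> r}" by (intro closure_minimal) auto
  show "{z. \<bar>Im z\<bar> \<le> r} \<subseteq> closure {z. \<bar>Im z\<bar> < r}"
  proof
    fix z assume "z \<in> {z. \<bar>Im z\<bar> \<le> r}"
    hence z: "\<bar>Im z\<bar> \<le> r" by simp
    show "z \<in> closure {z. \<bar>Im z\<bar> < r}" unfolding closure_approachable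
    proof (intro allI impI)
      fix e :: real assume e: "e > 0"
      define s where "s = min (1 / 2) (e / (2 * r))"
      have s: "0 < s" "s \<le> 1 / 2" "s \<le> e / (2 * r)" using e r by (auto simp: s_def)
      define w where "w = Complex (Re z) ((1 - s) * Im z)"
      have "\<bar>Im w\<bar> = (1 - s) * \<bar>Im z\<bar>" using s by (simp add: w_def abs_mult)
      also have "\<dots> \<le> (1 - s) * r" using s z by (intro mult_left_mono) auto
      also have "\<dots> < r" using s r by (simp add: algebra_simps)
      finally have "\<bar>Im w\<bar> < r" .
      have "w - z = Complex 0 (- s * Im z)" by (simp add: w_def complex_eq_iff algebra_simps)
      hence "dist w z = s * \<bar>Im z\<bar>" using s by (simp add: dist_norm cmod_def abs_mult)
      also have "\<dots> \<le> e / (2 * r) * r" using s z by (intro mult_mono) auto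
      also have "\<dots> < e" using r e by simp
      finally have "dist w z < e" .
      with \<open>\<bar>Im w\<bar> < r\<close> show "\<exists>y\<in>{z. \<bar>Im z\<bar> < r}. dist y z < e" by blast
    qed
  qed
qed

lemma closure_strip: "n \<ge> 1 \<Longrightarrow> closure (strip n) = {z. \<bar>Im z\<bar> \<le> 1 / real n}"
  unfolding strip_def by (rule closure_slab) simp

lemma strip_convex_open: "convex (strip n)" "open (strip n)"
proof -
  have "strip n = {z. - (1 / real n) < Im z \<and> Im z < 1 / real n}" by (auto simp: strip_def)
  thus "convex (strip n)" "open (strip n)" using convex_open_halfplanes(5,6) by simp_all
qed

lemma P_stepD:
  assumes "\<phi> \<in> P_step n" "n \<ge> 1"
  shows "\<phi> holomorphic_on strip n" "continuous_on {z. \<bar>Im z\<bar> \<le> 1 / real n} \<phi>"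
    "\<bar>Im z\<bar> \<le> 1 / real n \<Longrightarrow> cmod (\<phi> z) \<le> P_norm n \<phi> * growth (- (1 / real n)) z"
    "0 \<le> P_norm n \<phi>"
proof -
  show "\<phi> holomorphic_on strip n" "continuous_on {z. \<bar>Im z\<bar> \<le> 1 / real n} \<phi>"
    using assms closure_strip[of n] by (auto simp: P_step_def)
  have *: "cmod (\<phi> z) * growth (1 / real n) z \<le> P_norm n \<phi>" if "\<bar>Im z\<bar> \<le> 1 / real n" for z
    unfolding P_norm_def using assms that by (intro cSUP_upper) (auto simp: P_step_def closure_strip)
  thus "cmod (\<phi> z) \<le> P_norm n \<phi> * growth (- (1 / real n)) z" if "\<bar>Im z\<bar> \<le> 1 / real n"
    using *[OF that] by (simp add: exp_minus field_simps)
  show "0 \<le> P_norm n \<phi>" using order_trans[OF _ *[of 0], of 0] by simp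
qed

lemma P_stepI:
  assumes n: "n \<ge> 1" and hol: "\<phi> holomorphic_on strip n" and cont: "continuous_on {z. \<bar>Im z\<bar> \<le> 1 / real n} \<phi>"
    and C: "\<And>z. \<bar>Im z\<bar> \<le> 1 / real n \<Longrightarrow> cmod (\<phi> z) \<le> C * growth (- (1 / real n)) z"
  shows "\<phi> \<in> P_step n" "P_norm n \<phi> \<le> C"
proof -
  have *: "cmod (\<phi> z) * growth (1 / real n) z \<le> C" if "z \<in> closure (strip n)" for z
    using C[of z] that n by (simp add: closure_strip exp_minus field_simps)
  thus "\<phi> \<in> P_step n" unfolding P_step_def using hol cont n by (auto simp: closure_strip intro!: bdd_aboveI2[where M = C])
  have "closure (strip n) \<noteq> {}" using n by (auto simp: closure_strip intro!: exI[of _ 0])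
  thus "P_norm n \<phi> \<le> C" unfolding P_norm_def using * by (intro cSUP_least)
qed

lemma P_step_mono:
  assumes "\<phi> \<in> P_step n" "1 \<le> n" "n \<le> m"
  shows "\<phi> \<in> P_step m"
proof -
  have le: "1 / real m \<le> 1 / real n" using assms by (simp add: frac_le)
  have "strip m \<subseteq> strip n" using le by (auto simp: strip_def)
  show ?thesis
  proof (rule P_stepI)
    show "\<phi> holomorphic_on strip m" using P_stepD(1)[OF assms(1,2)] \<open>strip m \<subseteq> strip n\<close> holomorphic_on_subset by blast
    show "continuous_on {z. \<bar>Im z\<bar> \<le> 1 / real m} \<phi>" using P_stepD(2)[OF assms(1,2)] le by (rule_tac continuous_on_subset) auto
    show "cmod (\<phi> z) \<le> P_norm n \<phi> * growth (- (1 / real m)) z" if "\<bar>Im z\<bar> \<le> 1 / real m" for z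
    proof -
      have "1 / real m * \<bar>Re z\<bar> \<le> 1 / real n * \<bar>Re z\<bar>" using le by (intro mult_right_mono) auto
      hence "P_norm n \<phi> * growth (- (1 / real n)) z \<le> P_norm n \<phi> * growth (- (1 / real m)) z"
        using P_stepD(4)[OF assms(1,2)] by (intro mult_left_mono) auto
      thus ?thesis using P_stepD(3)[OF assms(1,2), of z] that le by linarith
    qed
  qed (use assms in auto)
qed

lemma P_step_add:
  assumes "\<phi> \<in> P_step n" "\<psi> \<in> P_step n" "n \<ge> 1"
  shows "(\<lambda>z. \<phi> z + \<psi> z) \<in> P_step n"
proof (rule P_stepI(1)[where C = "P_norm n \<phi> + P_norm n \<psi>"])
  show "cmod (\<phi> z + \<psi> z) \<le> (P_norm n \<phi> + P_norm n \<psi>) * growth (- (1 / real n)) z" if "\<bar>Im z\<bar> \<le> 1 / real n" for z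
    using P_stepD(3)[OF assms(1,3) that] P_stepD(3)[OF assms(2,3) that] norm_triangle_ineq[of "\<phi> z" "\<psi> z"] by (simp add: distrib_right)
qed (use assms P_stepD(1,2) in \<open>auto intro!: holomorphic_intros continuous_intros\<close>)

lemma P_step_scale:
  assumes "\<phi> \<in> P_step n" "n \<ge> 1"
  shows "(\<lambda>z. c * \<phi> z) \<in> P_step n"
proof (rule P_stepI(1)[where C = "cmod c * P_norm n \<phi>"])
  show "cmod (c * \<phi> z) \<le> cmod c * P_norm n \<phi> * growth (- (1 / real n)) z" if "\<bar>Im z\<bar> \<le> 1 / real n" for z
    using P_stepD(3)[OF assms that] by (simp add: norm_mult mult_left_mono mult.assoc)
qed (use assms P_stepD(1,2) in \<open>auto intro!: holomorphic_intros continuous_intros\<close>)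

lemma P_step_reflect:
  assumes "\<phi> \<in> P_step n" "n \<ge> 1"
  shows "(\<lambda>z. \<phi> (- z)) \<in> P_step n"
proof (rule P_stepI(1)[where C = "P_norm n \<phi>"])
  have "(\<phi> \<circ> uminus) holomorphic_on strip n"
    by (rule holomorphic_on_compose_gen[OF _ P_stepD(1)[OF assms]]) (auto simp: strip_def intro!: holomorphic_intros)
  thus "(\<lambda>z. \<phi> (- z)) holomorphic_on strip n" by (simp add: o_def)
  show "continuous_on {z. \<bar>Im z\<bar> \<le> 1 / real n} (\<lambda>z. \<phi> (- z))"
    by (rule continuous_on_compose2[OF P_stepD(2)[OF assms]]) (auto intro!: continuous_intros)
  show "cmod (\<phi> (- z)) \<le> P_norm n \<phi> * growth (- (1 / real n)) z" if "\<bar>Im z\<bar> \<le> 1 / real n" for z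
    using P_stepD(3)[OF assms, of "- z"] that by simp
qed (use assms in auto)

lemma P_funs_iff: "\<phi> \<in> P_funs \<longleftrightarrow> (\<exists>n\<ge>1. \<phi> \<in> P_step n)" by (auto simp: P_funs_def)

lemma P_funs_common:
  assumes "\<phi> \<in> P_funs" "\<psi> \<in> P_funs"
  obtains n where "n \<ge> 1" "\<phi> \<in> P_step n" "\<psi> \<in> P_step n"
proof -
  obtain k m where "k \<ge> 1" "\<phi> \<in> P_step k" "m \<ge> 1" "\<psi> \<in> P_step m" using assms by (auto simp: P_funs_iff)
  thus thesis using that[of "max k m"] P_step_mono[of \<phi> k "max k m"] P_step_mono[of \<psi> m "max k m"] by auto
qed

definition same_germ :: "(complex \<Rightarrow> complex) \<Rightarrow> (complex \<Rightarrow> complex) \<Rightarrow> bool" where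
  "same_germ \<phi> \<psi> \<longleftrightarrow> (\<exists>m\<ge>1. \<forall>z\<in>closure (strip m). \<phi> z = \<psi> z)"

lemma germ_iff: "\<psi> \<in> germ \<phi> \<longleftrightarrow> \<psi> \<in> P_funs \<and> same_germ \<psi> \<phi>"
  by (auto simp: germ_def same_germ_def)

lemma germ_self: "\<phi> \<in> P_funs \<Longrightarrow> \<phi> \<in> germ \<phi>" unfolding germ_iff same_germ_def by auto

lemma same_germ_real: "same_germ \<phi> \<psi> \<Longrightarrow> \<phi> (cor x) = \<psi> (cor x)"
  unfolding same_germ_def by (metis closure_strip mem_Collect_eq Im_complex_of_real abs_zero zero_le_divide_1_iff of_nat_0_le_iff)

text \<open>In the non-integrable case the integral has the default value \<open>0\<close>, for
  which the bound holds since \<open>B \<ge> 0\<close>.\<close>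

lemma line_int_bound:
  assumes "d > 0" "\<And>t. cmod (u (Complex t c)) \<le> B * exp (- d * \<bar>t\<bar>)"
  shows "cmod (line_int c u) \<le> B * (2 / d)"
proof -
  have B: "B \<ge> 0" using order_trans[OF norm_ge_zero assms(2)[of 0]] by simp
  show ?thesis
  proof (cases "integrable lborel (\<lambda>t. u (Complex t c))")
    case True
    have "cmod (line_int c u) \<le> (LINT t|lborel. cmod (u (Complex t c)))" unfolding line_int_def by (rule integral_norm_bound)
    also have "\<dots> \<le> (LINT t|lborel. B * exp (- d * \<bar>t\<bar>))"
      using True integrable_exp_abs[OF assms(1)] assms(2) by (intro integral_mono) auto
    also have "\<dots> = B * (2 / d)" using integral_exp_abs[OF assms(1)] by simp
    finally show ?thesis .
  next
    case False
    thus ?thesis using B assms(1) by (simp add: line_int_def not_integrable_integral_eq)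
  qed
qed

section \<open>The transform of test functions by shifting the line of integration\<close>

lemma fourier_eq_line_0: "fourier \<phi> z = line_int 0 (\<lambda>w. \<phi> w * exp (- \<i> * w * z))"
  by (simp add: fourier_def line_int_def complex_of_real_def)

lemma mult_le_abs_mult:
  fixes x y :: real
  assumes "\<bar>y\<bar> \<le> r"
  shows "x * y \<le> \<bar>x\<bar> * r"
proof -
  have "x * y \<le> \<bar>x\<bar> * \<bar>y\<bar>" by (simp add: abs_mult[symmetric])
  also have "\<dots> \<le> \<bar>x\<bar> * r" using assms by (intro mult_left_mono) auto
  finally show ?thesis .
qed

lemma fourier_integrand_bound:
  assumes \<phi>: "\<phi> \<in> P_step n" "n \<ge> 1" and w: "\<bar>Im w\<bar> \<le> 1 / real n" and z: "\<bar>Im z\<bar> \<le> r"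
  shows "cmod (\<phi> w * exp (- \<i> * w * z)) \<le> P_norm n \<phi> * exp (Im w * Re z) * growth (- (1 / real n - r)) w"
proof -
  have "Re w * Im z \<le> \<bar>Re w\<bar> * r" using z by (rule mult_le_abs_mult)
  hence "Re w * Im z + Im w * Re z \<le> Im w * Re z + r * \<bar>Re w\<bar>" by (simp add: mult.commute)
  hence "cmod (exp (- \<i> * w * z)) \<le> exp (Im w * Re z) * growth r w" unfolding cmod_exp_fourier exp_add[symmetric] by simp
  hence "cmod (\<phi> w * exp (- \<i> * w * z)) \<le> (P_norm n \<phi> * growth (- (1 / real n)) w) * (exp (Im w * Re z) * growth r w)"
    using P_stepD(3)[OF \<phi> w] P_stepD(4)[OF \<phi>] unfolding norm_mult by (intro mult_mono) auto
  also have "\<dots> = P_norm n \<phi> * exp (Im w * Re z) * growth (- (1 / real n - r)) w"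
    by (simp add: left_diff_distrib exp_diff exp_minus field_simps)
  finally show ?thesis .
qed

text \<open>The kernel uses up \<open>\<bar>Im z\<bar>\<close> of the decay rate
  \<open>1 / n\<close>, and the positive remainder permits Cauchy's theorem in the strip.\<close>

lemma fourier_eq_line:
  assumes \<phi>: "\<phi> \<in> P_step n" "n \<ge> 1" and b: "\<bar>b\<bar> < 1 / real n" and z: "\<bar>Im z\<bar> < 1 / real n"
  shows "fourier \<phi> z = line_int b (\<lambda>w. \<phi> w * exp (- \<i> * w * z))" unfolding fourier_eq_line_0
proof (rule line_int_shift[OF strip_convex_open])
  show "(\<lambda>w. \<phi> w * exp (- \<i> * w * z)) holomorphic_on strip n" by (intro holomorphic_intros P_stepD(1) \<phi>)
  show "cmod (\<phi> w * exp (- \<i> * w * z)) \<le> P_norm n \<phi> * exp (\<bar>b\<bar> * \<bar>Re z\<bar>) * growth (- (1 / real n - \<bar>Im z\<bar>)) w"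
    if "min 0 b \<le> Im w" "Im w \<le> max 0 b" for w
  proof -
    have "\<bar>Im w\<bar> \<le> \<bar>b\<bar>" using that by auto
    hence "Im w * Re z \<le> \<bar>b\<bar> * \<bar>Re z\<bar>"
      using mult_le_abs_mult[of "Im w" "\<bar>b\<bar>" "Re z"] by (simp add: mult.commute)
    hence "P_norm n \<phi> * exp (Im w * Re z) * growth (- (1 / real n - \<bar>Im z\<bar>)) w \<le> P_norm n \<phi> * exp (\<bar>b\<bar> * \<bar>Re z\<bar>) * growth (- (1 / real n - \<bar>Im z\<bar>)) w"
      using P_stepD(4)[OF \<phi>] by (intro mult_right_mono mult_left_mono) auto
    moreover have "\<bar>Im w\<bar> \<le> 1 / real n" using \<open>\<bar>Im w\<bar> \<le> \<bar>b\<bar>\<close> b by linarith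
    ultimately show ?thesis using fourier_integrand_bound[OF \<phi>, of w z "\<bar>Im z\<bar>"] by simp
  qed
qed (use b z in \<open>auto simp: strip_def\<close>)

text \<open>Moving the line against the sign of \<open>Re z\<close> turns the factor
  \<open>exp (Im w * Re z)\<close> into decay of rate \<open>b\<close> in
  \<open>Re z\<close>.\<close>

lemma fourier_bound:
  assumes \<phi>: "\<phi> \<in> P_step n" "n \<ge> 1" and b: "0 \<le> b" "b < 1 / real n" and z: "\<bar>Im z\<bar> \<le> r" "r < 1 / real n"
  shows "cmod (fourier \<phi> z) \<le> P_norm n \<phi> * (2 / (1 / real n - r)) * growth (- b) z"
proof -
  define c where "c = - b * sgn (Re z)"
  have c: "\<bar>c\<bar> \<le> b" "c * Re z = - b * \<bar>Re z\<bar>" using b by (auto simp: c_def sgn_if)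
  have "cmod (fourier \<phi> z) = cmod (line_int c (\<lambda>w. \<phi> w * exp (- \<i> * w * z)))"
    using fourier_eq_line[OF \<phi>, of c z] c b z by simp
  also have "\<dots> \<le> P_norm n \<phi> * growth (- b) z * (2 / (1 / real n - r))"
  proof (rule line_int_bound)
    show "cmod (\<phi> (Complex t c) * exp (- \<i> * Complex t c * z)) \<le> P_norm n \<phi> * growth (- b) z * exp (- (1 / real n - r) * \<bar>t\<bar>)" for t
      using fourier_integrand_bound[OF \<phi>, of "Complex t c" z r] c b z by simp
  qed (use z in simp)
  finally show ?thesis by (simp only: mult_ac)
qed

lemma P_step_real_continuous:
  assumes \<phi>: "\<phi> \<in> P_step n" "n \<ge> 1" and c: "\<bar>c\<bar> \<le> 1 / real n"
  shows "continuous_on UNIV (\<lambda>t. \<phi> (Complex t c))" using line_continuous[OF P_stepD(2)[OF \<phi>], of c] c by simp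

lemma fourier_holomorphic:
  assumes \<phi>: "\<phi> \<in> P_step n" "n \<ge> 1"
  shows "fourier \<phi> holomorphic_on strip n" unfolding fourier_def[abs_def]
proof (rule holomorphic_lebesgue_integral[OF strip_convex_open(2)])
  show "(\<lambda>t. \<phi> (cor t) * exp (- \<i> * cor t * z)) \<in> borel_measurable lborel" for z
    using P_step_real_continuous[OF \<phi>, of 0]
    by (auto simp: complex_of_real_def[symmetric] intro!: borel_measurable_continuous_onI continuous_intros)
  fix z assume "z \<in> strip n"
  hence z: "\<bar>Im z\<bar> < 1 / real n" by (simp add: strip_def)
  define r where "r = (1 / real n - \<bar>Im z\<bar>) / 2"
  have r: "r > 0" using z by (simp add: r_def)
  have "cmod (\<phi> (cor t) * exp (- \<i> * cor t * w)) \<le> P_norm n \<phi> * exp (- r * \<bar>t\<bar>)"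
    if "w \<in> ball z r" for w t
  proof -
    have "\<bar>Im w - Im z\<bar> \<le> dist z w" using abs_Im_le_cmod[of "w - z"] by (simp add: dist_norm norm_minus_commute)
    hence "\<bar>Im w\<bar> \<le> 1 / real n - r" using that unfolding r_def by (simp add: field_simps)
    from fourier_integrand_bound[OF \<phi> _ this, of "cor t"] show ?thesis by simp
  qed
  moreover have "integrable lborel (\<lambda>t. P_norm n \<phi> * exp (- r * \<bar>t\<bar>))" using integrable_exp_abs[OF r] by simp
  ultimately show "\<exists>r>0. \<exists>g. integrable lborel g \<and> (\<forall>w\<in>ball z r. \<forall>t\<in>space lborel. cmod (\<phi> (cor t) * exp (- \<i> * cor t * w)) \<le> g t)"
    using r by blast
qed (auto intro!: holomorphic_intros)

text \<open>The rate \<open>1 / n\<close> and the width \<open>1 / n\<close> of the strip are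
  attained only up to smaller values, so the transform lies in the later steps. This is where the
  index \<open>Suc n\<close> in the pairings below comes from.\<close>

lemma fourier_P_step:
  assumes \<phi>: "\<phi> \<in> P_step n" "n \<ge> 1" and m: "n < m"
  shows "fourier \<phi> \<in> P_step m"
proof -
  have lt: "1 / real m < 1 / real n" using m \<phi>(2) by (simp add: frac_less2)
  have bound: "cmod (fourier \<phi> z) \<le> P_norm n \<phi> * (2 / (1 / real n - 1 / real m)) * growth (- (1 / real m)) z"
    if "\<bar>Im z\<bar> \<le> 1 / real m" for z by (rule fourier_bound[OF \<phi>]) (use lt that in auto)
  have sub: "{z. \<bar>Im z\<bar> \<le> 1 / real m} \<subseteq> strip n" "strip m \<subseteq> strip n" using lt by (auto simp: strip_def)
  have hol: "fourier \<phi> holomorphic_on strip m" using fourier_holomorphic[OF \<phi>] sub(2) by (rule holomorphic_on_subset)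
  have cont: "continuous_on {z. \<bar>Im z\<bar> \<le> 1 / real m} (fourier \<phi>)"
    using holomorphic_on_imp_continuous_on[OF fourier_holomorphic[OF \<phi>]] sub(1) by (rule continuous_on_subset)
  show "fourier \<phi> \<in> P_step m" using P_stepI(1)[OF _ hol cont bound] m by auto
qed

lemma fourier_cong: "same_germ \<phi> \<psi> \<Longrightarrow> fourier \<phi> = fourier \<psi>"
  unfolding fourier_def using same_germ_real[of \<phi> \<psi>] by simp

lemma fourier_P_germ: "\<phi> \<in> P_funs \<Longrightarrow> fourier_P (germ \<phi>) = germ (fourier \<phi>)"
proof -
  assume \<phi>: "\<phi> \<in> P_funs"
  have "fourier \<psi> = fourier \<phi>" if "\<psi> \<in> germ \<phi>" for \<psi> using that fourier_cong[of \<psi> \<phi>] by (simp add: germ_iff)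
  hence "(\<Union>\<psi>\<in>germ \<phi>. germ (fourier \<psi>)) = (\<Union>\<psi>\<in>germ \<phi>. germ (fourier \<phi>))" by simp
  also have "\<dots> = germ (fourier \<phi>)" using germ_self[OF \<phi>] by auto
  finally show ?thesis by (simp add: fourier_P_def)
qed

lemma fourier_reflect: "fourier (\<lambda>w. \<phi> (- w)) z = fourier \<phi> (- z)"
  unfolding fourier_eq_line_0 using line_int_reflect[of 0 "\<lambda>w. \<phi> w * exp (- \<i> * w * - z)"] by simp

section \<open>Fubini and the inversion formula for test functions\<close>

lemma integrable_product_exp:
  assumes "0 < d" "0 < e"
  shows "integrable (lborel \<Otimes>\<^sub>M lborel) (\<lambda>(s::real, t::real). exp (- d * \<bar>s\<bar>) * exp (- e * \<bar>t\<bar>))"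
proof (rule lborel_pair.Fubini_integrable)
  show "integrable lborel (\<lambda>x. LINT y|lborel. norm (case (x, y) of (s, t) \<Rightarrow> exp (- d * \<bar>s\<bar>) * exp (- e * \<bar>t\<bar>)))"
    using integrable_exp_abs[OF assms(1)] by (simp add: abs_mult)
  show "AE x in lborel. integrable lborel (\<lambda>y. case (x, y) of (s, t) \<Rightarrow> exp (- d * \<bar>s\<bar>) * exp (- e * \<bar>t\<bar>))"
    using integrable_exp_abs[OF assms(2)] by simp
qed measurable

text \<open>The one exchange of integrals behind all pairings: the exponential kernel integrated
  along a path \<open>\<gamma>\<close> inside the strip and tested on the line \<open>Im = b\<close>
  equals the transform of the test function integrated along \<open>\<gamma>\<close>. The inversion
  formula, the cut-off transforms and the contours around infinity are instances.\<close>

lemma fourier_fubini: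
  assumes \<phi>: "\<phi> \<in> P_step n" "n \<ge> 1" and b: "\<bar>b\<bar> < 1 / real n" and c: "c < 1 / real n" "\<And>t. \<bar>Im (\<gamma> t)\<bar> \<le> c"
    and a [measurable]: "a \<in> borel_measurable lborel" and \<gamma> [measurable]: "\<gamma> \<in> borel_measurable lborel"
    and d: "d > 0" and dec: "\<And>t. cmod (a t) * exp (b * Re (\<gamma> t)) \<le> C * exp (- d * \<bar>t\<bar>)"
  shows "line_int b (\<lambda>w. \<phi> w * (LINT t|lborel. a t * exp (- \<i> * \<gamma> t * w))) = (LINT t|lborel. a t * fourier \<phi> (\<gamma> t))"
    and "integrable lborel (\<lambda>s. \<phi> (Complex s b) * (LINT t|lborel. a t * exp (- \<i> * \<gamma> t * Complex s b)))"
proof -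
  define f where "f s t = \<phi> (Complex s b) * (a t * exp (- \<i> * \<gamma> t * Complex s b))" for s t
  have C0: "C \<ge> 0" using order_trans[OF _ dec[of 0], of 0] by simp
  have cont: "continuous_on UNIV (\<lambda>t. \<phi> (Complex t b))" using P_step_real_continuous[OF \<phi>, of b] b by simp
  have [measurable]: "(\<lambda>t. \<phi> (Complex t b)) \<in> borel_measurable borel" "(\<lambda>t. Complex t b) \<in> borel_measurable borel"
    using cont by (auto intro!: borel_measurable_continuous_onI continuous_intros)
  have bound: "cmod (f s t) \<le> P_norm n \<phi> * C * (exp (- (1 / real n - c) * \<bar>s\<bar>) * exp (- d * \<bar>t\<bar>))" for s t
  proof -
    have "f s t = a t * (\<phi> (Complex s b) * exp (- \<i> * Complex s b * \<gamma> t))" by (simp add: f_def mult_ac)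
    hence "cmod (f s t) \<le> cmod (a t) * (P_norm n \<phi> * exp (b * Re (\<gamma> t)) * exp (- (1 / real n - c) * \<bar>s\<bar>))"
      using fourier_integrand_bound[OF \<phi> _ c(2), of "Complex s b" t] b by (simp add: norm_mult mult_left_mono)
    also have "\<dots> = (cmod (a t) * exp (b * Re (\<gamma> t))) * (P_norm n \<phi> * exp (- (1 / real n - c) * \<bar>s\<bar>))" by simp
    also have "\<dots> \<le> (C * exp (- d * \<bar>t\<bar>)) * (P_norm n \<phi> * exp (- (1 / real n - c) * \<bar>s\<bar>))"
      using dec[of t] P_stepD(4)[OF \<phi>] by (intro mult_right_mono) auto
    finally show ?thesis by (simp add: mult_ac)
  qed
  have int: "integrable (lborel \<Otimes>\<^sub>M lborel) (case_prod f)"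
  proof (rule Bochner_Integration.integrable_bound)
    show "integrable (lborel \<Otimes>\<^sub>M lborel) (\<lambda>x. P_norm n \<phi> * C * (\<lambda>(s::real, t::real). exp (- (1 / real n - c) * \<bar>s\<bar>) * exp (- d * \<bar>t\<bar>)) x)"
      using integrable_product_exp[OF _ d, of "1 / real n - c"] c by (intro integrable_mult_right) simp
    show "case_prod f \<in> borel_measurable (lborel \<Otimes>\<^sub>M lborel)" unfolding f_def by measurable
    show "AE x in lborel \<Otimes>\<^sub>M lborel. norm (case x of (x, xa) \<Rightarrow> f x xa) \<le> norm (P_norm n \<phi> * C * (case x of (s, t) \<Rightarrow> exp (- (1 / real n - c) * \<bar>s\<bar>) * exp (- d * \<bar>t\<bar>)))"
      using bound P_stepD(4)[OF \<phi>] C0 by (intro AE_I2) (auto simp: abs_mult)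
  qed
  from lborel_pair.Fubini_integral[OF int]
  have swap: "(LINT s|lborel. LINT t|lborel. f s t) = (LINT t|lborel. LINT s|lborel. f s t)" by simp
  have left: "(LINT s|lborel. LINT t|lborel. f s t) = line_int b (\<lambda>w. \<phi> w * (LINT t|lborel. a t * exp (- \<i> * \<gamma> t * w)))"
    unfolding line_int_def f_def by simp
  have "(LINT s|lborel. f s t) = a t * fourier \<phi> (\<gamma> t)" for t
  proof -
    have "\<bar>Im (\<gamma> t)\<bar> < 1 / real n" using c(2)[of t] c(1) by simp
    hence "fourier \<phi> (\<gamma> t) = line_int b (\<lambda>w. \<phi> w * exp (- \<i> * w * \<gamma> t))" by (rule fourier_eq_line[OF \<phi> b])
    moreover have "f s t = a t * (\<phi> (Complex s b) * exp (- \<i> * Complex s b * \<gamma> t))" for s by (simp add: f_def mult_ac)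
    ultimately show ?thesis by (simp add: line_int_def)
  qed
  thus "line_int b (\<lambda>w. \<phi> w * (LINT t|lborel. a t * exp (- \<i> * \<gamma> t * w))) = (LINT t|lborel. a t * fourier \<phi> (\<gamma> t))"
    using swap left by simp
  show "integrable lborel (\<lambda>s. \<phi> (Complex s b) * (LINT t|lborel. a t * exp (- \<i> * \<gamma> t * Complex s b)))"
    using lborel_pair.integrable_fst'[OF int] by (simp add: f_def)
qed

lemma exp_halfline_integral:
  assumes p: "Re p > 0"
  shows "(LINT t|lborel. indicator {0..} t *\<^sub>R exp (- p * cor t)) = 1 / p"
proof -
  have p0: "p \<noteq> 0" using p by auto
  have int: "integrable lborel (\<lambda>t. indicator {0..} t *\<^sub>R exp (- p * cor t))"
  proof (rule integrable_if_exp_bound[OF _ p])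
    show "norm (indicator {0..} t *\<^sub>R exp (- p * cor t)) \<le> 1 * exp (- Re p * \<bar>t\<bar>)" for t by (auto simp: indicator_def)
  qed measurable
  have "(LINT t|lborel. indicator {- real n..real n} t *\<^sub>R (indicator {0..} t *\<^sub>R exp (- p * cor t))) = (1 - exp (- p * real n)) / p" for n
  proof -
    have "(LINT t|lborel. indicator {0..real n} t *\<^sub>R (1 * (\<lambda>w. exp (- p * w)) (0 + cor t * 1))) =
        (\<lambda>w. - exp (- p * w) / p) (0 + cor (real n) * 1) - (\<lambda>w. - exp (- p * w) / p) (0 + cor 0 * 1)"
      by (rule affine_path_integral[where \<Omega> = UNIV]) (use p0 in \<open>auto intro!: derivative_eq_intros continuous_intros\<close>)
    moreover have "indicator {- real n..real n} t *\<^sub>R (indicator {0..} t *\<^sub>R exp (- p * cor t)) =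
        indicator {0..real n} t *\<^sub>R exp (- p * cor t)" for t by (auto simp: indicator_def)
    ultimately show ?thesis by (simp add: diff_divide_distrib)
  qed
  hence "(\<lambda>n. (1 - exp (- p * cor (real n))) / p) \<longlonglongrightarrow> (LINT t|lborel. indicator {0..} t *\<^sub>R exp (- p * cor t))"
    using integral_trunc_tendsto[OF int] by simp
  moreover have "(\<lambda>n. (1 - exp (- p * cor (real n))) / p) \<longlonglongrightarrow> (1 - 0) / p"
  proof (intro tendsto_intros)
    have "(\<lambda>n. exp (- Re p * real n)) \<longlonglongrightarrow> 0"
      using p by (intro filterlim_compose[OF exp_at_bot] filterlim_tendsto_neg_mult_at_bot[OF tendsto_const] filterlim_real_sequentially) auto
    thus "(\<lambda>n. exp (- p * cor (real n))) \<longlonglongrightarrow> 0"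
      by (rule tendsto_norm_zero_cancel[OF tendsto_cong[THEN iffD1, rotated]]) simp
  qed (use p0 in auto)
  ultimately show ?thesis using LIMSEQ_unique by fastforce
qed

text \<open>On the line \<open>Im = - b\<close> the kernel decays in \<open>t \<ge> 0\<close> with
  rate \<open>b\<close>, of which \<open>exp (- \<i> * cor t * x)\<close> consumes at most
  \<open>\<bar>Im x\<bar>\<close>. The inner integral is then the elementary
  \<open>1 / (\<i> * (w + x))\<close>, and a Cauchy integral is left.\<close>

lemma fourier_half_inversion:
  assumes \<phi>: "\<phi> \<in> P_step n" "n \<ge> 1" and b: "0 < b" "b < 1 / real n" and x: "\<bar>Im x\<bar> < b"
  shows "(LINT t|lborel. (indicator {0..} t *\<^sub>R exp (- \<i> * cor t * x)) * fourier \<phi> (cor t))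
    = - \<i> * line_int (- b) (\<lambda>w. \<phi> w / (w + x))"
proof -
  have "line_int (- b) (\<lambda>w. \<phi> w * (LINT t|lborel. (indicator {0..} t *\<^sub>R exp (- \<i> * cor t * x)) * exp (- \<i> * cor t * w)))
    = (LINT t|lborel. (indicator {0..} t *\<^sub>R exp (- \<i> * cor t * x)) * fourier \<phi> (cor t))"
  proof (rule fourier_fubini(1)[OF \<phi>, where c = 0 and C = 1 and d = "b - \<bar>Im x\<bar>"])
    show "cmod (indicator {0..} t *\<^sub>R exp (- \<i> * cor t * x)) * exp (- b * Re (cor t)) \<le> 1 * exp (- (b - \<bar>Im x\<bar>) * \<bar>t\<bar>)" for t
    proof (cases "t \<ge> 0")
      case True
      have "t * Im x \<le> t * \<bar>Im x\<bar>" using True by (intro mult_left_mono) auto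
      thus ?thesis using True by (simp add: exp_add[symmetric] algebra_simps)
    qed simp
  qed (use b x \<phi>(2) in auto)
  moreover have "line_int (- b) (\<lambda>w. \<phi> w * (LINT t|lborel. (indicator {0..} t *\<^sub>R exp (- \<i> * cor t * x)) * exp (- \<i> * cor t * w)))
    = - \<i> * line_int (- b) (\<lambda>w. \<phi> w / (w + x))"
  proof -
    have inner: "(LINT t|lborel. (indicator {0..} t *\<^sub>R exp (- \<i> * cor t * x)) * exp (- \<i> * cor t * w)) = - \<i> * (1 / (w + x))"
      if "Im w = - b" for w
    proof -
      have "(LINT t|lborel. (indicator {0..} t *\<^sub>R exp (- \<i> * cor t * x)) * exp (- \<i> * cor t * w))
        = (LINT t|lborel. indicator {0..} t *\<^sub>R exp (- (\<i> * (w + x)) * cor t))"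
        by (intro Bochner_Integration.integral_cong refl) (simp add: exp_add[symmetric] algebra_simps)
      also have "\<dots> = 1 / (\<i> * (w + x))" by (rule exp_halfline_integral) (use that x in auto)
      finally show ?thesis by (simp add: divide_inverse)
    qed
    have "line_int (- b) (\<lambda>w. \<phi> w * (LINT t|lborel. (indicator {0..} t *\<^sub>R exp (- \<i> * cor t * x)) * exp (- \<i> * cor t * w)))
      = line_int (- b) (\<lambda>w. - \<i> * (\<phi> w / (w + x)))"
      unfolding line_int_def by (intro Bochner_Integration.integral_cong refl, subst inner) simp_all
    thus ?thesis unfolding line_int_def by (simp only: integral_mult_right_zero)
  qed
  ultimately show ?thesis by simp
qed

text \<open>The halves \<open>t \<ge> 0\<close> and \<open>t \<le> 0\<close> give Cauchy integrals
  over \<open>Im = - b\<close> and \<open>Im = b\<close>, which Cauchy's formula in the strip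
  combines to the value at \<open>- x\<close>. The negative half is the positive half of the
  reflected function.\<close>

lemma fourier_fourier:
  assumes \<phi>: "\<phi> \<in> P_step n" "n \<ge> 1" and x: "\<bar>Im x\<bar> < 1 / real n"
  shows "fourier (fourier \<phi>) x = - \<i> * kappa * \<phi> (- x)"
proof -
  obtain b where b: "\<bar>Im x\<bar> < b" "b < 1 / real n" using x dense by blast
  hence b0: "0 < b" by linarith
  define h where "h \<phi> x t = (indicator {0..} t *\<^sub>R exp (- \<i> * cor t * x)) * fourier \<phi> (cor t)" for \<phi> x and t :: real
  have int: "integrable lborel (h \<phi> x)" if \<phi>: "\<phi> \<in> P_step n" and x: "\<bar>Im x\<bar> < b" for \<phi> x
  proof (rule integrable_if_exp_bound)
    have "continuous_on UNIV (\<lambda>t. fourier \<phi> (cor t))"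
      using P_step_real_continuous[OF fourier_P_step[OF \<phi> \<open>n \<ge> 1\<close> lessI], of 0] by (simp add: complex_of_real_def)
    hence [measurable]: "(\<lambda>t. fourier \<phi> (cor t)) \<in> borel_measurable borel" by (rule borel_measurable_continuous_onI)
    show "h \<phi> x \<in> borel_measurable lborel" unfolding h_def[abs_def] by measurable
    show "norm (h \<phi> x t) \<le> P_norm n \<phi> * (2 / (1 / real n - 0)) * exp (- (b - \<bar>Im x\<bar>) * \<bar>t\<bar>)" for t
    proof (cases "t \<ge> 0")
      case True
      have "t * Im x \<le> t * \<bar>Im x\<bar>" using True by (intro mult_left_mono) auto
      hence e: "exp (t * Im x) * exp (- b * \<bar>t\<bar>) \<le> exp (- (b - \<bar>Im x\<bar>) * \<bar>t\<bar>)"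
        using True by (simp add: exp_add[symmetric] algebra_simps)
      have "norm (h \<phi> x t) = exp (t * Im x) * cmod (fourier \<phi> (cor t))" using True by (simp add: h_def norm_mult)
      also have "\<dots> \<le> exp (t * Im x) * (P_norm n \<phi> * (2 / (1 / real n - 0)) * exp (- b * \<bar>t\<bar>))"
        using fourier_bound[OF \<phi> \<open>n \<ge> 1\<close>, of b "cor t" 0] b b0 \<open>n \<ge> 1\<close> by (intro mult_left_mono) auto
      also have "\<dots> = P_norm n \<phi> * (2 / (1 / real n - 0)) * (exp (t * Im x) * exp (- b * \<bar>t\<bar>))" by simp
      also have "\<dots> \<le> P_norm n \<phi> * (2 / (1 / real n - 0)) * exp (- (b - \<bar>Im x\<bar>) * \<bar>t\<bar>)"
        using P_stepD(4)[OF \<phi> \<open>n \<ge> 1\<close>] by (intro mult_left_mono e) auto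
      finally show ?thesis .
    qed (use P_stepD(4)[OF \<phi> \<open>n \<ge> 1\<close>] in \<open>simp add: h_def\<close>)
  qed (use x in simp)
  let ?r = "\<lambda>w. \<phi> (- w)"
  have r: "?r \<in> P_step n" by (rule P_step_reflect[OF \<phi>])
  have pos: "(LINT t|lborel. h \<phi> x t) = - \<i> * line_int (- b) (\<lambda>w. \<phi> w / (w + x))"
    unfolding h_def by (rule fourier_half_inversion[OF \<phi> b0 b(2,1)])
  have "(LINT t|lborel. h ?r (- x) t) = - \<i> * line_int (- b) (\<lambda>w. \<phi> (- w) / (w + (- x)))"
    unfolding h_def by (rule fourier_half_inversion[OF r \<phi>(2) b0 b(2)]) (use b in simp)
  also have "line_int (- b) (\<lambda>w. \<phi> (- w) / (w + (- x))) = line_int (- b) (\<lambda>w. (\<lambda>w. - (\<phi> w / (w + x))) (- w))"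
  proof -
    have "\<phi> (- w) / (w + - x) = - (\<phi> (- w) / (- w + x))" for w by (metis add.inverse_inverse divide_minus_right minus_add_distrib)
    thus ?thesis by simp
  qed
  also have "\<dots> = line_int (- (- b)) (\<lambda>w. - (\<phi> w / (w + x)))" by (rule line_int_reflect)
  also have "\<dots> = - line_int b (\<lambda>w. \<phi> w / (w + x))" by (simp add: line_int_def)
  finally have neg: "(LINT t|lborel. h ?r (- x) t) = \<i> * line_int b (\<lambda>w. \<phi> w / (w + x))" by simp
  have "fourier (fourier \<phi>) x = (LINT t|lborel. h \<phi> x t + h ?r (- x) (0 + (- 1) * t))" unfolding fourier_def[of "fourier \<phi>"]
  proof (rule integral_cong_AE)
    \<comment> \<open>The two halves share the point \<open>0\<close>, a null set.\<close>
    have "AE t in lborel. t \<noteq> (0::real)" by (rule AE_lborel_singleton)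
    thus "AE t in lborel. fourier \<phi> (cor t) * exp (- \<i> * cor t * x) = h \<phi> x t + h ?r (- x) (0 + (- 1) * t)"
      by eventually_elim (auto simp: h_def indicator_def fourier_reflect)
    have "integrable lborel (\<lambda>t. h ?r (- x) (0 + (- 1) * t))" using int[OF r, of "- x"] b by (intro lborel_integrable_real_affine) auto
    thus "(\<lambda>t. h \<phi> x t + h ?r (- x) (0 + (- 1) * t)) \<in> borel_measurable lborel"
      using int[OF \<phi>(1) b(1)] by (intro borel_measurable_add) auto
    show "(\<lambda>t. fourier \<phi> (cor t) * exp (- \<i> * cor t * x)) \<in> borel_measurable lborel"
      using P_step_real_continuous[OF fourier_P_step[OF \<phi> lessI], of 0]
      by (auto simp: complex_of_real_def[symmetric] intro!: borel_measurable_continuous_onI continuous_intros)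
  qed
  also have "\<dots> = (LINT t|lborel. h \<phi> x t) + (LINT t|lborel. h ?r (- x) (0 + (- 1) * t))" using int[OF \<phi>(1) b(1)] int[OF r, of "- x"] b
    by (intro Bochner_Integration.integral_add lborel_integrable_real_affine) auto
  also have "(LINT t|lborel. h ?r (- x) (0 + (- 1) * t)) = (LINT t|lborel. h ?r (- x) t)"
    using lborel_integral_real_affine[of "- 1" "h ?r (- x)" 0] by simp
  also have "(LINT t|lborel. h \<phi> x t) + (LINT t|lborel. h ?r (- x) t) =
      - \<i> * (line_int (- b) (\<lambda>w. \<phi> w / (w - (- x))) - line_int b (\<lambda>w. \<phi> w / (w - (- x))))"
    unfolding pos neg by (simp add: algebra_simps)
  also have "line_int (- b) (\<lambda>w. \<phi> w / (w - (- x))) - line_int b (\<lambda>w. \<phi> w / (w - (- x))) = kappa * \<phi> (- x)"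
  proof (rule strip_cauchy[OF strip_convex_open P_stepD(1)[OF \<phi>], where d = "1 / real n" and B = "P_norm n \<phi>"])
    show "cmod (\<phi> w) \<le> P_norm n \<phi> * growth (- (1 / real n)) w" if "- b \<le> Im w" "Im w \<le> b" for w
      by (rule P_stepD(3)[OF \<phi>]) (use that b in linarith)
  qed (use b \<phi>(2) in \<open>auto simp: strip_def\<close>)
  finally show ?thesis by simp
qed

text \<open>For \<open>\<phi> (w) = exp (- w\<^sup>2 / 2)\<close> the transform of the transform at \<open>0\<close> is \<open>2 \<pi>\<close>.\<close>

lemma kappa_nonzero: "kappa \<noteq> 0"
proof
  assume k: "kappa = 0"
  define \<phi> where "\<phi> w = exp (- (w\<^sup>2 / 2))" for w :: complex
  have \<phi>: "\<phi> \<in> P_step 1"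
  proof (rule P_stepI(1)[where C = "exp 1"])
    show "cmod (\<phi> z) \<le> exp 1 * growth (- (1 / real 1)) z" if "\<bar>Im z\<bar> \<le> 1 / real 1" for z
    proof -
      have lin: "- ((r - m) / 2) \<le> 1 + - s" if "m \<le> 1" "2 * s \<le> r + 1" for r m s :: real using that by (simp add: field_simps)
      have im: "(Im z)\<^sup>2 \<le> 1" using that by (simp add: abs_square_le_1)
      have "0 \<le> (\<bar>Re z\<bar> - 1)\<^sup>2" by simp
      hence "2 * \<bar>Re z\<bar> \<le> (Re z)\<^sup>2 + 1" by (simp add: power2_diff)
      with im have "- (((Re z)\<^sup>2 - (Im z)\<^sup>2) / 2) \<le> 1 + - \<bar>Re z\<bar>" by (rule lin)
      moreover have "Re (z\<^sup>2 / 2) = ((Re z)\<^sup>2 - (Im z)\<^sup>2) / 2" by (simp add: power2_eq_square)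
      ultimately have "- Re (z\<^sup>2 / 2) \<le> 1 + - \<bar>Re z\<bar>" by (simp only:)
      thus ?thesis unfolding \<phi>_def norm_exp_eq_Re exp_add[symmetric] by simp
    qed
  qed (auto simp: \<phi>_def[abs_def] intro!: holomorphic_intros continuous_intros)
  \<comment> \<open>Read off from the characteristic function of the standard normal distribution,
    taken at \<open>- t\<close> because of the sign in the kernel.\<close>
  have F: "fourier \<phi> (cor t) = cor (sqrt (2 * pi) * exp (- (t\<^sup>2) / 2))" for t
  proof -
    have "char std_normal_distribution (- t) = (LINT x|lborel. std_normal_density x *\<^sub>R iexp (- t * x))"
      unfolding char_def by (subst integral_density) auto
    also have "\<dots> = (LINT x|lborel. cor (1 / sqrt (2 * pi)) * (\<phi> (cor x) * exp (- \<i> * cor x * cor t)))"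
      by (intro Bochner_Integration.integral_cong refl)
        (simp add: std_normal_density_def \<phi>_def scaleR_conv_of_real mult_ac exp_of_real[symmetric])
    also have "\<dots> = cor (1 / sqrt (2 * pi)) * fourier \<phi> (cor t)" by (simp add: fourier_def)
    finally show ?thesis by (simp add: char_std_normal_distribution field_simps)
  qed
  have "fourier (fourier \<phi>) 0 = (LINT x|lborel. cor (sqrt (2 * pi)) * (\<phi> (cor x) * exp (- \<i> * cor x * 0)))"
    unfolding fourier_def[of "fourier \<phi>"] F by (intro Bochner_Integration.integral_cong refl) (simp add: \<phi>_def exp_of_real[symmetric])
  also have "\<dots> = cor (sqrt (2 * pi)) * fourier \<phi> 0" by (simp add: fourier_def)
  finally have "fourier (fourier \<phi>) 0 \<noteq> 0" using F[of 0] by simp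
  thus False using fourier_fourier[OF \<phi>, of 0] k by simp
qed

section \<open>The function spaces\<close>

lemma finite_part_simps:
  "- finite_part UNIV = off_real" "finite_part {} = {}" "finite_part {-\<infinity>, \<infinity>} = {}"
proof -
  have "z \<in> finite_part UNIV \<longleftrightarrow> Im z = 0" for z unfolding finite_part_def by (auto simp: complex_eq_iff)
  thus "- finite_part UNIV = off_real" by auto
qed (auto simp: finite_part_def)

lemma edist_real_line: "edist_set z (finite_part UNIV) < ereal c \<longleftrightarrow> \<bar>Im z\<bar> < c"
proof
  assume "edist_set z (finite_part UNIV) < ereal c"
  then obtain x where "cmod (z - cor x) < c" unfolding edist_set_def INF_less_iff finite_part_def by auto
  thus "\<bar>Im z\<bar> < c" using abs_Im_le_cmod[of "z - cor x"] by simp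
next
  assume c: "\<bar>Im z\<bar> < c"
  have "cor (Re z) \<in> finite_part UNIV" by (auto simp: finite_part_def)
  moreover have "cmod (z - cor (Re z)) = \<bar>Im z\<bar>" by (simp add: cmod_def)
  ultimately show "edist_set z (finite_part UNIV) < ereal c" unfolding edist_set_def INF_less_iff using c by force
qed

lemma S_set_UNIV:
  assumes "n \<ge> 1"
  shows "S_set n UNIV = {z. 1 / real n < \<bar>Im z\<bar> \<and> \<bar>Im z\<bar> < real n}"
proof -
  have "nbhd (1 / real n) UNIV = {z. \<bar>Im z\<bar> < 1 / real n}" unfolding nbhd_def edist_real_line by auto
  thus ?thesis unfolding S_set_def using closure_slab[of "1 / real n"] assms by auto
qed

lemma S_set_empty: "S_set n {} = {z. \<bar>Im z\<bar> < real n}" by (simp add: S_set_def nbhd_def edist_set_def finite_part_simps)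

text \<open>For the second claim the closure is replaced by the smaller set \<open>nbhd\<close>
  itself, which gives the weak inequality \<open>1 / real n \<le> \<bar>Im z\<bar>\<close>.\<close>

lemma S_set_pm:
  "S_set n UNIV \<subseteq> S_set n {-\<infinity>, \<infinity>}"
  "z \<in> S_set n {-\<infinity>, \<infinity>} \<Longrightarrow> \<bar>Im z\<bar> < real n \<and> (\<bar>Re z\<bar> \<le> real n \<or> 1 / real n \<le> \<bar>Im z\<bar>)"
proof -
  have "nbhd (1 / real n) {-\<infinity>, \<infinity>} \<subseteq> nbhd (1 / real n) UNIV" by (auto simp: nbhd_def edist_set_def finite_part_simps)
  thus "S_set n UNIV \<subseteq> S_set n {-\<infinity>, \<infinity>}" unfolding S_set_def using closure_mono by blast
  show "\<bar>Im z\<bar> < real n \<and> (\<bar>Re z\<bar> \<le> real n \<or> 1 / real n \<le> \<bar>Im z\<bar>)" if "z \<in> S_set n {-\<infinity>, \<infinity>}"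
  proof -
    have "z \<notin> nbhd (1 / real n) {-\<infinity>, \<infinity>}" "\<bar>Im z\<bar> < real n" using that closure_subset unfolding S_set_def by auto
    thus ?thesis by (auto simp: nbhd_def)
  qed
qed

text \<open>The constant is taken nonnegative so that the weight may be enlarged afterwards.\<close>

lemma bdd_above_weighted_iff:
  assumes "\<And>z. w z = inverse (v z)" "\<And>z. v z > (0::real)"
  shows "bdd_above ((\<lambda>z. f z * w z) ` S) \<longleftrightarrow> (\<exists>C\<ge>0. \<forall>z\<in>S. f z \<le> C * v z)"
proof
  assume "bdd_above ((\<lambda>z. f z * w z) ` S)"
  then obtain C where C: "\<And>z. z \<in> S \<Longrightarrow> f z * w z \<le> C" by (auto simp: bdd_above_def)
  have "f z \<le> max C 0 * v z" if "z \<in> S" for z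
  proof -
    have "f z = f z * w z * v z" using assms(2)[of z] by (simp add: assms(1))
    also have "\<dots> \<le> max C 0 * v z" using C[OF that] assms(2)[of z] by (intro mult_right_mono) auto
    finally show ?thesis .
  qed
  thus "\<exists>C\<ge>0. \<forall>z\<in>S. f z \<le> C * v z" by (intro exI[of _ "max C 0"]) auto
next
  assume "\<exists>C\<ge>0. \<forall>z\<in>S. f z \<le> C * v z"
  then obtain C where C: "\<And>z. z \<in> S \<Longrightarrow> f z \<le> C * v z" by blast
  show "bdd_above ((\<lambda>z. f z * w z) ` S)"
  proof (rule bdd_aboveI2)
    fix z assume "z \<in> S"
    hence "f z * w z \<le> C * v z * w z" using C assms(2)[of z] by (intro mult_right_mono) (auto simp: assms(1))
    also have "\<dots> = C" using assms(2)[of z] by (simp add: assms(1))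
    finally show "f z * w z \<le> C" .
  qed
qed

lemma bdd_above_growth_iff:
  "bdd_above ((\<lambda>z. f z * growth (- (1 / real n)) z) ` S) \<longleftrightarrow>
    (\<exists>C\<ge>0. \<forall>z\<in>S. f z \<le> C * growth (1 / real n) z)"
  by (rule bdd_above_weighted_iff) (simp_all add: exp_minus)

section \<open>Linear subspaces, local holomorphy and growth conditions\<close>

definition fun_subspace :: "(complex \<Rightarrow> 'e \<Rightarrow> 'e::ab_group_add) \<Rightarrow> (complex \<Rightarrow> 'e) set \<Rightarrow> bool" where
  "fun_subspace sc V \<longleftrightarrow> 0 \<in> V \<and> (\<forall>f\<in>V. \<forall>g\<in>V. f + g \<in> V) \<and> (\<forall>c. \<forall>f\<in>V. (\<lambda>z. sc c (f z)) \<in> V)"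

context lcs
begin

lemma fun_subspace_diff:
  assumes V: "fun_subspace sc V" and fg: "f \<in> V" "g \<in> V"
  shows "f - g \<in> V"
proof -
  have "f + (\<lambda>z. sc (- 1) (g z)) \<in> V" using V fg unfolding fun_subspace_def by blast
  moreover have "f + (\<lambda>z. sc (- 1) (g z)) = f - g" by (simp add: fun_eq_iff)
  ultimately show ?thesis by simp
qed

lemma fun_subspace_add: "fun_subspace sc V \<Longrightarrow> f \<in> V \<Longrightarrow> g \<in> V \<Longrightarrow> f + g \<in> V"
  and fun_subspace_scale: "fun_subspace sc V \<Longrightarrow> f \<in> V \<Longrightarrow> (\<lambda>z. sc c (f z)) \<in> V"
  and fun_subspace_zero: "fun_subspace sc V \<Longrightarrow> 0 \<in> V" by (auto simp: fun_subspace_def)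

lemma fun_subspace_minus: "fun_subspace sc V \<Longrightarrow> f \<in> V \<Longrightarrow> - f \<in> V"
  using fun_subspace_diff[OF _ fun_subspace_zero, of V f] by simp

lemma fun_subspace_plus:
  assumes "fun_subspace sc V" "fun_subspace sc W"
  shows "fun_subspace sc (V + W)" unfolding fun_subspace_def
proof (intro conjI ballI allI)
  show "0 \<in> V + W" using assms by (auto simp: fun_subspace_def set_plus_def intro!: bexI[of _ 0])
next
  fix f g assume "f \<in> V + W" "g \<in> V + W"
  then obtain a b c d where "a \<in> V" "b \<in> W" "f = a + b" "c \<in> V" "d \<in> W" "g = c + d" by (auto elim!: set_plus_elim)
  hence "f + g = (a + c) + (b + d)" "a + c \<in> V" "b + d \<in> W" using assms by (auto simp: fun_subspace_def algebra_simps)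
  thus "f + g \<in> V + W" by (auto simp: set_plus_def)
next
  fix c f assume "f \<in> V + W"
  then obtain a b where ab: "a \<in> V" "b \<in> W" "f = a + b" by (auto elim!: set_plus_elim)
  hence eq: "(\<lambda>z. sc c (f z)) = (\<lambda>z. sc c (a z)) + (\<lambda>z. sc c (b z))" by (simp add: fun_eq_iff scale_right_distrib)
  show "(\<lambda>z. sc c (f z)) \<in> V + W" unfolding eq using assms ab by (intro set_plus_intro) (simp_all add: fun_subspace_def)
qed

lemma fun_subspace_restr:
  assumes "fun_subspace sc V"
  shows "fun_subspace sc (restr \<Omega> ` V)" unfolding fun_subspace_def
proof (intro conjI ballI allI)
  have "restr \<Omega> 0 = (0 :: complex \<Rightarrow> 'e)" by (simp add: restr_def fun_eq_iff)
  thus "0 \<in> restr \<Omega> ` V" using assms by (metis fun_subspace_def imageI)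
next
  fix f g assume "f \<in> restr \<Omega> ` V" "g \<in> restr \<Omega> ` V"
  then obtain a b where "a \<in> V" "b \<in> V" "f = restr \<Omega> a" "g = restr \<Omega> b" by auto
  moreover have "restr \<Omega> a + restr \<Omega> b = restr \<Omega> (a + b)" by (simp add: restr_def fun_eq_iff)
  ultimately show "f + g \<in> restr \<Omega> ` V" using assms by (auto simp: fun_subspace_def)
next
  fix c f assume "f \<in> restr \<Omega> ` V"
  then obtain a where "a \<in> V" "f = restr \<Omega> a" by auto
  moreover have "(\<lambda>z. sc c (restr \<Omega> a z)) = restr \<Omega> (\<lambda>z. sc c (a z))" by (simp add: restr_def fun_eq_iff)
  ultimately show "(\<lambda>z. sc c (f z)) \<in> restr \<Omega> ` V" using assms by (auto simp: fun_subspace_def)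
qed

lemma fun_subspace_hol_space: "fun_subspace sc (hol_space sc \<Omega>)" unfolding fun_subspace_def
proof (intro conjI ballI allI)
  show "0 \<in> hol_space sc \<Omega>" by (auto simp: hol_space_def)
next
  fix f g assume f: "f \<in> hol_space sc \<Omega>" and g: "g \<in> hol_space sc \<Omega>"
  show "f + g \<in> hol_space sc \<Omega>" unfolding hol_space_def
  proof (safe)
    fix z assume "z \<in> \<Omega>"
    then obtain D E where "((\<lambda>w. sc (1 / (w - z)) (f w - f z)) \<longlongrightarrow> D) (at z)" "((\<lambda>w. sc (1 / (w - z)) (g w - g z)) \<longlongrightarrow> E) (at z)"
      using f g unfolding hol_space_def by blast
    from tendsto_add[OF this]
    have "((\<lambda>w. sc (1 / (w - z)) ((f + g) w - (f + g) z)) \<longlongrightarrow> D + E) (at z)"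
      by (simp add: scale_right_distrib scale_right_diff_distrib add_diff_add)
    thus "\<exists>D. ((\<lambda>w. sc (1 / (w - z)) ((f + g) w - (f + g) z)) \<longlongrightarrow> D) (at z)" by blast
  qed (use f g in \<open>auto simp: hol_space_def\<close>)
next
  fix c f assume f: "f \<in> hol_space sc \<Omega>"
  show "(\<lambda>z. sc c (f z)) \<in> hol_space sc \<Omega>" unfolding hol_space_def
  proof (safe)
    fix z assume "z \<in> \<Omega>"
    then obtain D where "((\<lambda>w. sc (1 / (w - z)) (f w - f z)) \<longlongrightarrow> D) (at z)" using f unfolding hol_space_def by blast
    from tendsto_scale_lcs[OF tendsto_const[of c] this]
    have "((\<lambda>w. sc (1 / (w - z)) (sc c (f w) - sc c (f z))) \<longlongrightarrow> sc c D) (at z)"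
      by (simp add: scale_right_diff_distrib mult.commute)
    thus "\<exists>D. ((\<lambda>w. sc (1 / (w - z)) (sc c (f w) - sc c (f z))) \<longlongrightarrow> D) (at z)" by blast
  qed (use f in \<open>auto simp: hol_space_def\<close>)
qed

lemma fun_subspace_growth:
  assumes w: "\<And>n z. w n z = inverse (v n z)" "\<And>n z. v n z > (0::real)"
  shows "fun_subspace sc {f \<in> hol_space sc \<Omega>. \<forall>n\<ge>1::nat. \<forall>i. bdd_above ((\<lambda>z. p i (f z) * w n z) ` S n)}"
  unfolding bdd_above_weighted_iff[of "w _" "v _", OF w] fun_subspace_def
proof (intro conjI ballI allI)
  show "0 \<in> {f \<in> hol_space sc \<Omega>. \<forall>n\<ge>1. \<forall>i. \<exists>C\<ge>0. \<forall>z\<in>S n. p i (f z) \<le> C * v n z}"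
    using fun_subspace_hol_space by (auto simp: fun_subspace_def intro!: exI[of _ 0])
next
  fix f g
  assume f: "f \<in> {f \<in> hol_space sc \<Omega>. \<forall>n\<ge>1. \<forall>i. \<exists>C\<ge>0. \<forall>z\<in>S n. p i (f z) \<le> C * v n z}"
    and g: "g \<in> {f \<in> hol_space sc \<Omega>. \<forall>n\<ge>1. \<forall>i. \<exists>C\<ge>0. \<forall>z\<in>S n. p i (f z) \<le> C * v n z}"
  have "\<exists>C\<ge>0. \<forall>z\<in>S n. p i ((f + g) z) \<le> C * v n z" if n: "n \<ge> 1" for n i
  proof -
    have "\<exists>C\<ge>0. \<forall>z\<in>S n. p i (f z) \<le> C * v n z" "\<exists>C\<ge>0. \<forall>z\<in>S n. p i (g z) \<le> C * v n z"
      using f g n by auto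
    then obtain C D where "C \<ge> 0" "D \<ge> 0" "\<And>z. z \<in> S n \<Longrightarrow> p i (f z) \<le> C * v n z" "\<And>z. z \<in> S n \<Longrightarrow> p i (g z) \<le> D * v n z"
      by metis
    thus ?thesis by (intro exI[of _ "C + D"]) (auto simp: distrib_right intro!: order_trans[OF seminorm_add] add_mono)
  qed
  thus "f + g \<in> {f \<in> hol_space sc \<Omega>. \<forall>n\<ge>1. \<forall>i. \<exists>C\<ge>0. \<forall>z\<in>S n. p i (f z) \<le> C * v n z}"
    using f g fun_subspace_hol_space by (auto simp: fun_subspace_def)
next
  fix c f
  assume f: "f \<in> {f \<in> hol_space sc \<Omega>. \<forall>n\<ge>1. \<forall>i. \<exists>C\<ge>0. \<forall>z\<in>S n. p i (f z) \<le> C * v n z}"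
  have "\<exists>C\<ge>0. \<forall>z\<in>S n. p i (sc c (f z)) \<le> C * v n z" if n: "n \<ge> 1" for n i
  proof -
    have "\<exists>C\<ge>0. \<forall>z\<in>S n. p i (f z) \<le> C * v n z" using f n by auto
    then obtain C where "C \<ge> 0" "\<And>z. z \<in> S n \<Longrightarrow> p i (f z) \<le> C * v n z" by metis
    thus ?thesis by (intro exI[of _ "cmod c * C"]) (auto simp: seminorm_scale mult.assoc intro!: mult_left_mono)
  qed
  thus "(\<lambda>z. sc c (f z)) \<in> {f \<in> hol_space sc \<Omega>. \<forall>n\<ge>1. \<forall>i. \<exists>C\<ge>0. \<forall>z\<in>S n. p i (f z) \<le> C * v n z}"
    using f fun_subspace_hol_space by (auto simp: fun_subspace_def)
qed

lemma fun_subspace_Oexp: "fun_subspace sc (Oexp sc p K)" unfolding Oexp_def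
  by (rule fun_subspace_growth[where v = "\<lambda>n z. growth (1 / real n) z"]) (auto simp: exp_minus)

lemma fun_subspace_FO_pinf: "fun_subspace sc (FO_pinf sc p)" unfolding FO_pinf_def
  by (rule fun_subspace_growth[where v = "\<lambda>k z. exp (1 / real k * cmod z - real k * \<bar>Im z\<bar>)"]) (auto simp: exp_minus[symmetric])

lemma fun_subspace_FO_minf: "fun_subspace sc (FO_minf sc p)" unfolding FO_minf_def
  by (rule fun_subspace_growth[where v = "\<lambda>k z. exp (1 / real k * cmod z - real k * \<bar>Im z\<bar>)"]) (auto simp: exp_minus[symmetric])

lemma fun_subspace_FO_pm: "fun_subspace sc (FO_pm sc p)" unfolding FO_pm_def by (intro fun_subspace_plus fun_subspace_FO_minf fun_subspace_FO_pinf)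

lemma fun_subspace_Oexp_entire: "fun_subspace sc (Oexp_entire sc p K)" unfolding Oexp_entire_def by (intro fun_subspace_restr fun_subspace_Oexp)

lemma fun_subspace_Oexp_pm: "fun_subspace sc (Oexp_pm sc p)" unfolding Oexp_pm_def by (intro fun_subspace_restr fun_subspace_Oexp)

lemma fun_subspace_hol_entire: "fun_subspace sc (hol_entire sc)" unfolding hol_entire_def by (intro fun_subspace_restr fun_subspace_hol_space)

text \<open>Difference quotients at a point see only a neighbourhood, so functions may be glued from
  holomorphic pieces.\<close>

lemma hol_space_local:
  assumes "\<And>z. z \<in> \<Omega> \<Longrightarrow> \<exists>U g \<Omega>'. open U \<and> z \<in> U \<and> g \<in> hol_space sc \<Omega>' \<and> z \<in> \<Omega>' \<and> (\<forall>w\<in>U. f w = g w)"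
    and "\<And>z. z \<notin> \<Omega> \<Longrightarrow> f z = 0"
  shows "f \<in> hol_space sc \<Omega>"
proof -
  have "\<exists>D. ((\<lambda>w. sc (1 / (w - z)) (f w - f z)) \<longlongrightarrow> D) (at z)" if z: "z \<in> \<Omega>" for z
  proof -
    obtain U g \<Omega>' where U: "open U" "z \<in> U" "g \<in> hol_space sc \<Omega>'" "z \<in> \<Omega>'" "\<And>w. w \<in> U \<Longrightarrow> f w = g w"
      using assms(1)[OF z] by blast
    then obtain D where D: "((\<lambda>w. sc (1 / (w - z)) (g w - g z)) \<longlongrightarrow> D) (at z)" unfolding hol_space_def by blast
    have "((\<lambda>w. sc (1 / (w - z)) (f w - f z)) \<longlongrightarrow> D) (at z)"
    proof (rule Lim_transform_within_open[OF D U(1,2)])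
      show "\<And>x. x \<in> U \<Longrightarrow> x \<noteq> z \<Longrightarrow> sc (1 / (x - z)) (g x - g z) = sc (1 / (x - z)) (f x - f z)"
        using U(2,5) by simp
    qed
    thus ?thesis by blast
  qed
  thus ?thesis using assms(2) by (auto simp: hol_space_def)
qed

lemma hol_space_restr:
  assumes "f \<in> hol_space sc \<Omega>" "open \<Omega>'" "\<Omega>' \<subseteq> \<Omega>"
  shows "restr \<Omega>' f \<in> hol_space sc \<Omega>'"
proof (rule hol_space_local)
  fix z assume "z \<in> \<Omega>'"
  thus "\<exists>U g \<Omega>. open U \<and> z \<in> U \<and> g \<in> hol_space sc \<Omega> \<and> z \<in> \<Omega> \<and> (\<forall>w\<in>U. restr \<Omega>' f w = g w)"
    using assms by (intro exI[of _ \<Omega>'] exI[of _ f] exI[of _ \<Omega>]) (auto simp: restr_def)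
qed (simp add: restr_def)

lemma open_Im: "open off_real" "open {z. Im z < 0}" "open {z. Im z > 0}"
proof -
  have "off_real = {z. Im z < 0} \<union> {z. Im z > 0}" by auto
  thus "open off_real" using convex_open_halfplanes(2,4)[of 0] by auto
qed (rule convex_open_halfplanes)+

lemma hol_space_halfplanes:
  assumes f: "f \<in> hol_space sc {z. Im z > 0}" and g: "g \<in> hol_space sc {z. Im z < 0}"
  shows "f + g \<in> hol_space sc off_real"
proof (rule hol_space_local)
  fix z :: complex assume "z \<in> off_real"
  then consider "Im z > 0" | "Im z < 0" by fastforce
  thus "\<exists>U h \<Omega>'. open U \<and> z \<in> U \<and> h \<in> hol_space sc \<Omega>' \<and> z \<in> \<Omega>' \<and> (\<forall>w\<in>U. (f + g) w = h w)"
  proof cases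
    case 1
    have "\<forall>w\<in>{z. Im z > 0}. (f + g) w = f w" using g by (auto simp: hol_space_def)
    thus ?thesis using 1 f open_Im(3) by blast
  next
    case 2
    have "\<forall>w\<in>{z. Im z < 0}. (f + g) w = g w" using f by (auto simp: hol_space_def)
    thus ?thesis using 2 g open_Im(2) by blast
  qed
qed (use f g in \<open>auto simp: hol_space_def\<close>)

text \<open>The number \<open>n\<close> in the definition of the space plays three roles: distance
  from the axis, height, and exponential rate. They are separated here into \<open>r\<close>,
  \<open>R\<close> and \<open>\<epsilon>\<close>; one large \<open>n\<close> serves all
  three.\<close>

definition slow_growth :: "(complex \<Rightarrow> 'e) \<Rightarrow> bool" where
  "slow_growth F \<longleftrightarrow> (\<forall>i. \<forall>r>0. \<forall>R. \<forall>\<epsilon>>0. \<exists>C\<ge>0. \<forall>z. r \<le> \<bar>Im z\<bar> \<and> \<bar>Im z\<bar> \<le> R \<longrightarrow> p i (F z) \<le> C * growth \<epsilon> z)"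

lemma Oexp_UNIV_iff: "F \<in> Oexp_R \<longleftrightarrow> F \<in> hol_space sc off_real \<and> slow_growth F"
proof -
  have "slow_growth F \<longleftrightarrow> (\<forall>n\<ge>1. \<forall>i. \<exists>C\<ge>0. \<forall>z\<in>S_set n UNIV. p i (F z) \<le> C * growth (1 / real n) z)" (is "_ \<longleftrightarrow> ?R")
  proof
    assume F: "slow_growth F"
    show ?R
    proof (intro allI impI)
      fix n :: nat and i assume n: "1 \<le> n"
      hence "1 / real n > 0" by simp
      then obtain C where "C \<ge> 0" "\<And>z. 1 / real n \<le> \<bar>Im z\<bar> \<and> \<bar>Im z\<bar> \<le> real n \<Longrightarrow> p i (F z) \<le> C * growth (1 / real n) z"
        using F unfolding slow_growth_def by blast
      thus "\<exists>C\<ge>0. \<forall>z\<in>S_set n UNIV. p i (F z) \<le> C * growth (1 / real n) z"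
        unfolding S_set_UNIV[OF n] by force
    qed
  next
    assume R: ?R
    show "slow_growth F" unfolding slow_growth_def
    proof (intro allI impI)
      fix i and r R \<epsilon> :: real assume re: "0 < r" "0 < \<epsilon>"
      obtain n :: nat where n: "1 / r < n" "1 / \<epsilon> < n" "R < n" "1 < n"
        using reals_Archimedean2[of "max (max (1 / r) (1 / \<epsilon>)) (max R 1)"] by auto
      hence n': "n \<ge> 1" "1 / real n < r" "1 / real n < \<epsilon>" using re by (auto simp: field_simps)
      obtain C where C: "C \<ge> 0" "\<And>z. z \<in> S_set n UNIV \<Longrightarrow> p i (F z) \<le> C * growth (1 / real n) z"
        using R n'(1) by blast
      have "p i (F z) \<le> C * growth \<epsilon> z" if z: "r \<le> \<bar>Im z\<bar>" "\<bar>Im z\<bar> \<le> R" for z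
      proof -
        have "1 / real n * \<bar>Re z\<bar> \<le> \<epsilon> * \<bar>Re z\<bar>" using n' by (intro mult_right_mono) auto
        hence "C * growth (1 / real n) z \<le> C * growth \<epsilon> z" using C(1) by (intro mult_left_mono) auto
        moreover have "z \<in> S_set n UNIV" unfolding S_set_UNIV[OF n'(1)] using z n n' by auto
        ultimately show ?thesis using C(2) by force
      qed
      thus "\<exists>C\<ge>0. \<forall>z. r \<le> \<bar>Im z\<bar> \<and> \<bar>Im z\<bar> \<le> R \<longrightarrow> p i (F z) \<le> C * growth \<epsilon> z"
        using C(1) by blast
    qed
  qed
  thus ?thesis unfolding Oexp_def bdd_above_growth_iff finite_part_simps(1) by auto
qed

lemma slow_growthE:
  assumes "slow_growth F" "0 < r" "0 < \<epsilon>"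
  obtains C where "C \<ge> 0" "\<And>z. r \<le> \<bar>Im z\<bar> \<Longrightarrow> \<bar>Im z\<bar> \<le> R \<Longrightarrow> p i (F z) \<le> C * growth \<epsilon> z"
proof -
  have "\<exists>C\<ge>0. \<forall>z. r \<le> \<bar>Im z\<bar> \<and> \<bar>Im z\<bar> \<le> R \<longrightarrow> p i (F z) \<le> C * growth \<epsilon> z"
    by (rule assms(1)[unfolded slow_growth_def, rule_format, OF assms(2,3)])
  then obtain C where "C \<ge> 0" "\<forall>z. r \<le> \<bar>Im z\<bar> \<and> \<bar>Im z\<bar> \<le> R \<longrightarrow> p i (F z) \<le> C * growth \<epsilon> z"
    by metis
  thus thesis by (intro that[of C]) simp_all
qed

lemma OexpD:
  assumes "F \<in> Oexp_R"
  shows "F \<in> hol_space sc off_real" "slow_growth F" "continuous_on off_real F"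
  using assms hol_space_continuous_on[OF _ open_Im(1)] by (auto simp: Oexp_UNIV_iff)

lemma dual_Oexp_holomorphic:
  "F \<in> Oexp_R \<Longrightarrow> y \<in> lcs_dual sc \<Longrightarrow> (\<lambda>z. y (F z)) holomorphic_on off_real"
  using hol_space_dual[OF OexpD(1) open_Im(1)] .

text \<open>Since \<open>- z\<close> exchanges the two boundary lines, this sign makes the
  functional of \<open>reflect F\<close> equal to that of \<open>F\<close> on reflected test
  functions.\<close>

definition reflect :: "(complex \<Rightarrow> 'e) \<Rightarrow> complex \<Rightarrow> 'e" where
  "reflect F = (\<lambda>z. - F (- z))"

lemma reflect_reflect [simp]: "reflect (reflect F) = F" by (simp add: reflect_def)

end

text \<open>The property shared by the scalar functions \<open>y (F z)\<close> for \<open>F\<close>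
  in \<open>Oexp_R\<close> and \<open>y\<close> in the dual.\<close>

definition slow_holomorphic :: "(complex \<Rightarrow> complex) \<Rightarrow> bool" where
  "slow_holomorphic f \<longleftrightarrow> f holomorphic_on off_real \<and>
    (\<forall>r>0. \<forall>R. \<forall>\<epsilon>>0. \<exists>C\<ge>0. \<forall>z. r \<le> \<bar>Im z\<bar> \<and> \<bar>Im z\<bar> \<le> R \<longrightarrow> cmod (f z) \<le> C * growth \<epsilon> z)"

lemma slow_holomorphicE:
  assumes "slow_holomorphic f" "0 < r" "0 < \<epsilon>"
  obtains C where "C \<ge> 0" "\<And>z. r \<le> \<bar>Im z\<bar> \<Longrightarrow> \<bar>Im z\<bar> \<le> R \<Longrightarrow> cmod (f z) \<le> C * growth \<epsilon> z"
proof -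
  have "\<exists>C\<ge>0. \<forall>z. r \<le> \<bar>Im z\<bar> \<and> \<bar>Im z\<bar> \<le> R \<longrightarrow> cmod (f z) \<le> C * growth \<epsilon> z"
    by (rule assms(1)[unfolded slow_holomorphic_def, THEN conjunct2, rule_format, OF assms(2,3)])
  then obtain C where "C \<ge> 0" "\<forall>z. r \<le> \<bar>Im z\<bar> \<and> \<bar>Im z\<bar> \<le> R \<longrightarrow> cmod (f z) \<le> C * growth \<epsilon> z"
    by metis
  thus thesis by (intro that[of C]) simp_all
qed

lemma (in lcs) dual_slow_holomorphic:
  assumes F: "F \<in> Oexp_R" and y: "y \<in> lcs_dual sc"
  shows "slow_holomorphic (\<lambda>z. y (F z))" unfolding slow_holomorphic_def
proof (intro conjI allI impI dual_Oexp_holomorphic F y)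
  fix r R \<epsilon> :: real assume re: "0 < r" "0 < \<epsilon>"
  obtain i B where B: "B \<ge> 0" "\<And>x. cmod (y x) \<le> B * p i x" using dual_bounded[OF y] by blast
  obtain C where C: "C \<ge> 0" "\<And>z. r \<le> \<bar>Im z\<bar> \<Longrightarrow> \<bar>Im z\<bar> \<le> R \<Longrightarrow> p i (F z) \<le> C * growth \<epsilon> z"
    using slow_growthE[OF OexpD(2)[OF F] re] by blast
  have "cmod (y (F z)) \<le> B * C * growth \<epsilon> z" if "r \<le> \<bar>Im z\<bar>" "\<bar>Im z\<bar> \<le> R" for z
    using B(2)[of "F z"] mult_left_mono[OF C(2)[OF that] B(1)] by (simp add: mult.assoc)
  thus "\<exists>C\<ge>0. \<forall>z. r \<le> \<bar>Im z\<bar> \<and> \<bar>Im z\<bar> \<le> R \<longrightarrow> cmod (y (F z)) \<le> C * growth \<epsilon> z"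
    using B(1) C(1) by (intro exI[of _ "B * C"]) auto
qed

section \<open>The integral over the boundary of a strip\<close>

definition gamma_int :: "(complex \<Rightarrow> complex) \<Rightarrow> (complex \<Rightarrow> complex) \<Rightarrow> real \<Rightarrow> complex" where
  "gamma_int f \<phi> c = line_int c (\<lambda>w. \<phi> w * f w) - line_int (- c) (\<lambda>w. \<phi> w * f w)"

text \<open>Half of the decay of \<open>\<phi>\<close> pays for the growth of \<open>f\<close>, the
  other half remains.\<close>

lemma slow_times_step_bound:
  assumes f: "slow_holomorphic f" and \<phi>: "\<phi> \<in> P_step n" "n \<ge> 1" and r: "r > 0"
  shows "\<exists>B\<ge>0. \<forall>w. r \<le> \<bar>Im w\<bar> \<longrightarrow> \<bar>Im w\<bar> \<le> 1 / real n \<longrightarrow> cmod (\<phi> w * f w) \<le> B * exp (- (1 / (2 * real n)) * \<bar>Re w\<bar>)"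
proof -
  have "1 / (2 * real n) > 0" using \<phi>(2) by simp
  then obtain C where C: "C \<ge> 0" "\<And>z. r \<le> \<bar>Im z\<bar> \<Longrightarrow> \<bar>Im z\<bar> \<le> 1 / real n \<Longrightarrow> cmod (f z) \<le> C * exp (1 / (2 * real n) * \<bar>Re z\<bar>)"
    using slow_holomorphicE[OF f r] by blast
  have "cmod (\<phi> w * f w) \<le> P_norm n \<phi> * C * exp (- (1 / (2 * real n)) * \<bar>Re w\<bar>)" if "r \<le> \<bar>Im w\<bar>" "\<bar>Im w\<bar> \<le> 1 / real n" for w
  proof -
    have "cmod (\<phi> w * f w) \<le> (P_norm n \<phi> * growth (- (1 / real n)) w) * (C * exp (1 / (2 * real n) * \<bar>Re w\<bar>))"
      using P_stepD(3,4)[OF \<phi>] C that unfolding norm_mult by (intro mult_mono) auto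
    also have "\<dots> = P_norm n \<phi> * C * (growth (- (1 / real n)) w * exp (1 / (2 * real n) * \<bar>Re w\<bar>))" by simp
    also have "growth (- (1 / real n)) w * exp (1 / (2 * real n) * \<bar>Re w\<bar>) = exp (- (1 / (2 * real n)) * \<bar>Re w\<bar>)"
      unfolding exp_add[symmetric] by (simp add: field_simps)
    finally show ?thesis .
  qed
  moreover have "P_norm n \<phi> * C \<ge> 0" using P_stepD(4)[OF \<phi>] C by simp
  ultimately show ?thesis by blast
qed

lemma slow_times_step_holomorphic:
  assumes f: "slow_holomorphic f" and \<phi>: "\<phi> \<in> P_step n" "n \<ge> 1"
  shows "(\<lambda>w. \<phi> w * f w) holomorphic_on {z. 0 < Im z \<and> Im z < 1 / real n}"
    "(\<lambda>w. \<phi> w * f w) holomorphic_on {z. - (1 / real n) < Im z \<and> Im z < 0}"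
  using f P_stepD(1)[OF \<phi>] unfolding slow_holomorphic_def by (auto intro!: holomorphic_intros elim!: holomorphic_on_subset simp: strip_def)

lemma gamma_int_shift:
  assumes f: "slow_holomorphic f" and \<phi>: "\<phi> \<in> P_step n" "n \<ge> 1"
    and c: "0 < c" "c < 1 / real n" "0 < c'" "c' < 1 / real n"
  shows "gamma_int f \<phi> c = gamma_int f \<phi> c'"
proof -
  have d: "1 / (2 * real n) > 0" using \<phi>(2) by simp
  obtain B where B: "\<And>w. min c c' \<le> \<bar>Im w\<bar> \<Longrightarrow> \<bar>Im w\<bar> \<le> 1 / real n \<Longrightarrow> cmod (\<phi> w * f w) \<le> B * exp (- (1 / (2 * real n)) * \<bar>Re w\<bar>)"
    using slow_times_step_bound[OF f \<phi>, of "min c c'"] c by auto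
  have "line_int c (\<lambda>w. \<phi> w * f w) = line_int c' (\<lambda>w. \<phi> w * f w)"
    by (rule line_int_shift[OF convex_open_halfplanes(5,6) slow_times_step_holomorphic(1)[OF f \<phi>] _ d B]) (use c in auto)
  moreover have "line_int (- c) (\<lambda>w. \<phi> w * f w) = line_int (- c') (\<lambda>w. \<phi> w * f w)"
    by (rule line_int_shift[OF convex_open_halfplanes(5,6) slow_times_step_holomorphic(2)[OF f \<phi>] _ d B]) (use c in auto)
  ultimately show ?thesis by (simp add: gamma_int_def)
qed

text \<open>Both integrals are moved to a height \<open>e\<close> inside the strip on which the two
  test functions coincide.\<close>

lemma gamma_int_germ:
  assumes f: "slow_holomorphic f" and \<phi>: "\<phi> \<in> P_step n" "n \<ge> 1" and \<psi>: "\<psi> \<in> P_step m" "m \<ge> 1"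
    and eq: "same_germ \<phi> \<psi>"
    and c: "0 < c" "c < 1 / real n" "0 < c'" "c' < 1 / real m"
  shows "gamma_int f \<phi> c = gamma_int f \<psi> c'"
proof -
  obtain k where k: "k \<ge> 1" "\<And>z. z \<in> closure (strip k) \<Longrightarrow> \<phi> z = \<psi> z" using eq by (auto simp: same_germ_def)
  define e where "e = min (min c c') (1 / real k)"
  have e: "0 < e" "e \<le> c" "e \<le> c'" "e \<le> 1 / real k" using c k by (auto simp: e_def)
  have "gamma_int f \<phi> c = gamma_int f \<phi> e" by (rule gamma_int_shift[OF f \<phi>]) (use c e in auto)
  also have "\<dots> = gamma_int f \<psi> e" using k e by (simp add: gamma_int_def line_int_def closure_strip)
  also have "\<dots> = gamma_int f \<psi> c'" by (rule gamma_int_shift[OF f \<psi>]) (use c e in auto)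
  finally show ?thesis .
qed

lemma gamma_int_integrable:
  assumes f: "slow_holomorphic f" and \<phi>: "\<phi> \<in> P_step n" "n \<ge> 1" and c: "0 < \<bar>c\<bar>" "\<bar>c\<bar> < 1 / real n"
  shows "integrable lborel (\<lambda>t. \<phi> (Complex t c) * f (Complex t c))"
proof -
  obtain B where B: "\<And>w. \<bar>c\<bar> \<le> \<bar>Im w\<bar> \<Longrightarrow> \<bar>Im w\<bar> \<le> 1 / real n \<Longrightarrow> cmod (\<phi> w * f w) \<le> B * exp (- (1 / (2 * real n)) * \<bar>Re w\<bar>)"
    using slow_times_step_bound[OF f \<phi> c(1)] by blast
  have "continuous_on ({z. 0 < Im z \<and> Im z < 1 / real n} \<union> {z. - (1 / real n) < Im z \<and> Im z < 0}) (\<lambda>w. \<phi> w * f w)"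
    using slow_times_step_holomorphic[OF f \<phi>] convex_open_halfplanes(6) by (intro continuous_on_open_Un holomorphic_on_imp_continuous_on) auto
  thus ?thesis by (rule line_integrable[where d = "1 / (2 * real n)" and B = B]) (use c \<phi>(2) B in auto)
qed

lemma gamma_int_entire:
  assumes f: "f holomorphic_on UNIV" and \<phi>: "\<phi> \<in> P_step n" "n \<ge> 1" and c: "0 < c" "c < 1 / real n"
    and bd: "\<And>w. \<bar>Im w\<bar> \<le> 1 \<Longrightarrow> cmod (f w) \<le> C * exp (1 / (2 * real n) * \<bar>Re w\<bar>)"
  shows "gamma_int f \<phi> c = 0"
proof -
  have "line_int (- c) (\<lambda>w. \<phi> w * f w) = line_int c (\<lambda>w. \<phi> w * f w)"
  proof (rule line_int_shift_le[OF strip_convex_open])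
    show "(\<lambda>w. \<phi> w * f w) holomorphic_on strip n" by (intro holomorphic_intros P_stepD(1)[OF \<phi>] holomorphic_on_subset[OF f]) auto
    show "cmod (\<phi> w * f w) \<le> P_norm n \<phi> * C * exp (- (1 / (2 * real n)) * \<bar>Re w\<bar>)" if w: "- c \<le> Im w" "Im w \<le> c" for w
    proof -
      have n1: "1 / real n \<le> 1" using \<phi>(2) by simp
      have w': "\<bar>Im w\<bar> \<le> 1 / real n" "\<bar>Im w\<bar> \<le> 1" using w c n1 by linarith+
      have "cmod (\<phi> w * f w) \<le> (P_norm n \<phi> * growth (- (1 / real n)) w) * (C * exp (1 / (2 * real n) * \<bar>Re w\<bar>))"
        using P_stepD(3,4)[OF \<phi>] bd[of w] w' unfolding norm_mult by (intro mult_mono) auto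
      also have "\<dots> = P_norm n \<phi> * C * (growth (- (1 / real n)) w * exp (1 / (2 * real n) * \<bar>Re w\<bar>))" by simp
      also have "growth (- (1 / real n)) w * exp (1 / (2 * real n) * \<bar>Re w\<bar>) = exp (- (1 / (2 * real n)) * \<bar>Re w\<bar>)"
        unfolding exp_add[symmetric] by (simp add: field_simps)
      finally show ?thesis .
    qed
  qed (use c \<phi>(2) in \<open>auto simp: strip_def\<close>)
  thus ?thesis by (simp add: gamma_int_def)
qed

lemma gauss_bound:
  assumes "\<bar>Im w\<bar> \<le> C"
  shows "cmod (exp (- (w\<^sup>2))) \<le> exp (C\<^sup>2 + 1) * exp (- \<bar>Re w\<bar>)"
proof -
  have "(Im w)\<^sup>2 \<le> C\<^sup>2" using assms by (metis abs_ge_zero power2_abs power_mono)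
  moreover have "exp (- ((Re w)\<^sup>2)) \<le> exp 1 * exp (- \<bar>Re w\<bar>)" using gauss_le_exp[of "Re w" 1] by (rule order_trans) simp
  ultimately have "exp ((Im w)\<^sup>2) * exp (- ((Re w)\<^sup>2)) \<le> exp (C\<^sup>2) * (exp 1 * exp (- \<bar>Re w\<bar>))"
    by (intro mult_mono) auto
  thus ?thesis unfolding cmod_gauss by (simp add: exp_diff exp_minus exp_add divide_inverse mult.assoc)
qed

lemma gauss_cauchy_P_step:
  assumes n: "n \<ge> 1" and z: "1 / real n < \<bar>Im z\<bar>"
  shows "(\<lambda>w. gauss_cauchy (w - z)) \<in> P_step n"
proof (rule P_stepI(1)[OF n])
  have ne: "w \<noteq> z" if "\<bar>Im w\<bar> \<le> 1 / real n" for w using that z by auto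
  show "(\<lambda>w. gauss_cauchy (w - z)) holomorphic_on strip n"
    unfolding gauss_cauchy_def by (intro holomorphic_intros) (use ne in \<open>force simp: strip_def\<close>)
  show "continuous_on {w. \<bar>Im w\<bar> \<le> 1 / real n} (\<lambda>w. gauss_cauchy (w - z))"
    unfolding gauss_cauchy_def by (intro continuous_intros) (use ne in auto)
  show "cmod (gauss_cauchy (w - z)) \<le> exp ((1 + \<bar>Im z\<bar>)\<^sup>2 + 1) / (\<bar>Im z\<bar> - 1 / real n) * exp \<bar>Re z\<bar> * growth (- (1 / real n)) w"
    if w: "\<bar>Im w\<bar> \<le> 1 / real n" for w
  proof -
    have n1: "1 / real n \<le> 1" using n by simp
    have "cmod (gauss_cauchy (w - z)) \<le> exp ((1 + \<bar>Im z\<bar>)\<^sup>2 + 1) / (\<bar>Im z\<bar> - 1 / real n) * exp (- 1 * \<bar>Re (w - z)\<bar>)"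
      by (rule gauss_cauchy_bound) (use w z n1 in auto)
    also have "\<dots> \<le> exp ((1 + \<bar>Im z\<bar>)\<^sup>2 + 1) / (\<bar>Im z\<bar> - 1 / real n) * (exp \<bar>Re z\<bar> * growth (- (1 / real n)) w)"
    proof (intro mult_left_mono)
      have "1 / real n * \<bar>Re w\<bar> \<le> 1 * \<bar>Re w\<bar>" using n1 by (intro mult_right_mono) auto
      thus "exp (- 1 * \<bar>Re (w - z)\<bar>) \<le> exp \<bar>Re z\<bar> * growth (- (1 / real n)) w"
        unfolding exp_add[symmetric] by simp
    qed (use z in auto)
    finally show ?thesis by simp
  qed
qed

text \<open>With the test function \<open>gauss_cauchy (w - z)\<close> the vanishing of the functional moves the inner of the
  two lines in Cauchy's formula to the other side of the real axis.\<close>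

lemma gamma_int_kernel:
  assumes f: "slow_holomorphic f"
    and zero: "\<And>n \<phi> c. n \<ge> 1 \<Longrightarrow> \<phi> \<in> P_step n \<Longrightarrow> 0 < c \<Longrightarrow> c < 1 / real n \<Longrightarrow> gamma_int f \<phi> c = 0"
    and z: "0 < \<bar>Im z\<bar>" "\<bar>Im z\<bar> < 1"
  shows "line_int (- 1) (\<lambda>w. gauss_cauchy (w - z) * f w) - line_int 1 (\<lambda>w. gauss_cauchy (w - z) * f w) = kappa * f z"
proof -
  obtain n :: nat where n: "n \<ge> 1" "1 / real n < \<bar>Im z\<bar>"
    using reals_Archimedean[OF z(1)] by (metis One_nat_def Suc_le_mono inverse_eq_divide le0)
  \<comment> \<open>Below \<open>1 / n\<close>, so that the test function is admissible at this
    height, and below \<open>\<bar>Im z\<bar>\<close>, so that \<open>z\<close> is enclosed by the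
    lines at heights \<open>c\<close> and \<open>1\<close>, or \<open>- 1\<close> and
    \<open>- c\<close>.\<close>
  define c where "c = 1 / (2 * real n)"
  have c: "0 < c" "c < 1 / real n" "c < \<bar>Im z\<bar>" "c < 1" using n z by (auto simp: c_def field_simps)
  define u where "u w = gauss_cauchy (w - z) * f w" for w
  have lines: "line_int c u = line_int (- c) u" using zero[OF n(1) gauss_cauchy_P_step[OF n] c(1,2)] by (simp add: gamma_int_def u_def[abs_def])
  obtain C where C: "C \<ge> 0" "\<And>z. c \<le> \<bar>Im z\<bar> \<Longrightarrow> \<bar>Im z\<bar> \<le> 1 \<Longrightarrow> cmod (f z) \<le> C * exp (1 / 2 * \<bar>Re z\<bar>)"
    using slow_holomorphicE[OF f c(1), of "1/2"] by (metis half_gt_zero zero_less_one)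
  have fh: "f holomorphic_on off_real" using f by (simp add: slow_holomorphic_def)
  have dec0: "exp (- \<bar>Re w - Re z\<bar>) * exp (1 / 2 * \<bar>Re w\<bar>) \<le> exp \<bar>Re z\<bar> * growth (- (1 / 2)) w" for w
    unfolding exp_add[symmetric] by simp
  define q where "q w = exp (- ((w - z)\<^sup>2)) * f w" for w
  have qdec: "cmod (q w) \<le> exp (2\<^sup>2 + 1) * C * exp \<bar>Re z\<bar> * growth (- (1 / 2)) w"
    if w: "c \<le> \<bar>Im w\<bar>" "\<bar>Im w\<bar> \<le> 1" for w
  proof -
    have "cmod (q w) \<le> (exp (2\<^sup>2 + 1) * exp (- \<bar>Re (w - z)\<bar>)) * (C * exp (1 / 2 * \<bar>Re w\<bar>))"
      unfolding q_def norm_mult using gauss_bound[of "w - z" 2] C w z by (intro mult_mono) auto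
    also have "\<dots> = exp (2\<^sup>2 + 1) * C * (exp (- \<bar>Re w - Re z\<bar>) * exp (1 / 2 * \<bar>Re w\<bar>))" by simp
    also have "\<dots> \<le> exp (2\<^sup>2 + 1) * C * (exp \<bar>Re z\<bar> * growth (- (1 / 2)) w)"
      using C(1) dec0 by (intro mult_left_mono) auto
    finally show ?thesis by simp
  qed
  have qh: "q holomorphic_on {z. Im z > 0}" "q holomorphic_on {z. Im z < 0}"
    unfolding q_def[abs_def] using fh by (auto intro!: holomorphic_intros elim!: holomorphic_on_subset)
  have uq: "u = (\<lambda>w. q w / (w - z))" by (simp add: u_def q_def gauss_cauchy_def fun_eq_iff)
  have qz: "q z = f z" by (simp add: q_def)
  \<comment> \<open>On the side of the axis opposite to \<open>z\<close> the denominator keeps the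
    distance \<open>\<bar>Im z\<bar>\<close> from \<open>0\<close>.\<close>
  have udec: "cmod (u w) \<le> exp (2\<^sup>2 + 1) * C * exp \<bar>Re z\<bar> / \<bar>Im z\<bar> * growth (- (1 / 2)) w"
    if w: "c \<le> \<bar>Im w\<bar>" "\<bar>Im w\<bar> \<le> 1" "Im w * Im z < 0" for w
  proof -
    have "\<bar>Im z\<bar> \<le> \<bar>Im (w - z)\<bar>" using w(3) by (cases "Im z > 0") (auto simp: mult_less_0_iff)
    hence "\<bar>Im z\<bar> \<le> cmod (w - z)" using abs_Im_le_cmod order_trans by blast
    hence "cmod (u w) \<le> exp (2\<^sup>2 + 1) * C * exp \<bar>Re z\<bar> * growth (- (1 / 2)) w / \<bar>Im z\<bar>"
      unfolding uq norm_divide using qdec[OF w(1,2)] z C(1) by (intro frac_le) auto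
    thus ?thesis by simp
  qed
  consider "Im z > 0" | "Im z < 0" using z(1) by linarith
  hence "line_int (- 1) u - line_int 1 u = kappa * q z"
  proof cases
    case 1
    have "line_int c u - line_int 1 u = kappa * q z" unfolding uq by (rule strip_cauchy[OF convex_open_halfplanes(1,2) qh(1), where d = "1 / 2"])
        (use 1 c z in \<open>auto intro!: qdec[simplified]\<close>)
    moreover have "line_int (- 1) u = line_int (- c) u"
    proof (rule line_int_shift_le[OF convex_open_halfplanes(3,4), of _ 0])
      show "u holomorphic_on {z. Im z < 0}" unfolding uq by (intro holomorphic_intros qh) (use 1 in auto)
      show "cmod (u w) \<le> exp (2\<^sup>2 + 1) * C * exp \<bar>Re z\<bar> / \<bar>Im z\<bar> * growth (- (1 / 2)) w" if "- 1 \<le> Im w" "Im w \<le> - c" for w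
        using that c 1 by (intro udec) (auto simp: mult_less_0_iff)
    qed (use c in auto)
    ultimately show ?thesis using lines by simp
  next
    case 2
    have "line_int (- 1) u - line_int (- c) u = kappa * q z" unfolding uq
      by (rule strip_cauchy[OF convex_open_halfplanes(3,4) qh(2), where d = "1 / 2"]) (use 2 c z in \<open>auto intro!: qdec[simplified]\<close>)
    moreover have "line_int c u = line_int 1 u"
    proof (rule line_int_shift_le[OF convex_open_halfplanes(1,2), of _ 0])
      show "u holomorphic_on {z. Im z > 0}" unfolding uq by (intro holomorphic_intros qh) (use 2 in auto)
      show "cmod (u w) \<le> exp (2\<^sup>2 + 1) * C * exp \<bar>Re z\<bar> / \<bar>Im z\<bar> * growth (- (1 / 2)) w" if "c \<le> Im w" "Im w \<le> 1" for w
        using that c 2 by (intro udec) (auto simp: mult_less_0_iff)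
    qed (use c in auto)
    ultimately show ?thesis using lines by simp
  qed
  thus ?thesis by (simp add: u_def[abs_def] qz)
qed

section \<open>The representation by boundary integrals\<close>

context lcs
begin

section \<open>Entire functions of slow growth, cosets and boundary integrands\<close>

lemma Oexp_entire_iff:
  "g \<in> Oexp sc p {} \<longleftrightarrow> g \<in> hol_space sc UNIV \<and>
    (\<forall>n\<ge>1. \<forall>i. \<exists>C\<ge>0. \<forall>z. \<bar>Im z\<bar> < real n \<longrightarrow> p i (g z) \<le> C * growth (1 / real n) z)"
  unfolding Oexp_def bdd_above_growth_iff S_set_empty finite_part_simps by simp

lemma Oexp_entire_growth:
  assumes g: "g \<in> Oexp sc p {}" and e: "\<epsilon> > 0"
  shows "\<exists>C\<ge>0. \<forall>z. \<bar>Im z\<bar> \<le> R \<longrightarrow> p i (g z) \<le> C * growth \<epsilon> z"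
proof -
  obtain n :: nat where n: "1 / \<epsilon> < n" "R < n" "1 < n" using reals_Archimedean2[of "max (1 / \<epsilon>) (max R 1)"] by auto
  hence n': "n \<ge> 1" "1 / real n < \<epsilon>" using e by (auto simp: field_simps)
  have "\<exists>C\<ge>0. \<forall>z. \<bar>Im z\<bar> < real n \<longrightarrow> p i (g z) \<le> C * growth (1 / real n) z"
    using g n'(1) unfolding Oexp_entire_iff by simp
  then obtain C where C: "C \<ge> 0" "\<forall>z. \<bar>Im z\<bar> < real n \<longrightarrow> p i (g z) \<le> C * growth (1 / real n) z" by metis
  have "p i (g z) \<le> C * growth \<epsilon> z" if z: "\<bar>Im z\<bar> \<le> R" for z
  proof -
    have "1 / real n * \<bar>Re z\<bar> \<le> \<epsilon> * \<bar>Re z\<bar>" using n' by (intro mult_right_mono) auto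
    hence "C * growth (1 / real n) z \<le> C * growth \<epsilon> z" using C(1) by (intro mult_left_mono) auto
    moreover have "p i (g z) \<le> C * growth (1 / real n) z" using C(2) z n(2) by simp
    ultimately show ?thesis by linarith
  qed
  thus ?thesis using C(1) by blast
qed

lemma Oexp_entire_subset: "Oexp_0 \<subseteq> Oexp_R"
proof
  fix e assume "e \<in> Oexp_0"
  then obtain g where g: "g \<in> Oexp sc p {}" "e = restr off_real g" by (auto simp: Oexp_entire_def finite_part_simps)
  have "g \<in> hol_space sc UNIV" using g(1) by (simp add: Oexp_entire_iff)
  hence "e \<in> hol_space sc off_real" unfolding g(2) by (rule hol_space_restr[OF _ open_Im(1)]) simp
  moreover have "slow_growth e" unfolding slow_growth_def
  proof (intro allI impI)
    fix i and r R \<epsilon> :: real assume "0 < r" "0 < \<epsilon>"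
    from Oexp_entire_growth[OF g(1) this(2), of R i]
    obtain C where "C \<ge> 0" "\<forall>z. \<bar>Im z\<bar> \<le> R \<longrightarrow> p i (g z) \<le> C * growth \<epsilon> z" by metis
    thus "\<exists>C\<ge>0. \<forall>z. r \<le> \<bar>Im z\<bar> \<and> \<bar>Im z\<bar> \<le> R \<longrightarrow> p i (e z) \<le> C * growth \<epsilon> z"
      by (intro exI[of _ C]) (auto simp: g(2) restr_def)
  qed
  ultimately show "e \<in> Oexp_R" by (simp add: Oexp_UNIV_iff)
qed

lemma coset_eq_iff:
  assumes W: "fun_subspace sc W"
  shows "f +o W = g +o W \<longleftrightarrow> f - g \<in> W"
proof
  assume "f +o W = g +o W"
  moreover have "f \<in> f +o W" using fun_subspace_zero[OF W] unfolding elt_set_plus_def by force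
  ultimately obtain w where "w \<in> W" "f = g + w" by (auto simp: elt_set_plus_def)
  thus "f - g \<in> W" by simp
next
  assume fg: "f - g \<in> W"
  have "x \<in> f +o W \<longleftrightarrow> x - f \<in> W" "x \<in> g +o W \<longleftrightarrow> x - g \<in> W" for x
    by (auto simp: elt_set_plus_def intro: bexI[of _ "x - f"] bexI[of _ "x - g"])
  moreover have "x - f \<in> W \<longleftrightarrow> x - g \<in> W" for x
    using fun_subspace_add[OF W, of "x - f" "f - g"] fun_subspace_diff[OF W, of "x - g" "f - g"] fg by auto
  ultimately show "f +o W = g +o W" by blast
qed

lemma continuous_on_line:
  assumes "F \<in> Oexp_R" "c \<noteq> 0"
  shows "continuous_on UNIV (\<lambda>t. F (Complex t c))"
  by (rule continuous_on_compose2[OF OexpD(3)[OF assms(1)]]) (use assms(2) in \<open>auto intro!: continuous_intros\<close>)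

lemma decayingI:
  assumes "continuous_on UNIV g" "\<And>i. \<exists>C. \<exists>d>0. \<forall>t. p i (g t) \<le> C * exp (- d * \<bar>t\<bar>)"
  shows "decaying g" unfolding decaying_def using assms by (intro conjI allI exI[of _ "{}"]) auto

text \<open>The constant is uniform over the whole step, as continuity on the inductive limit
  demands.\<close>

lemma gamma_term_bound:
  assumes F: "F \<in> Oexp_R" and n: "n \<ge> 1" and c: "c \<noteq> 0" "\<bar>c\<bar> \<le> 1 / real n"
  shows "\<exists>C\<ge>0. \<forall>\<phi>\<in>P_step n. \<forall>t. p i (sc (\<phi> (Complex t c)) (F (Complex t c))) \<le> C * P_norm n \<phi> * exp (- (1 / (2 * real n)) * \<bar>t\<bar>)"
proof -
  have "\<bar>c\<bar> > 0" "1 / (2 * real n) > 0" using c n by auto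
  then obtain C where C: "C \<ge> 0" "\<And>z. \<bar>c\<bar> \<le> \<bar>Im z\<bar> \<Longrightarrow> \<bar>Im z\<bar> \<le> \<bar>c\<bar> \<Longrightarrow> p i (F z) \<le> C * exp (1 / (2 * real n) * \<bar>Re z\<bar>)"
    using slow_growthE[OF OexpD(2)[OF F]] by metis
  have "p i (sc (\<phi> (Complex t c)) (F (Complex t c))) \<le> C * P_norm n \<phi> * exp (- (1 / (2 * real n)) * \<bar>t\<bar>)"
    if \<phi>: "\<phi> \<in> P_step n" for \<phi> t
  proof -
    have "p i (sc (\<phi> (Complex t c)) (F (Complex t c))) \<le> (P_norm n \<phi> * exp (- (1 / real n) * \<bar>t\<bar>)) * (C * exp (1 / (2 * real n) * \<bar>t\<bar>))"
      unfolding seminorm_scale using P_stepD(3)[OF \<phi> n, of "Complex t c"] P_stepD(4)[OF \<phi> n] C(1) C(2)[of "Complex t c"] c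
      by (intro mult_mono) auto
    also have "\<dots> = C * P_norm n \<phi> * (exp (- (1 / real n) * \<bar>t\<bar>) * exp (1 / (2 * real n) * \<bar>t\<bar>))" by simp
    also have "exp (- (1 / real n) * \<bar>t\<bar>) * exp (1 / (2 * real n) * \<bar>t\<bar>) = exp (- (1 / (2 * real n)) * \<bar>t\<bar>)"
      unfolding exp_add[symmetric] by (simp add: field_simps)
    finally show ?thesis .
  qed
  thus ?thesis using C(1) by blast
qed

lemma gamma_term_decaying:
  assumes F: "F \<in> Oexp_R" and \<phi>: "\<phi> \<in> P_step n" "n \<ge> 1" and c: "c \<noteq> 0" "\<bar>c\<bar> \<le> 1 / real n"
  shows "decaying (\<lambda>t. sc (\<phi> (Complex t c)) (F (Complex t c)))"
proof (rule decayingI)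
  show "continuous_on UNIV (\<lambda>t. sc (\<phi> (Complex t c)) (F (Complex t c)))"
    using P_step_real_continuous[OF \<phi> c(2)] continuous_on_line[OF F c(1)] by (intro continuous_on_scale_lcs)
  show "\<exists>C. \<exists>d>0. \<forall>t. p i (sc (\<phi> (Complex t c)) (F (Complex t c))) \<le> C * exp (- d * \<bar>t\<bar>)" for i
  proof -
    from gamma_term_bound[OF F \<phi>(2) c, of i] obtain C where
      "\<forall>\<phi>\<in>P_step n. \<forall>t. p i (sc (\<phi> (Complex t c)) (F (Complex t c))) \<le> C * P_norm n \<phi> * exp (- (1 / (2 * real n)) * \<bar>t\<bar>)" by metis
    thus ?thesis using \<phi> by (intro exI[of _ "C * P_norm n \<phi>"] exI[of _ "1 / (2 * real n)"]) auto
  qed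
qed

definition gamma_vec :: "(complex \<Rightarrow> 'e) \<Rightarrow> (complex \<Rightarrow> complex) \<Rightarrow> real \<Rightarrow> 'e" where
  "gamma_vec F \<phi> c = pint (\<lambda>t. sc (\<phi> (Complex t c)) (F (Complex t c))) - pint (\<lambda>t. sc (\<phi> (Complex t (- c))) (F (Complex t (- c))))"

lemma gamma_integral_unique: "has_gamma_integral sc F \<phi> c I \<Longrightarrow> I = gamma_vec F \<phi> c"
  unfolding has_gamma_integral_def gamma_vec_def using pint_eq by blast

end

context sc_lcs
begin

section \<open>The functional of a class and its kernel\<close>

lemma has_gamma_vec:
  assumes F: "F \<in> Oexp_R" and \<phi>: "\<phi> \<in> P_step n" "n \<ge> 1" and c: "0 < c" "c < 1 / real n"
  shows "has_gamma_integral sc F \<phi> c (gamma_vec F \<phi> c)" unfolding has_gamma_integral_def gamma_vec_def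
  using has_pettis_pint[OF gamma_term_decaying[OF F \<phi>, of c]] has_pettis_pint[OF gamma_term_decaying[OF F \<phi>, of "- c"]] c by auto

lemma dual_gamma_vec:
  assumes F: "F \<in> Oexp_R" and \<phi>: "\<phi> \<in> P_step n" "n \<ge> 1" and c: "0 < c" "c < 1 / real n" and y: "y \<in> lcs_dual sc"
  shows "y (gamma_vec F \<phi> c) = gamma_int (\<lambda>z. y (F z)) \<phi> c"
  using dual_pint(1)[OF gamma_term_decaying[OF F \<phi>, of c] y] dual_pint(1)[OF gamma_term_decaying[OF F \<phi>, of "- c"] y] c
  by (simp add: gamma_vec_def dual_diff[OF y] gamma_int_def line_int_def dual_scale[OF y])

lemma gamma_vec_bound:
  assumes F: "F \<in> Oexp_R" and n: "n \<ge> 1"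
  shows "\<exists>C. \<forall>\<phi>\<in>P_step n. p i (gamma_vec F \<phi> (1 / (2 * real n))) \<le> C * P_norm n \<phi>"
proof -
  define c where "c = 1 / (2 * real n)"
  have c: "c > 0" "c \<le> 1 / real n" using n by (auto simp: c_def field_simps)
  obtain C1 where C1: "C1 \<ge> 0" "\<forall>\<phi>\<in>P_step n. \<forall>t. p i (sc (\<phi> (Complex t c)) (F (Complex t c))) \<le> C1 * P_norm n \<phi> * exp (- (1 / (2 * real n)) * \<bar>t\<bar>)"
    using gamma_term_bound[OF F n, of c i] c by auto
  obtain C2 where C2: "C2 \<ge> 0" "\<forall>\<phi>\<in>P_step n. \<forall>t. p i (sc (\<phi> (Complex t (- c))) (F (Complex t (- c)))) \<le> C2 * P_norm n \<phi> * exp (- (1 / (2 * real n)) * \<bar>t\<bar>)"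
    using gamma_term_bound[OF F n, of "- c" i] c by auto
  have "p i (gamma_vec F \<phi> c) \<le> (C1 + C2) * (2 / (1 / (2 * real n))) * P_norm n \<phi>" if \<phi>: "\<phi> \<in> P_step n" for \<phi>
  proof -
    have "p i (pint (\<lambda>t. sc (\<phi> (Complex t c)) (F (Complex t c)))) \<le> C1 * P_norm n \<phi> * (2 / (1 / (2 * real n)))"
      by (rule pint_bound_exp[OF gamma_term_decaying[OF F \<phi> n], where x = 0]) (use c n C1 \<phi> in auto)
    moreover have "p i (pint (\<lambda>t. sc (\<phi> (Complex t (- c))) (F (Complex t (- c))))) \<le> C2 * P_norm n \<phi> * (2 / (1 / (2 * real n)))"
      by (rule pint_bound_exp[OF gamma_term_decaying[OF F \<phi> n], where x = 0]) (use c n C2 \<phi> in auto)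
    ultimately show ?thesis unfolding gamma_vec_def by (intro order_trans[OF seminorm_diff]) (simp add: algebra_simps)
  qed
  thus ?thesis unfolding c_def by blast
qed

text \<open>The representative extends across the axis, so one boundary line can be moved onto the
  other.\<close>

lemma gamma_vec_entire:
  assumes e: "e \<in> Oexp_0" and \<phi>: "\<phi> \<in> P_step n" "n \<ge> 1" and c: "0 < c" "c < 1 / real n"
  shows "gamma_vec e \<phi> c = 0"
proof (rule dual_separates)
  fix y assume y: "y \<in> lcs_dual sc"
  obtain g where g: "g \<in> Oexp sc p {}" "e = restr off_real g" using e by (auto simp: Oexp_entire_def finite_part_simps)
  obtain i B where B: "B \<ge> 0" "\<And>x. cmod (y x) \<le> B * p i x" using dual_bounded[OF y] by blast
  have "1 / (2 * real n) > 0" using \<phi>(2) by simp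
  from Oexp_entire_growth[OF g(1) this, of 1 i] obtain C
    where C: "\<forall>z. \<bar>Im z\<bar> \<le> 1 \<longrightarrow> p i (g z) \<le> C * exp (1 / (2 * real n) * \<bar>Re z\<bar>)" by metis
  have "gamma_int (\<lambda>z. y (g z)) \<phi> c = 0"
  proof (rule gamma_int_entire[OF _ \<phi> c])
    have "g \<in> hol_space sc UNIV" using g(1) by (simp add: Oexp_entire_iff)
    thus "(\<lambda>z. y (g z)) holomorphic_on UNIV" using y by (intro hol_space_dual) auto
    show "cmod (y (g w)) \<le> B * C * exp (1 / (2 * real n) * \<bar>Re w\<bar>)" if "\<bar>Im w\<bar> \<le> 1" for w
      using B(2)[of "g w"] mult_left_mono[OF C[rule_format, OF that] B(1)] by (simp add: mult.assoc)
  qed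
  moreover have "gamma_int (\<lambda>z. y (e z)) \<phi> c = gamma_int (\<lambda>z. y (g z)) \<phi> c"
    using c by (simp add: gamma_int_def line_int_def g(2) restr_def)
  ultimately show "y (gamma_vec e \<phi> c) = y 0" using dual_gamma_vec[OF subsetD[OF Oexp_entire_subset e] \<phi> c y] by (simp add: dual_zero[OF y])
qed

lemma gamma_vec_add:
  assumes F: "F \<in> Oexp_R" and G: "G \<in> Oexp_R" and \<phi>: "\<phi> \<in> P_step n" "n \<ge> 1" and c: "0 < c" "c < 1 / real n"
  shows "gamma_vec (F + G) \<phi> c = gamma_vec F \<phi> c + gamma_vec G \<phi> c"
proof (rule dual_separates)
  fix y assume y: "y \<in> lcs_dual sc"
  have int: "integrable lborel (\<lambda>t. \<phi> (Complex t b) * y (H (Complex t b)))" if "H \<in> {F, G}" "b \<in> {c, - c}" for H b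
    using that gamma_int_integrable[OF dual_slow_holomorphic[OF F y] \<phi>, of b] gamma_int_integrable[OF dual_slow_holomorphic[OF G y] \<phi>, of b] c
    by auto
  show "y (gamma_vec (F + G) \<phi> c) = y (gamma_vec F \<phi> c + gamma_vec G \<phi> c)" using int
    by (simp add: dual_add[OF y] dual_gamma_vec[OF F \<phi> c y] dual_gamma_vec[OF G \<phi> c y]
        dual_gamma_vec[OF fun_subspace_add[OF fun_subspace_Oexp F G] \<phi> c y] gamma_int_def line_int_def distrib_left)
qed

text \<open>The vector described in \<open>H_map\<close> exists because the integral is independent
  of \<open>F\<close>, \<open>\<phi>\<close> and \<open>c\<close>, and it is unique because Pettis
  integrals are.\<close>

lemma H_map_eq:
  assumes F: "F \<in> Oexp_R" and \<phi>: "\<phi> \<in> P_step n" "n \<ge> 1" and c: "0 < c" "c < 1 / real n"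
  shows "H_map sc (F +o Oexp_0) (germ \<phi>) = gamma_vec F \<phi> c"
proof -
  have \<phi>': "\<phi> \<in> P_funs" using \<phi> by (auto simp: P_funs_iff)
  have indep: "gamma_vec G \<psi> b = gamma_vec F \<phi> c"
    if G: "G \<in> F +o Oexp_0" and m: "m \<ge> 1" and \<psi>: "\<psi> \<in> germ \<phi> \<inter> P_step m" and b: "0 < b" "b < 1 / real m" for G m \<psi> b
  proof -
    obtain e where e: "e \<in> Oexp_0" "G = F + e" using G by (auto simp: elt_set_plus_def)
    have eA: "e \<in> Oexp_R" using e(1) Oexp_entire_subset by blast
    have "gamma_vec G \<psi> b = gamma_vec F \<psi> b"
      unfolding e(2) using gamma_vec_add[OF F eA, of \<psi> m b] gamma_vec_entire[OF e(1), of \<psi> m b] \<psi> m b by simp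
    also have "\<dots> = gamma_vec F \<phi> c"
    proof (rule dual_separates)
      fix y assume y: "y \<in> lcs_dual sc"
      have "gamma_int (\<lambda>z. y (F z)) \<psi> b = gamma_int (\<lambda>z. y (F z)) \<phi> c"
        using \<psi> by (intro gamma_int_germ[OF dual_slow_holomorphic[OF F y] _ m \<phi> _ b c]) (auto simp: germ_iff)
      thus "y (gamma_vec F \<psi> b) = y (gamma_vec F \<phi> c)"
        using dual_gamma_vec[OF F _ m b y, of \<psi>] dual_gamma_vec[OF F \<phi> c y] \<psi> by simp
    qed
    finally show ?thesis .
  qed
  have sub: "G \<in> Oexp_R" if "G \<in> F +o Oexp_0" for G
    using that F Oexp_entire_subset fun_subspace_add[OF fun_subspace_Oexp] by (auto simp: elt_set_plus_def)
  have "(THE I. \<forall>G\<in>F +o Oexp_0. \<forall>m\<ge>1. \<forall>\<psi>\<in>germ \<phi> \<inter> P_step m. \<forall>b. 0 < b \<and> b < 1 / real m \<longrightarrow>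
      has_gamma_integral sc G \<psi> b I) = gamma_vec F \<phi> c"
  proof (rule the_equality)
    show "\<forall>G\<in>F +o Oexp_0. \<forall>m\<ge>1. \<forall>\<psi>\<in>germ \<phi> \<inter> P_step m. \<forall>b. 0 < b \<and> b < 1 / real m \<longrightarrow>
        has_gamma_integral sc G \<psi> b (gamma_vec F \<phi> c)"
    proof (intro ballI allI impI)
      fix G m \<psi> b
      assume a: "G \<in> F +o Oexp_0" "1 \<le> m" "\<psi> \<in> germ \<phi> \<inter> P_step m" "0 < b \<and> b < 1 / real m"
      hence "has_gamma_integral sc G \<psi> b (gamma_vec G \<psi> b)" using sub by (intro has_gamma_vec) auto
      thus "has_gamma_integral sc G \<psi> b (gamma_vec F \<phi> c)" using indep[of G m \<psi> b] a by simp
    qed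
  next
    fix I
    assume I: "\<forall>G\<in>F +o Oexp_0. \<forall>m\<ge>1. \<forall>\<psi>\<in>germ \<phi> \<inter> P_step m. \<forall>b. 0 < b \<and> b < 1 / real m \<longrightarrow>
        has_gamma_integral sc G \<psi> b I"
    have "F \<in> F +o Oexp_0" using fun_subspace_zero[OF fun_subspace_Oexp_entire] by (force simp: elt_set_plus_def)
    hence "has_gamma_integral sc F \<phi> c I" using I \<phi> c germ_self[OF \<phi>'] by blast
    thus "I = gamma_vec F \<phi> c" by (rule gamma_integral_unique)
  qed
  moreover have "germ \<phi> \<in> P_star" using \<phi>' by (simp add: P_star_def)
  ultimately show ?thesis by (simp add: H_map_def)
qed

lemma H_map_eq_dual:
  assumes F: "F \<in> Oexp_R" and \<phi>: "\<phi> \<in> P_step n" "n \<ge> 1" and c: "0 < c" "c < 1 / real n" and y: "y \<in> lcs_dual sc"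
  shows "y (H_map sc (F +o Oexp_0) (germ \<phi>)) = gamma_int (\<lambda>z. y (F z)) \<phi> c"
  using H_map_eq[OF F \<phi> c] dual_gamma_vec[OF F \<phi> c y] by simp

lemma P_step_half: "n \<ge> 1 \<Longrightarrow> 0 < 1 / (2 * real n) \<and> 1 / (2 * real n) < 1 / real n" by (auto simp: field_simps)

text \<open>\<open>H_inv\<close> is restricted to \<open>L_space\<close>, so membership is needed
  before it can be evaluated. The continuous seminorm dominating \<open>p i (T g)\<close> is this
  function itself.\<close>

lemma H_map_in_L_space:
  assumes F: "F \<in> Oexp_R"
  shows "H_map sc (F +o Oexp_0) \<in> L_space sc p"
proof -
  define T where "T = H_map sc (F +o Oexp_0)"
  have T: "T (germ \<phi>) = gamma_vec F \<phi> (1 / (2 * real n))" if "\<phi> \<in> P_step n" "n \<ge> 1" for \<phi> n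
    unfolding T_def using P_step_half[OF that(2)] by (intro H_map_eq[OF F that]) auto
  have Tdual: "y (T (germ \<phi>)) = gamma_int (\<lambda>z. y (F z)) \<phi> (1 / (2 * real n))" if "\<phi> \<in> P_step n" "n \<ge> 1" "y \<in> lcs_dual sc" for \<phi> n y
    unfolding T_def using P_step_half[OF that(2)] that(3) by (intro H_map_eq_dual[OF F that(1,2)]) auto
  have off: "T g = 0" if "g \<notin> P_star" for g using that by (simp add: T_def H_map_def)
  have add: "T (germ (\<lambda>z. \<phi> z + \<psi> z)) = T (germ \<phi>) + T (germ \<psi>)" if \<phi>\<psi>: "\<phi> \<in> P_funs" "\<psi> \<in> P_funs" for \<phi> \<psi>
  proof (rule dual_separates)
    fix y assume y: "y \<in> lcs_dual sc"
    obtain n where n: "n \<ge> 1" "\<phi> \<in> P_step n" "\<psi> \<in> P_step n" using P_funs_common[OF \<phi>\<psi>] by blast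
    have int: "integrable lborel (\<lambda>t. \<theta> (Complex t b) * y (F (Complex t b)))" if "\<theta> \<in> {\<phi>, \<psi>}" "b \<in> {1 / (2 * real n), - (1 / (2 * real n))}" for \<theta> b
      using that n P_step_half[OF n(1)] gamma_int_integrable[OF dual_slow_holomorphic[OF F y] _ n(1), of \<theta> b] by auto
    show "y (T (germ (\<lambda>z. \<phi> z + \<psi> z))) = y (T (germ \<phi>) + T (germ \<psi>))"
      using int by (simp add: dual_add[OF y] Tdual[OF n(2,1) y] Tdual[OF n(3,1) y] Tdual[OF P_step_add[OF n(2,3,1)] n(1) y]
          gamma_int_def line_int_def distrib_right)
  qed
  have scale: "T (germ (\<lambda>z. c * \<phi> z)) = sc c (T (germ \<phi>))" if \<phi>: "\<phi> \<in> P_funs" for c \<phi>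
  proof (rule dual_separates)
    fix y assume y: "y \<in> lcs_dual sc"
    obtain n where n: "n \<ge> 1" "\<phi> \<in> P_step n" using \<phi> by (auto simp: P_funs_iff)
    show "y (T (germ (\<lambda>z. c * \<phi> z))) = y (sc c (T (germ \<phi>)))"
      by (simp add: dual_scale[OF y] Tdual[OF n(2,1) y] Tdual[OF P_step_scale[OF n(2,1)] n(1) y]
          gamma_int_def line_int_def mult.assoc right_diff_distrib)
  qed
  have "\<exists>q\<in>P_seminorms. \<forall>g\<in>P_star. p i (T g) \<le> q g" for i
  proof (intro bexI[of _ "\<lambda>g. p i (T g)"] ballI)
    show "(\<lambda>g. p i (T g)) \<in> P_seminorms" unfolding P_seminorms_def
    proof (intro CollectI conjI ballI allI impI)
      fix n :: nat assume n: "1 \<le> n"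
      show "\<exists>C. \<forall>\<phi>\<in>P_step n. p i (T (germ \<phi>)) \<le> C * P_norm n \<phi>"
        using gamma_vec_bound[OF F n, of i] T[OF _ n] by metis
    qed (simp_all add: add scale seminorm_add seminorm_scale)
  qed simp
  thus ?thesis unfolding L_space_def T_def[symmetric] using off add scale by blast
qed

text \<open>If the functional vanishes, a representative of \<open>F\<close> near the real line is the difference of the Cauchy integrals of \<open>F\<close> over the lines \<open>Im = \<plusminus>1\<close>.\<close>

lemma H_map_kernel:
  assumes F: "F \<in> Oexp_R"
    and zero: "\<And>n \<phi> c. n \<ge> 1 \<Longrightarrow> \<phi> \<in> P_step n \<Longrightarrow> 0 < c \<Longrightarrow> c < 1 / real n \<Longrightarrow> gamma_vec F \<phi> c = 0"
  shows "F \<in> Oexp_0"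
proof -
  define \<Omega> where "\<Omega> = {z. \<bar>Im z\<bar> < 1}"
  have op: "open \<Omega>" unfolding \<Omega>_def by (intro open_Collect_less continuous_intros)
  define k where "k b t z = gauss_cauchy (Complex t b - z)" for b t z
  \<comment> \<open>The damped Cauchy integral of \<open>F\<close> over \<open>Im = b\<close>; the
    kernel decays like \<open>exp (- \<bar>t - Re z\<bar>)\<close> and thus absorbs the growth of
    \<open>F\<close>.\<close>
  define E where "E b z = pint (\<lambda>t. sc (k b t z) (F (Complex t b)))" for b z
  have gc: "cmod (k b t z) \<le> exp (2\<^sup>2 + 1) / r * exp (- 1 * \<bar>t - Re z\<bar>)"
    if "\<bar>b\<bar> = 1" "r > 0" "\<bar>Im z\<bar> \<le> 1 - r" for b t z r
    using gauss_cauchy_bound[of r "Complex t b - z" 2] that by (simp add: k_def)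
  \<comment> \<open>The growth \<open>\<epsilon> * \<bar>t\<bar>\<close> is split at
    \<open>Re z\<close>: the part \<open>\<epsilon> * \<bar>Re z\<bar>\<close> is the growth allowed
    for the result, the part \<open>\<epsilon> * \<bar>t - Re z\<bar>\<close> is charged to the
    kernel.\<close>
  have dom: "\<exists>C\<ge>0. \<forall>z t. \<bar>Im z\<bar> \<le> 1 - r \<longrightarrow> cmod (k b t z) * p i (F (Complex t b)) \<le> C * growth \<epsilon> z * exp (- (1 - \<epsilon>) * \<bar>t - Re z\<bar>)"
    if b: "\<bar>b\<bar> = 1" and r: "r > 0" and e: "0 < \<epsilon>" for b r \<epsilon> i
  proof -
    obtain C where C: "C \<ge> 0" "\<And>z. 1 \<le> \<bar>Im z\<bar> \<Longrightarrow> \<bar>Im z\<bar> \<le> 1 \<Longrightarrow> p i (F z) \<le> C * growth \<epsilon> z"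
      using slow_growthE[OF OexpD(2)[OF F] zero_less_one e] by metis
    have "cmod (k b t z) * p i (F (Complex t b)) \<le> exp (2\<^sup>2 + 1) / r * C * growth \<epsilon> z * exp (- (1 - \<epsilon>) * \<bar>t - Re z\<bar>)"
      if z: "\<bar>Im z\<bar> \<le> 1 - r" for z t
    proof -
      have "cmod (k b t z) * p i (F (Complex t b)) \<le> (exp (2\<^sup>2 + 1) / r * exp (- 1 * \<bar>t - Re z\<bar>)) * (C * exp (\<epsilon> * \<bar>t\<bar>))"
        using gc[OF b r z] C(2)[of "Complex t b"] b r by (intro mult_mono) auto
      also have "\<dots> = exp (2\<^sup>2 + 1) / r * C * (exp (- 1 * \<bar>t - Re z\<bar>) * exp (\<epsilon> * \<bar>t\<bar>))" by simp
      also have "\<dots> \<le> exp (2\<^sup>2 + 1) / r * C * (growth \<epsilon> z * exp (- (1 - \<epsilon>) * \<bar>t - Re z\<bar>))"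
      proof (rule mult_left_mono)
        have "\<epsilon> * \<bar>t\<bar> \<le> \<epsilon> * (\<bar>Re z\<bar> + \<bar>t - Re z\<bar>)" using e by (intro mult_left_mono) auto
        thus "exp (- 1 * \<bar>t - Re z\<bar>) * exp (\<epsilon> * \<bar>t\<bar>) \<le> growth \<epsilon> z * exp (- (1 - \<epsilon>) * \<bar>t - Re z\<bar>)"
          unfolding exp_add[symmetric] by (simp add: algebra_simps)
      qed (use r C in auto)
      finally show ?thesis by (simp add: mult.assoc)
    qed
    moreover have "exp (2\<^sup>2 + 1) / r * C \<ge> 0" using r C by simp
    ultimately show ?thesis by blast
  qed
  have contF: "continuous_on (- {}) (\<lambda>t. F (Complex t b))" if "\<bar>b\<bar> = 1" for b using continuous_on_line[OF F, of b] that by auto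
  have ne: "Complex t b \<noteq> z" if "\<bar>b\<bar> = 1" "z \<in> \<Omega>" for b t z using that by (auto simp: \<Omega>_def)
  have kc: "continuous_on (- {}) (\<lambda>t. k b t z)" if "\<bar>b\<bar> = 1" "z \<in> \<Omega>" for b z
    unfolding k_def gauss_cauchy_def by (intro continuous_intros) (use ne[OF that] in auto)
  have kh: "k b t holomorphic_on \<Omega>" if "\<bar>b\<bar> = 1" for b t
    unfolding k_def[abs_def] gauss_cauchy_def by (intro holomorphic_intros) (use ne[OF that] in auto)
  have kd: "\<exists>r>0. \<exists>C. \<exists>d>0. \<forall>w\<in>ball z r. \<forall>t. cmod (k b t w) * p i (F (Complex t b)) \<le> C * exp (- d * \<bar>t\<bar>)"
    if b: "\<bar>b\<bar> = 1" and z: "z \<in> \<Omega>" for b z i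
  proof -
    define r where "r = (1 - \<bar>Im z\<bar>) / 2"
    have r: "r > 0" using z by (simp add: r_def \<Omega>_def)
    obtain C where C: "C \<ge> 0" "\<forall>z t. \<bar>Im z\<bar> \<le> 1 - r \<longrightarrow> cmod (k b t z) * p i (F (Complex t b)) \<le> C * exp (1 / 2 * \<bar>Re z\<bar>) * exp (- (1 - 1 / 2) * \<bar>t - Re z\<bar>)"
      using dom[OF b r, of "1 / 2" i] by auto
    have "cmod (k b t w) * p i (F (Complex t b)) \<le> C * exp (\<bar>Re z\<bar> + r) * exp (- (1 / 2) * \<bar>t\<bar>)"
      if w: "w \<in> ball z r" for w t
    proof -
      have "\<bar>Im w - Im z\<bar> < r" "\<bar>Re w - Re z\<bar> < r"
        using w abs_Im_le_cmod[of "w - z"] abs_Re_le_cmod[of "w - z"] by (auto simp: dist_norm norm_minus_commute)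
      moreover have "2 * r = 1 - \<bar>Im z\<bar>" by (simp add: r_def)
      ultimately have "\<bar>Im w\<bar> \<le> 1 - r" and *: "\<bar>Re w\<bar> \<le> \<bar>Re z\<bar> + r" by linarith+
      hence "cmod (k b t w) * p i (F (Complex t b)) \<le> C * exp (1 / 2 * \<bar>Re w\<bar>) * exp (- (1 - 1 / 2) * \<bar>t - Re w\<bar>)"
        using C(2) by blast
      also have "\<dots> = C * (exp (1 / 2 * \<bar>Re w\<bar>) * exp (- (1 - 1 / 2) * \<bar>t - Re w\<bar>))" by simp
      also have "\<dots> \<le> C * (exp (\<bar>Re z\<bar> + r) * exp (- (1 / 2) * \<bar>t\<bar>))"
      proof (rule mult_left_mono[OF _ C(1)])
        have "1 / 2 * \<bar>Re w\<bar> + - (1 - 1 / 2) * \<bar>t - Re w\<bar> \<le> \<bar>Re z\<bar> + r + - (1 / 2) * \<bar>t\<bar>"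
          using * abs_triangle_ineq[of "t - Re w" "Re w"] by simp
        thus "exp (1 / 2 * \<bar>Re w\<bar>) * exp (- (1 - 1 / 2) * \<bar>t - Re w\<bar>) \<le> exp (\<bar>Re z\<bar> + r) * exp (- (1 / 2) * \<bar>t\<bar>)"
          unfolding exp_add[symmetric] exp_le_cancel_iff .
      qed
      finally show ?thesis by simp
    qed
    thus ?thesis using r by (intro exI[of _ r] conjI exI[of _ "C * exp (\<bar>Re z\<bar> + r)"] exI[of _ "1 / 2"]) auto
  qed
  have dec: "decaying (\<lambda>t. sc (k b t z) (F (Complex t b)))" if "\<bar>b\<bar> = 1" "z \<in> \<Omega>" for b z
    using hol_space_kernel_integral(1)[OF op _ contF kc kh kd, of b z] that by simp
  have hol: "restr \<Omega> (E b) \<in> hol_space sc \<Omega>" if "\<bar>b\<bar> = 1" for b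
    unfolding E_def[abs_def] using hol_space_kernel_integral(2)[OF op _ contF kc kh kd, of b] that by simp
  define E1 where "E1 z = sc (1 / kappa) (restr \<Omega> (E (- 1)) z - restr \<Omega> (E 1) z)" for z
  have E1_hol: "E1 \<in> hol_space sc \<Omega>"
    using fun_subspace_scale[OF fun_subspace_hol_space fun_subspace_diff[OF fun_subspace_hol_space hol[of "- 1"] hol[of 1]], of "1 / kappa"]
    by (simp add: E1_def[abs_def])
  have F_eq: "F z = E1 z" if z: "z \<in> \<Omega>" "Im z \<noteq> 0" for z
  proof (rule dual_separates)
    fix y assume y: "y \<in> lcs_dual sc"
    have "y (E b z) = line_int b (\<lambda>w. gauss_cauchy (w - z) * y (F w))" if "\<bar>b\<bar> = 1" for b
      using dual_pint(1)[OF dec[OF that z(1)] y] by (simp add: E_def line_int_def k_def dual_scale[OF y])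
    moreover have "line_int (- 1) (\<lambda>w. gauss_cauchy (w - z) * y (F w)) - line_int 1 (\<lambda>w. gauss_cauchy (w - z) * y (F w)) = kappa * y (F z)"
    proof (rule gamma_int_kernel[OF dual_slow_holomorphic[OF F y]])
      fix n \<phi> c assume a: "1 \<le> n" "\<phi> \<in> P_step n" "0 < (c::real)" "c < 1 / real n"
      show "gamma_int (\<lambda>z. y (F z)) \<phi> c = 0" using dual_gamma_vec[OF F a(2,1,3,4) y] zero[OF a] dual_zero[OF y] by simp
    qed (use z in \<open>auto simp: \<Omega>_def\<close>)
    ultimately show "y (F z) = y (E1 z)" using z kappa_nonzero by (simp add: E1_def restr_def dual_scale[OF y] dual_diff[OF y])
  qed
  \<comment> \<open>The holomorphic extension: the Cauchy integrals inside the strip and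
    \<open>F\<close> outside, which agree off the axis by \<open>F_eq\<close>.\<close>
  define G where "G z = (if z \<in> \<Omega> then E1 z else F z)" for z
  have G_eq: "G z = F z" if "Im z \<noteq> 0" for z using F_eq that by (simp add: G_def)
  have "G \<in> hol_space sc UNIV"
  proof (rule hol_space_local)
    fix z
    show "\<exists>U g \<Omega>'. open U \<and> z \<in> U \<and> g \<in> hol_space sc \<Omega>' \<and> z \<in> \<Omega>' \<and> (\<forall>w\<in>U. G w = g w)"
    proof (cases "Im z = 0")
      case True
      hence "z \<in> \<Omega>" by (simp add: \<Omega>_def)
      moreover have "\<forall>w\<in>\<Omega>. G w = E1 w" by (simp add: G_def)
      ultimately show ?thesis using op E1_hol by blast
    next
      case False
      hence "z \<in> off_real" by simp
      moreover have "\<forall>w\<in>off_real. G w = F w" using G_eq by simp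
      ultimately show ?thesis using open_Im(1) OexpD(1)[OF F] by blast
    qed
  qed simp
  moreover have "\<exists>C\<ge>0. \<forall>z. \<bar>Im z\<bar> < real n \<longrightarrow> p i (G z) \<le> C * growth (1 / real n) z" if n: "n \<ge> 1" for n :: nat and i
  proof -
    \<comment> \<open>At most the rate \<open>1 / n\<close> to be proved, and strictly below the
      decay rate \<open>1\<close> of the kernel.\<close>
    define e where "e = min (1 / real n) (1 / 2)"
    have e: "0 < e" "e \<le> 1 / real n" "e < 1" using n by (auto simp: e_def)
    have "\<exists>C\<ge>0. \<forall>z. \<bar>Im z\<bar> \<le> 1 / 2 \<longrightarrow> p i (E b z) \<le> C * growth e z" if b: "\<bar>b\<bar> = 1" for b
    proof -
      obtain C where C: "C \<ge> 0" "\<forall>z t. \<bar>Im z\<bar> \<le> 1 - 1 / 2 \<longrightarrow> cmod (k b t z) * p i (F (Complex t b)) \<le> C * growth e z * exp (- (1 - e) * \<bar>t - Re z\<bar>)"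
        using dom[OF b _ e(1), of "1 / 2" i] by auto
      have "p i (E b z) \<le> C * (2 / (1 - e)) * growth e z" if z: "\<bar>Im z\<bar> \<le> 1 / 2" for z
      proof -
        have "p i (E b z) \<le> C * growth e z * (2 / (1 - e))" unfolding E_def
        proof (rule pint_bound_exp[OF dec[OF b], where x = "Re z"])
          show "p i (sc (k b t z) (F (Complex t b))) \<le> C * growth e z * exp (- (1 - e) * \<bar>t - Re z\<bar>)" for t
            unfolding seminorm_scale using C(2) z by simp
        qed (use e z in \<open>auto simp: \<Omega>_def\<close>)
        thus ?thesis by (simp add: mult_ac)
      qed
      thus ?thesis using C(1) e by (intro exI[of _ "C * (2 / (1 - e))"]) auto
    qed
    from this[of "- 1"] this[of 1] obtain C1 C2 where C12: "C1 \<ge> 0" "C2 \<ge> 0"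
        "\<And>z. \<bar>Im z\<bar> \<le> 1 / 2 \<Longrightarrow> p i (E (- 1) z) \<le> C1 * growth e z" "\<And>z. \<bar>Im z\<bar> \<le> 1 / 2 \<Longrightarrow> p i (E 1 z) \<le> C2 * growth e z"
      by (metis abs_minus abs_one)
    obtain C3 where C3: "C3 \<ge> 0" "\<And>z. 1 / 2 \<le> \<bar>Im z\<bar> \<Longrightarrow> \<bar>Im z\<bar> \<le> real n \<Longrightarrow> p i (F z) \<le> C3 * growth e z"
      using slow_growthE[OF OexpD(2)[OF F] _ e(1), of "1 / 2"] by (metis half_gt_zero zero_less_one)
    define C4 where "C4 = cmod (1 / kappa) * (C1 + C2)"
    have C4: "C4 \<ge> 0" using C12 by (simp add: C4_def)
    have "p i (G z) \<le> (C3 + C4) * growth (1 / real n) z" if z: "\<bar>Im z\<bar> < real n" for z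
    proof -
      have "p i (G z) \<le> (C3 + C4) * growth e z"
      proof (cases "\<bar>Im z\<bar> \<le> 1 / 2")
        case True
        hence "z \<in> \<Omega>" by (simp add: \<Omega>_def)
        hence "p i (G z) = cmod (1 / kappa) * p i (E (- 1) z - E 1 z)" by (simp add: G_def E1_def restr_def seminorm_scale)
        also have "\<dots> \<le> cmod (1 / kappa) * (C1 * growth e z + C2 * growth e z)"
          using C12 True by (intro mult_left_mono order_trans[OF seminorm_diff] add_mono) auto
        also have "\<dots> = C4 * growth e z" by (simp add: C4_def distrib_right mult.assoc distrib_left)
        also have "\<dots> \<le> (C3 + C4) * growth e z" using C3 by (intro mult_right_mono) auto
        finally show ?thesis .
      next
        case False
        hence "p i (G z) \<le> C3 * growth e z" using G_eq C3 z by auto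
        also have "\<dots> \<le> (C3 + C4) * growth e z" using C4 by (intro mult_right_mono) auto
        finally show ?thesis .
      qed
      also have "\<dots> \<le> (C3 + C4) * growth (1 / real n) z"
      proof (rule mult_left_mono)
        have "e * \<bar>Re z\<bar> \<le> 1 / real n * \<bar>Re z\<bar>" using e by (intro mult_right_mono) auto
        thus "growth e z \<le> growth (1 / real n) z" by simp
      qed (use C3 C4 in simp)
      finally show ?thesis .
    qed
    thus ?thesis using C3(1) C4 by (intro exI[of _ "C3 + C4"]) auto
  qed
  ultimately have "G \<in> Oexp sc p {}" by (simp add: Oexp_entire_iff)
  moreover have "F = restr (- finite_part UNIV) G" using OexpD(1)[OF F] G_eq by (auto simp: finite_part_simps restr_def hol_space_def fun_eq_iff)
  ultimately show ?thesis unfolding Oexp_entire_def by blast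
qed

text \<open>One suitable height per test function is asked because the integral does not depend on
  the height; each application picks the height that is convenient for it.\<close>

lemma Oexp_entire_if_same_functional:
  assumes F: "F \<in> Oexp_R" and G: "G \<in> Oexp_R"
    and eq: "\<And>n \<phi> y. n \<ge> 1 \<Longrightarrow> \<phi> \<in> P_step n \<Longrightarrow> y \<in> lcs_dual sc \<Longrightarrow>
      \<exists>c>0. c < 1 / real n \<and> gamma_int (\<lambda>z. y (F z)) \<phi> c = gamma_int (\<lambda>z. y (G z)) \<phi> c"
  shows "F - G \<in> Oexp_0"
proof (rule H_map_kernel[OF fun_subspace_diff[OF fun_subspace_Oexp F G]])
  fix n \<phi> and c :: real assume a: "1 \<le> n" "\<phi> \<in> P_step n" "0 < c" "c < 1 / real n"
  have "gamma_vec F \<phi> c = gamma_vec G \<phi> c"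
  proof (rule dual_separates)
    fix y assume y: "y \<in> lcs_dual sc"
    obtain b where b: "0 < b" "b < 1 / real n" "gamma_int (\<lambda>z. y (F z)) \<phi> b = gamma_int (\<lambda>z. y (G z)) \<phi> b"
      using eq[OF a(1,2) y] by blast
    thus "y (gamma_vec F \<phi> c) = y (gamma_vec G \<phi> c)" using dual_gamma_vec[OF F a(2,1,3,4) y] dual_gamma_vec[OF G a(2,1,3,4) y]
        gamma_int_shift[OF dual_slow_holomorphic[OF F y] a(2,1,3,4) b(1,2)]
        gamma_int_shift[OF dual_slow_holomorphic[OF G y] a(2,1,3,4) b(1,2)] by simp
  qed
  moreover have "gamma_vec F \<phi> c = gamma_vec (F - G) \<phi> c + gamma_vec G \<phi> c"
    using gamma_vec_add[OF fun_subspace_diff[OF fun_subspace_Oexp F G] G a(2,1,3,4)] by simp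
  ultimately show "gamma_vec (F - G) \<phi> c = 0" by simp
qed

lemma H_map_inj: "inj_on (H_map sc) (bv sc p UNIV)"
proof (rule inj_onI)
  fix X Y assume "X \<in> bv sc p UNIV" "Y \<in> bv sc p UNIV" and eq: "H_map sc X = H_map sc Y"
  then obtain F G where F: "F \<in> Oexp_R" "X = F +o Oexp_0" and G: "G \<in> Oexp_R" "Y = G +o Oexp_0"
    by (auto simp: bv_def quot_space_def)
  have "F - G \<in> Oexp_0"
  proof (rule Oexp_entire_if_same_functional[OF F(1) G(1)])
    fix n \<phi> y assume a: "1 \<le> n" "\<phi> \<in> P_step n" "y \<in> lcs_dual sc"
    thus "\<exists>c>0. c < 1 / real n \<and> gamma_int (\<lambda>z. y (F z)) \<phi> c = gamma_int (\<lambda>z. y (G z)) \<phi> c"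
      using H_map_eq_dual[OF F(1) a(2,1) _ _ a(3), of "1 / (2 * real n)"] H_map_eq_dual[OF G(1) a(2,1) _ _ a(3), of "1 / (2 * real n)"]
        eq F(2) G(2) P_step_half[OF a(1)] by (intro exI[of _ "1 / (2 * real n)"]) auto
  qed
  thus "X = Y" using coset_eq_iff[OF fun_subspace_Oexp_entire] F G by simp
qed

end

section \<open>The Fourier transform on representatives\<close>

context lcs
begin

text \<open>Functions on the two half-planes are encoded by two functions on the lower one.\<close>

definition glue :: "(complex \<Rightarrow> 'e) \<Rightarrow> (complex \<Rightarrow> 'e) \<Rightarrow> complex \<Rightarrow> 'e" where
  "glue n1 n2 = (\<lambda>z. n2 (- z) - n1 z)"

definition lower_slow :: "(complex \<Rightarrow> 'e) \<Rightarrow> bool" where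
  "lower_slow n \<longleftrightarrow> n \<in> hol_space sc {z. Im z < 0} \<and>
    (\<forall>i. \<forall>r>0. \<forall>R. \<forall>\<epsilon>>0. \<exists>C\<ge>0. \<forall>z. - R \<le> Im z \<and> Im z \<le> - r \<longrightarrow> p i (n z) \<le> C * growth \<epsilon> z)"

lemma lower_slowE:
  assumes "lower_slow n" "0 < r" "0 < \<epsilon>"
  obtains C where "C \<ge> 0" "\<And>z. - R \<le> Im z \<Longrightarrow> Im z \<le> - r \<Longrightarrow> p i (n z) \<le> C * growth \<epsilon> z"
proof -
  have "\<exists>C\<ge>0. \<forall>z. - R \<le> Im z \<and> Im z \<le> - r \<longrightarrow> p i (n z) \<le> C * growth \<epsilon> z"
    by (rule assms(1)[unfolded lower_slow_def, THEN conjunct2, rule_format, OF assms(2,3)])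
  then obtain C where "C \<ge> 0" "\<forall>z. - R \<le> Im z \<and> Im z \<le> - r \<longrightarrow> p i (n z) \<le> C * growth \<epsilon> z"
    by metis
  thus thesis by (intro that[of C]) simp_all
qed

lemma lower_slow_zero: "lower_slow n \<Longrightarrow> \<not> Im z < 0 \<Longrightarrow> n z = 0" by (simp add: lower_slow_def hol_space_def)

end

context sc_lcs
begin

section \<open>Reflection and gluing of half-planes\<close>

lemma hol_space_reflect_arg:
  assumes f: "f \<in> hol_space sc \<Omega>" and op: "open \<Omega>" "open \<Omega>'" and iff: "\<And>z. z \<in> \<Omega>' \<longleftrightarrow> - z \<in> \<Omega>"
  shows "(\<lambda>z. f (- z)) \<in> hol_space sc \<Omega>'"
proof (rule hol_space_weakI[OF op(2)])
  fix y assume y: "y \<in> lcs_dual sc"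
  have "((\<lambda>z. y (f z)) \<circ> uminus) holomorphic_on \<Omega>'"
    by (rule holomorphic_on_compose_gen[OF _ hol_space_dual[OF f op(1) y]]) (use iff in \<open>auto intro!: holomorphic_intros\<close>)
  thus "(\<lambda>z. y (f (- z))) holomorphic_on \<Omega>'" by (simp add: o_def)
next
  have "continuous_on \<Omega>' (\<lambda>z. f (- z))"
    by (rule continuous_on_compose2[OF hol_space_continuous_on[OF f op(1)]]) (use iff in \<open>auto intro!: continuous_intros\<close>)
  thus "\<exists>r>0. \<exists>M. \<forall>w\<in>ball z r. p i (f (- w)) \<le> M" if "z \<in> \<Omega>'" for z i
    using locally_bounded_if_continuous[OF op(2)] that by blast
next
  show "f (- z) = 0" if "z \<notin> \<Omega>'" for z using f iff that by (auto simp: hol_space_def)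
qed

lemma reflect_Oexp:
  assumes F: "F \<in> Oexp_R"
  shows "reflect F \<in> Oexp_R"
proof -
  have "(\<lambda>z. F (- z)) \<in> hol_space sc off_real" by (rule hol_space_reflect_arg[OF OexpD(1)[OF F] open_Im(1) open_Im(1)]) simp
  from fun_subspace_minus[OF fun_subspace_hol_space this]
  have "reflect F \<in> hol_space sc off_real" by (simp add: reflect_def fun_Compl_def)
  moreover have "slow_growth (reflect F)" unfolding slow_growth_def
  proof (intro allI impI)
    fix i and r R \<epsilon> :: real assume "0 < r" "0 < \<epsilon>"
    from slow_growthE[OF OexpD(2)[OF F] this, of R i] obtain C
      where C: "C \<ge> 0" "\<And>z. r \<le> \<bar>Im z\<bar> \<Longrightarrow> \<bar>Im z\<bar> \<le> R \<Longrightarrow> p i (F z) \<le> C * growth \<epsilon> z" by metis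
    show "\<exists>C\<ge>0. \<forall>z. r \<le> \<bar>Im z\<bar> \<and> \<bar>Im z\<bar> \<le> R \<longrightarrow> p i (reflect F z) \<le> C * growth \<epsilon> z"
      using C(1) C(2)[of "- z" for z] by (intro exI[of _ C]) (auto simp: reflect_def)
  qed
  ultimately show ?thesis by (simp add: Oexp_UNIV_iff)
qed

lemma glue_Oexp:
  assumes n1: "lower_slow n1" and n2: "lower_slow n2"
  shows "glue n1 n2 \<in> Oexp_R"
proof -
  have h1: "- n1 \<in> hol_space sc {z. Im z < 0}" using n1 by (intro fun_subspace_minus[OF fun_subspace_hol_space]) (simp add: lower_slow_def)
  have h2: "(\<lambda>z. n2 (- z)) \<in> hol_space sc {z. Im z > 0}"
    using n2 by (intro hol_space_reflect_arg[OF _ open_Im(2,3)]) (auto simp: lower_slow_def)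
  have "glue n1 n2 = (\<lambda>z. n2 (- z)) + (- n1)" by (simp add: glue_def fun_eq_iff)
  hence "glue n1 n2 \<in> hol_space sc off_real" using hol_space_halfplanes[OF h2 h1] by simp
  moreover have "slow_growth (glue n1 n2)" unfolding slow_growth_def
  proof (intro allI impI)
    fix i and r R \<epsilon> :: real assume re: "0 < r" "0 < \<epsilon>"
    obtain C1 where C1: "C1 \<ge> 0" "\<And>z. - R \<le> Im z \<Longrightarrow> Im z \<le> - r \<Longrightarrow> p i (n1 z) \<le> C1 * growth \<epsilon> z"
      using lower_slowE[OF n1 re] by metis
    obtain C2 where C2: "C2 \<ge> 0" "\<And>z. - R \<le> Im z \<Longrightarrow> Im z \<le> - r \<Longrightarrow> p i (n2 z) \<le> C2 * growth \<epsilon> z"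
      using lower_slowE[OF n2 re] by metis
    have "p i (glue n1 n2 z) \<le> (C1 + C2) * growth \<epsilon> z" if z: "r \<le> \<bar>Im z\<bar>" "\<bar>Im z\<bar> \<le> R" for z
    proof (cases "Im z < 0")
      case True
      hence "p i (glue n1 n2 z) \<le> C1 * growth \<epsilon> z"
        using C1(2)[of z] z lower_slow_zero[OF n2, of "- z"] by (simp add: glue_def)
      also have "\<dots> \<le> (C1 + C2) * growth \<epsilon> z" using C2(1) by (intro mult_right_mono) auto
      finally show ?thesis .
    next
      case False
      hence "p i (glue n1 n2 z) \<le> C2 * growth \<epsilon> z"
        using C2(2)[of "- z"] z lower_slow_zero[OF n1, of z] by (simp add: glue_def)
      also have "\<dots> \<le> (C1 + C2) * growth \<epsilon> z" using C1(1) by (intro mult_right_mono) auto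
      finally show ?thesis .
    qed
    thus "\<exists>C\<ge>0. \<forall>z. r \<le> \<bar>Im z\<bar> \<and> \<bar>Im z\<bar> \<le> R \<longrightarrow> p i (glue n1 n2 z) \<le> C * growth \<epsilon> z"
      using C1(1) C2(1) by (intro exI[of _ "C1 + C2"]) auto
  qed
  ultimately show ?thesis by (simp add: Oexp_UNIV_iff)
qed

text \<open>The minus sign in \<open>glue\<close> cancels the orientation of the lower line, and the
  upper line is reflected to the lower one. Both halves become integrals over
  \<open>Im = - b\<close>.\<close>

lemma glue_gamma_int:
  assumes n1: "lower_slow n1" and n2: "lower_slow n2" and y: "y \<in> lcs_dual sc" and b: "b > 0"
  shows "gamma_int (\<lambda>z. y (glue n1 n2 z)) \<phi> b =
    line_int (- b) (\<lambda>w. \<phi> w * y (n1 w)) + line_int (- b) (\<lambda>w. \<phi> (- w) * y (n2 w))"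
proof -
  have "line_int b (\<lambda>w. \<phi> w * y (glue n1 n2 w)) = line_int b (\<lambda>w. (\<lambda>w. \<phi> (- w) * y (n2 w)) (- w))"
    using b lower_slow_zero[OF n1] by (simp add: line_int_def glue_def)
  also have "\<dots> = line_int (- b) (\<lambda>w. \<phi> (- w) * y (n2 w))" by (rule line_int_reflect)
  finally have up: "line_int b (\<lambda>w. \<phi> w * y (glue n1 n2 w)) = line_int (- b) (\<lambda>w. \<phi> (- w) * y (n2 w))" .
  have "line_int (- b) (\<lambda>w. \<phi> w * y (glue n1 n2 w)) = - line_int (- b) (\<lambda>w. \<phi> w * y (n1 w))"
    using b lower_slow_zero[OF n2] by (simp add: line_int_def glue_def dual_minus[OF y])
  thus ?thesis using up by (simp add: gamma_int_def)
qed

lemma reflect_gamma_int: "gamma_int (\<lambda>z. - f (- z)) \<phi> c = gamma_int f (\<lambda>w. \<phi> (- w)) c"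
proof -
  have "line_int b (\<lambda>w. \<phi> w * - f (- w)) = - line_int (- b) (\<lambda>w. \<phi> (- w) * f w)" for b
    using line_int_reflect[of b "\<lambda>w. - (\<phi> (- w) * f w)"] by (simp add: line_int_def)
  from this[of c] this[of "- c"] show ?thesis unfolding gamma_int_def by simp
qed

text \<open>Meant for \<open>Im \<zeta> < 0\<close>: the kernel decays to the right, and the cut-off
  controls the left end.\<close>

definition cut_vec :: "(complex \<Rightarrow> 'e) \<Rightarrow> real \<Rightarrow> complex \<Rightarrow> 'e" where
  "cut_vec F c \<zeta> = pint (\<lambda>t. sc (exp (- \<i> * Complex t c * \<zeta>)) (sc (cutoff (Complex t c)) (F (Complex t c))))"

text \<open>The decay \<open>2 * \<delta>\<close> of the kernel to the right is shared out: one
  \<open>\<delta>\<close> against the growth of \<open>F\<close>, the other left for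
  integrability.\<close>

lemma cut_estimate:
  assumes F: "F \<in> Oexp_R" and r: "0 < r" and \<delta>: "0 < \<delta>" and N: "0 \<le> N"
  shows "\<exists>C\<ge>0. \<forall>w \<zeta>. r \<le> \<bar>Im w\<bar> \<longrightarrow> \<bar>Im w\<bar> \<le> 1 \<longrightarrow> - N \<le> Im \<zeta> \<longrightarrow> Im \<zeta> \<le> - (2 * \<delta>) \<longrightarrow>
    cmod (exp (- \<i> * w * \<zeta>)) * p i (sc (cutoff w) (F w)) \<le> C * exp (\<bar>Im w\<bar> * \<bar>Re \<zeta>\<bar>) * growth (- \<delta>) w"
proof -
  obtain C where C: "C \<ge> 0" "\<And>z. r \<le> \<bar>Im z\<bar> \<Longrightarrow> \<bar>Im z\<bar> \<le> 1 \<Longrightarrow> p i (F z) \<le> C * growth \<delta> z"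
    using slow_growthE[OF OexpD(2)[OF F] r \<delta>] by metis
  obtain B where B: "B \<ge> 0" "\<And>z \<eta>. \<bar>Im z\<bar> \<le> 1 \<Longrightarrow> - N \<le> \<eta> \<Longrightarrow> \<eta> \<le> - \<delta> - \<delta> \<Longrightarrow>
      cmod (cutoff z) * exp (\<delta> * \<bar>Re z\<bar> + Re z * \<eta>) \<le> B * growth (- \<delta>) z"
    using cutoff_weight[OF \<delta> less_imp_le[OF \<delta>] N] by metis
  have "cmod (exp (- \<i> * w * \<zeta>)) * p i (sc (cutoff w) (F w)) \<le> C * B * exp (\<bar>Im w\<bar> * \<bar>Re \<zeta>\<bar>) * growth (- \<delta>) w"
    if w: "r \<le> \<bar>Im w\<bar>" "\<bar>Im w\<bar> \<le> 1" and z: "- N \<le> Im \<zeta>" "Im \<zeta> \<le> - (2 * \<delta>)" for w \<zeta>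
  proof -
    have "Im w * Re \<zeta> \<le> \<bar>Im w\<bar> * \<bar>Re \<zeta>\<bar>" by (simp add: abs_mult[symmetric])
    hence "cmod (exp (- \<i> * w * \<zeta>)) \<le> exp (\<bar>Im w\<bar> * \<bar>Re \<zeta>\<bar>) * exp (Re w * Im \<zeta>)"
      unfolding cmod_exp_fourier exp_add[symmetric] by simp
    hence "cmod (exp (- \<i> * w * \<zeta>)) * p i (sc (cutoff w) (F w)) \<le>
        (exp (\<bar>Im w\<bar> * \<bar>Re \<zeta>\<bar>) * exp (Re w * Im \<zeta>)) * (cmod (cutoff w) * (C * growth \<delta> w))"
      unfolding seminorm_scale using C(2)[OF w] by (intro mult_mono mult_left_mono) auto
    also have "\<dots> = C * exp (\<bar>Im w\<bar> * \<bar>Re \<zeta>\<bar>) * (cmod (cutoff w) * exp (\<delta> * \<bar>Re w\<bar> + Re w * Im \<zeta>))"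
      unfolding exp_add[of "\<delta> * \<bar>Re w\<bar>"] by simp
    also have "\<dots> \<le> C * exp (\<bar>Im w\<bar> * \<bar>Re \<zeta>\<bar>) * (B * growth (- \<delta>) w)"
      using C(1) B(2)[OF w(2) z(1)] z(2) by (intro mult_left_mono) auto
    finally show ?thesis by (simp add: mult_ac)
  qed
  thus ?thesis using C(1) B(1) by (intro exI[of _ "C * B"]) auto
qed

lemma cut_continuous:
  assumes F: "F \<in> Oexp_R" and c: "c \<noteq> 0"
  shows "continuous_on UNIV (\<lambda>t. sc (cutoff (Complex t c)) (F (Complex t c)))"
proof (rule continuous_on_scale_lcs[OF _ continuous_on_line[OF F c]])
  show "continuous_on UNIV (\<lambda>t. cutoff (Complex t c))"
    by (rule continuous_on_cutoff[where r = "\<bar>c\<bar>"]) (auto intro!: continuous_intros)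
qed

lemma cut_hol:
  assumes F: "F \<in> Oexp_R" and c: "c \<noteq> 0" "\<bar>c\<bar> \<le> 1"
  shows "Im \<zeta> < 0 \<Longrightarrow> decaying (\<lambda>t. sc (exp (- \<i> * Complex t c * \<zeta>)) (sc (cutoff (Complex t c)) (F (Complex t c))))"
    and "restr {z. Im z < 0} (cut_vec F c) \<in> hol_space sc {z. Im z < 0}"
proof -
  have cont: "continuous_on (- {}) (\<lambda>t. sc (cutoff (Complex t c)) (F (Complex t c)))" using cut_continuous[OF F c(1)] by simp
  have kc: "continuous_on (- {}) (\<lambda>t. exp (- \<i> * Complex t c * \<zeta>))" for \<zeta> by (intro continuous_intros)
  have kh: "(\<lambda>\<zeta>. exp (- \<i> * Complex t c * \<zeta>)) holomorphic_on {z. Im z < 0}" for t by (intro holomorphic_intros)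
  have dom: "\<exists>r>0. \<exists>C. \<exists>d>0. \<forall>w\<in>ball z r. \<forall>t. cmod (exp (- \<i> * Complex t c * w)) * p i (sc (cutoff (Complex t c)) (F (Complex t c))) \<le> C * exp (- d * \<bar>t\<bar>)"
    if z: "z \<in> {z. Im z < 0}" for z i
  proof -
    \<comment> \<open>On the ball of this radius \<open>Im w\<close> stays between
      \<open>- 3 * r\<close> and \<open>- r\<close>, which fixes \<open>N = 3 * r\<close> and
      \<open>\<delta> = r / 2\<close> in the estimate.\<close>
    define r where "r = - Im z / 2"
    have r: "r > 0" using z by (simp add: r_def)
    have "\<bar>c\<bar> > 0" "r / 2 > 0" "3 * r \<ge> 0" using c r by auto
    from cut_estimate[OF F this, of i] obtain C where C: "C \<ge> 0"
      "\<And>w \<zeta>. \<bar>c\<bar> \<le> \<bar>Im w\<bar> \<Longrightarrow> \<bar>Im w\<bar> \<le> 1 \<Longrightarrow> - (3 * r) \<le> Im \<zeta> \<Longrightarrow> Im \<zeta> \<le> - (2 * (r / 2)) \<Longrightarrow>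
        cmod (exp (- \<i> * w * \<zeta>)) * p i (sc (cutoff w) (F w)) \<le> C * exp (\<bar>Im w\<bar> * \<bar>Re \<zeta>\<bar>) * growth (- (r / 2)) w" by metis
    have "cmod (exp (- \<i> * Complex t c * w)) * p i (sc (cutoff (Complex t c)) (F (Complex t c))) \<le> C * exp (\<bar>Re z\<bar> + r) * exp (- (r / 2) * \<bar>t\<bar>)"
      if w: "w \<in> ball z r" for w t
    proof -
      have "\<bar>Im w - Im z\<bar> < r" and re: "\<bar>Re w - Re z\<bar> < r"
        using w abs_Im_le_cmod[of "w - z"] abs_Re_le_cmod[of "w - z"] by (auto simp: dist_norm norm_minus_commute)
      hence "- (3 * r) \<le> Im w" "Im w \<le> - (2 * (r / 2))" by (auto simp: r_def)
      hence "cmod (exp (- \<i> * Complex t c * w)) * p i (sc (cutoff (Complex t c)) (F (Complex t c))) \<le> C * exp (\<bar>c\<bar> * \<bar>Re w\<bar>) * exp (- (r / 2) * \<bar>t\<bar>)"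
        using C(2)[of "Complex t c" w] c by simp
      also have "\<dots> \<le> C * exp (\<bar>Re z\<bar> + r) * exp (- (r / 2) * \<bar>t\<bar>)"
      proof (intro mult_right_mono mult_left_mono)
        have "\<bar>c\<bar> * \<bar>Re w\<bar> \<le> 1 * \<bar>Re w\<bar>" using c(2) by (intro mult_right_mono) auto
        thus "exp (\<bar>c\<bar> * \<bar>Re w\<bar>) \<le> exp (\<bar>Re z\<bar> + r)" using re by simp
      qed (use C in auto)
      finally show ?thesis .
    qed
    thus ?thesis using r by (intro exI[of _ r] conjI exI[of _ "C * exp (\<bar>Re z\<bar> + r)"] exI[of _ "r / 2"]) auto
  qed
  show "decaying (\<lambda>t. sc (exp (- \<i> * Complex t c * \<zeta>)) (sc (cutoff (Complex t c)) (F (Complex t c))))" if "Im \<zeta> < 0"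
    using hol_space_kernel_integral(1)[OF open_Im(2) _ cont kc kh dom, of \<zeta>] that by simp
  show "restr {z. Im z < 0} (cut_vec F c) \<in> hol_space sc {z. Im z < 0}"
    using hol_space_kernel_integral(2)[OF open_Im(2) _ cont kc kh dom] by (simp add: cut_vec_def[abs_def])
qed

lemma cut_vec_bound:
  assumes F: "F \<in> Oexp_R" and c: "c \<noteq> 0" "\<bar>c\<bar> \<le> 1" and \<delta>: "0 < \<delta>" and N: "0 \<le> N"
  shows "\<exists>C\<ge>0. \<forall>\<zeta>. - N \<le> Im \<zeta> \<longrightarrow> Im \<zeta> \<le> - (2 * \<delta>) \<longrightarrow> p i (cut_vec F c \<zeta>) \<le> C * exp (\<bar>c\<bar> * \<bar>Re \<zeta>\<bar>)"
proof -
  have "\<bar>c\<bar> > 0" using c by simp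
  from cut_estimate[OF F this \<delta> N, of i] obtain C where C: "C \<ge> 0"
    "\<And>w \<zeta>. \<bar>c\<bar> \<le> \<bar>Im w\<bar> \<Longrightarrow> \<bar>Im w\<bar> \<le> 1 \<Longrightarrow> - N \<le> Im \<zeta> \<Longrightarrow> Im \<zeta> \<le> - (2 * \<delta>) \<Longrightarrow>
      cmod (exp (- \<i> * w * \<zeta>)) * p i (sc (cutoff w) (F w)) \<le> C * exp (\<bar>Im w\<bar> * \<bar>Re \<zeta>\<bar>) * growth (- \<delta>) w" by metis
  have "p i (cut_vec F c \<zeta>) \<le> C * (2 / \<delta>) * exp (\<bar>c\<bar> * \<bar>Re \<zeta>\<bar>)" if z: "- N \<le> Im \<zeta>" "Im \<zeta> \<le> - (2 * \<delta>)" for \<zeta>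
  proof -
    have "p i (cut_vec F c \<zeta>) \<le> C * exp (\<bar>c\<bar> * \<bar>Re \<zeta>\<bar>) * (2 / \<delta>)" unfolding cut_vec_def
    proof (rule pint_bound_exp[OF cut_hol(1)[OF F c] \<delta>, where x = 0])
      show "p i (sc (exp (- \<i> * Complex t c * \<zeta>)) (sc (cutoff (Complex t c)) (F (Complex t c)))) \<le> C * exp (\<bar>c\<bar> * \<bar>Re \<zeta>\<bar>) * exp (- \<delta> * \<bar>t - 0\<bar>)" for t
        unfolding seminorm_scale[of i "exp _"] using C(2)[of "Complex t c" \<zeta>] c z by simp
    qed (use \<delta> z in simp)
    thus ?thesis by (simp add: mult_ac)
  qed
  thus ?thesis using C(1) \<delta> by (intro exI[of _ "C * (2 / \<delta>)"]) auto
qed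

lemma dual_cut_vec:
  assumes F: "F \<in> Oexp_R" and c: "c \<noteq> 0" "\<bar>c\<bar> \<le> 1" and z: "Im \<zeta> < 0" and y: "y \<in> lcs_dual sc"
  shows "y (cut_vec F c \<zeta>) = line_int c (\<lambda>w. exp (- \<i> * w * \<zeta>) * (cutoff w * y (F w)))"
  using dual_pint(1)[OF cut_hol(1)[OF F c z] y] by (simp add: cut_vec_def line_int_def dual_scale[OF y] mult.assoc)

text \<open>This is where the cut-off has to be holomorphic: within one half-plane nothing obstructs
  Cauchy's theorem, so the lines may be lowered towards the axis.\<close>

lemma cut_vec_shift:
  assumes F: "F \<in> Oexp_R" and c: "\<bar>c\<bar> \<le> 1" "\<bar>c'\<bar> \<le> 1" "c * c' > 0" and z: "Im \<zeta> < 0"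
  shows "cut_vec F c \<zeta> = cut_vec F c' \<zeta>"
proof (rule dual_separates)
  fix y assume y: "y \<in> lcs_dual sc"
  have c0: "c \<noteq> 0" "c' \<noteq> 0" using c by auto
  obtain i B where B: "B \<ge> 0" "\<And>x. cmod (y x) \<le> B * p i x" using dual_bounded[OF y] by blast
  define r where "r = min \<bar>c\<bar> \<bar>c'\<bar>"
  define \<delta> where "\<delta> = - Im \<zeta> / 2"
  have rd: "0 < r" "0 < \<delta>" "0 \<le> - Im \<zeta>" using c0 z by (auto simp: r_def \<delta>_def)
  from cut_estimate[OF F rd, of i] obtain C where C: "C \<ge> 0"
    "\<And>w \<zeta>'. r \<le> \<bar>Im w\<bar> \<Longrightarrow> \<bar>Im w\<bar> \<le> 1 \<Longrightarrow> - (- Im \<zeta>) \<le> Im \<zeta>' \<Longrightarrow> Im \<zeta>' \<le> - (2 * \<delta>) \<Longrightarrow>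
      cmod (exp (- \<i> * w * \<zeta>')) * p i (sc (cutoff w) (F w)) \<le> C * exp (\<bar>Im w\<bar> * \<bar>Re \<zeta>'\<bar>) * growth (- \<delta>) w" by metis
  define u where "u w = exp (- \<i> * w * \<zeta>) * (cutoff w * y (F w))" for w
  have dec: "cmod (u w) \<le> B * C * exp \<bar>Re \<zeta>\<bar> * growth (- \<delta>) w" if w: "r \<le> \<bar>Im w\<bar>" "\<bar>Im w\<bar> \<le> 1" for w
  proof -
    have "u w = exp (- \<i> * w * \<zeta>) * y (sc (cutoff w) (F w))" by (simp add: u_def dual_scale[OF y])
    hence "cmod (u w) \<le> cmod (exp (- \<i> * w * \<zeta>)) * (B * p i (sc (cutoff w) (F w)))"
      unfolding norm_mult using B(2) by (metis norm_ge_zero norm_mult mult_left_mono)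
    also have "\<dots> = B * (cmod (exp (- \<i> * w * \<zeta>)) * p i (sc (cutoff w) (F w)))" by simp
    also have "\<dots> \<le> B * (C * exp (\<bar>Im w\<bar> * \<bar>Re \<zeta>\<bar>) * growth (- \<delta>) w)"
      using C(2)[OF w, of \<zeta>] B(1) by (intro mult_left_mono) (auto simp: \<delta>_def)
    also have "\<dots> \<le> B * (C * exp \<bar>Re \<zeta>\<bar> * growth (- \<delta>) w)"
    proof (intro mult_left_mono mult_right_mono)
      have "\<bar>Im w\<bar> * \<bar>Re \<zeta>\<bar> \<le> 1 * \<bar>Re \<zeta>\<bar>" using w by (intro mult_right_mono) auto
      thus "exp (\<bar>Im w\<bar> * \<bar>Re \<zeta>\<bar>) \<le> exp \<bar>Re \<zeta>\<bar>" by simp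
    qed (use B C in auto)
    finally show ?thesis by (simp add: mult.assoc)
  qed
  have hol: "u holomorphic_on {z. Im z \<noteq> 0 \<and> \<bar>Im z\<bar> < 2}" unfolding u_def[abs_def]
    by (intro holomorphic_intros cutoff_holomorphic holomorphic_on_subset[OF dual_Oexp_holomorphic[OF F y]]) auto
  have "line_int c u = line_int c' u"
  proof (cases "c > 0")
    case True
    hence "c' > 0" using c by (simp add: zero_less_mult_iff)
    show ?thesis by (rule line_int_shift[OF convex_open_halfplanes(5,6)[of 0 2] holomorphic_on_subset[OF hol] _ rd(2) dec])
        (use True \<open>c' > 0\<close> c in \<open>auto simp: r_def\<close>)
  next
    case False
    hence "c < 0" "c' < 0" using c by (auto simp: zero_less_mult_iff)
    show ?thesis by (rule line_int_shift[OF convex_open_halfplanes(5,6)[of "- 2" 0] holomorphic_on_subset[OF hol] _ rd(2) dec])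
        (use \<open>c < 0\<close> \<open>c' < 0\<close> c in \<open>auto simp: r_def\<close>)
  qed
  thus "y (cut_vec F c \<zeta>) = y (cut_vec F c' \<zeta>)"
    using dual_cut_vec[OF F c0(1) c(1) z y] dual_cut_vec[OF F c0(2) c(2) z y] by (simp add: u_def[abs_def])
qed

text \<open>The boundary lines at height one stand for any lower ones, by
  \<open>cut_vec_shift\<close>.\<close>

definition lower_transform :: "(complex \<Rightarrow> 'e) \<Rightarrow> complex \<Rightarrow> 'e" where
  "lower_transform F = restr {z. Im z < 0} (\<lambda>\<zeta>. cut_vec F 1 \<zeta> - cut_vec F (- 1) \<zeta>)"

lemma lower_transform_eq:
  assumes "F \<in> Oexp_R" "0 < c" "c \<le> 1" "Im \<zeta> < 0"
  shows "lower_transform F \<zeta> = cut_vec F c \<zeta> - cut_vec F (- c) \<zeta>"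
  using assms cut_vec_shift[of F 1 c \<zeta>] cut_vec_shift[of F "- 1" "- c" \<zeta>] by (simp add: lower_transform_def restr_def)

text \<open>Integration at the heights \<open>\<plusminus> c\<close> gives growth at most
  \<open>exp (c * \<bar>Re \<zeta>\<bar>)\<close>, and \<open>c\<close> may be chosen below any
  given \<open>\<epsilon>\<close>.\<close>

lemma lower_transform_slow:
  assumes F: "F \<in> Oexp_R"
  shows "lower_slow (lower_transform F)" unfolding lower_slow_def
proof (intro conjI allI impI)
  have "restr {z. Im z < 0} (cut_vec F 1) - restr {z. Im z < 0} (cut_vec F (- 1)) \<in> hol_space sc {z. Im z < 0}"
    using F by (intro fun_subspace_diff[OF fun_subspace_hol_space] cut_hol(2)) auto
  moreover have "restr {z. Im z < 0} (cut_vec F 1) - restr {z. Im z < 0} (cut_vec F (- 1)) = lower_transform F"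
    by (simp add: lower_transform_def restr_def fun_eq_iff)
  ultimately show "lower_transform F \<in> hol_space sc {z. Im z < 0}" by simp
next
  fix i and r R \<epsilon> :: real assume re: "0 < r" "0 < \<epsilon>"
  define c where "c = min 1 \<epsilon>"
  have c: "0 < c" "c \<le> 1" "c \<le> \<epsilon>" using re by (auto simp: c_def)
  have c': "c \<noteq> 0" "\<bar>c\<bar> \<le> 1" "- c \<noteq> 0" "\<bar>- c\<bar> \<le> 1" "0 < r / 2" "0 \<le> max R 0" using c re by auto
  from cut_vec_bound[OF F c'(1,2,5,6), of i] obtain C1 where C1: "C1 \<ge> 0"
    "\<And>\<zeta>. - max R 0 \<le> Im \<zeta> \<Longrightarrow> Im \<zeta> \<le> - (2 * (r / 2)) \<Longrightarrow> p i (cut_vec F c \<zeta>) \<le> C1 * exp (\<bar>c\<bar> * \<bar>Re \<zeta>\<bar>)" by metis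
  from cut_vec_bound[OF F c'(3,4,5,6), of i] obtain C2 where C2: "C2 \<ge> 0"
    "\<And>\<zeta>. - max R 0 \<le> Im \<zeta> \<Longrightarrow> Im \<zeta> \<le> - (2 * (r / 2)) \<Longrightarrow> p i (cut_vec F (- c) \<zeta>) \<le> C2 * exp (\<bar>- c\<bar> * \<bar>Re \<zeta>\<bar>)" by metis
  have "p i (lower_transform F \<zeta>) \<le> (C1 + C2) * growth \<epsilon> \<zeta>" if z: "- R \<le> Im \<zeta>" "Im \<zeta> \<le> - r" for \<zeta>
  proof -
    have "p i (lower_transform F \<zeta>) \<le> C1 * exp (\<bar>c\<bar> * \<bar>Re \<zeta>\<bar>) + C2 * exp (\<bar>- c\<bar> * \<bar>Re \<zeta>\<bar>)"
      using lower_transform_eq[OF F c(1,2), of \<zeta>] C1(2)[of \<zeta>] C2(2)[of \<zeta>] z re(1)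
        seminorm_diff[of i "cut_vec F c \<zeta>" "cut_vec F (- c) \<zeta>"] by auto
    also have "\<dots> = (C1 + C2) * growth c \<zeta>" using c by (simp add: distrib_right)
    also have "\<dots> \<le> (C1 + C2) * growth \<epsilon> \<zeta>"
    proof (rule mult_left_mono)
      have "c * \<bar>Re \<zeta>\<bar> \<le> \<epsilon> * \<bar>Re \<zeta>\<bar>" using c by (intro mult_right_mono) auto
      thus "growth c \<zeta> \<le> growth \<epsilon> \<zeta>" by simp
    qed (use C1 C2 in simp)
    finally show ?thesis .
  qed
  thus "\<exists>C\<ge>0. \<forall>z. - R \<le> Im z \<and> Im z \<le> - r \<longrightarrow> p i (lower_transform F z) \<le> C * growth \<epsilon> z"
    using C1(1) C2(1) by (intro exI[of _ "C1 + C2"]) auto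
qed

text \<open>\<open>fourier_fubini\<close> on each boundary line, tested on \<open>Im = - b\<close>
  in the half-plane where the transform is defined. The estimate at the single point
  \<open>- \<i> * b\<close> supplies the required decay.\<close>

lemma lower_transform_fubini:
  assumes F: "F \<in> Oexp_R" and y: "y \<in> lcs_dual sc" and \<phi>: "\<phi> \<in> P_step n" "n \<ge> 1"
    and b: "0 < b" "b < 1 / real n" and c: "0 < c" "c < 1 / real n"
  shows "line_int (- b) (\<lambda>w. \<phi> w * y (lower_transform F w)) = gamma_int (\<lambda>z. cutoff z * y (F z)) (fourier \<phi>) c"
proof -
  have n1: "1 / real n \<le> 1" using \<phi>(2) by simp
  define a where "a e t = cutoff (Complex t e) * y (F (Complex t e))" for e t
  have fub: "line_int (- b) (\<lambda>w. \<phi> w * (LINT t|lborel. a e t * exp (- \<i> * Complex t e * w))) = (LINT t|lborel. a e t * fourier \<phi> (Complex t e))"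
    and int: "integrable lborel (\<lambda>s. \<phi> (Complex s (- b)) * (LINT t|lborel. a e t * exp (- \<i> * Complex t e * Complex s (- b))))"
    if e: "\<bar>e\<bar> = c" for e
  proof -
    have e': "e \<noteq> 0" "\<bar>e\<bar> \<le> 1" "0 < \<bar>e\<bar>" using e c n1 by auto
    obtain i B where B: "B \<ge> 0" "\<And>x. cmod (y x) \<le> B * p i x" using dual_bounded[OF y] by blast
    have "0 < b / 2" "0 \<le> b" using b by auto
    from cut_estimate[OF F e'(3) this, of i] obtain C where C: "C \<ge> 0"
      "\<And>w \<zeta>. \<bar>e\<bar> \<le> \<bar>Im w\<bar> \<Longrightarrow> \<bar>Im w\<bar> \<le> 1 \<Longrightarrow> - b \<le> Im \<zeta> \<Longrightarrow> Im \<zeta> \<le> - (2 * (b / 2)) \<Longrightarrow>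
        cmod (exp (- \<i> * w * \<zeta>)) * p i (sc (cutoff w) (F w)) \<le> C * exp (\<bar>Im w\<bar> * \<bar>Re \<zeta>\<bar>) * growth (- (b / 2)) w" by metis
    have dec: "cmod (a e t) * exp (- b * Re (Complex t e)) \<le> B * C * exp (- (b / 2) * \<bar>t\<bar>)" for t
    proof -
      have "cmod (a e t) \<le> B * p i (sc (cutoff (Complex t e)) (F (Complex t e)))"
        using B(2)[of "sc (cutoff (Complex t e)) (F (Complex t e))"] by (simp add: a_def dual_scale[OF y])
      hence "cmod (a e t) * exp (- b * Re (Complex t e)) \<le> B * p i (sc (cutoff (Complex t e)) (F (Complex t e))) * exp (- b * Re (Complex t e))"
        by (intro mult_right_mono) auto
      also have "\<dots> = B * (cmod (exp (- \<i> * Complex t e * Complex 0 (- b))) * p i (sc (cutoff (Complex t e)) (F (Complex t e))))"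
        unfolding cmod_exp_fourier by (simp add: mult_ac)
      also have "\<dots> \<le> B * (C * exp (\<bar>Im (Complex t e)\<bar> * \<bar>Re (Complex 0 (- b))\<bar>) * exp (- (b / 2) * \<bar>Re (Complex t e)\<bar>))"
        using e' B(1) by (intro mult_left_mono C(2)) auto
      finally show ?thesis by (simp add: mult.assoc)
    qed
    have "continuous_on UNIV (a e)" using dual_continuous_on[OF y cut_continuous[OF F e'(1)]] by (simp add: a_def[abs_def] dual_scale[OF y])
    hence meas: "a e \<in> borel_measurable lborel" "(\<lambda>t. Complex t e) \<in> borel_measurable lborel"
      by (auto intro!: borel_measurable_continuous_onI continuous_intros)
    show "line_int (- b) (\<lambda>w. \<phi> w * (LINT t|lborel. a e t * exp (- \<i> * Complex t e * w))) = (LINT t|lborel. a e t * fourier \<phi> (Complex t e))"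
      "integrable lborel (\<lambda>s. \<phi> (Complex s (- b)) * (LINT t|lborel. a e t * exp (- \<i> * Complex t e * Complex s (- b))))"
      using fourier_fubini[OF \<phi> _ c(2) _ meas _ dec] b e by auto
  qed
  have "y (lower_transform F w) = (LINT t|lborel. a c t * exp (- \<i> * Complex t c * w)) - (LINT t|lborel. a (- c) t * exp (- \<i> * Complex t (- c) * w))"
    if "Im w = - b" for w
  proof -
    have w: "Im w < 0" using that b by simp
    have "\<bar>c\<bar> \<le> 1" "\<bar>- c\<bar> \<le> 1" "c \<noteq> 0" "- c \<noteq> 0" "c \<le> 1" using c n1 by auto
    thus ?thesis using lower_transform_eq[OF F c(1) _ w] dual_cut_vec[OF F _ _ w y, of c] dual_cut_vec[OF F _ _ w y, of "- c"]
      by (simp add: dual_diff[OF y] line_int_def a_def mult.commute)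
  qed
  hence "line_int (- b) (\<lambda>w. \<phi> w * y (lower_transform F w)) =
      line_int (- b) (\<lambda>w. \<phi> w * (LINT t|lborel. a c t * exp (- \<i> * Complex t c * w)) - \<phi> w * (LINT t|lborel. a (- c) t * exp (- \<i> * Complex t (- c) * w)))"
    unfolding line_int_def by (simp add: right_diff_distrib)
  also have "\<dots> = line_int (- b) (\<lambda>w. \<phi> w * (LINT t|lborel. a c t * exp (- \<i> * Complex t c * w))) - line_int (- b) (\<lambda>w. \<phi> w * (LINT t|lborel. a (- c) t * exp (- \<i> * Complex t (- c) * w)))"
    unfolding line_int_def using c by (intro Bochner_Integration.integral_diff int) auto
  also have "\<dots> = (LINT t|lborel. a c t * fourier \<phi> (Complex t c)) - (LINT t|lborel. a (- c) t * fourier \<phi> (Complex t (- c)))"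
    using fub[of c] fub[of "- c"] c by simp
  also have "\<dots> = gamma_int (\<lambda>z. cutoff z * y (F z)) (fourier \<phi>) c" by (simp add: gamma_int_def line_int_def a_def mult_ac)
  finally show ?thesis .
qed

section \<open>The transform of representatives and its inversion\<close>

definition Phi :: "(complex \<Rightarrow> 'e) \<Rightarrow> complex \<Rightarrow> 'e" where
  "Phi F = glue (lower_transform F) (lower_transform (reflect F))"

lemma Phi_Oexp: "F \<in> Oexp_R \<Longrightarrow> Phi F \<in> Oexp_R"
  unfolding Phi_def by (intro glue_Oexp lower_transform_slow reflect_Oexp)

lemma cutoff_gamma_integrable:
  assumes f: "slow_holomorphic f" and \<psi>: "\<psi> \<in> P_step n" "n \<ge> 1" and c: "0 < \<bar>c\<bar>" "\<bar>c\<bar> < 1 / real n"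
  shows "integrable lborel (\<lambda>t. \<psi> (Complex t c) * (cutoff (Complex t c) * f (Complex t c)))"
    "integrable lborel (\<lambda>t. \<psi> (Complex t c) * (cutoff (- Complex t c) * f (Complex t c)))"
proof -
  obtain B where B: "B \<ge> 0" "\<And>z. \<bar>Im z\<bar> \<le> 1 \<Longrightarrow> cmod (cutoff z) \<le> B"
    using cutoff_bound[OF zero_less_one] by metis
  have n1: "1 / real n \<le> 1" using \<psi>(2) by simp
  have int: "integrable lborel (\<lambda>t. \<psi> (Complex t c) * f (Complex t c))" by (rule gamma_int_integrable[OF f \<psi> c])
  have "integrable lborel (\<lambda>t. cutoff (\<sigma> (Complex t c)) * (\<psi> (Complex t c) * f (Complex t c)))"
    if \<sigma>: "continuous_on UNIV \<sigma>" "\<And>z. \<bar>Im (\<sigma> z)\<bar> = \<bar>Im z\<bar>" for \<sigma> :: "complex \<Rightarrow> complex"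
  proof (rule Bochner_Integration.integrable_bound)
    show "integrable lborel (\<lambda>t. B * cmod (\<psi> (Complex t c) * f (Complex t c)))" using int by (intro integrable_mult_right integrable_norm)
    have "continuous_on UNIV (\<lambda>t. cutoff (\<sigma> (Complex t c)))" by (rule continuous_on_cutoff[where r = "\<bar>c\<bar>"])
        (auto simp: \<sigma>(2) intro!: continuous_on_compose2[OF \<sigma>(1)] continuous_intros)
    hence "(\<lambda>t. cutoff (\<sigma> (Complex t c))) \<in> borel_measurable lborel" by (simp add: borel_measurable_continuous_onI)
    thus "(\<lambda>t. cutoff (\<sigma> (Complex t c)) * (\<psi> (Complex t c) * f (Complex t c))) \<in> borel_measurable lborel"
      by (rule borel_measurable_times[OF _ borel_measurable_integrable[OF int]])
    have "cmod (cutoff (\<sigma> (Complex t c)) * (\<psi> (Complex t c) * f (Complex t c))) \<le> norm (B * cmod (\<psi> (Complex t c) * f (Complex t c)))" for t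
    proof -
      have "cmod (cutoff (\<sigma> (Complex t c))) \<le> B" using \<sigma>(2) c n1 by (intro B(2)) auto
      thus ?thesis using B(1) unfolding norm_mult[of "cutoff _"] by (simp add: mult_right_mono)
    qed
    thus "AE t in lborel. norm (cutoff (\<sigma> (Complex t c)) * (\<psi> (Complex t c) * f (Complex t c))) \<le> norm (B * cmod (\<psi> (Complex t c) * f (Complex t c)))"
      by (intro AE_I2)
  qed
  from this[of "\<lambda>z. z"] this[of uminus]
  show "integrable lborel (\<lambda>t. \<psi> (Complex t c) * (cutoff (Complex t c) * f (Complex t c)))"
    "integrable lborel (\<lambda>t. \<psi> (Complex t c) * (cutoff (- Complex t c) * f (Complex t c)))" by (simp_all add: mult_ac continuous_on_minus)
qed

text \<open>The two lower transforms contribute \<open>F\<close> weighted by \<open>cutoff w\<close>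
  and by \<open>cutoff (- w)\<close>, the latter through the reflected function, and the weights add
  up to one. So \<open>Phi F\<close> represents the functional of \<open>F\<close> composed with the
  transform of test functions.\<close>

lemma Phi_gamma_int:
  assumes F: "F \<in> Oexp_R" and y: "y \<in> lcs_dual sc" and \<phi>: "\<phi> \<in> P_step n" "n \<ge> 1"
    and b: "0 < b" "b < 1 / real n" and c: "0 < c" "c < 1 / real (Suc n)"
  shows "gamma_int (\<lambda>z. y (Phi F z)) \<phi> b = gamma_int (\<lambda>z. y (F z)) (fourier \<phi>) c"
proof -
  have cn: "c < 1 / real n" using c(2) \<phi>(2) by (simp add: less_divide_eq) (smt (verit, best) c(1) mult_strict_left_mono)
  note \<psi> = fourier_P_step[OF \<phi> lessI]
  have f: "slow_holomorphic (\<lambda>z. y (F z))" by (rule dual_slow_holomorphic[OF F y])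
  have "gamma_int (\<lambda>z. y (Phi F z)) \<phi> b = line_int (- b) (\<lambda>w. \<phi> w * y (lower_transform F w))
      + line_int (- b) (\<lambda>w. \<phi> (- w) * y (lower_transform (reflect F) w))"
    unfolding Phi_def by (intro glue_gamma_int lower_transform_slow reflect_Oexp F y b)
  also have "line_int (- b) (\<lambda>w. \<phi> w * y (lower_transform F w)) = gamma_int (\<lambda>z. cutoff z * y (F z)) (fourier \<phi>) c"
    by (rule lower_transform_fubini[OF F y \<phi> b c(1) cn])
  also have "line_int (- b) (\<lambda>w. \<phi> (- w) * y (lower_transform (reflect F) w)) =
      gamma_int (\<lambda>z. cutoff z * y (reflect F z)) (fourier (\<lambda>w. \<phi> (- w))) c"
    by (rule lower_transform_fubini[OF reflect_Oexp[OF F] y P_step_reflect[OF \<phi>] \<phi>(2) b c(1) cn])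
  also have "\<dots> = gamma_int (\<lambda>z. - (cutoff (- (- z)) * y (F (- z)))) (\<lambda>w. fourier \<phi> (- w)) c"
    by (simp add: fourier_reflect[abs_def] reflect_def dual_minus[OF y])
  also have "\<dots> = gamma_int (\<lambda>z. cutoff (- z) * y (F z)) (\<lambda>w. fourier \<phi> (- (- w))) c" by (rule reflect_gamma_int)
  also have "gamma_int (\<lambda>z. cutoff z * y (F z)) (fourier \<phi>) c + gamma_int (\<lambda>z. cutoff (- z) * y (F z)) (\<lambda>w. fourier \<phi> (- (- w))) c
      = gamma_int (\<lambda>z. y (F z)) (fourier \<phi>) c"
  proof -
    have "line_int e (\<lambda>w. fourier \<phi> w * (cutoff w * y (F w))) + line_int e (\<lambda>w. fourier \<phi> w * (cutoff (- w) * y (F w)))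
        = line_int e (\<lambda>w. fourier \<phi> w * y (F w))" if "\<bar>e\<bar> = c" for e
    proof -
      have e: "0 < \<bar>e\<bar>" "\<bar>e\<bar> < 1 / real (Suc n)" using that c by auto
      have "line_int e (\<lambda>w. fourier \<phi> w * (cutoff w * y (F w))) + line_int e (\<lambda>w. fourier \<phi> w * (cutoff (- w) * y (F w)))
          = (LINT t|lborel. fourier \<phi> (Complex t e) * (cutoff (Complex t e) * y (F (Complex t e))) + fourier \<phi> (Complex t e) * (cutoff (- Complex t e) * y (F (Complex t e))))"
        unfolding line_int_def using cutoff_gamma_integrable[OF f \<psi> _ e] by (intro Bochner_Integration.integral_add[symmetric]) auto
      also have "\<dots> = (LINT t|lborel. fourier \<phi> (Complex t e) * ((cutoff (Complex t e) + cutoff (- Complex t e)) * y (F (Complex t e))))"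
        by (simp add: algebra_simps)
      finally show ?thesis unfolding cutoff_reflect by (simp add: line_int_def)
    qed
    from this[of c] this[of "- c"] show ?thesis using c by (simp add: gamma_int_def add_diff_add[symmetric])
  qed
  finally show ?thesis .
qed

lemma P_step_Suc_half: "n \<ge> 1 \<Longrightarrow> 0 < 1 / (2 * real (Suc n)) \<and> 1 / (2 * real (Suc n)) < 1 / real (Suc n) \<and> 1 / (2 * real (Suc n)) < 1 / real n"
  by (auto simp: field_simps)

text \<open>The device for all rules on \<open>Phi\<close>: a candidate is compared with
  \<open>Phi F\<close> through its pairings, and the result holds modulo
  \<open>Oexp_0\<close>.\<close>

lemma Phi_unique:
  assumes F: "F \<in> Oexp_R" and G: "G \<in> Oexp_R"
    and eq: "\<And>n \<phi> y. n \<ge> 1 \<Longrightarrow> \<phi> \<in> P_step n \<Longrightarrow> y \<in> lcs_dual sc \<Longrightarrow>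
      \<exists>b c. 0 < b \<and> b < 1 / real n \<and> 0 < c \<and> c < 1 / real (Suc n) \<and>
        gamma_int (\<lambda>z. y (G z)) \<phi> b = gamma_int (\<lambda>z. y (F z)) (fourier \<phi>) c"
  shows "G - Phi F \<in> Oexp_0"
proof (rule Oexp_entire_if_same_functional[OF G Phi_Oexp[OF F]])
  fix n \<phi> y assume a: "1 \<le> n" "\<phi> \<in> P_step n" "y \<in> lcs_dual sc"
  obtain b c where bc: "0 < b" "b < 1 / real n" "0 < c" "c < 1 / real (Suc n)"
      "gamma_int (\<lambda>z. y (G z)) \<phi> b = gamma_int (\<lambda>z. y (F z)) (fourier \<phi>) c" using eq[OF a] by blast
  thus "\<exists>c>0. c < 1 / real n \<and> gamma_int (\<lambda>z. y (G z)) \<phi> c = gamma_int (\<lambda>z. y (Phi F z)) \<phi> c"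
    using Phi_gamma_int[OF F a(3,2,1) bc(1-4)] by auto
qed

lemma fourier_star_H_map:
  assumes F: "F \<in> Oexp_R"
  shows "fourier_star (H_map sc (F +o Oexp_0)) = H_map sc (Phi F +o Oexp_0)"
proof
  fix g
  show "fourier_star (H_map sc (F +o Oexp_0)) g = H_map sc (Phi F +o Oexp_0) g"
  proof (cases "g \<in> P_star")
    case False
    thus ?thesis by (simp add: fourier_star_def H_map_def)
  next
    case True
    then obtain \<phi> where "\<phi> \<in> P_funs" and g: "g = germ \<phi>" by (auto simp: P_star_def)
    then obtain n where n: "n \<ge> 1" "\<phi> \<in> P_step n" by (auto simp: P_funs_iff)
    define c where "c = 1 / (2 * real (Suc n))"
    have c: "0 < c" "c < 1 / real (Suc n)" "c < 1 / real n" using P_step_Suc_half[OF n(1)] by (auto simp: c_def)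
    have "H_map sc (F +o Oexp_0) (germ (fourier \<phi>)) = H_map sc (Phi F +o Oexp_0) (germ \<phi>)"
    proof (rule dual_separates)
      fix y assume y: "y \<in> lcs_dual sc"
      show "y (H_map sc (F +o Oexp_0) (germ (fourier \<phi>))) = y (H_map sc (Phi F +o Oexp_0) (germ \<phi>))"
        using H_map_eq_dual[OF F fourier_P_step[OF n(2,1) lessI] _ c(1,2) y] H_map_eq_dual[OF Phi_Oexp[OF F] n(2,1) c(1,3) y]
          Phi_gamma_int[OF F y n(2,1) c(1,3,1,2)] by simp
    qed
    thus ?thesis using True by (simp add: fourier_star_def g fourier_P_germ[OF \<open>\<phi> \<in> P_funs\<close>])
  qed
qed

text \<open>\<open>fourier_star_H_map\<close> exhibits the transformed functional as a value of
  \<open>H_map\<close>; injectivity then identifies the class.\<close>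

lemma fourier_bv_eq:
  assumes F: "F \<in> Oexp_R"
  shows "fourier_bv sc p (F +o Oexp_0) = Phi F +o Oexp_0"
proof -
  have "Phi F +o Oexp_0 \<in> bv sc p UNIV" using Phi_Oexp[OF F] by (auto simp: bv_def quot_space_def)
  hence "the_inv_into (bv sc p UNIV) (H_map sc) (H_map sc (Phi F +o Oexp_0)) = Phi F +o Oexp_0"
    by (rule the_inv_into_f_f[OF H_map_inj])
  thus ?thesis by (simp add: fourier_bv_def H_inv_def fourier_star_H_map[OF F] H_map_in_L_space[OF Phi_Oexp[OF F]])
qed

lemma Phi_add:
  assumes F: "F \<in> Oexp_R" and G: "G \<in> Oexp_R"
  shows "(Phi F + Phi G) - Phi (F + G) \<in> Oexp_0"
proof (rule Phi_unique[OF fun_subspace_add[OF fun_subspace_Oexp F G] fun_subspace_add[OF fun_subspace_Oexp Phi_Oexp[OF F] Phi_Oexp[OF G]]])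
  fix n \<phi> y assume a: "1 \<le> n" "\<phi> \<in> P_step n" "y \<in> lcs_dual sc"
  define c where "c = 1 / (2 * real (Suc n))"
  have c: "0 < c" "c < 1 / real (Suc n)" "c < 1 / real n" using P_step_Suc_half[OF a(1)] by (auto simp: c_def)
  have add: "gamma_int (\<lambda>z. y ((F' + G') z)) \<psi> c = gamma_int (\<lambda>z. y (F' z)) \<psi> c + gamma_int (\<lambda>z. y (G' z)) \<psi> c"
    if "F' \<in> Oexp_R" "G' \<in> Oexp_R" "\<psi> \<in> P_step m" "m \<ge> 1" "c < 1 / real m" for F' G' \<psi> m
    using that c(1) dual_gamma_vec[OF fun_subspace_add[OF fun_subspace_Oexp that(1,2)] that(3,4) c(1) that(5) a(3)]
      dual_gamma_vec[OF that(1,3,4) c(1) that(5) a(3)] dual_gamma_vec[OF that(2,3,4) c(1) that(5) a(3)]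
      gamma_vec_add[OF that(1-4) c(1) that(5)] by (simp add: dual_add[OF a(3)])
  have "Suc n \<ge> 1" by simp
  have "gamma_int (\<lambda>z. y ((Phi F + Phi G) z)) \<phi> c = gamma_int (\<lambda>z. y ((F + G) z)) (fourier \<phi>) c"
    unfolding add[OF Phi_Oexp[OF F] Phi_Oexp[OF G] a(2,1) c(3)]
      add[OF F G fourier_P_step[OF a(2,1) lessI] \<open>Suc n \<ge> 1\<close> c(2)]
    using Phi_gamma_int[OF F a(3,2,1) c(1,3,1,2)] Phi_gamma_int[OF G a(3,2,1) c(1,3,1,2)] by simp
  thus "\<exists>b c. 0 < b \<and> b < 1 / real n \<and> 0 < c \<and> c < 1 / real (Suc n) \<and>
      gamma_int (\<lambda>z. y ((Phi F + Phi G) z)) \<phi> b = gamma_int (\<lambda>z. y ((F + G) z)) (fourier \<phi>) c" using c by blast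
qed

lemma Phi_scale:
  assumes F: "F \<in> Oexp_R"
  shows "(\<lambda>z. sc a (Phi F z)) - Phi (\<lambda>z. sc a (F z)) \<in> Oexp_0"
proof (rule Phi_unique[OF fun_subspace_scale[OF fun_subspace_Oexp F] fun_subspace_scale[OF fun_subspace_Oexp Phi_Oexp[OF F]]])
  fix n \<phi> y assume a: "1 \<le> n" "\<phi> \<in> P_step n" "y \<in> lcs_dual sc"
  define c where "c = 1 / (2 * real (Suc n))"
  have c: "0 < c" "c < 1 / real (Suc n)" "c < 1 / real n" using P_step_Suc_half[OF a(1)] by (auto simp: c_def)
  have scale: "gamma_int (\<lambda>z. y (sc e (F' z))) \<psi> c = e * gamma_int (\<lambda>z. y (F' z)) \<psi> c" for e F' \<psi>
    by (simp add: dual_scale[OF a(3)] gamma_int_def line_int_def mult.left_commute right_diff_distrib)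
  show "\<exists>b c'. 0 < b \<and> b < 1 / real n \<and> 0 < c' \<and> c' < 1 / real (Suc n) \<and>
      gamma_int (\<lambda>z. y (sc a (Phi F z))) \<phi> b = gamma_int (\<lambda>z. y (sc a (F z))) (fourier \<phi>) c'" for a
    using c Phi_gamma_int[OF F \<open>y \<in> lcs_dual sc\<close> \<open>\<phi> \<in> P_step n\<close> \<open>1 \<le> n\<close> c(1,3,1,2)]
    by (intro exI[of _ c]) (simp add: scale)
qed

lemma Phi_reflect:
  assumes F: "F \<in> Oexp_R"
  shows "reflect (Phi F) - Phi (reflect F) \<in> Oexp_0"
proof (rule Phi_unique[OF reflect_Oexp[OF F] reflect_Oexp[OF Phi_Oexp[OF F]]])
  fix n \<phi> y assume a: "1 \<le> n" "\<phi> \<in> P_step n" "y \<in> lcs_dual sc"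
  define c where "c = 1 / (2 * real (Suc n))"
  have c: "0 < c" "c < 1 / real (Suc n)" "c < 1 / real n" using P_step_Suc_half[OF a(1)] by (auto simp: c_def)
  have "gamma_int (\<lambda>z. y (reflect (Phi F) z)) \<phi> c = gamma_int (\<lambda>z. y (Phi F z)) (\<lambda>w. \<phi> (- w)) c"
    by (simp add: reflect_def dual_minus[OF a(3)] reflect_gamma_int[of "\<lambda>z. y (Phi F z)"])
  also have "\<dots> = gamma_int (\<lambda>z. y (F z)) (fourier (\<lambda>w. \<phi> (- w))) c"
    by (rule Phi_gamma_int[OF F a(3) P_step_reflect[OF a(2,1)] a(1) c(1,3,1,2)])
  also have "\<dots> = gamma_int (\<lambda>z. y (reflect F z)) (fourier \<phi>) c"
    by (simp add: reflect_def dual_minus[OF a(3)] reflect_gamma_int[of "\<lambda>z. y (F z)"] fourier_reflect[abs_def])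
  finally show "\<exists>b c. 0 < b \<and> b < 1 / real n \<and> 0 < c \<and> c < 1 / real (Suc n) \<and>
      gamma_int (\<lambda>z. y (reflect (Phi F) z)) \<phi> b = gamma_int (\<lambda>z. y (reflect F z)) (fourier \<phi>) c" using c by blast
qed

text \<open>Pairing twice moves both transforms to the test function, where
  \<open>fourier_fourier\<close> applies. Each transform costs one step of the inductive limit,
  hence the height below \<open>1 / real (Suc (Suc n))\<close>.\<close>

lemma Phi_Phi:
  assumes F: "F \<in> Oexp_R"
  shows "(\<lambda>z. sc (- \<i> * kappa) (reflect F z)) - Phi (Phi F) \<in> Oexp_0"
proof (rule Phi_unique[OF Phi_Oexp[OF F] fun_subspace_scale[OF fun_subspace_Oexp reflect_Oexp[OF F]]])
  fix n \<phi> y assume a: "1 \<le> n" "\<phi> \<in> P_step n" "y \<in> lcs_dual sc"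
  define c where "c = 1 / (2 * real (Suc (Suc n)))"
  have c: "0 < c" "c < 1 / real (Suc (Suc n))" "c < 1 / real (Suc n)" using P_step_Suc_half[of "Suc n"] by (auto simp: c_def)
  have cn: "c < 1 / real n" using c(3) a(1) by (rule_tac less_trans[OF c(3)]) (simp add: frac_less2)
  have eq: "fourier (fourier \<phi>) (Complex t e) = - \<i> * kappa * \<phi> (- Complex t e)" if "\<bar>e\<bar> = c" for t e
    using that cn by (intro fourier_fourier[OF a(2,1)]) simp
  have "gamma_int (\<lambda>z. y (Phi F z)) (fourier \<phi>) c = gamma_int (\<lambda>z. y (F z)) (fourier (fourier \<phi>)) c"
    by (rule Phi_gamma_int[OF F a(3) fourier_P_step[OF a(2,1) lessI] _ c(1,3,1,2)]) simp
  also have "\<dots> = - \<i> * kappa * gamma_int (\<lambda>z. y (F z)) (\<lambda>w. \<phi> (- w)) c"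
    using c(1) by (simp add: gamma_int_def line_int_def eq mult.assoc right_diff_distrib)
  also have "gamma_int (\<lambda>z. y (F z)) (\<lambda>w. \<phi> (- w)) c = gamma_int (\<lambda>z. y (reflect F z)) \<phi> c"
    by (simp add: reflect_def dual_minus[OF a(3)] reflect_gamma_int[of "\<lambda>z. y (F z)"])
  also have "- \<i> * kappa * gamma_int (\<lambda>z. y (reflect F z)) \<phi> c = gamma_int (\<lambda>z. y (sc (- \<i> * kappa) (reflect F z))) \<phi> c"
    unfolding dual_scale[OF a(3)] gamma_int_def line_int_def by (simp add: mult.left_commute right_diff_distrib mult.assoc)
  finally show "\<exists>b c. 0 < b \<and> b < 1 / real n \<and> 0 < c \<and> c < 1 / real (Suc n) \<and>
      gamma_int (\<lambda>z. y (sc (- \<i> * kappa) (reflect F z))) \<phi> b = gamma_int (\<lambda>z. y (Phi F z)) (fourier \<phi>) c"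
    using c(1,3) cn by metis
qed

end

section \<open>Functionals supported at infinity\<close>

lemma integral_reflect_real:
  fixes f :: "real \<Rightarrow> complex"
  shows "(LINT t|lborel. f (- t)) = (LINT t|lborel. f t)" using lborel_integral_real_affine[of "- 1" f 0] by simp

lemma integrable_half:
  fixes f :: "real \<Rightarrow> complex"
  assumes "integrable lborel f"
  shows "integrable lborel (\<lambda>t. if 0 \<le> t then f t else 0)" "integrable lborel (\<lambda>t. if t \<le> 0 then f t else 0)"
proof -
  have "integrable lborel (\<lambda>t. indicator {0..} t *\<^sub>R f t)" "integrable lborel (\<lambda>t. indicator {..0} t *\<^sub>R f t)"
    using assms by (auto intro!: integrable_mult_indicator)
  moreover have "(\<lambda>t. indicator {0..} t *\<^sub>R f t) = (\<lambda>t. if 0 \<le> t then f t else 0)"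
    "(\<lambda>t. indicator {..0} t *\<^sub>R f t) = (\<lambda>t. if t \<le> 0 then f t else 0)" by (auto simp: indicator_def)
  ultimately show "integrable lborel (\<lambda>t. if 0 \<le> t then f t else 0)" "integrable lborel (\<lambda>t. if t \<le> 0 then f t else 0)"
    by simp_all
qed

lemma integral_halves:
  fixes f :: "real \<Rightarrow> complex"
  assumes f: "integrable lborel f"
  shows "(LINT t|lborel. f t) = (LINT t|lborel. (if t \<le> 0 then f t else 0)) + (LINT t|lborel. (if 0 \<le> t then f t else 0))"
proof -
  have "(LINT t|lborel. f t) = (LINT t|lborel. (if t \<le> 0 then f t else 0) + (if 0 \<le> t then f t else 0))"
  proof (rule integral_cong_AE)
    have "AE t in lborel. t \<noteq> (0::real)" by (rule AE_lborel_singleton)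
    thus "AE t in lborel. f t = (if t \<le> 0 then f t else 0) + (if 0 \<le> t then f t else 0)" by eventually_elim auto
    show "(\<lambda>t. (if t \<le> 0 then f t else 0) + (if 0 \<le> t then f t else 0)) \<in> borel_measurable lborel"
      using integrable_half[OF f] by (intro borel_measurable_add) auto
  qed (use f in auto)
  thus ?thesis using integrable_half[OF f] by simp
qed

lemma integral_le_half_reflect:
  fixes f :: "real \<Rightarrow> complex"
  shows "(LINT t|lborel. (if 0 \<le> t then f (- t) else 0)) = (LINT t|lborel. (if t \<le> 0 then f t else 0))"
  using integral_reflect_real[of "\<lambda>t. if t \<le> 0 then f t else 0"] by simp

text \<open>Expressing integrals along half-lines by a primitive reduces the comparison of contours
  to that of values of \<open>P\<close>.\<close>

lemma halfline_integral_limit: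
  assumes der: "\<And>z. z \<in> \<Omega> \<Longrightarrow> (P has_field_derivative u z) (at z)" and cont: "continuous_on \<Omega> u"
    and path: "\<And>t. a \<le> t \<Longrightarrow> w0 + cor t * v \<in> \<Omega>"
    and int: "integrable lborel (\<lambda>t. if a \<le> t then v * u (w0 + cor t * v) else 0)"
    and a: "a \<ge> 0"
  shows "(\<lambda>n. P (w0 + cor (a + real n) * v) - P (w0 + cor a * v)) \<longlonglongrightarrow>
    (LINT t|lborel. (if a \<le> t then v * u (w0 + cor t * v) else 0))"
proof -
  obtain k :: nat where k: "a \<le> real k" using real_arch_simple by blast
  define f where "f t = (if a \<le> t then v * u (w0 + cor t * v) else 0)" for t
  have "(\<lambda>n. LINT t|lborel. indicator {a..a + real n} t *\<^sub>R f t) \<longlonglongrightarrow> (LINT t|lborel. f t)"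
  proof (rule integral_dominated_convergence[where w = "\<lambda>t. norm (f t)"])
    show "AE t in lborel. (\<lambda>n. indicator {a..a + real n} t *\<^sub>R f t) \<longlonglongrightarrow> f t"
    proof (intro AE_I2)
      fix t :: real
      obtain N :: nat where N: "\<bar>t\<bar> \<le> real N" using real_arch_simple by blast
      have "\<forall>\<^sub>F n in sequentially. f t = indicator {a..a + real n} t *\<^sub>R f t"
        unfolding eventually_sequentially using N a by (intro exI[of _ N]) (auto simp: indicator_def f_def)
      thus "(\<lambda>n. indicator {a..a + real n} t *\<^sub>R f t) \<longlonglongrightarrow> f t"
        by (rule Lim_transform_eventually[OF tendsto_const])
    qed
  qed (use int in \<open>auto simp: indicator_def f_def[abs_def]\<close>)
  moreover have "(LINT t|lborel. indicator {a..a + real n} t *\<^sub>R f t) = P (w0 + cor (a + real n) * v) - P (w0 + cor a * v)" for n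
  proof -
    have "(LINT t|lborel. indicator {a..a + real n} t *\<^sub>R f t) = (LINT t|lborel. indicator {a..a + real n} t *\<^sub>R (v * u (w0 + cor t * v)))"
      by (intro Bochner_Integration.integral_cong refl) (auto simp: f_def indicator_def)
    also have "\<dots> = P (w0 + cor (a + real n) * v) - P (w0 + cor a * v)"
      by (rule affine_path_integral[OF der cont]) (auto intro: path)
    finally show ?thesis .
  qed
  ultimately show ?thesis by (simp add: f_def)
qed

lemma exp_minus_real_tendsto_0:
  fixes d :: real
  assumes "d > 0"
  shows "(\<lambda>n. exp (- d * real n)) \<longlonglongrightarrow> 0"
  using assms by (intro filterlim_compose[OF exp_at_bot] filterlim_tendsto_neg_mult_at_bot[OF tendsto_const] filterlim_real_sequentially) auto

context sc_lcs
begin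

section \<open>Functions extending across the real axis and functions of \<open>FO\<close>\<close>

lemma Oexp_pm_growth:
  assumes g: "g \<in> Oexp sc p {-\<infinity>, \<infinity>}"
  shows "g \<in> hol_space sc UNIV" "restr off_real g \<in> Oexp_R"
proof -
  show h: "g \<in> hol_space sc UNIV" using g by (simp add: Oexp_def finite_part_simps)
  have "restr off_real g \<in> hol_space sc off_real" using h by (rule hol_space_restr[OF _ open_Im(1)]) simp
  moreover have "bdd_above ((\<lambda>z. p i (restr off_real g z) * growth (- (1 / real n)) z) ` S_set n UNIV)" if n: "n \<ge> 1" for n i
  proof -
    have "(\<lambda>z. p i (restr off_real g z) * growth (- (1 / real n)) z) ` S_set n UNIV
        = (\<lambda>z. p i (g z) * growth (- (1 / real n)) z) ` S_set n UNIV"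
      by (intro image_cong refl) (auto simp: S_set_UNIV[OF n] restr_def)
    also have "bdd_above \<dots>"
    proof (rule bdd_above_mono)
      show "bdd_above ((\<lambda>z. p i (g z) * growth (- (1 / real n)) z) ` S_set n {-\<infinity>, \<infinity>})"
        using g n unfolding Oexp_def by simp
    qed (intro image_mono S_set_pm)
    finally show ?thesis .
  qed
  ultimately show "restr off_real g \<in> Oexp_R" by (simp add: Oexp_def finite_part_simps)
qed

lemma Oexp_pm_subset: "Oexp_pm sc p \<subseteq> Oexp_R" unfolding Oexp_pm_def finite_part_simps using Oexp_pm_growth(2) by blast

text \<open>The part of \<open>S\<^sub>n({\<plusminus>\<infinity>})\<close> near the real line is bounded.\<close>

lemma entire_in_Oexp_pm:
  assumes V: "V \<in> hol_space sc UNIV" and A: "restr off_real V \<in> Oexp_R"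
  shows "V \<in> Oexp sc p {-\<infinity>, \<infinity>}" "restr off_real V \<in> Oexp_pm sc p"
proof -
  have "\<exists>C\<ge>0. \<forall>z\<in>S_set n {-\<infinity>, \<infinity>}. p i (V z) \<le> C * growth (1 / real n) z" if n: "n \<ge> 1" for n :: nat and i
  proof -
    have "1 / real n > 0" using n by simp
    from slow_growthE[OF OexpD(2)[OF A] this this, of "real n" i] obtain C1 where C1: "C1 \<ge> 0"
      "\<And>z. 1 / real n \<le> \<bar>Im z\<bar> \<Longrightarrow> \<bar>Im z\<bar> \<le> real n \<Longrightarrow> p i (restr off_real V z) \<le> C1 * growth (1 / real n) z" by metis
    define R where "R = cbox (Complex (- real n) (- real n)) (Complex (real n) (real n))"
    have "continuous_on R (\<lambda>z. p i (V z))"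
      using hol_space_continuous_on[OF V open_UNIV] by (intro continuous_on_seminorm) (rule continuous_on_subset, auto)
    hence "compact ((\<lambda>z. p i (V z)) ` R)" by (intro compact_continuous_image) (auto simp: R_def)
    then obtain C2 where C2: "\<And>z. z \<in> R \<Longrightarrow> \<bar>p i (V z)\<bar> \<le> C2"
      by (metis bounded_iff compact_imp_bounded imageI real_norm_def)
    have "p i (V z) \<le> (C1 + \<bar>C2\<bar>) * growth (1 / real n) z" if z: "z \<in> S_set n {-\<infinity>, \<infinity>}" for z
    proof -
      note S = S_set_pm(2)[OF z]
      have e: "1 \<le> growth (1 / real n) z" by simp
      show ?thesis
      proof (cases "1 / real n \<le> \<bar>Im z\<bar>")
        case True
        hence "Im z \<noteq> 0" using n by auto
        hence "p i (V z) \<le> C1 * growth (1 / real n) z" using C1(2)[OF True] S by (simp add: restr_def)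
        also have "\<dots> \<le> (C1 + \<bar>C2\<bar>) * growth (1 / real n) z" by (intro mult_right_mono) auto
        finally show ?thesis .
      next
        case False
        hence "z \<in> R" using S by (auto simp: R_def in_cbox_complex_iff)
        hence "p i (V z) \<le> \<bar>C2\<bar> * 1" using C2[of z] by simp
        also have "\<dots> \<le> (C1 + \<bar>C2\<bar>) * growth (1 / real n) z" using C1(1) e by (intro mult_mono) auto
        finally show ?thesis .
      qed
    qed
    thus ?thesis using C1(1) by (intro exI[of _ "C1 + \<bar>C2\<bar>"]) auto
  qed
  thus *: "V \<in> Oexp sc p {-\<infinity>, \<infinity>}" using V unfolding Oexp_def bdd_above_growth_iff finite_part_simps by simp
  show "restr off_real V \<in> Oexp_pm sc p" using * unfolding Oexp_pm_def finite_part_simps by blast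
qed

lemma Oexp_entire_subset_pm: "Oexp_0 \<subseteq> Oexp_pm sc p"
proof
  fix e assume e: "e \<in> Oexp_0"
  then obtain g where "g \<in> Oexp sc p {}" "e = restr off_real g" by (auto simp: Oexp_entire_def finite_part_simps)
  thus "e \<in> Oexp_pm sc p" using entire_in_Oexp_pm(2)[of g] subsetD[OF Oexp_entire_subset e] by (simp add: Oexp_entire_iff)
qed

lemma reflect_hol_UNIV:
  assumes "g \<in> hol_space sc UNIV"
  shows "reflect g \<in> hol_space sc UNIV"
proof -
  have "(\<lambda>z. g (- z)) \<in> hol_space sc UNIV" by (rule hol_space_reflect_arg[OF assms]) auto
  from fun_subspace_minus[OF fun_subspace_hol_space this] show ?thesis by (simp add: reflect_def fun_Compl_def)
qed

lemma reflect_restr: "reflect (restr off_real g) = restr off_real (reflect g)" by (simp add: reflect_def restr_def fun_eq_iff)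

lemma reflect_Oexp_pm:
  assumes "G \<in> Oexp_pm sc p"
  shows "reflect G \<in> Oexp_pm sc p"
proof -
  obtain g where g: "g \<in> Oexp sc p {-\<infinity>, \<infinity>}" "G = restr off_real g"
    using assms by (auto simp: Oexp_pm_def finite_part_simps)
  have "restr off_real (reflect g) \<in> Oexp_R" using reflect_Oexp[OF Oexp_pm_growth(2)[OF g(1)]] by (simp add: reflect_restr)
  thus ?thesis using entire_in_Oexp_pm(2)[OF reflect_hol_UNIV[OF Oexp_pm_growth(1)[OF g(1)]]] by (simp add: g(2) reflect_restr)
qed

lemma FO_pinf_iff:
  "h \<in> FO_pinf sc p \<longleftrightarrow> h \<in> hol_space sc {z. Im z < 0} \<and>
    (\<forall>k\<ge>1::nat. \<forall>i. \<exists>C\<ge>0. \<forall>z. Im z \<le> - (1 / real k) \<longrightarrow> p i (h z) \<le> C * exp (1 / real k * cmod z - real k * \<bar>Im z\<bar>))"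
proof -
  have "bdd_above ((\<lambda>z. f z * exp (- (1 / real k) * cmod z + real k * \<bar>Im z\<bar>)) ` S) \<longleftrightarrow>
      (\<exists>C\<ge>0. \<forall>z\<in>S. f z \<le> C * exp (1 / real k * cmod z - real k * \<bar>Im z\<bar>))" for f S and k :: nat
    by (rule bdd_above_weighted_iff) (simp_all add: exp_minus[symmetric])
  thus ?thesis unfolding FO_pinf_def by simp
qed

lemma FO_minf_iff:
  "h \<in> FO_minf sc p \<longleftrightarrow> h \<in> hol_space sc {z. Im z > 0} \<and>
    (\<forall>k\<ge>1::nat. \<forall>i. \<exists>C\<ge>0. \<forall>z. Im z \<ge> 1 / real k \<longrightarrow> p i (h z) \<le> C * exp (1 / real k * cmod z - real k * \<bar>Im z\<bar>))"
proof -
  have "bdd_above ((\<lambda>z. f z * exp (- (1 / real k) * cmod z + real k * \<bar>Im z\<bar>)) ` S) \<longleftrightarrow>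
      (\<exists>C\<ge>0. \<forall>z\<in>S. f z \<le> C * exp (1 / real k * cmod z - real k * \<bar>Im z\<bar>))" for f S and k :: nat
    by (rule bdd_above_weighted_iff) (simp_all add: exp_minus[symmetric])
  thus ?thesis unfolding FO_minf_def by simp
qed

lemma FO_pinfE:
  assumes "h \<in> FO_pinf sc p" "k \<ge> 1"
  obtains C where "C \<ge> 0" "\<And>z. Im z \<le> - (1 / real k) \<Longrightarrow> p i (h z) \<le> C * exp (1 / real k * cmod z - real k * \<bar>Im z\<bar>)"
proof -
  have "\<exists>C\<ge>0. \<forall>z. Im z \<le> - (1 / real k) \<longrightarrow> p i (h z) \<le> C * exp (1 / real k * cmod z - real k * \<bar>Im z\<bar>)"
    using assms unfolding FO_pinf_iff by simp
  then obtain C where "C \<ge> 0" "\<forall>z. Im z \<le> - (1 / real k) \<longrightarrow> p i (h z) \<le> C * exp (1 / real k * cmod z - real k * \<bar>Im z\<bar>)" by metis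
  thus thesis by (intro that[of C]) simp_all
qed

text \<open>For large \<open>k\<close> the weight satisfies \<open>cmod z / real k \<le> \<epsilon>
  * \<bar>Re z\<bar> + \<bar>Im z\<bar>\<close>, and \<open>\<bar>Im z\<bar>\<close> is bounded in
  the region concerned.\<close>

lemma FO_pinf_lower_slow:
  assumes h: "h \<in> FO_pinf sc p"
  shows "lower_slow h" unfolding lower_slow_def
proof (intro conjI allI impI)
  show "h \<in> hol_space sc {z. Im z < 0}" using h by (simp add: FO_pinf_iff)
  fix i and r R \<epsilon> :: real assume re: "0 < r" "0 < \<epsilon>"
  obtain k :: nat where k: "1 / r < k" "1 / \<epsilon> < k" "1 < k" using reals_Archimedean2[of "max (max (1 / r) (1 / \<epsilon>)) 1"] by auto
  hence k': "k \<ge> 1" "1 / real k \<le> r" "1 / real k \<le> \<epsilon>" "1 / real k \<le> 1" using re by (auto simp: field_simps)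
  obtain C where C: "C \<ge> 0" "\<And>z. Im z \<le> - (1 / real k) \<Longrightarrow> p i (h z) \<le> C * exp (1 / real k * cmod z - real k * \<bar>Im z\<bar>)"
    using FO_pinfE[OF h k'(1)] by metis
  have "p i (h z) \<le> C * exp \<bar>R\<bar> * growth \<epsilon> z" if z: "- R \<le> Im z" "Im z \<le> - r" for z
  proof -
    have "1 / real k * cmod z \<le> 1 / real k * (\<bar>Re z\<bar> + \<bar>Im z\<bar>)" using cmod_le[of z] k' by (intro mult_left_mono) auto
    also have "\<dots> \<le> \<epsilon> * \<bar>Re z\<bar> + 1 * \<bar>Im z\<bar>"
      unfolding distrib_left using k' by (intro add_mono mult_right_mono) auto
    finally have "1 / real k * cmod z - real k * \<bar>Im z\<bar> \<le> \<bar>R\<bar> + \<epsilon> * \<bar>Re z\<bar>"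
      using z re(1) mult_nonneg_nonneg[of "real k" "\<bar>Im z\<bar>"] by linarith
    hence "C * exp (1 / real k * cmod z - real k * \<bar>Im z\<bar>) \<le> C * exp (\<bar>R\<bar> + \<epsilon> * \<bar>Re z\<bar>)"
      using C(1) by (intro mult_left_mono) auto
    thus ?thesis using C(2)[of z] z k' by (simp add: exp_add mult.assoc)
  qed
  thus "\<exists>C\<ge>0. \<forall>z. - R \<le> Im z \<and> Im z \<le> - r \<longrightarrow> p i (h z) \<le> C * growth \<epsilon> z"
    using C(1) by (intro exI[of _ "C * exp \<bar>R\<bar>"]) auto
qed

lemma FO_pinf_reflect_arg:
  "h \<in> FO_pinf sc p \<Longrightarrow> (\<lambda>z. h (- z)) \<in> FO_minf sc p"
  "h \<in> FO_minf sc p \<Longrightarrow> (\<lambda>z. h (- z)) \<in> FO_pinf sc p"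
proof -
  assume h: "h \<in> FO_pinf sc p"
  have "(\<lambda>z. h (- z)) \<in> hol_space sc {z. Im z > 0}" using h by (intro hol_space_reflect_arg[OF _ open_Im(2,3)]) (auto simp: FO_pinf_iff)
  moreover have "\<exists>C\<ge>0. \<forall>z. Im z \<ge> 1 / real k \<longrightarrow> p i (h (- z)) \<le> C * exp (1 / real k * cmod z - real k * \<bar>Im z\<bar>)"
    if k: "k \<ge> 1" for k :: nat and i
  proof -
    obtain C where C: "C \<ge> 0" "\<And>z. Im z \<le> - (1 / real k) \<Longrightarrow> p i (h z) \<le> C * exp (1 / real k * cmod z - real k * \<bar>Im z\<bar>)"
      using FO_pinfE[OF h k] by metis
    thus ?thesis using C(2)[of "- z" for z] by (intro exI[of _ C]) auto
  qed
  ultimately show "(\<lambda>z. h (- z)) \<in> FO_minf sc p" by (simp add: FO_minf_iff)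
next
  assume h: "h \<in> FO_minf sc p"
  have "(\<lambda>z. h (- z)) \<in> hol_space sc {z. Im z < 0}" using h by (intro hol_space_reflect_arg[OF _ open_Im(3,2)]) (auto simp: FO_minf_iff)
  moreover have "\<exists>C\<ge>0. \<forall>z. Im z \<le> - (1 / real k) \<longrightarrow> p i (h (- z)) \<le> C * exp (1 / real k * cmod z - real k * \<bar>Im z\<bar>)"
    if k: "k \<ge> 1" for k :: nat and i
  proof -
    have "\<exists>C\<ge>0. \<forall>z. Im z \<ge> 1 / real k \<longrightarrow> p i (h z) \<le> C * exp (1 / real k * cmod z - real k * \<bar>Im z\<bar>)"
      using h k unfolding FO_minf_iff by simp
    then obtain C where C: "C \<ge> 0" "\<forall>z. Im z \<ge> 1 / real k \<longrightarrow> p i (h z) \<le> C * exp (1 / real k * cmod z - real k * \<bar>Im z\<bar>)" by metis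
    thus ?thesis using C(2)[rule_format, of "- z" for z] by (intro exI[of _ C]) auto
  qed
  ultimately show "(\<lambda>z. h (- z)) \<in> FO_pinf sc p" by (simp add: FO_pinf_iff)
qed

text \<open>Both summands are coded on the lower half-plane, the shape in which the transforms are
  produced.\<close>

lemma FO_pm_iff: "H \<in> FO_pm sc p \<longleftrightarrow> (\<exists>n1\<in>FO_pinf sc p. \<exists>n2\<in>FO_pinf sc p. H = glue n1 n2)"
proof
  assume "H \<in> FO_pm sc p"
  then obtain f g where fg: "f \<in> FO_minf sc p" "g \<in> FO_pinf sc p" "H = f + g" unfolding FO_pm_def by (auto elim!: set_plus_elim)
  have "H = glue (- g) (\<lambda>z. f (- z))" by (simp add: fg(3) glue_def fun_eq_iff)
  thus "\<exists>n1\<in>FO_pinf sc p. \<exists>n2\<in>FO_pinf sc p. H = glue n1 n2"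
    using fun_subspace_minus[OF fun_subspace_FO_pinf fg(2)] FO_pinf_reflect_arg(2)[OF fg(1)] by blast
next
  assume "\<exists>n1\<in>FO_pinf sc p. \<exists>n2\<in>FO_pinf sc p. H = glue n1 n2"
  then obtain n1 n2 where n: "n1 \<in> FO_pinf sc p" "n2 \<in> FO_pinf sc p" "H = glue n1 n2" by blast
  have eq: "H = (\<lambda>z. n2 (- z)) + (- n1)" by (simp add: n(3) glue_def fun_eq_iff)
  show "H \<in> FO_pm sc p" unfolding FO_pm_def eq
    by (rule set_plus_intro[OF FO_pinf_reflect_arg(1)[OF n(2)] fun_subspace_minus[OF fun_subspace_FO_pinf n(1)]])
qed

lemma FO_pm_subset: "FO_pm sc p \<subseteq> Oexp_R" using glue_Oexp FO_pinf_lower_slow by (auto simp: FO_pm_iff)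

text \<open>A piece of a contour on which the Laplace kernel is absolutely integrable for \<open>Im \<zeta> < 0\<close>.\<close>

definition contour_piece :: "real \<Rightarrow> real \<Rightarrow> (real \<Rightarrow> complex) \<Rightarrow> (real \<Rightarrow> 'e) \<Rightarrow> bool" where
  "contour_piece K c \<gamma> a \<longleftrightarrow> continuous_on UNIV \<gamma> \<and> (\<exists>S. finite S \<and> continuous_on (- S) a) \<and>
    (\<forall>i. \<forall>\<delta>>0. \<exists>C\<ge>0. \<forall>\<zeta> t. Im \<zeta> \<le> - (2 * \<delta>) \<longrightarrow>
      cmod (exp (- \<i> * \<gamma> t * \<zeta>)) * p i (a t) \<le> C * (exp (K * Im \<zeta>) * growth c \<zeta>) * exp (- \<delta> * \<bar>t\<bar>))"

definition piece_int :: "(real \<Rightarrow> complex) \<Rightarrow> (real \<Rightarrow> 'e) \<Rightarrow> complex \<Rightarrow> 'e" where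
  "piece_int \<gamma> a \<zeta> = pint (\<lambda>t. sc (exp (- \<i> * \<gamma> t * \<zeta>)) (a t))"

lemma contour_pieceE:
  assumes "contour_piece K c \<gamma> a" "\<delta> > 0"
  obtains C where "C \<ge> 0" "\<And>\<zeta> t. Im \<zeta> \<le> - (2 * \<delta>) \<Longrightarrow>
      cmod (exp (- \<i> * \<gamma> t * \<zeta>)) * p i (a t) \<le> C * (exp (K * Im \<zeta>) * growth c \<zeta>) * exp (- \<delta> * \<bar>t\<bar>)"
proof -
  have "\<exists>C\<ge>0. \<forall>\<zeta> t. Im \<zeta> \<le> - (2 * \<delta>) \<longrightarrow>
      cmod (exp (- \<i> * \<gamma> t * \<zeta>)) * p i (a t) \<le> C * (exp (K * Im \<zeta>) * growth c \<zeta>) * exp (- \<delta> * \<bar>t\<bar>)"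
    by (rule assms(1)[unfolded contour_piece_def, THEN conjunct2, THEN conjunct2, rule_format, OF assms(2)])
  then obtain C where "C \<ge> 0" "\<forall>\<zeta> t. Im \<zeta> \<le> - (2 * \<delta>) \<longrightarrow>
      cmod (exp (- \<i> * \<gamma> t * \<zeta>)) * p i (a t) \<le> C * (exp (K * Im \<zeta>) * growth c \<zeta>) * exp (- \<delta> * \<bar>t\<bar>)" by metis
  thus thesis by (intro that[of C]) blast+
qed

lemma piece_hol:
  assumes pc: "contour_piece K c \<gamma> a" and Kc: "K \<ge> 0" "c \<ge> 0"
  shows "Im \<zeta> < 0 \<Longrightarrow> decaying (\<lambda>t. sc (exp (- \<i> * \<gamma> t * \<zeta>)) (a t))"
    and "restr {z. Im z < 0} (piece_int \<gamma> a) \<in> hol_space sc {z. Im z < 0}"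
proof -
  obtain S where S: "finite S" "continuous_on (- S) a" using pc by (auto simp: contour_piece_def)
  have \<gamma>: "continuous_on (- S) \<gamma>" using pc continuous_on_subset by (auto simp: contour_piece_def)
  have kc: "continuous_on (- S) (\<lambda>t. exp (- \<i> * \<gamma> t * \<zeta>))" for \<zeta> by (intro continuous_intros \<gamma>)
  have kh: "(\<lambda>\<zeta>. exp (- \<i> * \<gamma> t * \<zeta>)) holomorphic_on {z. Im z < 0}" for t by (intro holomorphic_intros)
  have dom: "\<exists>r>0. \<exists>C. \<exists>d>0. \<forall>w\<in>ball z r. \<forall>t. cmod (exp (- \<i> * \<gamma> t * w)) * p i (a t) \<le> C * exp (- d * \<bar>t\<bar>)"
    if z: "z \<in> {z. Im z < 0}" for z i
  proof -
    define r where "r = - Im z / 2"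
    have r: "r > 0" "r / 2 > 0" using z by (auto simp: r_def)
    obtain C where C: "C \<ge> 0" "\<And>\<zeta> t. Im \<zeta> \<le> - (2 * (r / 2)) \<Longrightarrow>
        cmod (exp (- \<i> * \<gamma> t * \<zeta>)) * p i (a t) \<le> C * (exp (K * Im \<zeta>) * growth c \<zeta>) * exp (- (r / 2) * \<bar>t\<bar>)"
      using contour_pieceE[OF pc r(2)] by metis
    have "cmod (exp (- \<i> * \<gamma> t * w)) * p i (a t) \<le> C * exp (c * (\<bar>Re z\<bar> + r)) * exp (- (r / 2) * \<bar>t\<bar>)" if w: "w \<in> ball z r" for w t
    proof -
      have im: "\<bar>Im w - Im z\<bar> < r" and re: "\<bar>Re w - Re z\<bar> < r"
        using w abs_Im_le_cmod[of "w - z"] abs_Re_le_cmod[of "w - z"] by (auto simp: dist_norm norm_minus_commute)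
      have w0: "Im w \<le> - (2 * (r / 2))" "Im w \<le> 0" using im r by (auto simp: r_def)
      have "exp (K * Im w) * growth c w \<le> 1 * exp (c * (\<bar>Re z\<bar> + r))"
        using Kc w0(2) re by (intro mult_mono) (auto simp: mult_nonneg_nonpos intro!: mult_left_mono)
      hence "C * (exp (K * Im w) * growth c w) * exp (- (r / 2) * \<bar>t\<bar>) \<le> C * (1 * exp (c * (\<bar>Re z\<bar> + r))) * exp (- (r / 2) * \<bar>t\<bar>)"
        using C(1) by (intro mult_right_mono mult_left_mono) auto
      thus ?thesis using C(2)[OF w0(1), of t] by simp
    qed
    thus ?thesis using r by (intro exI[of _ r] conjI exI[of _ "C * exp (c * (\<bar>Re z\<bar> + r))"] exI[of _ "r / 2"]) auto
  qed
  show "decaying (\<lambda>t. sc (exp (- \<i> * \<gamma> t * \<zeta>)) (a t))" if "Im \<zeta> < 0"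
    using hol_space_kernel_integral(1)[OF open_Im(2) S kc kh dom, of \<zeta>] that by simp
  show "restr {z. Im z < 0} (piece_int \<gamma> a) \<in> hol_space sc {z. Im z < 0}"
    using hol_space_kernel_integral(2)[OF open_Im(2) S kc kh dom] by (simp add: piece_int_def[abs_def])
qed

lemma piece_bound:
  assumes pc: "contour_piece K c \<gamma> a" and Kc: "K \<ge> 0" "c \<ge> 0" and \<delta>: "\<delta> > 0"
  shows "\<exists>C\<ge>0. \<forall>\<zeta>. Im \<zeta> \<le> - (2 * \<delta>) \<longrightarrow> p i (piece_int \<gamma> a \<zeta>) \<le> C * (exp (K * Im \<zeta>) * growth c \<zeta>)"
proof -
  obtain C where C: "C \<ge> 0" "\<And>\<zeta> t. Im \<zeta> \<le> - (2 * \<delta>) \<Longrightarrow>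
      cmod (exp (- \<i> * \<gamma> t * \<zeta>)) * p i (a t) \<le> C * (exp (K * Im \<zeta>) * growth c \<zeta>) * exp (- \<delta> * \<bar>t\<bar>)"
    using contour_pieceE[OF pc \<delta>] by metis
  have "p i (piece_int \<gamma> a \<zeta>) \<le> C * (2 / \<delta>) * (exp (K * Im \<zeta>) * growth c \<zeta>)" if z: "Im \<zeta> \<le> - (2 * \<delta>)" for \<zeta>
  proof -
    have "p i (piece_int \<gamma> a \<zeta>) \<le> C * (exp (K * Im \<zeta>) * growth c \<zeta>) * (2 / \<delta>)"
      unfolding piece_int_def by (rule pint_bound_exp[OF piece_hol(1)[OF pc Kc] \<delta>, where x = 0])
        (use z \<delta> C(2)[OF z] in \<open>auto simp: seminorm_scale[of i "exp _"]\<close>)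
    thus ?thesis by (simp add: mult_ac)
  qed
  thus ?thesis using C(1) \<delta> by (intro exI[of _ "C * (2 / \<delta>)"]) auto
qed

lemma dual_piece_int:
  assumes pc: "contour_piece K c \<gamma> a" and Kc: "K \<ge> 0" "c \<ge> 0" and z: "Im \<zeta> < 0" and y: "y \<in> lcs_dual sc"
  shows "y (piece_int \<gamma> a \<zeta>) = (LINT t|lborel. y (a t) * exp (- \<i> * \<gamma> t * \<zeta>))"
    and "integrable lborel (\<lambda>t. y (a t) * exp (- \<i> * \<gamma> t * \<zeta>))"
  using dual_pint[OF piece_hol(1)[OF pc Kc z] y] by (simp_all add: piece_int_def dual_scale[OF y] mult.commute)

lemma piece_fubini:
  assumes pc: "contour_piece K c \<gamma> a" and Kc: "K \<ge> 0" "c \<ge> 0" and y: "y \<in> lcs_dual sc" and \<phi>: "\<phi> \<in> P_step n" "n \<ge> 1"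
    and b: "0 < b" "b < 1 / real n" and c: "c < 1 / real n" "\<And>t. \<bar>Im (\<gamma> t)\<bar> \<le> c"
  shows "line_int (- b) (\<lambda>w. \<phi> w * (LINT t|lborel. y (a t) * exp (- \<i> * \<gamma> t * w))) = (LINT t|lborel. y (a t) * fourier \<phi> (\<gamma> t))"
    and "integrable lborel (\<lambda>s. \<phi> (Complex s (- b)) * (LINT t|lborel. y (a t) * exp (- \<i> * \<gamma> t * Complex s (- b))))"
proof -
  obtain S where S: "finite S" "continuous_on (- S) a" using pc by (auto simp: contour_piece_def)
  have \<gamma>: "continuous_on UNIV \<gamma>" using pc by (auto simp: contour_piece_def)
  have meas: "(\<lambda>t. y (a t)) \<in> borel_measurable lborel" "\<gamma> \<in> borel_measurable lborel"
    using borel_measurable_finite_exceptions[OF S(1) dual_continuous_on[OF y S(2)]] \<gamma> by (auto intro: borel_measurable_continuous_onI)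
  obtain i B where B: "B \<ge> 0" "\<And>x. cmod (y x) \<le> B * p i x" using dual_bounded[OF y] by blast
  have b2: "b / 2 > 0" using b by simp
  obtain C where C: "C \<ge> 0" "\<And>\<zeta> t. Im \<zeta> \<le> - (2 * (b / 2)) \<Longrightarrow>
      cmod (exp (- \<i> * \<gamma> t * \<zeta>)) * p i (a t) \<le> C * (exp (K * Im \<zeta>) * growth c \<zeta>) * exp (- (b / 2) * \<bar>t\<bar>)"
    using contour_pieceE[OF pc b2] by metis
  have dec: "cmod (y (a t)) * exp (- b * Re (\<gamma> t)) \<le> B * C * exp (- K * b) * exp (- (b / 2) * \<bar>t\<bar>)" for t
  proof -
    have "cmod (y (a t)) * exp (- b * Re (\<gamma> t)) \<le> B * p i (a t) * exp (- b * Re (\<gamma> t))" using B by (intro mult_right_mono) auto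
    also have "\<dots> = B * (cmod (exp (- \<i> * \<gamma> t * Complex 0 (- b))) * p i (a t))" unfolding cmod_exp_fourier by (simp add: mult_ac)
    also have "\<dots> \<le> B * (C * (exp (K * Im (Complex 0 (- b))) * exp (c * \<bar>Re (Complex 0 (- b))\<bar>)) * exp (- (b / 2) * \<bar>t\<bar>))"
      using B(1) b by (intro mult_left_mono C(2)) auto
    finally show ?thesis by (simp add: mult.assoc)
  qed
  show "line_int (- b) (\<lambda>w. \<phi> w * (LINT t|lborel. y (a t) * exp (- \<i> * \<gamma> t * w))) = (LINT t|lborel. y (a t) * fourier \<phi> (\<gamma> t))"
    "integrable lborel (\<lambda>s. \<phi> (Complex s (- b)) * (LINT t|lborel. y (a t) * exp (- \<i> * \<gamma> t * Complex s (- b))))"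
    using fourier_fubini[OF \<phi> _ c meas b2 dec] b by auto
qed

section \<open>Contours around the positive half-axis\<close>

definition ray :: "(complex \<Rightarrow> 'e) \<Rightarrow> real \<Rightarrow> real \<Rightarrow> real \<Rightarrow> 'e" where
  "ray g K c t = (if 0 \<le> t then g (Complex (K + t) c) else 0)"

text \<open>The factor \<open>\<i>\<close> is the derivative of the vertical path.\<close>

definition gate :: "(complex \<Rightarrow> 'e) \<Rightarrow> real \<Rightarrow> real \<Rightarrow> real \<Rightarrow> 'e" where
  "gate g K c t = (if \<bar>t\<bar> \<le> c then sc \<i> (g (Complex K t)) else 0)"

text \<open>The starting abscissa \<open>K\<close> yields the factor
  \<open>exp (K * Im \<zeta>)\<close> and the height yields the growth \<open>c\<close> in
  \<open>Re \<zeta>\<close>. Along the ray the kernel decays at least with rate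
  \<open>2 * \<delta>\<close>, half of which pays for \<open>g\<close>.\<close>

lemma ray_piece:
  assumes g: "g \<in> Oexp sc p {-\<infinity>, \<infinity>}" and K: "K \<ge> 0" and c: "\<bar>e\<bar> = c" "c > 0"
  shows "contour_piece K c (\<lambda>t. Complex (K + t) e) (ray g K e)" unfolding contour_piece_def
proof (intro conjI allI impI)
  show "continuous_on UNIV (\<lambda>t. Complex (K + t) e)" by (intro continuous_intros)
  have gc: "continuous_on UNIV (\<lambda>t. g (Complex (K + t) e))"
    by (rule continuous_on_compose2[OF hol_space_continuous_on[OF Oexp_pm_growth(1)[OF g] open_UNIV]]) (auto intro!: continuous_intros)
  have "continuous_on ({0<..} \<union> {..<0}) (ray g K e)"
  proof (rule continuous_on_open_Un)
    show "continuous_on {0<..} (ray g K e)" by (rule continuous_on_eq[OF continuous_on_subset[OF gc]]) (auto simp: ray_def)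
    show "continuous_on {..<0} (ray g K e)" by (rule continuous_on_eq[OF continuous_on_const[of _ 0]]) (auto simp: ray_def)
  qed auto
  moreover have "- {0} = {0<..} \<union> {..<0::real}" by auto
  ultimately show "\<exists>S. finite S \<and> continuous_on (- S) (ray g K e)" by (metis finite.emptyI finite.insertI)
  fix i and \<delta> :: real assume \<delta>: "\<delta> > 0"
  obtain C where C: "C \<ge> 0" "\<And>z. c \<le> \<bar>Im z\<bar> \<Longrightarrow> \<bar>Im z\<bar> \<le> c \<Longrightarrow> p i (restr off_real g z) \<le> C * growth \<delta> z"
    using slow_growthE[OF OexpD(2)[OF Oexp_pm_growth(2)[OF g]] c(2) \<delta>] by metis
  have e0: "e \<noteq> 0" using c by auto
  have "cmod (exp (- \<i> * Complex (K + t) e * \<zeta>)) * p i (ray g K e t) \<le> C * exp (\<delta> * K) * (exp (K * Im \<zeta>) * growth c \<zeta>) * exp (- \<delta> * \<bar>t\<bar>)"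
    if z: "Im \<zeta> \<le> - (2 * \<delta>)" for \<zeta> t
  proof (cases "0 \<le> t")
    case True
    have pg: "p i (g (Complex (K + t) e)) \<le> C * exp (\<delta> * (K + t))" using C(2)[of "Complex (K + t) e"] c e0 K True by (simp add: restr_def)
    have "e * Re \<zeta> \<le> c * \<bar>Re \<zeta>\<bar>" using c by (metis abs_ge_self abs_mult)
    moreover have "t * Im \<zeta> \<le> t * (- (2 * \<delta>))" using True z by (intro mult_left_mono)
    ultimately have ex: "(K + t) * Im \<zeta> + e * Re \<zeta> + \<delta> * (K + t) \<le> \<delta> * K + (K * Im \<zeta> + c * \<bar>Re \<zeta>\<bar>) + - \<delta> * \<bar>t\<bar>"
      using True by (simp add: algebra_simps)
    have "cmod (exp (- \<i> * Complex (K + t) e * \<zeta>)) * p i (ray g K e t) \<le> exp ((K + t) * Im \<zeta> + e * Re \<zeta>) * (C * exp (\<delta> * (K + t)))"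
      unfolding cmod_exp_fourier using pg True by (simp add: ray_def)
    also have "\<dots> = C * exp ((K + t) * Im \<zeta> + e * Re \<zeta> + \<delta> * (K + t))" by (simp add: exp_add)
    also have "\<dots> \<le> C * exp (\<delta> * K + (K * Im \<zeta> + c * \<bar>Re \<zeta>\<bar>) + - \<delta> * \<bar>t\<bar>)"
      using C(1) ex by (intro mult_left_mono) (auto simp only: exp_le_cancel_iff)
    finally show ?thesis by (simp only: exp_add mult.assoc)
  qed (use C(1) in \<open>simp add: ray_def\<close>)
  thus "\<exists>C\<ge>0. \<forall>\<zeta> t. Im \<zeta> \<le> - (2 * \<delta>) \<longrightarrow>
      cmod (exp (- \<i> * Complex (K + t) e * \<zeta>)) * p i (ray g K e t) \<le> C * (exp (K * Im \<zeta>) * growth c \<zeta>) * exp (- \<delta> * \<bar>t\<bar>)"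
    using C(1) by (intro exI[of _ "C * exp (\<delta> * K)"]) auto
qed

lemma gate_piece:
  assumes g: "g \<in> Oexp sc p {-\<infinity>, \<infinity>}" and K: "K \<ge> 0" and c: "c > 0"
  shows "contour_piece K c (\<lambda>t. if \<bar>t\<bar> \<le> c then Complex K t else Complex K (c * sgn t)) (gate g K c)"
  unfolding contour_piece_def
proof (intro conjI allI impI)
  let ?\<gamma> = "\<lambda>t. if \<bar>t\<bar> \<le> c then Complex K t else Complex K (c * sgn t)"
  \<comment> \<open>Beyond the segment the path stands still while the integrand vanishes; written
    as a clamping it is visibly continuous.\<close>
  have "?\<gamma> = (\<lambda>t. Complex K (max (- c) (min c t)))" using c by (auto simp: fun_eq_iff sgn_if)
  moreover have "continuous_on UNIV (\<lambda>t. Complex K (max (- c) (min c t)))" by (intro continuous_intros)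
  ultimately show "continuous_on UNIV ?\<gamma>" by metis
  have gc: "continuous_on UNIV (\<lambda>t. sc \<i> (g (Complex K t)))"
    by (intro continuous_on_scale_lcs continuous_intros continuous_on_compose2[OF hol_space_continuous_on[OF Oexp_pm_growth(1)[OF g] open_UNIV]]) auto
  have "continuous_on ({- c<..<c} \<union> {t. c < \<bar>t\<bar>}) (gate g K c)"
  proof (rule continuous_on_open_Un)
    show "open {t. c < \<bar>t\<bar>}" by (intro open_Collect_less continuous_intros)
    show "continuous_on {- c<..<c} (gate g K c)" by (rule continuous_on_eq[OF continuous_on_subset[OF gc]]) (auto simp: gate_def)
    show "continuous_on {t. c < \<bar>t\<bar>} (gate g K c)" by (rule continuous_on_eq[OF continuous_on_const[of _ 0]]) (auto simp: gate_def)
  qed auto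
  moreover have "- {c, - c} = {- c<..<c} \<union> {t. c < \<bar>t\<bar>}" using c by auto
  ultimately show "\<exists>S. finite S \<and> continuous_on (- S) (gate g K c)" by (metis finite.emptyI finite.insertI)
  fix i and \<delta> :: real assume \<delta>: "\<delta> > 0"
  have "compact ((\<lambda>t. p i (sc \<i> (g (Complex K t)))) ` {- c..c})"
    by (intro compact_continuous_image continuous_on_seminorm continuous_on_subset[OF gc]) auto
  then obtain M where M: "\<And>t. t \<in> {- c..c} \<Longrightarrow> \<bar>p i (sc \<i> (g (Complex K t)))\<bar> \<le> M"
    by (metis bounded_iff compact_imp_bounded imageI real_norm_def)
  have M0: "M \<ge> 0" using order_trans[OF abs_ge_zero M[of 0]] c by simp
  have "cmod (exp (- \<i> * ?\<gamma> t * \<zeta>)) * p i (gate g K c t) \<le> M * exp (\<delta> * c) * (exp (K * Im \<zeta>) * growth c \<zeta>) * exp (- \<delta> * \<bar>t\<bar>)" for \<zeta> t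
  proof (cases "\<bar>t\<bar> \<le> c")
    case True
    have "t * Re \<zeta> \<le> \<bar>t\<bar> * \<bar>Re \<zeta>\<bar>" by (simp add: abs_mult[symmetric])
    also have "\<dots> \<le> c * \<bar>Re \<zeta>\<bar>" using True by (intro mult_right_mono) auto
    finally have tr: "t * Re \<zeta> \<le> c * \<bar>Re \<zeta>\<bar>" .
    have dt: "\<delta> * \<bar>t\<bar> \<le> \<delta> * c" using True \<delta> by (intro mult_left_mono) auto
    have "cmod (exp (- \<i> * ?\<gamma> t * \<zeta>)) * p i (gate g K c t) \<le> exp (K * Im \<zeta> + t * Re \<zeta>) * M"
      unfolding cmod_exp_fourier using True M[of t] by (simp add: gate_def abs_le_iff)
    also have "\<dots> \<le> exp (\<delta> * c + (K * Im \<zeta> + c * \<bar>Re \<zeta>\<bar>) + - \<delta> * \<bar>t\<bar>) * M"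
      using M0 tr dt by (intro mult_right_mono) auto
    finally show ?thesis by (simp only: exp_add mult_ac)
  qed (use M0 in \<open>simp add: gate_def\<close>)
  thus "\<exists>C\<ge>0. \<forall>\<zeta> t. Im \<zeta> \<le> - (2 * \<delta>) \<longrightarrow>
      cmod (exp (- \<i> * ?\<gamma> t * \<zeta>)) * p i (gate g K c t) \<le> C * (exp (K * Im \<zeta>) * growth c \<zeta>) * exp (- \<delta> * \<bar>t\<bar>)"
    using M0 by (intro exI[of _ "M * exp (\<delta> * c)"]) auto
qed

text \<open>The Laplace transform over the contour \<open>+\<infinity> - ic \<rightarrow> K - ic \<rightarrow> K + ic \<rightarrow> +\<infinity> + ic\<close>.\<close>

definition end_transform :: "(complex \<Rightarrow> 'e) \<Rightarrow> real \<Rightarrow> real \<Rightarrow> complex \<Rightarrow> 'e" where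
  "end_transform g K c \<zeta> = piece_int (\<lambda>t. Complex (K + t) c) (ray g K c) \<zeta>
    - piece_int (\<lambda>t. Complex (K + t) (- c)) (ray g K (- c)) \<zeta>
    + piece_int (\<lambda>t. if \<bar>t\<bar> \<le> c then Complex K t else Complex K (c * sgn t)) (gate g K c) \<zeta>"

text \<open>With a primitive \<open>P\<close> the three pieces telescope: the values at the corners
  \<open>K \<plusminus> \<i> * c\<close> cancel and only the far ends remain.\<close>

lemma end_transform_limit:
  assumes g: "g \<in> Oexp sc p {-\<infinity>, \<infinity>}" and c: "c > 0" and K: "K \<ge> 0" and z: "Im \<zeta> < 0" and y: "y \<in> lcs_dual sc"
    and P: "\<And>w. (P has_field_derivative exp (- \<i> * w * \<zeta>) * y (g w)) (at w)"
  shows "(\<lambda>n. P (Complex (K + real n) c) - P (Complex (K + real n) (- c))) \<longlonglongrightarrow> y (end_transform g K c \<zeta>)"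
proof -
  define u where "u w = exp (- \<i> * w * \<zeta>) * y (g w)" for w
  have P': "\<And>z. z \<in> UNIV \<Longrightarrow> (P has_field_derivative u z) (at z)" using P by (simp add: u_def)
  have cont: "continuous_on UNIV u"
    unfolding u_def by (intro continuous_intros dual_continuous_on[OF y] hol_space_continuous_on[OF Oexp_pm_growth(1)[OF g]]) auto
  have ray: "(\<lambda>n. P (Complex (K + real n) e) - P (Complex K e)) \<longlonglongrightarrow> y (piece_int (\<lambda>t. Complex (K + t) e) (ray g K e) \<zeta>)" if e: "\<bar>e\<bar> = c" for e
  proof -
    note pc = ray_piece[OF g K e c]
    have eq: "(\<lambda>t. y (ray g K e t) * exp (- \<i> * Complex (K + t) e * \<zeta>)) = (\<lambda>t. if 0 \<le> t then 1 * u (Complex K e + cor t * 1) else 0)"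
      by (auto simp: fun_eq_iff ray_def u_def dual_zero[OF y] Complex_eq algebra_simps)
    have "(\<lambda>n. P (Complex K e + cor (0 + real n) * 1) - P (Complex K e + cor 0 * 1)) \<longlonglongrightarrow>
        (LINT t|lborel. (if 0 \<le> t then 1 * u (Complex K e + cor t * 1) else 0))"
      using dual_piece_int(2)[OF pc K _ z y] c unfolding eq by (intro halfline_integral_limit[OF P' cont]) auto
    thus ?thesis using dual_piece_int(1)[OF pc K _ z y] c unfolding eq by (simp add: Complex_eq algebra_simps)
  qed
  have gate: "y (piece_int (\<lambda>t. if \<bar>t\<bar> \<le> c then Complex K t else Complex K (c * sgn t)) (gate g K c) \<zeta>) = P (Complex K c) - P (Complex K (- c))"
  proof -
    have "y (piece_int (\<lambda>t. if \<bar>t\<bar> \<le> c then Complex K t else Complex K (c * sgn t)) (gate g K c) \<zeta>) =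
        (LINT t|lborel. y (gate g K c t) * exp (- \<i> * (if \<bar>t\<bar> \<le> c then Complex K t else Complex K (c * sgn t)) * \<zeta>))"
      using dual_piece_int(1)[OF gate_piece[OF g K c] K _ z y] c by simp
    also have "\<dots> = (LINT t|lborel. indicator {- c..c} t *\<^sub>R (\<i> * u (cor K + cor t * \<i>)))"
      by (intro Bochner_Integration.integral_cong refl) (auto simp: gate_def u_def dual_zero[OF y] dual_scale[OF y] indicator_def Complex_eq mult_ac)
    also have "\<dots> = P (cor K + cor c * \<i>) - P (cor K + cor (- c) * \<i>)"
      by (rule affine_path_integral[OF P' cont]) (use c in auto)
    finally show ?thesis by (simp add: Complex_eq mult.commute)
  qed
  have "(\<lambda>n. (P (Complex (K + real n) c) - P (Complex K c)) - (P (Complex (K + real n) (- c)) - P (Complex K (- c)))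
      + (P (Complex K c) - P (Complex K (- c)))) \<longlonglongrightarrow> y (end_transform g K c \<zeta>)"
    unfolding end_transform_def dual_add[OF y] dual_diff[OF y] gate using c by (intro tendsto_intros ray) auto
  thus ?thesis by (simp add: algebra_simps)
qed

text \<open>In the limit formula \<open>K\<close> survives only as an offset of the sequence, which
  is why it is a natural number here. Different heights are compared along the segments
  \<open>Re w = n\<close> between them: these keep off the real axis, where no growth bound for
  \<open>g\<close> is available, and the integrand tends to zero on them.\<close>

lemma end_transform_indep:
  assumes g: "g \<in> Oexp sc p {-\<infinity>, \<infinity>}" and c: "c > 0" "c' > 0" and z: "Im \<zeta> < 0"
  shows "end_transform g (real K) c \<zeta> = end_transform g 0 c' \<zeta>"
proof (rule dual_separates)
  fix y assume y: "y \<in> lcs_dual sc"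
  define u where "u w = exp (- \<i> * w * \<zeta>) * y (g w)" for w
  have "u holomorphic_on UNIV" unfolding u_def by (intro holomorphic_intros hol_space_dual[OF Oexp_pm_growth(1)[OF g] open_UNIV y])
  then obtain P where P: "\<And>w. (P has_field_derivative exp (- \<i> * w * \<zeta>) * y (g w)) (at w)"
    using primitive_exists[of UNIV u] by (auto simp: u_def)
  define D where "D e x = P (Complex x e) - P (Complex x (- e))" for e x
  have lim1: "(\<lambda>n. D c (real n)) \<longlonglongrightarrow> y (end_transform g (real K) c \<zeta>)"
  proof (rule LIMSEQ_offset[of _ K])
    show "(\<lambda>n. D c (real (n + K))) \<longlonglongrightarrow> y (end_transform g (real K) c \<zeta>)"
      using end_transform_limit[OF g c(1) _ z y P, of "real K"] by (simp add: D_def add.commute)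
  qed
  have lim2: "(\<lambda>n. D c' (real n)) \<longlonglongrightarrow> y (end_transform g 0 c' \<zeta>)"
    using end_transform_limit[OF g c(2) _ z y P, of 0] by (simp add: D_def)
  obtain i B where B: "B \<ge> 0" "\<And>x. cmod (y x) \<le> B * p i x" using dual_bounded[OF y] by blast
  define r where "r = min c c'"
  define R where "R = max c c'"
  define \<delta> where "\<delta> = - Im \<zeta> / 2"
  have rd: "r > 0" "\<delta> > 0" using c z by (auto simp: r_def \<delta>_def)
  obtain C where C: "C \<ge> 0" "\<And>z. r \<le> \<bar>Im z\<bar> \<Longrightarrow> \<bar>Im z\<bar> \<le> R \<Longrightarrow> p i (restr off_real g z) \<le> C * growth \<delta> z"
    using slow_growthE[OF OexpD(2)[OF Oexp_pm_growth(2)[OF g]] rd] by metis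
  have ub: "cmod (u w) \<le> B * C * growth R \<zeta> * exp (- \<delta> * real n)" if w: "Re w = real n" "r \<le> \<bar>Im w\<bar>" "\<bar>Im w\<bar> \<le> R" for w n
  proof -
    have pg: "p i (g w) \<le> C * exp (\<delta> * real n)" using C(2)[OF w(2,3)] w(1,2) rd by (auto simp: restr_def split: if_splits)
    have "Im w * Re \<zeta> \<le> \<bar>Im w\<bar> * \<bar>Re \<zeta>\<bar>" by (simp add: abs_mult[symmetric])
    also have "\<dots> \<le> R * \<bar>Re \<zeta>\<bar>" using w by (intro mult_right_mono) auto
    finally have im: "Im w * Re \<zeta> \<le> R * \<bar>Re \<zeta>\<bar>" .
    have "cmod (u w) = exp (Re w * Im \<zeta> + Im w * Re \<zeta>) * cmod (y (g w))" by (simp add: u_def norm_mult)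
    also have "\<dots> \<le> exp (Re w * Im \<zeta> + R * \<bar>Re \<zeta>\<bar>) * (B * (C * exp (\<delta> * real n)))"
      using im B(2)[of "g w"] mult_left_mono[OF pg B(1)] by (intro mult_mono) auto
    also have "\<dots> = B * C * exp (Re w * Im \<zeta> + R * \<bar>Re \<zeta>\<bar> + \<delta> * real n)" by (simp add: exp_add)
    also have "Re w * Im \<zeta> + R * \<bar>Re \<zeta>\<bar> + \<delta> * real n = R * \<bar>Re \<zeta>\<bar> + - \<delta> * real n"
      using w(1) by (simp add: \<delta>_def algebra_simps)
    finally show ?thesis by (simp only: exp_add mult.assoc)
  qed
  have small: "(\<lambda>n. P (Complex (real n) (s * c)) - P (Complex (real n) (s * c'))) \<longlonglongrightarrow> 0" if s: "\<bar>s\<bar> = 1" for s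
  proof (rule Lim_null_comparison)
    show "(\<lambda>n. B * C * growth R \<zeta> * exp (- \<delta> * real n) * \<bar>c - c'\<bar>) \<longlonglongrightarrow> 0"
      by (intro tendsto_mult_left_zero tendsto_mult_right_zero exp_minus_real_tendsto_0 rd)
    have "cmod (P (Complex (real n) (s * c)) - P (Complex (real n) (s * c'))) \<le> B * C * growth R \<zeta> * exp (- \<delta> * real n) * cmod (Complex (real n) (s * c) - Complex (real n) (s * c'))" for n
    proof (rule primitive_bound)
      fix w assume w: "w \<in> closed_segment (Complex (real n) (s * c')) (Complex (real n) (s * c))"
      hence "Re w = real n" "Im w \<in> closed_segment (s * c') (s * c)" by (auto simp: closed_segment_same_Re)
      hence "Re w = real n" "r \<le> \<bar>Im w\<bar>" "\<bar>Im w\<bar> \<le> R"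
        using s c by (auto simp: closed_segment_eq_real_ivl r_def R_def abs_if split: if_splits)
      thus "cmod (u w) \<le> B * C * growth R \<zeta> * exp (- \<delta> * real n)" by (rule ub)
      show "(P has_field_derivative u w) (at w)" using P by (simp add: u_def)
    qed
    moreover have "cmod (Complex (real n) (s * c) - Complex (real n) (s * c')) = \<bar>c - c'\<bar>" for n
      using s by (simp add: cmod_def right_diff_distrib[symmetric] abs_mult)
    ultimately show "\<forall>\<^sub>F n in sequentially. cmod (P (Complex (real n) (s * c)) - P (Complex (real n) (s * c'))) \<le> B * C * growth R \<zeta> * exp (- \<delta> * real n) * \<bar>c - c'\<bar>"
      by (intro always_eventually) simp
  qed
  have "(\<lambda>n. (P (Complex (real n) (1 * c)) - P (Complex (real n) (1 * c'))) - (P (Complex (real n) ((-1) * c)) - P (Complex (real n) ((-1) * c')))) \<longlonglongrightarrow> 0 - 0"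
    by (intro tendsto_diff small) auto
  hence "(\<lambda>n. D c (real n) - D c' (real n)) \<longlonglongrightarrow> 0" by (simp add: D_def algebra_simps)
  moreover have "(\<lambda>n. D c (real n) - D c' (real n)) \<longlonglongrightarrow> y (end_transform g (real K) c \<zeta>) - y (end_transform g 0 c' \<zeta>)"
    by (intro tendsto_diff lim1 lim2)
  ultimately show "y (end_transform g (real K) c \<zeta>) = y (end_transform g 0 c' \<zeta>)" using LIMSEQ_unique by fastforce
qed

text \<open>By \<open>end_transform_indep\<close> the values \<open>K = 0\<close> and
  \<open>c = 1\<close> stand for all others.\<close>

definition end_lower :: "(complex \<Rightarrow> 'e) \<Rightarrow> complex \<Rightarrow> 'e" where
  "end_lower g = restr {z. Im z < 0} (end_transform g 0 1)"

text \<open>For the \<open>k\<close>-th estimate the contour is pushed out to \<open>K = k\<close>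
  and narrowed to \<open>c = 1 / (2 * k)\<close>. The first gives the factor
  \<open>exp (- k * \<bar>Im \<zeta>\<bar>)\<close>, the second keeps the growth in
  \<open>Re \<zeta>\<close> below the rate \<open>1 / k\<close>, and \<open>2 * c = 1 / k\<close>
  matches the half-plane in question.\<close>

lemma end_lower_FO:
  assumes g: "g \<in> Oexp sc p {-\<infinity>, \<infinity>}"
  shows "end_lower g \<in> FO_pinf sc p" unfolding FO_pinf_iff
proof (intro conjI allI impI)
  have "restr {z. Im z < 0} (piece_int (\<lambda>t. Complex (0 + t) 1) (ray g 0 1))
      - restr {z. Im z < 0} (piece_int (\<lambda>t. Complex (0 + t) (- 1)) (ray g 0 (- 1)))
      + restr {z. Im z < 0} (piece_int (\<lambda>t. if \<bar>t\<bar> \<le> 1 then Complex 0 t else Complex 0 (1 * sgn t)) (gate g 0 1)) \<in> hol_space sc {z. Im z < 0}"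
    by (intro fun_subspace_add[OF fun_subspace_hol_space] fun_subspace_diff[OF fun_subspace_hol_space]
        piece_hol(2)[OF ray_piece[OF g]] piece_hol(2)[OF gate_piece[OF g]]) auto
  also have "restr {z. Im z < 0} (piece_int (\<lambda>t. Complex (0 + t) 1) (ray g 0 1))
      - restr {z. Im z < 0} (piece_int (\<lambda>t. Complex (0 + t) (- 1)) (ray g 0 (- 1)))
      + restr {z. Im z < 0} (piece_int (\<lambda>t. if \<bar>t\<bar> \<le> 1 then Complex 0 t else Complex 0 (1 * sgn t)) (gate g 0 1)) = end_lower g"
    by (simp add: end_lower_def end_transform_def[abs_def] restr_def fun_eq_iff)
  finally show "end_lower g \<in> hol_space sc {z. Im z < 0}" .
next
  fix k :: nat and i assume k: "1 \<le> k"
  define c where "c = 1 / (2 * real k)"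
  have c: "c > 0" "c \<ge> 0" "c \<le> 1 / real k" "2 * c = 1 / real k" using k by (auto simp: c_def field_simps)
  have K: "real k \<ge> 0" by simp
  obtain C1 where C1: "C1 \<ge> 0" "\<And>\<zeta>. Im \<zeta> \<le> - (2 * c) \<Longrightarrow> p i (piece_int (\<lambda>t. Complex (real k + t) c) (ray g (real k) c) \<zeta>) \<le> C1 * (exp (real k * Im \<zeta>) * growth c \<zeta>)"
    using piece_bound[OF ray_piece[OF g K _ c(1)] K c(2,1), of c i] c by auto
  obtain C2 where C2: "C2 \<ge> 0" "\<And>\<zeta>. Im \<zeta> \<le> - (2 * c) \<Longrightarrow> p i (piece_int (\<lambda>t. Complex (real k + t) (- c)) (ray g (real k) (- c)) \<zeta>) \<le> C2 * (exp (real k * Im \<zeta>) * growth c \<zeta>)"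
    using piece_bound[OF ray_piece[OF g K _ c(1)] K c(2,1), of "- c" i] c by auto
  obtain C3 where C3: "C3 \<ge> 0" "\<And>\<zeta>. Im \<zeta> \<le> - (2 * c) \<Longrightarrow> p i (piece_int (\<lambda>t. if \<bar>t\<bar> \<le> c then Complex (real k) t else Complex (real k) (c * sgn t)) (gate g (real k) c) \<zeta>) \<le> C3 * (exp (real k * Im \<zeta>) * growth c \<zeta>)"
    using piece_bound[OF gate_piece[OF g K c(1)] K c(2,1), of i] by auto
  have "p i (end_lower g \<zeta>) \<le> (C1 + C2 + C3) * exp (1 / real k * cmod \<zeta> - real k * \<bar>Im \<zeta>\<bar>)" if z: "Im \<zeta> \<le> - (1 / real k)" for \<zeta>
  proof -
    have "1 / real k > 0" using k by simp
    hence z0: "Im \<zeta> < 0" and z2: "Im \<zeta> \<le> - (2 * c)" using z c by linarith+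
    have "end_lower g \<zeta> = end_transform g (real k) c \<zeta>"
      using end_transform_indep[OF g c(1) zero_less_one z0, of k] z0 by (simp add: end_lower_def restr_def)
    hence "p i (end_lower g \<zeta>) \<le> (C1 + C2 + C3) * (exp (real k * Im \<zeta>) * growth c \<zeta>)"
      unfolding end_transform_def distrib_right using C1(2)[OF z2] C2(2)[OF z2] C3(2)[OF z2]
      by (simp only:) (intro order_trans[OF seminorm_add] order_trans[OF seminorm_diff] add_mono)
    also have "\<dots> \<le> (C1 + C2 + C3) * exp (1 / real k * cmod \<zeta> - real k * \<bar>Im \<zeta>\<bar>)"
    proof (rule mult_left_mono)
      have "c * \<bar>Re \<zeta>\<bar> \<le> 1 / real k * cmod \<zeta>" using c abs_Re_le_cmod[of \<zeta>] by (intro mult_mono) auto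
      thus "exp (real k * Im \<zeta>) * growth c \<zeta> \<le> exp (1 / real k * cmod \<zeta> - real k * \<bar>Im \<zeta>\<bar>)"
        unfolding exp_add[symmetric] using z0 by simp
    qed (use C1 C2 C3 in simp)
    finally show ?thesis .
  qed
  thus "\<exists>C\<ge>0. \<forall>z. Im z \<le> - (1 / real k) \<longrightarrow> p i (end_lower g z) \<le> C * exp (1 / real k * cmod z - real k * \<bar>Im z\<bar>)"
    using C1 C2 C3 by (intro exI[of _ "C1 + C2 + C3"]) auto
qed

text \<open>The contour of \<open>end_transform\<close> for \<open>K = 0\<close>, applied to a
  scalar function.\<close>

definition end_functional :: "(complex \<Rightarrow> complex) \<Rightarrow> real \<Rightarrow> complex" where
  "end_functional v c = (LINT t|lborel. (if 0 \<le> t then v (Complex t c) else 0)) - (LINT t|lborel. (if 0 \<le> t then v (Complex t (- c)) else 0))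
    + (LINT t|lborel. (if \<bar>t\<bar> \<le> c then \<i> * v (Complex 0 t) else 0))"

lemma end_lower_fubini:
  assumes g: "g \<in> Oexp sc p {-\<infinity>, \<infinity>}" and y: "y \<in> lcs_dual sc" and \<phi>: "\<phi> \<in> P_step n" "n \<ge> 1"
    and b: "0 < b" "b < 1 / real n" and c: "0 < c" "c < 1 / real n"
  shows "line_int (- b) (\<lambda>w. \<phi> w * y (end_lower g w)) = end_functional (\<lambda>z. y (g z) * fourier \<phi> z) c"
proof -
  define A where "A \<gamma> a w = (LINT t|lborel. y (a t) * exp (- \<i> * \<gamma> t * w))" for \<gamma> :: "real \<Rightarrow> complex" and a :: "real \<Rightarrow> 'e" and w
  let ?r = "\<lambda>e t. Complex (0 + t) e"
  let ?v = "\<lambda>t. if \<bar>t\<bar> \<le> c then Complex 0 t else Complex 0 (c * sgn t)"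
  have c': "c \<ge> 0" "\<bar>c\<bar> = c" "\<bar>- c\<bar> = c" using c by auto
  note pc = ray_piece[OF g order_refl c'(2) c(1)] ray_piece[OF g order_refl c'(3) c(1)] gate_piece[OF g order_refl c(1)]
  have eq: "y (end_lower g w) = A (?r c) (ray g 0 c) w - A (?r (- c)) (ray g 0 (- c)) w + A ?v (gate g 0 c) w" if "Im w = - b" for w
  proof -
    have w: "Im w < 0" using that b by simp
    have "end_lower g w = end_transform g 0 c w" using end_transform_indep[OF g zero_less_one c(1) w, of 0] w by (simp add: end_lower_def restr_def)
    thus ?thesis
      using dual_piece_int(1)[OF pc(1) order_refl c'(1) w y] dual_piece_int(1)[OF pc(2) order_refl c'(1) w y] dual_piece_int(1)[OF pc(3) order_refl c'(1) w y]
      by (simp add: end_transform_def A_def dual_add[OF y] dual_diff[OF y])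
  qed
  have im: "\<bar>Im (?r c t)\<bar> \<le> c" "\<bar>Im (?r (- c) t)\<bar> \<le> c" "\<bar>Im (?v t)\<bar> \<le> c" for t
    using c by (auto simp: abs_mult sgn_if)
  note f1 = piece_fubini[OF pc(1) order_refl c'(1) y \<phi> b c(2) im(1)]
  note f2 = piece_fubini[OF pc(2) order_refl c'(1) y \<phi> b c(2) im(2)]
  note f3 = piece_fubini[OF pc(3) order_refl c'(1) y \<phi> b c(2) im(3)]
  have "line_int (- b) (\<lambda>w. \<phi> w * y (end_lower g w)) =
      (LINT s|lborel. (\<phi> (Complex s (- b)) * A (?r c) (ray g 0 c) (Complex s (- b)) - \<phi> (Complex s (- b)) * A (?r (- c)) (ray g 0 (- c)) (Complex s (- b)))
        + \<phi> (Complex s (- b)) * A ?v (gate g 0 c) (Complex s (- b)))"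
    unfolding line_int_def by (intro Bochner_Integration.integral_cong refl) (simp add: eq algebra_simps)
  also have "\<dots> = line_int (- b) (\<lambda>w. \<phi> w * A (?r c) (ray g 0 c) w) - line_int (- b) (\<lambda>w. \<phi> w * A (?r (- c)) (ray g 0 (- c)) w)
      + line_int (- b) (\<lambda>w. \<phi> w * A ?v (gate g 0 c) w)" using f1(2) f2(2) f3(2) unfolding line_int_def A_def
    by (subst Bochner_Integration.integral_add, simp, simp, subst Bochner_Integration.integral_diff, simp_all)
  also have "\<dots> = (LINT t|lborel. y (ray g 0 c t) * fourier \<phi> (?r c t)) - (LINT t|lborel. y (ray g 0 (- c) t) * fourier \<phi> (?r (- c) t))
      + (LINT t|lborel. y (gate g 0 c t) * fourier \<phi> (?v t))" unfolding A_def f1(1) f2(1) f3(1) ..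
  also have "\<dots> = end_functional (\<lambda>z. y (g z) * fourier \<phi> z) c" unfolding end_functional_def
    by (intro arg_cong2[where f = "(+)"] arg_cong2[where f = "(-)"] Bochner_Integration.integral_cong refl)
      (auto simp: ray_def gate_def dual_zero[OF y] dual_scale[OF y])
  finally show ?thesis .
qed

text \<open>The reflected contour surrounds the other half of the axis. The vertical segments
  cancel, and the half-lines join to the two full boundary lines.\<close>

lemma end_functional_sum:
  assumes int: "integrable lborel (\<lambda>t. v (Complex t c))" "integrable lborel (\<lambda>t. v (Complex t (- c)))"
  shows "end_functional v c + end_functional (\<lambda>z. - v (- z)) c = line_int c v - line_int (- c) v"
proof -
  have minus: "(LINT t|lborel. (if Q t then - f t else 0)) = - (LINT t|lborel. (if Q t then f t else (0::complex)))" for Q :: "real \<Rightarrow> bool" and f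
    by (subst integral_minus[symmetric], intro Bochner_Integration.integral_cong) auto
  have neg: "- Complex t e = Complex (- t) (- e)" for t e by (simp add: complex_eq_iff)
  have r: "(LINT t|lborel. (if 0 \<le> t then - v (- Complex t e) else 0)) = - (LINT t|lborel. (if t \<le> 0 then v (Complex t (- e)) else 0))" for e
    unfolding minus neg integral_le_half_reflect[of "\<lambda>t. v (Complex t (- e))"] ..
  have vt: "(LINT t|lborel. (if \<bar>t\<bar> \<le> c then \<i> * - v (- Complex 0 t) else 0)) = - (LINT t|lborel. (if \<bar>t\<bar> \<le> c then \<i> * v (Complex 0 t) else 0))"
    using integral_reflect_real[of "\<lambda>t. if \<bar>t\<bar> \<le> c then \<i> * v (Complex 0 t) else 0"]
    unfolding mult_minus_right minus neg minus_zero by simp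
  show ?thesis unfolding end_functional_def r vt line_int_def minus_minus integral_halves[OF int(1)] integral_halves[OF int(2)] by simp
qed

text \<open>As \<open>G\<close> extends across the axis by \<open>g\<close>, the boundary of the
  strip may be cut at the imaginary axis into a contour around each end. The right one belongs to
  \<open>end_lower g\<close>, the left one after reflection to
  \<open>end_lower (reflect g)\<close>.\<close>

theorem Phi_Oexp_pm:
  assumes G: "G \<in> Oexp_pm sc p"
  shows "\<exists>H\<in>FO_pm sc p. H - Phi G \<in> Oexp_0"
proof -
  obtain g where g: "g \<in> Oexp sc p {-\<infinity>, \<infinity>}" "G = restr off_real g"
    using G by (auto simp: Oexp_pm_def finite_part_simps)
  have GA: "G \<in> Oexp_R" using G Oexp_pm_subset by blast
  have rg: "reflect g \<in> Oexp sc p {-\<infinity>, \<infinity>}" using entire_in_Oexp_pm(1)[OF reflect_hol_UNIV[OF Oexp_pm_growth(1)[OF g(1)]]]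
      reflect_Oexp[OF Oexp_pm_growth(2)[OF g(1)]] by (simp add: reflect_restr)
  define H where "H = glue (end_lower g) (end_lower (reflect g))"
  have H: "H \<in> FO_pm sc p" unfolding FO_pm_iff H_def using end_lower_FO[OF g(1)] end_lower_FO[OF rg] by blast
  have "H - Phi G \<in> Oexp_0"
  proof (rule Phi_unique[OF GA subsetD[OF FO_pm_subset H]])
    fix n \<phi> y assume a: "1 \<le> n" "\<phi> \<in> P_step n" "y \<in> lcs_dual sc"
    define c where "c = 1 / (2 * real (Suc n))"
    have c: "0 < c" "c < 1 / real (Suc n)" "c < 1 / real n" using P_step_Suc_half[OF a(1)] by (auto simp: c_def)
    define v where "v z = y (g z) * fourier \<phi> z" for z
    have int: "integrable lborel (\<lambda>t. v (Complex t e))" if e: "\<bar>e\<bar> = c" for e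
      using gamma_int_integrable[OF dual_slow_holomorphic[OF GA a(3)] fourier_P_step[OF a(2,1) lessI], of e] e c
      by (simp add: v_def g(2) restr_def mult.commute) (cases "e = 0"; simp)
    have "gamma_int (\<lambda>z. y (H z)) \<phi> c = line_int (- c) (\<lambda>w. \<phi> w * y (end_lower g w)) + line_int (- c) (\<lambda>w. \<phi> (- w) * y (end_lower (reflect g) w))"
      unfolding H_def by (intro glue_gamma_int FO_pinf_lower_slow end_lower_FO g rg a c)
    also have "line_int (- c) (\<lambda>w. \<phi> w * y (end_lower g w)) = end_functional v c"
      unfolding v_def by (rule end_lower_fubini[OF g(1) a(3,2,1) c(1,3,1,3)])
    also have "line_int (- c) (\<lambda>w. \<phi> (- w) * y (end_lower (reflect g) w)) = end_functional (\<lambda>z. y (reflect g z) * fourier (\<lambda>w. \<phi> (- w)) z) c"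
      by (rule end_lower_fubini[OF rg a(3) P_step_reflect[OF a(2,1)] a(1) c(1,3,1,3)])
    also have "(\<lambda>z. y (reflect g z) * fourier (\<lambda>w. \<phi> (- w)) z) = (\<lambda>z. - v (- z))"
      by (simp add: reflect_def v_def dual_minus[OF a(3)] fourier_reflect)
    also have "end_functional v c + end_functional (\<lambda>z. - v (- z)) c = line_int c v - line_int (- c) v"
      using c by (intro end_functional_sum int) auto
    also have "\<dots> = gamma_int (\<lambda>z. y (G z)) (fourier \<phi>) c"
      using c by (simp add: gamma_int_def line_int_def v_def g(2) restr_def mult.commute)
    finally show "\<exists>b c. 0 < b \<and> b < 1 / real n \<and> 0 < c \<and> c < 1 / real (Suc n) \<and>
        gamma_int (\<lambda>z. y (H z)) \<phi> b = gamma_int (\<lambda>z. y (G z)) (fourier \<phi>) c" using c by blast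
  qed
  thus ?thesis using H by blast
qed

end

section \<open>Transforms of functions that decay at infinity\<close>

text \<open>The half-line from \<open>- \<i>\<close> in the direction \<open>s\<close> is turned to
  the negative imaginary axis through the quarter-plane of the points
  \<open>s * t - \<i> * r\<close>, on which \<open>u\<close> decays like
  \<open>exp (- d * (t + r))\<close>. The sign of \<open>s\<close> makes the kernel decay along the
  horizontal half-line.\<close>

lemma quarter_plane_integral:
  fixes f :: "complex \<Rightarrow> complex"
  assumes hol: "f holomorphic_on {w. Im w < 0}"
    and bd: "\<And>k::nat. k \<ge> 1 \<Longrightarrow> \<exists>C\<ge>0. \<forall>w. Im w \<le> - (1 / real k) \<longrightarrow> cmod (f w) \<le> C * exp (1 / real k * cmod w - real k * \<bar>Im w\<bar>)"
    and s: "\<bar>s\<bar> = 1" "s * Im z < 0"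
  defines "u \<equiv> \<lambda>w. exp (- \<i> * w * z) * f w"
  shows "integrable lborel (\<lambda>t. if 0 \<le> t then cor s * u (Complex (s * t) (- 1)) else 0)"
    and "(LINT t|lborel. (if 0 \<le> t then cor s * u (Complex (s * t) (- 1)) else 0)) =
      (LINT t|lborel. (if 1 \<le> t then - \<i> * u (Complex 0 (- t)) else 0))"
proof -
  have z: "Im z \<noteq> 0" and sz: "s * Im z = - \<bar>Im z\<bar>" using s by (auto simp: abs_if split: if_splits)
  \<comment> \<open>One \<open>k\<close> does two things:
    \<open>1 / k \<le> \<bar>Im z\<bar> / 2\<close> leaves half of the decay of the kernel in
    \<open>t\<close>, and \<open>k > \<bar>Re z\<bar> + 2\<close> beats the growth of the kernel and
    of the weight in \<open>r\<close>.\<close>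
  obtain k :: nat where k0: "2 / \<bar>Im z\<bar> < k" "\<bar>Re z\<bar> + 2 < k"
    using reals_Archimedean2[of "max (2 / \<bar>Im z\<bar>) (\<bar>Re z\<bar> + 2)"] by auto
  have "0 < real k" using k0(2) by linarith
  hence k: "k \<ge> 1" "1 / real k \<le> \<bar>Im z\<bar> / 2" "1 / real k \<le> 1" using k0 z by (auto simp: field_simps)
  obtain C where C: "C \<ge> 0" "\<And>w. Im w \<le> - (1 / real k) \<Longrightarrow> cmod (f w) \<le> C * exp (1 / real k * cmod w - real k * \<bar>Im w\<bar>)"
    using bd[OF k(1)] by metis
  define d where "d = min (\<bar>Im z\<bar> / 2) 1"
  have d: "d > 0" "d \<le> \<bar>Im z\<bar> / 2" "d \<le> 1" using z by (auto simp: d_def)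
  have ub: "cmod (u (Complex (s * t) (- r))) \<le> C * exp (- d * (t + r))" if tr: "t \<ge> 0" "r \<ge> 1" for t r
  proof -
    let ?w = "Complex (s * t) (- r)"
    have "cmod ?w \<le> t + r" using cmod_le[of ?w] tr s(1) by (simp add: abs_mult)
    hence "1 / real k * cmod ?w \<le> 1 / real k * (t + r)" using k by (intro mult_left_mono) auto
    also have "\<dots> \<le> \<bar>Im z\<bar> / 2 * t + 1 * r" unfolding distrib_left using k tr by (intro add_mono mult_right_mono) auto
    finally have 1: "1 / real k * cmod ?w \<le> \<bar>Im z\<bar> / 2 * t + r" by simp
    have 2: "(\<bar>Re z\<bar> + 2) * r \<le> real k * r" using k0 tr by (intro mult_right_mono) auto
    have 3: "- r * Re z \<le> r * \<bar>Re z\<bar>" using tr by (metis abs_ge_minus_self mult.commute mult_left_mono mult_minus_left mult_minus_right order_trans zero_le_one)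
    have 4: "d * t \<le> \<bar>Im z\<bar> / 2 * t" "d * r \<le> 1 * r" using mult_right_mono[OF d(2), of t] mult_right_mono[OF d(3), of r] tr by linarith+
    have "s * t * Im z = - \<bar>Im z\<bar> * t" using sz by (metis mult.assoc mult.commute)
    hence ex: "(s * t * Im z + - r * Re z) + (1 / real k * cmod ?w - real k * r) \<le> - d * (t + r)" using 1 2 3 4 by (simp add: algebra_simps)
    have "1 / real k \<le> 1" using k by simp
    hence "- r \<le> - (1 / real k)" using tr by linarith
    hence "cmod (f ?w) \<le> C * exp (1 / real k * cmod ?w - real k * r)" using C(2)[of ?w] tr by simp
    hence "cmod (u ?w) \<le> exp (s * t * Im z + - r * Re z) * (C * exp (1 / real k * cmod ?w - real k * r))"
      unfolding u_def norm_mult cmod_exp_fourier by (simp add: mult_left_mono)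
    also have "\<dots> = C * exp ((s * t * Im z + - r * Re z) + (1 / real k * cmod ?w - real k * r))" by (simp only: exp_add mult_ac)
    also have "\<dots> \<le> C * exp (- d * (t + r))" using C(1) ex by (intro mult_left_mono) (auto simp only: exp_le_cancel_iff)
    finally show ?thesis .
  qed
  have uhol: "u holomorphic_on {w. Im w < 0}" unfolding u_def by (intro holomorphic_intros hol)
  have ucont: "continuous_on {w. Im w < 0} u" using uhol by (rule holomorphic_on_imp_continuous_on)
  obtain P where P: "\<And>w. w \<in> {w. Im w < 0} \<Longrightarrow> (P has_field_derivative u w) (at w)"
    using primitive_exists[OF convex_open_halfplanes(3,4) uhol] by blast
  have "continuous_on UNIV (\<lambda>t. u (Complex (s * t) (- 1)))" by (rule continuous_on_compose2[OF ucont]) (auto intro!: continuous_intros)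
  hence [measurable]: "(\<lambda>t. u (Complex (s * t) (- 1))) \<in> borel_measurable borel" by (rule borel_measurable_continuous_onI)
  show int1: "integrable lborel (\<lambda>t. if 0 \<le> t then cor s * u (Complex (s * t) (- 1)) else 0)"
  proof (rule integrable_if_exp_bound[OF _ d(1)])
    show "norm (if 0 \<le> t then cor s * u (Complex (s * t) (- 1)) else 0) \<le> C * exp (- d * \<bar>t\<bar>)" for t
    proof (cases "0 \<le> t")
      case True
      have "C * exp (- d * (t + 1)) \<le> C * exp (- d * \<bar>t\<bar>)" using True C(1) d by (intro mult_left_mono) auto
      thus ?thesis using ub[OF True order_refl] True s(1) by (simp add: norm_mult)
    qed (use C in simp)
  qed measurable
  have "continuous_on UNIV (\<lambda>t. u (Complex 0 (- max t 1)))" by (rule continuous_on_compose2[OF ucont]) (auto intro!: continuous_intros)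
  hence [measurable]: "(\<lambda>t. u (Complex 0 (- max t 1))) \<in> borel_measurable borel" by (rule borel_measurable_continuous_onI)
  have eq2: "(\<lambda>t. if 1 \<le> t then - \<i> * u (Complex 0 (- max t 1)) else 0) = (\<lambda>t. if 1 \<le> t then - \<i> * u (Complex 0 (- t)) else 0)"
    by (auto simp: fun_eq_iff max_def)
  have "integrable lborel (\<lambda>t. if 1 \<le> t then - \<i> * u (Complex 0 (- max t 1)) else 0)"
  proof (rule integrable_if_exp_bound[OF _ d(1)])
    show "norm (if 1 \<le> t then - \<i> * u (Complex 0 (- max t 1)) else 0) \<le> C * exp (- d * \<bar>t\<bar>)" for t
      using ub[of 0 t] C(1) by (auto simp: norm_mult max_def)
  qed measurable
  hence int2: "integrable lborel (\<lambda>t. if 1 \<le> t then - \<i> * u (Complex 0 (- t)) else 0)" unfolding eq2 .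
  have c1: "Complex (s * t) (- 1) = - \<i> + cor t * cor s" for t by (simp add: complex_eq_iff mult.commute)
  have c2: "Complex 0 (- t) = 0 + cor t * (- \<i>)" for t by (simp add: complex_eq_iff)
  have l1: "(\<lambda>n. P (Complex (s * (0 + real n)) (- 1)) - P (Complex (s * 0) (- 1))) \<longlonglongrightarrow>
      (LINT t|lborel. (if 0 \<le> t then cor s * u (Complex (s * t) (- 1)) else 0))"
    using int1 unfolding c1 by (intro halfline_integral_limit[OF P ucont]) auto
  have l2: "(\<lambda>n. P (Complex 0 (- (1 + real n))) - P (Complex 0 (- 1))) \<longlonglongrightarrow>
      (LINT t|lborel. (if 1 \<le> t then - \<i> * u (Complex 0 (- t)) else 0))"
    using int2 unfolding c2 by (intro halfline_integral_limit[OF P ucont]) auto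
  \<comment> \<open>The far ends of both half-lines are joined by a segment on which
    \<open>t + r = 1 + real n\<close>.\<close>
  have small: "(\<lambda>n. P (Complex (s * real n) (- 1)) - P (Complex 0 (- (1 + real n)))) \<longlonglongrightarrow> 0"
  proof (rule Lim_null_comparison)
    show "(\<lambda>n. C * exp (- d * real n) * (2 * real n)) \<longlonglongrightarrow> 0" using d(1) by real_asymp
    have "cmod (P (Complex (s * real n) (- 1)) - P (Complex 0 (- (1 + real n)))) \<le> C * exp (- d * real n) * cmod (Complex (s * real n) (- 1) - Complex 0 (- (1 + real n)))" for n
    proof (rule primitive_bound)
      fix w assume "w \<in> closed_segment (Complex 0 (- (1 + real n))) (Complex (s * real n) (- 1))"
      then obtain x where x: "0 \<le> x" "x \<le> 1" "w = (1 - x) *\<^sub>R Complex 0 (- (1 + real n)) + x *\<^sub>R Complex (s * real n) (- 1)"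
        by (auto simp: in_segment)
      define t where "t = x * real n"
      define r where "r = 1 + (1 - x) * real n"
      have tr: "t \<ge> 0" "r \<ge> 1" "t + r = 1 + real n" using x mult_nonneg_nonneg[of "1 - x" "real n"] by (simp_all add: t_def r_def algebra_simps)
      have w: "w = Complex (s * t) (- r)" by (simp add: x(3) t_def r_def complex_eq_iff algebra_simps)
      have "C * exp (- d * (t + r)) \<le> C * exp (- d * real n)" using C(1) d tr(3) by (intro mult_left_mono) auto
      thus "cmod (u w) \<le> C * exp (- d * real n)" using ub[OF tr(1,2)] w by simp
      show "(P has_field_derivative u w) (at w)" using tr w by (intro P) simp
    qed
    moreover have "cmod (Complex (s * real n) (- 1) - Complex 0 (- (1 + real n))) \<le> 2 * real n" for n
      using cmod_le[of "Complex (s * real n) (- 1) - Complex 0 (- (1 + real n))"] s(1) by (simp add: abs_mult)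
    ultimately have "cmod (P (Complex (s * real n) (- 1)) - P (Complex 0 (- (1 + real n)))) \<le> C * exp (- d * real n) * (2 * real n)" for n
      using C(1) by (meson mult_left_mono mult_nonneg_nonneg exp_ge_zero order_trans)
    thus "\<forall>\<^sub>F n in sequentially. cmod (P (Complex (s * real n) (- 1)) - P (Complex 0 (- (1 + real n)))) \<le> C * exp (- d * real n) * (2 * real n)"
      by (intro always_eventually) simp
  qed
  have "(\<lambda>n. (P (Complex (s * (0 + real n)) (- 1)) - P (Complex (s * 0) (- 1))) - (P (Complex 0 (- (1 + real n))) - P (Complex 0 (- 1)))) \<longlonglongrightarrow>
      (LINT t|lborel. (if 0 \<le> t then cor s * u (Complex (s * t) (- 1)) else 0)) - (LINT t|lborel. (if 1 \<le> t then - \<i> * u (Complex 0 (- t)) else 0))"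
    by (intro tendsto_diff l1 l2)
  hence "(\<lambda>n. P (Complex (s * real n) (- 1)) - P (Complex 0 (- (1 + real n)))) \<longlonglongrightarrow>
      (LINT t|lborel. (if 0 \<le> t then cor s * u (Complex (s * t) (- 1)) else 0)) - (LINT t|lborel. (if 1 \<le> t then - \<i> * u (Complex 0 (- t)) else 0))"
    by simp
  from LIMSEQ_unique[OF this small]
  show "(LINT t|lborel. (if 0 \<le> t then cor s * u (Complex (s * t) (- 1)) else 0)) =
      (LINT t|lborel. (if 1 \<le> t then - \<i> * u (Complex 0 (- t)) else 0))" by simp
qed

context sc_lcs
begin

text \<open>The decay rate and constant may depend on the radius \<open>N\<close>, because
  holomorphy is local; a density decaying faster than every kernel thus gives an entire
  function.\<close>

lemma entire_piece:
  assumes \<gamma>: "continuous_on UNIV \<gamma>" and S: "finite S" "continuous_on (- S) a"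
    and dom: "\<And>i N. N \<ge> 0 \<Longrightarrow> \<exists>C. \<exists>d>0. \<forall>z t. cmod z \<le> N \<longrightarrow> cmod (exp (- \<i> * \<gamma> t * z)) * p i (a t) \<le> C * exp (- d * \<bar>t\<bar>)"
  shows "piece_int \<gamma> a \<in> hol_space sc UNIV"
    and "y \<in> lcs_dual sc \<Longrightarrow> y (piece_int \<gamma> a z) = (LINT t|lborel. exp (- \<i> * \<gamma> t * z) * y (a t))"
proof -
  have kc: "continuous_on (- S) (\<lambda>t. exp (- \<i> * \<gamma> t * \<zeta>))" for \<zeta>
    by (intro continuous_intros continuous_on_subset[OF \<gamma>]) auto
  have kh: "(\<lambda>\<zeta>. exp (- \<i> * \<gamma> t * \<zeta>)) holomorphic_on UNIV" for t by (intro holomorphic_intros)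
  have d: "\<exists>r>0. \<exists>C. \<exists>d>0. \<forall>w\<in>ball z r. \<forall>t. cmod (exp (- \<i> * \<gamma> t * w)) * p i (a t) \<le> C * exp (- d * \<bar>t\<bar>)" for z i
  proof -
    obtain C d where "d > 0" and *: "\<forall>w t. cmod w \<le> cmod z + 1 \<longrightarrow> cmod (exp (- \<i> * \<gamma> t * w)) * p i (a t) \<le> C * exp (- d * \<bar>t\<bar>)"
      using dom[of "cmod z + 1" i] by auto
    have "cmod w \<le> cmod z + 1" if "w \<in> ball z 1" for w using that norm_triangle_ineq2[of w z] by (simp add: dist_norm norm_minus_commute)
    thus ?thesis using * \<open>d > 0\<close> by (intro exI[of _ 1] conjI exI[of _ C] exI[of _ d]) auto
  qed
  have "restr UNIV (piece_int \<gamma> a) \<in> hol_space sc UNIV"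
    using hol_space_kernel_integral(2)[OF open_UNIV S kc kh d] by (simp add: piece_int_def[abs_def])
  thus "piece_int \<gamma> a \<in> hol_space sc UNIV" by (simp add: restr_def)
  show "y (piece_int \<gamma> a z) = (LINT t|lborel. exp (- \<i> * \<gamma> t * z) * y (a t))" if y: "y \<in> lcs_dual sc"
    using dual_pint(1)[OF hol_space_kernel_integral(1)[OF open_UNIV S kc kh d] y] by (simp add: piece_int_def dual_scale[OF y])
qed

text \<open>Off the real axis \<open>Phi h\<close> is the transform of \<open>h\<close> over \<open>Im = - 1\<close>, cut off at one end. Removing the
  cut-off on the other half-line costs an entire function, and the half-line without cut-off can be
  rotated to the negative imaginary axis, where \<open>h\<close> decays faster than every exponential.\<close>

lemma Phi_FO_pinf:
  assumes h: "h \<in> FO_pinf sc p"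
  shows "h \<in> Oexp_R" "Phi h \<in> Oexp_pm sc p"
proof -
  have h_hol: "h \<in> hol_space sc {z. Im z < 0}" using h by (simp add: FO_pinf_iff)
  have h0: "h z = 0" if "\<not> Im z < 0" for z using lower_slow_zero[OF FO_pinf_lower_slow[OF h] that] .
  have "glue (- h) 0 \<in> Oexp_R" using fun_subspace_minus[OF fun_subspace_FO_pinf h] fun_subspace_zero[OF fun_subspace_FO_pinf]
    by (intro glue_Oexp FO_pinf_lower_slow)
  moreover have "glue (- h) 0 = h" by (simp add: glue_def fun_eq_iff)
  ultimately show hA: "h \<in> Oexp_R" by simp
  have h_cont: "continuous_on {z. Im z < 0} h" by (rule hol_space_continuous_on[OF h_hol open_Im(2)])
  define L where "L t = Complex t (- 1)" for t :: real
  have Lc: "continuous_on S L" for S unfolding L_def by (intro continuous_intros)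
  have hL: "continuous_on S (\<lambda>t. h (L t))" for S by (rule continuous_on_compose2[OF h_cont Lc]) (auto simp: L_def)
  \<comment> \<open>Each half-line carries the cut-off that decays along it:
    \<open>cutoff (- L t)\<close> for \<open>s = 1\<close> and \<open>t \<ge> 0\<close>,
    \<open>cutoff (L t)\<close> for \<open>s = - 1\<close> and \<open>t \<le> 0\<close>. Hence the
    integrals converge for all \<open>z\<close>.\<close>
  define side where "side s t = (if 0 \<le> s * t then sc (cutoff (- cor s * L t)) (h (L t)) else 0)" for s t :: real
  have side_cont: "continuous_on (- {0}) (side s)" if s: "\<bar>s\<bar> = 1" for s
  proof -
    have cc: "continuous_on S (\<lambda>t. sc (cutoff (- cor s * L t)) (h (L t)))" for S
      by (intro continuous_on_scale_lcs hL continuous_on_cutoff[where r = 1] continuous_intros Lc) (auto simp: L_def s)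
    have "continuous_on ({t. 0 < s * t} \<union> {t. s * t < 0}) (side s)"
    proof (rule continuous_on_open_Un)
      show "open {t. 0 < s * t}" "open {t. s * t < 0}" by (intro open_Collect_less continuous_intros)+
      show "continuous_on {t. 0 < s * t} (side s)" by (rule continuous_on_eq[OF cc]) (auto simp: side_def)
      show "continuous_on {t. s * t < 0} (side s)" by (rule continuous_on_eq[OF continuous_on_const[of _ 0]]) (auto simp: side_def)
    qed
    moreover have "- {0} = {t. 0 < s * t} \<union> {t. s * t < 0}" using s by (auto simp: abs_if split: if_splits)
    ultimately show ?thesis by simp
  qed
  have side_dom: "\<exists>C. \<exists>d>0. \<forall>z t. cmod z \<le> N \<longrightarrow> cmod (exp (- \<i> * L t * z)) * p i (side s t) \<le> C * exp (- d * \<bar>t\<bar>)"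
    if s: "\<bar>s\<bar> = 1" and N: "N \<ge> 0" for s N i
  proof -
    obtain C where C: "C \<ge> 0" "\<And>z. - 1 \<le> Im z \<Longrightarrow> Im z \<le> - 1 \<Longrightarrow> p i (h z) \<le> C * growth 1 z"
      using lower_slowE[OF FO_pinf_lower_slow[OF h] zero_less_one zero_less_one] by metis
    \<comment> \<open>Of the rate \<open>N + 2\<close>, the part \<open>N\<close> is spent on the
      kernel and \<open>1\<close> on the growth of \<open>h\<close>; the rate \<open>1\<close>
      remains.\<close>
    have "N + 2 > 0" using N by simp
    then obtain B where B: "B \<ge> 0" "\<And>z. \<bar>Im z\<bar> \<le> 1 \<Longrightarrow> cmod (cutoff z) \<le> B * exp ((N + 2) * Re z)"
      using cutoff_bound by metis
    have "cmod (exp (- \<i> * L t * z)) * p i (side s t) \<le> C * B * exp N * exp (- 1 * \<bar>t\<bar>)" if z: "cmod z \<le> N" for z t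
    proof (cases "0 \<le> s * t")
      case True
      hence st: "s * t = \<bar>t\<bar>" using s by (metis abs_mult abs_of_nonneg mult_1)
      have "t * Im z \<le> \<bar>t\<bar> * N" using z abs_Im_le_cmod[of z] by (intro mult_le_abs_mult) linarith
      moreover have "- Re z \<le> N" using z abs_Re_le_cmod[of z] by linarith
      ultimately have 1: "cmod (exp (- \<i> * L t * z)) \<le> exp (\<bar>t\<bar> * N + N)" unfolding cmod_exp_fourier by (simp add: L_def)
      have 2: "cmod (cutoff (- cor s * L t)) \<le> B * exp ((N + 2) * - \<bar>t\<bar>)"
        using B(2)[of "- cor s * L t"] s st by (simp add: L_def)
      have 3: "p i (h (L t)) \<le> C * exp \<bar>t\<bar>" using C(2)[of "L t"] by (simp add: L_def)
      have "cmod (exp (- \<i> * L t * z)) * p i (side s t) \<le> exp (\<bar>t\<bar> * N + N) * ((B * exp ((N + 2) * - \<bar>t\<bar>)) * (C * exp \<bar>t\<bar>))"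
        unfolding side_def seminorm_scale if_P[OF True] using 1 2 3 B(1) C(1) by (intro mult_mono) auto
      also have "\<dots> = C * B * (exp (\<bar>t\<bar> * N + N) * exp ((N + 2) * - \<bar>t\<bar>) * exp \<bar>t\<bar>)" by simp
      also have "exp (\<bar>t\<bar> * N + N) * exp ((N + 2) * - \<bar>t\<bar>) * exp \<bar>t\<bar> = exp N * exp (- 1 * \<bar>t\<bar>)"
        unfolding exp_add[symmetric] by (simp add: algebra_simps)
      finally show ?thesis by (simp add: mult.assoc)
    qed (use C(1) B(1) in \<open>simp add: side_def\<close>)
    thus ?thesis by (intro exI[of _ "C * B * exp N"] exI[of _ 1]) auto
  qed
  note side = entire_piece[OF Lc _ side_cont side_dom, simplified]
  define D where "D t = Complex 0 (- t)" for t :: real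
  define down where "down t = (if 1 \<le> t then sc (- \<i>) (h (D t)) else 0)" for t
  have Dc: "continuous_on S D" for S unfolding D_def by (intro continuous_intros)
  have down_cont: "continuous_on (- {1}) down"
  proof -
    have cc: "continuous_on {1<..} (\<lambda>t. sc (- \<i>) (h (D t)))"
      by (intro continuous_on_scale_lcs continuous_intros continuous_on_compose2[OF h_cont Dc]) (auto simp: D_def)
    have "continuous_on ({1<..} \<union> {..<1}) down"
    proof (rule continuous_on_open_Un)
      show "continuous_on {1<..} down" by (rule continuous_on_eq[OF cc]) (auto simp: down_def)
      show "continuous_on {..<1} down" by (rule continuous_on_eq[OF continuous_on_const[of _ 0]]) (auto simp: down_def)
    qed auto
    moreover have "- {1} = {1<..} \<union> {..<1::real}" by auto
    ultimately show ?thesis by simp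
  qed
  have down_dom: "\<exists>C. \<exists>d>0. \<forall>z t. cmod z \<le> N \<longrightarrow> cmod (exp (- \<i> * D t * z)) * p i (down t) \<le> C * exp (- d * \<bar>t\<bar>)"
    if N: "N \<ge> 0" for N i
  proof -
    obtain k :: nat where k: "N + 2 < k" using reals_Archimedean2 by blast
    hence k1: "k \<ge> 1" using N by linarith
    obtain C where C: "C \<ge> 0" "\<And>z. Im z \<le> - (1 / real k) \<Longrightarrow> p i (h z) \<le> C * exp (1 / real k * cmod z - real k * \<bar>Im z\<bar>)"
      using FO_pinfE[OF h k1] by metis
    have "cmod (exp (- \<i> * D t * z)) * p i (down t) \<le> C * exp (- 1 * \<bar>t\<bar>)" if z: "cmod z \<le> N" for z t
    proof (cases "1 \<le> t")
      case True
      have "- t * Re z \<le> t * N" using mult_le_abs_mult[of "- Re z" N t] z abs_Re_le_cmod[of z] True by (simp add: mult.commute)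
      hence 1: "cmod (exp (- \<i> * D t * z)) \<le> exp (t * N)" unfolding cmod_exp_fourier by (simp add: D_def)
      have "1 / real k \<le> 1" using k1 by simp
      hence "Im (D t) \<le> - (1 / real k)" using True by (simp add: D_def)
      moreover have "cmod (D t) = t" using True by (simp add: D_def cmod_def)
      ultimately have "p i (h (D t)) \<le> C * exp (1 / real k * t - real k * t)" using C(2)[of "D t"] True by (simp add: D_def)
      also have "\<dots> \<le> C * exp (1 * t - (N + 2) * t)"
        using C(1) k \<open>1 / real k \<le> 1\<close> True by (intro mult_left_mono exp_le_cancel_iff[THEN iffD2] diff_mono mult_right_mono) auto
      finally have "cmod (exp (- \<i> * D t * z)) * p i (down t) \<le> exp (t * N) * (C * exp (1 * t - (N + 2) * t))"
        using mult_mono[OF 1 _ _ seminorm_nonneg] by (simp add: down_def seminorm_scale True)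
      also have "\<dots> = C * (exp (t * N) * exp (1 * t - (N + 2) * t))" by simp
      also have "exp (t * N) * exp (1 * t - (N + 2) * t) = exp (- 1 * \<bar>t\<bar>)"
        unfolding exp_add[symmetric] using True by (simp add: algebra_simps)
      finally show ?thesis .
    qed (use C(1) in \<open>simp add: down_def\<close>)
    thus ?thesis by (intro exI[of _ C] exI[of _ 1]) auto
  qed
  note down = entire_piece[OF Dc _ down_cont down_dom, simplified]
  \<comment> \<open>The same function arises from both half-planes. On the lower one the cut-off is
    removed from the right half-line, on the upper one from the left half-line; either bare
    half-line rotates to the integral of \<open>down\<close>, and the orientation makes the sign the
    same.\<close>
  define V where "V = piece_int L (side (- 1)) - piece_int L (side 1) + piece_int D down"
  have V_hol: "V \<in> hol_space sc UNIV" unfolding V_def using side(1)[of "- 1"] side(1)[of 1] down(1)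
    by (intro fun_subspace_add[OF fun_subspace_hol_space] fun_subspace_diff[OF fun_subspace_hol_space]) auto
  have eq: "Phi h z = V z" if z: "Im z \<noteq> 0" for z
  proof (rule dual_separates)
    fix y assume y: "y \<in> lcs_dual sc"
    define f where "f w = y (h w)" for w
    define u where "u w = exp (- \<i> * w * z) * f w" for w
    obtain i B where B: "B \<ge> 0" "\<And>x. cmod (y x) \<le> B * p i x" using dual_bounded[OF y] by blast
    have f_hol: "f holomorphic_on {w. Im w < 0}" unfolding f_def by (rule hol_space_dual[OF h_hol open_Im(2) y])
    have f_bd: "\<exists>C\<ge>0. \<forall>w. Im w \<le> - (1 / real k) \<longrightarrow> cmod (f w) \<le> C * exp (1 / real k * cmod w - real k * \<bar>Im w\<bar>)" if k: "k \<ge> 1" for k :: nat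
    proof -
      obtain C where C: "C \<ge> 0" "\<And>z. Im z \<le> - (1 / real k) \<Longrightarrow> p i (h z) \<le> C * exp (1 / real k * cmod z - real k * \<bar>Im z\<bar>)"
        using FO_pinfE[OF h k] by metis
      have "cmod (f w) \<le> B * C * exp (1 / real k * cmod w - real k * \<bar>Im w\<bar>)" if "Im w \<le> - (1 / real k)" for w
        using B(2)[of "h w"] mult_left_mono[OF C(2)[OF that] B(1)] by (simp add: f_def mult.assoc)
      thus ?thesis using B(1) C(1) by (intro exI[of _ "B * C"]) auto
    qed
    have quarter: "integrable lborel (\<lambda>t. if 0 \<le> t then cor s * u (Complex (s * t) (- 1)) else 0)"
      "(LINT t|lborel. (if 0 \<le> t then cor s * u (Complex (s * t) (- 1)) else 0)) = y (piece_int D down z)"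
      if s: "\<bar>s\<bar> = 1" "s * Im z < 0" for s
    proof -
      show "integrable lborel (\<lambda>t. if 0 \<le> t then cor s * u (Complex (s * t) (- 1)) else 0)"
        unfolding u_def by (rule quarter_plane_integral(1)[OF f_hol f_bd s])
      have "(LINT t|lborel. (if 0 \<le> t then cor s * u (Complex (s * t) (- 1)) else 0)) = (LINT t|lborel. (if 1 \<le> t then - \<i> * u (Complex 0 (- t)) else 0))"
        unfolding u_def by (rule quarter_plane_integral(2)[OF f_hol f_bd s])
      also have "\<dots> = y (piece_int D down z)" unfolding down(2)[OF y]
        by (intro Bochner_Integration.integral_cong refl) (auto simp: down_def D_def u_def f_def dual_scale[OF y] dual_zero[OF y] dual_minus[OF y])
      finally show "(LINT t|lborel. (if 0 \<le> t then cor s * u (Complex (s * t) (- 1)) else 0)) = y (piece_int D down z)" .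
    qed
    have yV: "y (V z) = (LINT t|lborel. (if t \<le> 0 then cutoff (L t) * u (L t) else 0)) - (LINT t|lborel. (if 0 \<le> t then cutoff (- L t) * u (L t) else 0)) + y (piece_int D down z)"
    proof -
      have "y (piece_int L (side (- 1)) z) = (LINT t|lborel. (if t \<le> 0 then cutoff (L t) * u (L t) else 0))"
        unfolding side(2)[of "- 1", simplified, OF y]
        by (intro Bochner_Integration.integral_cong refl) (auto simp: side_def u_def f_def dual_scale[OF y] dual_zero[OF y])
      moreover have "y (piece_int L (side 1) z) = (LINT t|lborel. (if 0 \<le> t then cutoff (- L t) * u (L t) else 0))"
        unfolding side(2)[of 1, simplified, OF y]
        by (intro Bochner_Integration.integral_cong refl) (auto simp: side_def u_def f_def dual_scale[OF y] dual_zero[OF y])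
      ultimately show ?thesis by (simp add: V_def dual_add[OF y] dual_diff[OF y])
    qed
    have cr: "cutoff (- w) = 1 - cutoff w" for w using cutoff_reflect[of w] by (simp add: eq_diff_eq add.commute)
    consider "Im z < 0" | "Im z > 0" using z by linarith
    thus "y (Phi h z) = y (V z)"
    proof cases
      case 1
      have "Phi h z = - (cut_vec h 1 z - cut_vec h (- 1) z)" using 1 lower_slow_zero[OF lower_transform_slow[OF reflect_Oexp[OF hA]], of "- z"]
        by (simp add: Phi_def glue_def lower_transform_def restr_def)
      \<comment> \<open>\<open>h\<close> vanishes on the upper half-plane, so the upper boundary
        line contributes nothing.\<close>
      moreover have "y (cut_vec h 1 z) = 0" using dual_cut_vec[OF hA _ _ 1 y, of 1] by (simp add: line_int_def h0 dual_zero[OF y])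
      moreover have cv: "y (cut_vec h (- 1) z) = (LINT t|lborel. cutoff (L t) * u (L t))"
        using dual_cut_vec[OF hA _ _ 1 y, of "- 1"] by (simp add: line_int_def L_def u_def f_def mult_ac)
      ultimately have "y (Phi h z) = (LINT t|lborel. cutoff (L t) * u (L t))" by (simp add: dual_minus[OF y] dual_diff[OF y])
      also have int: "integrable lborel (\<lambda>t. cutoff (L t) * u (L t))"
        using dual_pint(2)[OF cut_hol(1)[OF hA _ _ 1] y, of "- 1"] by (simp add: L_def u_def f_def dual_scale[OF y] mult_ac)
      note integral_halves[OF int]
      also have "(LINT t|lborel. (if 0 \<le> t then cutoff (L t) * u (L t) else 0)) =
          (LINT t|lborel. (if 0 \<le> t then u (L t) else 0)) - (LINT t|lborel. (if 0 \<le> t then cutoff (- L t) * u (L t) else 0))"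
      proof -
        have q: "integrable lborel (\<lambda>t. if 0 \<le> t then u (L t) else 0)" using quarter(1)[of 1] 1 by (simp add: L_def cong: if_cong)
        have "integrable lborel (\<lambda>t. (if 0 \<le> t then u (L t) else 0) - (if 0 \<le> t then cutoff (L t) * u (L t) else 0))"
          using q integrable_half(1)[OF int] by (rule Bochner_Integration.integrable_diff)
        moreover have e: "(\<lambda>t. (if 0 \<le> t then u (L t) else 0) - (if 0 \<le> t then cutoff (L t) * u (L t) else 0)) = (\<lambda>t. if 0 \<le> t then cutoff (- L t) * u (L t) else 0)"
          by (auto simp: fun_eq_iff cr algebra_simps)
        ultimately have "(LINT t|lborel. (if 0 \<le> t then cutoff (- L t) * u (L t) else 0)) = (LINT t|lborel. (if 0 \<le> t then u (L t) else 0)) - (LINT t|lborel. (if 0 \<le> t then cutoff (L t) * u (L t) else 0))"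
          unfolding e[symmetric] using q integrable_half(1)[OF int] by (intro Bochner_Integration.integral_diff)
        thus ?thesis by simp
      qed
      also have "(LINT t|lborel. (if 0 \<le> t then u (L t) else 0)) = y (piece_int D down z)"
        using quarter(2)[of 1] 1 by (simp add: L_def cong: if_cong)
      finally show ?thesis using yV by simp
    next
      case 2
      have mz: "Im (- z) < 0" using 2 by simp
      have "Phi h z = cut_vec (reflect h) 1 (- z) - cut_vec (reflect h) (- 1) (- z)" using 2 lower_slow_zero[OF lower_transform_slow[OF hA], of z]
        by (simp add: Phi_def glue_def lower_transform_def restr_def)
      moreover have "y (cut_vec (reflect h) (- 1) (- z)) = 0"
        using dual_cut_vec[OF reflect_Oexp[OF hA] _ _ mz y, of "- 1"] by (simp add: line_int_def reflect_def h0 dual_zero[OF y])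
      moreover have "y (cut_vec (reflect h) 1 (- z)) = line_int 1 (\<lambda>w. (\<lambda>w. - (cutoff (- w) * u w)) (- w))"
        using dual_cut_vec[OF reflect_Oexp[OF hA] _ _ mz y, of 1] by (simp add: reflect_def u_def f_def dual_minus[OF y] mult_ac)
      moreover have "line_int 1 (\<lambda>w. (\<lambda>w. - (cutoff (- w) * u w)) (- w)) = line_int (- 1) (\<lambda>w. - (cutoff (- w) * u w))"
        by (rule line_int_reflect)
      ultimately have "y (Phi h z) = - (LINT t|lborel. cutoff (- L t) * u (L t))" by (simp add: dual_diff[OF y] line_int_def L_def)
      also have int: "integrable lborel (\<lambda>t. cutoff (- L t) * u (L t))"
      proof -
        have "integrable lborel (\<lambda>t. exp (- \<i> * Complex t 1 * - z) * (cutoff (Complex t 1) * y (reflect h (Complex t 1))))"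
          using dual_pint(2)[OF cut_hol(1)[OF reflect_Oexp[OF hA] _ _ mz] y, of 1] by (simp add: dual_scale[OF y] mult.assoc)
        hence "integrable lborel (\<lambda>t. exp (- \<i> * Complex (0 + (- 1) * t) 1 * - z) * (cutoff (Complex (0 + (- 1) * t) 1) * y (reflect h (Complex (0 + (- 1) * t) 1))))"
          by (rule lborel_integrable_real_affine) simp
        hence "integrable lborel (\<lambda>t. - (exp (- \<i> * Complex (0 + (- 1) * t) 1 * - z) * (cutoff (Complex (0 + (- 1) * t) 1) * y (reflect h (Complex (0 + (- 1) * t) 1)))))"
          by (rule integrable_minus)
        moreover have "Complex (- t) 1 = - L t" for t by (simp add: L_def complex_eq_iff)
        ultimately show ?thesis by (simp add: reflect_def u_def f_def dual_minus[OF y] mult_ac)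
      qed
      note integral_halves[OF int]
      also have "(LINT t|lborel. (if t \<le> 0 then cutoff (- L t) * u (L t) else 0)) =
          (LINT t|lborel. (if t \<le> 0 then u (L t) else 0)) - (LINT t|lborel. (if t \<le> 0 then cutoff (L t) * u (L t) else 0))"
      proof -
        have "integrable lborel (\<lambda>t. - (if 0 \<le> t then cor (- 1) * u (Complex ((- 1) * t) (- 1)) else 0))"
          using 2 by (intro integrable_minus quarter(1)) auto
        hence "integrable lborel (\<lambda>t. - (if 0 \<le> 0 + (- 1) * t then cor (- 1) * u (Complex ((- 1) * (0 + (- 1) * t)) (- 1)) else 0))"
          by (rule lborel_integrable_real_affine) simp
        moreover have "(\<lambda>t. - (if 0 \<le> 0 + (- 1) * t then cor (- 1) * u (Complex ((- 1) * (0 + (- 1) * t)) (- 1)) else 0)) = (\<lambda>t. if t \<le> 0 then u (L t) else 0)"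
          by (auto simp: fun_eq_iff L_def)
        ultimately have q: "integrable lborel (\<lambda>t. if t \<le> 0 then u (L t) else 0)" by (simp only:)
        have e: "(\<lambda>t. (if t \<le> 0 then u (L t) else 0) - (if t \<le> 0 then cutoff (- L t) * u (L t) else 0)) = (\<lambda>t. if t \<le> 0 then cutoff (L t) * u (L t) else 0)"
          by (auto simp: fun_eq_iff cr algebra_simps)
        have "(LINT t|lborel. (if t \<le> 0 then cutoff (L t) * u (L t) else 0)) = (LINT t|lborel. (if t \<le> 0 then u (L t) else 0)) - (LINT t|lborel. (if t \<le> 0 then cutoff (- L t) * u (L t) else 0))"
          unfolding e[symmetric] using q integrable_half(2)[OF int] by (rule Bochner_Integration.integral_diff)
        thus ?thesis by simp
      qed
      also have "(LINT t|lborel. (if t \<le> 0 then u (L t) else 0)) = - y (piece_int D down z)"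
      proof -
        have "y (piece_int D down z) = (LINT t|lborel. (if 0 \<le> t then cor (- 1) * u (Complex ((- 1) * t) (- 1)) else 0))"
          using 2 by (intro quarter(2)[symmetric]) auto
        also have "\<dots> = (LINT t|lborel. - (if 0 \<le> t then u (L (- t)) else 0))"
          by (intro Bochner_Integration.integral_cong refl) (auto simp: L_def)
        also have "\<dots> = - (LINT t|lborel. (if t \<le> 0 then u (L t) else 0))"
          using integral_le_half_reflect[of "\<lambda>t. u (L t)"] by (simp only: integral_minus)
        finally show ?thesis by simp
      qed
      finally show ?thesis using yV by simp
    qed
  qed
  have Phi_A: "Phi h \<in> Oexp_R" by (rule Phi_Oexp[OF hA])
  have "Phi h = restr off_real V" using eq OexpD(1)[OF Phi_A] by (auto simp: fun_eq_iff restr_def hol_space_def)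
  thus "Phi h \<in> Oexp_pm sc p" using entire_in_Oexp_pm(2)[OF V_hol] Phi_A by simp
qed

text \<open>The upper component is a reflected function of the lower half-plane, so
  \<open>Phi_reflect\<close> reduces it to the case of \<open>FO_pinf\<close>.\<close>

theorem Phi_FO_pm:
  assumes H: "H \<in> FO_pm sc p"
  shows "Phi H \<in> Oexp_pm sc p"
proof -
  obtain n1 n2 where n: "n1 \<in> FO_pinf sc p" "n2 \<in> FO_pinf sc p" "H = glue n1 n2" using H by (auto simp: FO_pm_iff)
  have m: "- n1 \<in> FO_pinf sc p" "- n2 \<in> FO_pinf sc p" using n by (auto intro: fun_subspace_minus[OF fun_subspace_FO_pinf])
  have H_eq: "H = - n1 + reflect (- n2)" by (simp add: n(3) glue_def reflect_def fun_eq_iff)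
  note A1 = Phi_FO_pinf[OF m(1)] and A2 = Phi_FO_pinf[OF m(2)]
  have W: "x \<in> Oexp_pm sc p" if "x \<in> Oexp_0" for x using that Oexp_entire_subset_pm by blast
  note sub = fun_subspace_Oexp_pm
  have 1: "Phi (reflect (- n2)) \<in> Oexp_pm sc p" using fun_subspace_diff[OF sub reflect_Oexp_pm[OF A2(2)] W[OF Phi_reflect[OF A2(1)]]] by simp
  have 2: "(Phi (- n1) + Phi (reflect (- n2))) - Phi H \<in> Oexp_pm sc p" unfolding H_eq by (rule W[OF Phi_add[OF A1(1) reflect_Oexp[OF A2(1)]]])
  from fun_subspace_diff[OF sub fun_subspace_add[OF sub A1(2) 1] 2] show ?thesis by simp
qed

end

section \<open>Representatives of slow growth\<close>

definition flat :: "nat \<Rightarrow> real \<Rightarrow> real" where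
  "flat m t = (if t > 0 then (1 / t) ^ m * exp (- (1 / t)) else 0)"

lemma flat_tendsto_0: "(flat m \<longlongrightarrow> 0) (at 0)"
proof -
  have "((\<lambda>t. inverse t ^ m / exp (inverse t)) \<longlongrightarrow> 0) (at_right (0::real))"
    by (rule filterlim_compose[OF tendsto_power_div_exp_0 filterlim_inverse_at_top_right])
  moreover have "\<forall>\<^sub>F t in at_right 0. inverse t ^ m / exp (inverse t) = flat m t"
    using eventually_at_right_less by eventually_elim (simp add: flat_def exp_minus divide_simps)
  ultimately have r: "(flat m \<longlongrightarrow> 0) (at_right 0)" by (rule Lim_transform_eventually)
  have "\<forall>\<^sub>F t in at_left 0. 0 = flat m t" unfolding eventually_at_left_field by (intro exI[of _ "-1"]) (auto simp: flat_def)
  hence "(flat m \<longlongrightarrow> 0) (at_left 0)" by (rule Lim_transform_eventually[OF tendsto_const])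
  thus ?thesis using r by (rule filterlim_split_at)
qed

text \<open>The powers of \<open>1 / t\<close> are included in the family so that differentiation
  stays inside its linear span; derivatives of all orders remain explicit.\<close>

lemma flat_deriv: "(flat m has_real_derivative flat (m + 2) t - real m * flat (m + 1) t) (at t)"
proof -
  consider "t > 0" | "t < 0" | "t = 0" by linarith
  thus ?thesis
  proof cases
    case 1
    have "((\<lambda>t. 1 / t) has_real_derivative - ((1 / t) * (1 / t))) (at t)"
      using 1 by (auto intro!: derivative_eq_intros simp: field_simps power2_eq_square)
    hence "((\<lambda>t. (1 / t) ^ m) has_real_derivative - real m * (1 / t) ^ (m + 1)) (at t)"
      by (rule DERIV_cong[OF DERIV_power]) (cases m; simp add: algebra_simps add_divide_distrib diff_divide_distrib)
    moreover have "((\<lambda>t. exp (- (1 / t))) has_real_derivative exp (- (1 / t)) * (1 / t) ^ 2) (at t)"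
      using 1 by (auto intro!: derivative_eq_intros simp: field_simps power2_eq_square)
    ultimately have "((\<lambda>t. (1 / t) ^ m * exp (- (1 / t))) has_real_derivative
        - real m * (1 / t) ^ (m + 1) * exp (- (1 / t)) + exp (- (1 / t)) * (1 / t) ^ 2 * (1 / t) ^ m) (at t)" by (rule DERIV_mult)
    hence "((\<lambda>t. (1 / t) ^ m * exp (- (1 / t))) has_real_derivative
        flat (m + 2) t - real m * flat (m + 1) t) (at t)" using 1 by (simp add: flat_def power2_eq_square algebra_simps)
    thus ?thesis by (rule has_field_derivative_transform_within_open[of _ _ _ "{0<..}"]) (use 1 in \<open>auto simp: flat_def\<close>)
  next
    case 2
    have "((\<lambda>t. 0) has_real_derivative flat (m + 2) t - real m * flat (m + 1) t) (at t)" using 2 by (simp add: flat_def)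
    thus ?thesis by (rule has_field_derivative_transform_within_open[of _ _ _ "{..<0}"]) (use 2 in \<open>auto simp: flat_def\<close>)
  next
    case 3
    \<comment> \<open>At \<open>0\<close> the difference quotient of \<open>flat m\<close> is
      \<open>flat (m + 1)\<close> itself, which tends to \<open>0\<close>.\<close>
    have "(\<lambda>h. (flat m (0 + h) - flat m 0) / h) = flat (m + 1)" by (auto simp: flat_def fun_eq_iff)
    thus ?thesis using flat_tendsto_0[of "m + 1"] 3 by (simp add: DERIV_def flat_def)
  qed
qed

lemma flat_isCont: "isCont (flat m) t" using flat_deriv DERIV_isCont by blast

text \<open>A normalised primitive of a bump living between \<open>2\<close> and \<open>4\<close>.
  The derivative is part of the statement since it enters the right-hand side of the Cauchy-Riemann
  equation.\<close>

lemma smooth_cutoff_exists: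
  obtains \<psi> c where "\<And>t. (\<psi> has_real_derivative c * flat 0 ((t - 2) * (4 - t))) (at t)"
    "\<And>t. t \<le> 2 \<Longrightarrow> \<psi> t = 1" "\<And>t. 4 \<le> t \<Longrightarrow> \<psi> t = 0"
proof -
  let ?b = "\<lambda>t::real. flat 0 ((t - 2) * (4 - t))"
  have bc: "isCont ?b t" for t by (intro isCont_o2[OF _ flat_isCont] continuous_intros)
  have "continuous_on {0..t} ?b" for t using bc continuous_at_imp_continuous_on by blast
  define I where "I t = integral {0..t} ?b" for t
  have I: "(I has_real_derivative ?b t) (at t)" if "t > 0" for t
  proof -
    have "(I has_real_derivative ?b t) (at t within {0..t + 1})" unfolding I_def using that bc
      by (intro integral_has_real_derivative continuous_at_imp_continuous_on) auto
    thus ?thesis using that at_within_Icc_at[of 0 t "t + 1"] by simp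
  qed
  have eq: "\<exists>z>a. z < b \<and> I b - I a = (b - a) * ?b z" if "0 < a" "a < b" for a b using that by (intro MVT2 I) auto
  have nonpos: "?b z = 0" if "z \<le> 2 \<or> 4 \<le> z" for z
    using that mult_nonpos_nonneg[of "z - 2" "4 - z"] mult_nonneg_nonpos[of "z - 2" "4 - z"] by (auto simp: flat_def)
  obtain z where z: "z > 2" "z < 4" "I 4 - I 2 = (4 - 2) * ?b z" using eq[of 2 4] by auto
  have "?b z > 0" using z by (simp add: flat_def)
  hence pos: "I 4 - I 2 > 0" using z by simp
  \<comment> \<open>The primitive \<open>I\<close> starts at \<open>0\<close> and its derivative is
    known for \<open>t > 0\<close> only. Left of \<open>1\<close> the value is set to
    \<open>1\<close>, which agrees with the quotient between \<open>1\<close> and \<open>2\<close>,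
    where the bump vanishes.\<close>
  define \<psi> where "\<psi> t = (if t \<le> 1 then 1 else (I 4 - I t) / (I 4 - I 2))" for t
  have one: "\<psi> t = 1" if "t \<le> 2" for t
  proof (cases "1 < t \<and> t < 2")
    case True
    then obtain z where "z > t" "z < 2" "I 2 - I t = (2 - t) * ?b z" using eq[of t 2] by auto
    thus ?thesis using nonpos[of z] pos by (simp add: \<psi>_def)
  next
    case False
    hence "t \<le> 1 \<or> t = 2" using that by auto
    thus ?thesis using pos by (auto simp: \<psi>_def)
  qed
  have zero: "\<psi> t = 0" if "4 \<le> t" for t
  proof (cases "t = 4")
    case False
    hence "4 < t" using that by simp
    then obtain z where "z > 4" "I t - I 4 = (t - 4) * ?b z" using eq[of 4 t] that by auto
    thus ?thesis using nonpos[of z] that by (simp add: \<psi>_def)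
  qed (simp add: \<psi>_def)
  have deriv: "(\<psi> has_real_derivative - (1 / (I 4 - I 2)) * ?b t) (at t)" for t
  proof (cases "t < 2")
    case True
    have "((\<lambda>t. 1) has_real_derivative - (1 / (I 4 - I 2)) * ?b t) (at t)" using nonpos[of t] True by simp
    thus ?thesis by (rule has_field_derivative_transform_within_open[of _ _ _ "{..<2}"]) (use True one in auto)
  next
    case False
    have "((\<lambda>t. (I 4 - I t) / (I 4 - I 2)) has_real_derivative - (1 / (I 4 - I 2)) * ?b t) (at t)"
      using False pos by (auto intro!: derivative_eq_intros I)
    thus ?thesis by (rule has_field_derivative_transform_within_open[of _ _ _ "{1<..}"]) (use False in \<open>auto simp: \<psi>_def\<close>)
  qed
  show ?thesis by (rule that[OF deriv one zero])
qed

text \<open>The level sets of \<open>level\<close> approach the real axis at infinity, so that each \<open>S\<^sub>n({\<plusminus>\<infinity>})\<close> meets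
  \<open>{level \<le> 4}\<close> in a bounded set.\<close>

definition level :: "complex \<Rightarrow> real" where
  "level z = (Im z)\<^sup>2 * (1 + (Re z)\<^sup>2)"

text \<open>Positive exactly for \<open>2 < level z < 4\<close>, the zone in which the cut-off
  varies; elsewhere \<open>flat m (bump_arg z) = 0\<close>.\<close>

definition bump_arg :: "complex \<Rightarrow> real" where
  "bump_arg z = (level z - 2) * (4 - level z)"

lemma continuous_level: "continuous_on S level" "continuous_on S bump_arg" unfolding bump_arg_def level_def by (intro continuous_intros)+

lemma bump_arg_real: "Im z = 0 \<Longrightarrow> bump_arg z < 0" by (simp add: bump_arg_def level_def)

lemma bump_arg_outside: "level z \<le> 2 \<or> 4 \<le> level z \<Longrightarrow> bump_arg z \<le> 0"
  using mult_nonpos_nonneg[of "level z - 2" "4 - level z"] mult_nonneg_nonpos[of "level z - 2" "4 - level z"] by (auto simp: bump_arg_def)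

lemma open_bump_arg: "open {z. bump_arg z < 0}" "open {z. level z < 2}" using continuous_level by (auto intro!: open_Collect_less continuous_intros)

lemma real_partialI:
  assumes "((\<lambda>h. r (z + cor h * v)) has_real_derivative d) (at 0)"
  shows "has_partial_deriv (*) v (\<lambda>z. cor (r z)) z (cor d)"
proof -
  have "((\<lambda>h. cor ((r (z + cor h * v) - r z) / h)) \<longlongrightarrow> cor d) (at 0)"
    using assms unfolding DERIV_def by (intro tendsto_of_real) simp
  thus ?thesis by (simp add: has_partial_deriv_def)
qed

text \<open>The real differential of \<open>level\<close> at \<open>z\<close> in the direction
  \<open>v\<close>, with the products written out so that it is recognisable as a polynomial in
  \<open>Re z\<close> and \<open>Im z\<close>.\<close>

definition level_deriv :: "complex \<Rightarrow> complex \<Rightarrow> real" where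
  "level_deriv v z = 2 * (Im z * (Im v * (1 + Re z * Re z))) + 2 * (Im z * (Im z * (Re z * Re v)))"

lemma level_partial: "((\<lambda>h. level (z + cor h * v)) has_real_derivative level_deriv v z) (at 0)"
  unfolding level_def level_deriv_def by (auto intro!: derivative_eq_intros simp: power2_eq_square algebra_simps)

lemma bump_partial:
  "has_partial_deriv (*) v (\<lambda>z. cor (flat m (bump_arg z))) z
    (cor ((flat (m + 2) (bump_arg z) - real m * flat (m + 1) (bump_arg z)) * ((6 - 2 * level z) * level_deriv v z)))"
proof (rule real_partialI)
  have "((\<lambda>h. bump_arg (z + cor h * v)) has_real_derivative (6 - 2 * level z) * level_deriv v z) (at 0)" unfolding bump_arg_def
    by (rule DERIV_cong[OF DERIV_mult[OF DERIV_diff[OF level_partial DERIV_const] DERIV_diff[OF DERIV_const level_partial]]])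
      (simp add: algebra_simps)
  from DERIV_chain2[OF flat_deriv this]
  show "((\<lambda>h. flat m (bump_arg (z + cor h * v))) has_real_derivative
      (flat (m + 2) (bump_arg z) - real m * flat (m + 1) (bump_arg z)) * ((6 - 2 * level z) * level_deriv v z)) (at 0)" by simp
qed

lemma has_vector_derivativeI:
  fixes f :: "real \<Rightarrow> complex"
  assumes "((\<lambda>h. (f (x + h) - f x) / cor h) \<longlongrightarrow> D) (at 0)"
  shows "(f has_vector_derivative D) (at x)"
proof -
  have "((\<lambda>h. norm ((f (x + h) - f x) / cor h - D)) \<longlongrightarrow> 0) (at 0)"
    using assms by (intro tendsto_norm_zero LIM_zero)
  moreover have "\<forall>\<^sub>F h in at 0. norm ((f (x + h) - f x) / cor h - D) = norm (f (x + h) - f x - h *\<^sub>R D) / norm h"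
    using eventually_neq_at_within[of 0]
  proof eventually_elim
    case (elim h)
    have "(f (x + h) - f x) / cor h - D = (f (x + h) - f x - h *\<^sub>R D) / cor h"
      using elim by (simp add: diff_divide_distrib scaleR_conv_of_real)
    thus ?case by (simp add: norm_divide)
  qed
  ultimately have "((\<lambda>h. norm (f (x + h) - f x - h *\<^sub>R D) / norm h) \<longlongrightarrow> 0) (at 0)" by (rule Lim_transform_eventually)
  thus ?thesis by (simp add: has_vector_derivative_def has_derivative_at bounded_linear_scaleR_left)
qed

lemma level_has_derivative: "(level has_derivative (\<lambda>h. level_deriv h z)) (at z)" unfolding level_def[abs_def] level_deriv_def
  by (auto intro!: derivative_eq_intros simp: fun_eq_iff power2_eq_square algebra_simps)

context sc_lcs
begin

section \<open>Partial derivatives of vector-valued functions\<close>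

lemma partial_deriv_eq:
  "has_partial_deriv sc v f z D \<Longrightarrow> partial_deriv sc v f z = D" unfolding partial_deriv_def has_partial_deriv_def
  by (intro the_equality) (auto intro: tendsto_unique[OF trivial_limit_at])

lemma has_partial_deriv_add:
  assumes "has_partial_deriv sc v f z D" "has_partial_deriv sc v g z D'"
  shows "has_partial_deriv sc v (\<lambda>z. f z + g z) z (D + D')"
proof -
  have "(\<lambda>h::real. sc (1 / cor h) ((f (z + cor h * v) + g (z + cor h * v)) - (f z + g z))) =
      (\<lambda>h. sc (1 / cor h) (f (z + cor h * v) - f z) + sc (1 / cor h) (g (z + cor h * v) - g z))"
    by (simp only: scale_right_distrib[symmetric] add_diff_add)
  thus ?thesis using tendsto_add[OF assms[unfolded has_partial_deriv_def]] by (simp only: has_partial_deriv_def)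
qed

lemma has_partial_deriv_product:
  assumes b: "has_partial_deriv (*) v \<beta> z \<beta>'" and f: "has_partial_deriv sc v f z D"
  shows "has_partial_deriv sc v (\<lambda>z. sc (\<beta> z) (f z)) z (sc \<beta>' (f z) + sc (\<beta> z) D)"
proof -
  let ?f = "\<lambda>h::real. f (z + cor h * v)" and ?b = "\<lambda>h::real. \<beta> (z + cor h * v)"
  \<comment> \<open>The derivative in the direction \<open>v\<close> yields continuity in that
    direction, which is needed for the term in which \<open>\<beta>\<close> is
    differentiated.\<close>
  have "((\<lambda>h. sc (cor h) (sc (1 / cor h) (?f h - f z))) \<longlongrightarrow> sc 0 D) (at 0)"
    using f unfolding has_partial_deriv_def by (intro tendsto_scale_lcs) (auto intro!: tendsto_eq_intros)
  moreover have "\<forall>\<^sub>F h in at 0. sc (cor h) (sc (1 / cor h) (?f h - f z)) = ?f h - f z"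
    using eventually_neq_at_within[of 0] by eventually_elim simp
  ultimately have "((\<lambda>h. ?f h - f z) \<longlongrightarrow> sc 0 D) (at 0)" by (rule Lim_transform_eventually)
  hence "((\<lambda>h. ?f h - f z + f z) \<longlongrightarrow> sc 0 D + f z) (at 0)" by (intro tendsto_add tendsto_const)
  hence lim: "(?f \<longlongrightarrow> f z) (at 0)" by simp
  have "((\<lambda>h. sc (1 / cor h * (?b h - \<beta> z)) (?f h) + sc (\<beta> z) (sc (1 / cor h) (?f h - f z)))
      \<longlongrightarrow> sc \<beta>' (f z) + sc (\<beta> z) D) (at 0)"
    using b f lim unfolding has_partial_deriv_def by (intro tendsto_add tendsto_scale_lcs tendsto_const)
  moreover have "sc (1 / cor h * (?b h - \<beta> z)) (?f h) + sc (\<beta> z) (sc (1 / cor h) (?f h - f z)) =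
      sc (1 / cor h) (sc (?b h) (?f h) - sc (\<beta> z) (f z))" for h
    by (simp only: right_diff_distrib scale_left_diff_distrib scale_right_diff_distrib scale_scale mult.commute[of "\<beta> z"]) simp
  ultimately show ?thesis unfolding has_partial_deriv_def by simp
qed

lemma has_partial_deriv_const_scale:
  assumes "has_partial_deriv sc v f z D"
  shows "has_partial_deriv sc v (\<lambda>z. sc c (f z)) z (sc c D)"
  using has_partial_deriv_product[of v "\<lambda>_. c" z 0 f D] assms by (simp add: has_partial_deriv_def)

lemma has_partial_deriv_transform:
  assumes f: "has_partial_deriv sc v f z D" and U: "open U" "z \<in> U" and eq: "\<And>w. w \<in> U \<Longrightarrow> f w = g w"
  shows "has_partial_deriv sc v g z D"
proof -
  have "((\<lambda>h::real. z + cor h * v) \<longlongrightarrow> z) (at 0)" by (auto intro!: tendsto_eq_intros)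
  hence "\<forall>\<^sub>F h::real in at 0. z + cor h * v \<in> U" by (rule topological_tendstoD[OF _ U])
  hence "\<forall>\<^sub>F h::real in at 0. sc (1 / cor h) (f (z + cor h * v) - f z) =
      sc (1 / cor h) (g (z + cor h * v) - g z)" by eventually_elim (simp add: eq U(2))
  with f show ?thesis unfolding has_partial_deriv_def by (rule Lim_transform_eventually)
qed

lemma has_partial_deriv_zero: "has_partial_deriv sc v (\<lambda>_. 0) z 0" by (simp add: has_partial_deriv_def)

lemma has_partial_deriv_holomorphic:
  assumes D: "((\<lambda>w. sc (1 / (w - z)) (f w - f z)) \<longlongrightarrow> D) (at z)" and v: "v \<noteq> 0"
  shows "has_partial_deriv sc v f z (sc v D)"
proof -
  have "filterlim (\<lambda>h::real. z + cor h * v) (at z) (at 0)" using v eventually_neq_at_within[of "0::real"]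
    by (intro filterlim_atI) (auto intro!: tendsto_eq_intros elim: eventually_mono)
  from filterlim_compose[OF D this]
  have "((\<lambda>h. sc v (sc (1 / (cor h * v)) (f (z + cor h * v) - f z))) \<longlongrightarrow> sc v D) (at 0)"
    by (intro tendsto_scale_lcs) auto
  thus ?thesis using v by (simp add: has_partial_deriv_def)
qed

text \<open>The Cauchy estimates for \<open>y (f z)\<close>, uniform over the polar, bound the
  derivative locally; being weakly holomorphic it is then holomorphic.\<close>

lemma hol_space_derivative:
  assumes f: "f \<in> hol_space sc \<Omega>" and op: "open \<Omega>"
  obtains f' where "f' \<in> hol_space sc \<Omega>" "\<And>v z. v \<noteq> 0 \<Longrightarrow> z \<in> \<Omega> \<Longrightarrow> has_partial_deriv sc v f z (sc v (f' z))"
proof -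
  define f' where "f' z = (if z \<in> \<Omega> then (SOME D. ((\<lambda>w. sc (1 / (w - z)) (f w - f z)) \<longlongrightarrow> D) (at z)) else 0)" for z
  have D: "((\<lambda>w. sc (1 / (w - z)) (f w - f z)) \<longlongrightarrow> f' z) (at z)" if "z \<in> \<Omega>" for z
    using someI_ex[of "\<lambda>D. ((\<lambda>w. sc (1 / (w - z)) (f w - f z)) \<longlongrightarrow> D) (at z)"] f that
    by (auto simp: hol_space_def f'_def)
  have yD: "deriv (\<lambda>z. y (f z)) z = y (f' z)" if "z \<in> \<Omega>" and y: "y \<in> lcs_dual sc" for y z
  proof (rule DERIV_imp_deriv)
    show "((\<lambda>z. y (f z)) has_field_derivative y (f' z)) (at z)" using dual_tendsto[OF y D[OF that(1)]]
      by (simp add: has_field_derivative_iff dual_scale[OF y] dual_diff[OF y])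
  qed
  have "f' \<in> hol_space sc \<Omega>"
  proof (rule hol_space_weakI[OF op])
    fix y assume y: "y \<in> lcs_dual sc"
    have "deriv (\<lambda>z. y (f z)) holomorphic_on \<Omega>" by (rule holomorphic_deriv[OF hol_space_dual[OF f op y] op])
    thus "(\<lambda>z. y (f' z)) holomorphic_on \<Omega>" by (rule holomorphic_transform) (simp add: yD y)
  next
    fix i z assume z: "z \<in> \<Omega>"
    obtain r0 M where r0: "r0 > 0" "\<And>w. w \<in> ball z r0 \<Longrightarrow> p i (f w) \<le> M"
      using locally_bounded_if_continuous[OF op hol_space_continuous_on[OF f op] z] by metis
    obtain r1 where r1: "r1 > 0" "ball z r1 \<subseteq> \<Omega>" using op z openE by blast
    define r where "r = min r0 r1"
    have r: "r > 0" "ball z r \<subseteq> \<Omega>" "\<And>w. w \<in> ball z r \<Longrightarrow> p i (f w) \<le> M" using r0 r1 by (auto simp: r_def)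
    have "p i (f' w) \<le> 4 * M / r" if w: "w \<in> ball z (r / 2)" for w
    proof (rule seminorm_le_dual)
      fix y assume y: "y \<in> dual_ball i"
      have "w \<in> \<Omega>" using w r(1,2) by auto
      have "cmod (deriv (\<lambda>z. y (f z)) w) \<le> 4 * M / r"
      proof (rule deriv_bound_ball[OF _ _ r(1) w])
        show "(\<lambda>z. y (f z)) holomorphic_on ball z r" using holomorphic_on_subset[OF hol_space_dual[OF f op dual_ballD(1)[OF y]] r(2)] .
        show "cmod (y (f w)) \<le> M" if "w \<in> ball z r" for w using order_trans[OF dual_ballD(2)[OF y] r(3)[OF that]] .
      qed
      thus "cmod (y (f' w)) \<le> 4 * M / r" using yD[OF \<open>w \<in> \<Omega>\<close> dual_ballD(1)[OF y]] by simp
    qed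
    thus "\<exists>r>0. \<exists>M. \<forall>w\<in>ball z r. p i (f' w) \<le> M"
      using r(1) by (intro exI[of _ "r / 2"] conjI exI[of _ "4 * M / r"]) auto
  qed (simp add: f'_def)
  thus ?thesis using that has_partial_deriv_holomorphic[OF D] by blast
qed

text \<open>A class that contains the right-hand side and is invariant under partial derivatives, so
  that smoothness and the bounds for all derivatives follow without computing them. The factors
  \<open>Re z\<close> and \<open>Im z\<close> are those produced by differentiating
  \<open>level\<close>.\<close>

inductive_set bump_class :: "(complex \<Rightarrow> 'e) set" where
  base: "h \<in> hol_space sc off_real \<Longrightarrow> (\<lambda>z. sc (cor (flat m (bump_arg z))) (h z)) \<in> bump_class"
| add: "f \<in> bump_class \<Longrightarrow> g \<in> bump_class \<Longrightarrow> (\<lambda>z. f z + g z) \<in> bump_class"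
| scale: "f \<in> bump_class \<Longrightarrow> (\<lambda>z. sc c (f z)) \<in> bump_class"
| Re: "f \<in> bump_class \<Longrightarrow> (\<lambda>z. sc (cor (Re z)) (f z)) \<in> bump_class"
| Im: "f \<in> bump_class \<Longrightarrow> (\<lambda>z. sc (cor (Im z)) (f z)) \<in> bump_class"

text \<open>Polynomials in \<open>Re z\<close> and \<open>Im z\<close> are multipliers, which can be
  verified along their syntax.\<close>

definition multiplier :: "(complex \<Rightarrow> complex) \<Rightarrow> bool" where
  "multiplier \<beta> \<longleftrightarrow> (\<forall>f\<in>bump_class. (\<lambda>z. sc (\<beta> z) (f z)) \<in> bump_class)"

lemma multiplier_intros:
  "multiplier (\<lambda>z. c)" "multiplier (\<lambda>z. cor (Re z))" "multiplier (\<lambda>z. cor (Im z))"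
  "multiplier \<beta> \<Longrightarrow> multiplier \<gamma> \<Longrightarrow> multiplier (\<lambda>z. \<beta> z + \<gamma> z)"
  "multiplier \<beta> \<Longrightarrow> multiplier \<gamma> \<Longrightarrow> multiplier (\<lambda>z. \<beta> z * \<gamma> z)"
proof -
  show "multiplier (\<lambda>z. c)" "multiplier (\<lambda>z. cor (Re z))" "multiplier (\<lambda>z. cor (Im z))"
    by (simp_all add: multiplier_def bump_class.scale bump_class.Re bump_class.Im)
  assume bc: "multiplier \<beta>" "multiplier \<gamma>"
  show "multiplier (\<lambda>z. \<beta> z + \<gamma> z)" using bc by (simp add: multiplier_def scale_left_distrib bump_class.add)
  show "multiplier (\<lambda>z. \<beta> z * \<gamma> z)" unfolding multiplier_def
  proof
    fix f assume "f \<in> bump_class"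
    hence "(\<lambda>z. sc (\<beta> z) (sc (\<gamma> z) (f z))) \<in> bump_class" using bc by (auto simp: multiplier_def simp del: scale_scale)
    thus "(\<lambda>z. sc (\<beta> z * \<gamma> z) (f z)) \<in> bump_class" by simp
  qed
qed

lemma bump_class_multiply: "multiplier \<beta> \<Longrightarrow> f \<in> bump_class \<Longrightarrow> (\<lambda>z. sc (\<beta> z) (f z)) \<in> bump_class"
  by (simp add: multiplier_def)

lemma bump_class_continuous: "f \<in> bump_class \<Longrightarrow> continuous_on UNIV f"
proof (induction rule: bump_class.induct)
  case (base h m)
  have "continuous_on off_real (\<lambda>z. cor (flat m (bump_arg z)))"
    by (intro continuous_on_of_real continuous_on_compose2[OF continuous_at_imp_continuous_on continuous_level(2)]) (auto simp: flat_isCont)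
  hence "continuous_on off_real (\<lambda>z. sc (cor (flat m (bump_arg z))) (h z))"
    by (intro continuous_on_scale_lcs hol_space_continuous_on[OF base open_Im(1)])
  moreover have "continuous_on {z. bump_arg z < 0} (\<lambda>z. sc (cor (flat m (bump_arg z))) (h z))"
    by (rule continuous_on_eq[OF continuous_on_const[of _ 0]]) (auto simp: flat_def)
  ultimately have "continuous_on (off_real \<union> {z. bump_arg z < 0}) (\<lambda>z. sc (cor (flat m (bump_arg z))) (h z))"
    by (intro continuous_on_open_Un open_Im open_bump_arg)
  moreover have "off_real \<union> {z. bump_arg z < 0} = UNIV" using bump_arg_real by auto
  ultimately show ?case by simp
qed (auto intro!: continuous_on_scale_lcs continuous_intros)

lemma bump_class_vanishes: "f \<in> bump_class \<Longrightarrow> 4 \<le> level z \<Longrightarrow> f z = 0"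
  by (induction rule: bump_class.induct) (use bump_arg_outside[of z] in \<open>auto simp: flat_def\<close>)

lemma bump_class_partial:
  assumes "f \<in> bump_class" and v: "v \<noteq> 0"
  shows "\<exists>g\<in>bump_class. \<forall>z. has_partial_deriv sc v f z (g z)" using assms(1)
proof (induction rule: bump_class.induct)
  case (base h m)
  obtain h' where h': "h' \<in> hol_space sc off_real" "\<And>z. z \<in> off_real \<Longrightarrow> has_partial_deriv sc v h z (sc v (h' z))"
    by (rule hol_space_derivative[OF base open_Im(1)]) (use v in auto)
  \<comment> \<open>The inner derivative: \<open>6 - 2 * l\<close> is the derivative of
    \<open>(l - 2) * (4 - l)\<close>, followed by that of \<open>level\<close>.\<close>
  define q where "q z = cor ((6 - 2 * level z) * level_deriv v z)" for z
  have q_eq: "q = (\<lambda>z. (6 + (- 2) * (cor (Im z) * (cor (Im z) * (1 + cor (Re z) * cor (Re z))))) *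
    (2 * (cor (Im z) * (cor (Im v) * (1 + cor (Re z) * cor (Re z)))) +
     2 * (cor (Im z) * (cor (Im z) * (cor (Re z) * cor (Re v))))))"
    by (simp add: fun_eq_iff q_def level_def level_deriv_def power2_eq_square mult.assoc)
  have q: "multiplier q" unfolding q_eq by (intro multiplier_intros)
  define g where "g z = (sc (q z) (sc (cor (flat (m + 2) (bump_arg z))) (h z)) +
      sc (cor (- real m)) (sc (q z) (sc (cor (flat (m + 1) (bump_arg z))) (h z)))) +
      sc v (sc (cor (flat m (bump_arg z))) (h' z))" for z
  have "g \<in> bump_class" unfolding g_def by (intro bump_class.add bump_class.scale bump_class_multiply[OF q] bump_class.base base h'(1))
  moreover have "has_partial_deriv sc v (\<lambda>z. sc (cor (flat m (bump_arg z))) (h z)) z (g z)" for z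
  proof (cases "Im z = 0")
    case True
    \<comment> \<open>Around a real point \<open>bump_arg\<close> is negative and the product
      vanishes identically, however \<open>h\<close> behaves near the axis.\<close>
    have "g z = 0" using bump_arg_real[OF True] by (simp add: g_def flat_def)
    thus ?thesis using has_partial_deriv_transform[OF has_partial_deriv_zero open_bump_arg(1), of z] bump_arg_real[OF True]
      by (simp add: flat_def)
  next
    case False
    have e1: "cor ((flat (m + 2) (bump_arg z) - real m * flat (m + 1) (bump_arg z)) * ((6 - 2 * level z) * level_deriv v z))
        = q z * cor (flat (m + 2) (bump_arg z)) + cor (- real m) * (q z * cor (flat (m + 1) (bump_arg z)))"
      by (simp add: q_def algebra_simps)
    have "g z = sc (q z * cor (flat (m + 2) (bump_arg z)) + cor (- real m) * (q z * cor (flat (m + 1) (bump_arg z)))) (h z) +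
        sc (cor (flat m (bump_arg z))) (sc v (h' z))" unfolding g_def scale_left_distrib scale_scale by (simp only: mult_ac)
    thus ?thesis using has_partial_deriv_product[OF bump_partial[of v m z, unfolded e1] h'(2)] False by simp
  qed
  ultimately show ?case by blast
next
  case (add f g)
  then obtain f1 g1 where "f1 \<in> bump_class" "g1 \<in> bump_class"
    "\<forall>z. has_partial_deriv sc v f z (f1 z)" "\<forall>z. has_partial_deriv sc v g z (g1 z)" by blast
  thus ?case by (intro bexI[of _ "\<lambda>z. f1 z + g1 z"]) (auto intro: bump_class.add has_partial_deriv_add)
next
  case (scale f c)
  then obtain f1 where "f1 \<in> bump_class" "\<forall>z. has_partial_deriv sc v f z (f1 z)" by blast
  thus ?case by (intro bexI[of _ "\<lambda>z. sc c (f1 z)"]) (auto intro: bump_class.scale has_partial_deriv_const_scale)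
next
  case (Re f)
  then obtain f1 where f1: "f1 \<in> bump_class" "\<forall>z. has_partial_deriv sc v f z (f1 z)" by blast
  have "has_partial_deriv (*) v (\<lambda>z. cor (Re z)) z (cor (Re v))" for z
    by (rule real_partialI) (auto intro!: derivative_eq_intros)
  with f1 Re show ?case by (intro bexI[of _ "\<lambda>z. sc (cor (Re v)) (f z) + sc (cor (Re z)) (f1 z)"])
      (auto intro!: bump_class.add bump_class.scale bump_class.Re has_partial_deriv_product)
next
  case (Im f)
  then obtain f1 where f1: "f1 \<in> bump_class" "\<forall>z. has_partial_deriv sc v f z (f1 z)" by blast
  have "has_partial_deriv (*) v (\<lambda>z. cor (Im z)) z (cor (Im v))" for z
    by (rule real_partialI) (auto intro!: derivative_eq_intros)
  with f1 Im show ?case by (intro bexI[of _ "\<lambda>z. sc (cor (Im v)) (f z) + sc (cor (Im z)) (f1 z)"])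
      (auto intro!: bump_class.add bump_class.scale bump_class.Im has_partial_deriv_product)
qed

lemma bump_class_partial_deriv:
  assumes "f \<in> bump_class" "v \<noteq> 0"
  shows "partial_deriv sc v f \<in> bump_class" "\<exists>D. has_partial_deriv sc v f z D"
proof -
  obtain g where g: "g \<in> bump_class" "\<forall>z. has_partial_deriv sc v f z (g z)" using bump_class_partial[OF assms] by blast
  hence "partial_deriv sc v f = g" using partial_deriv_eq by blast
  thus "partial_deriv sc v f \<in> bump_class" using g by simp
  show "\<exists>D. has_partial_deriv sc v f z D" using g by blast
qed

lemma bump_class_Ck: "f \<in> bump_class \<Longrightarrow> Ck_on sc k UNIV f"
proof (induction k arbitrary: f)
  case (Suc k)
  thus ?case using bump_class_partial_deriv[OF Suc.prems] by auto
qed (simp add: bump_class_continuous)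

lemma bump_class_multi_deriv:
  assumes "f \<in> bump_class"
  shows "multi_deriv sc \<beta> f \<in> bump_class"
proof -
  have it: "(partial_deriv sc v ^^ n) f \<in> bump_class" if "f \<in> bump_class" "v \<noteq> 0" for n f v
    using that by (induction n) (auto intro: bump_class_partial_deriv)
  show ?thesis unfolding multi_deriv_def by (intro it assms) auto
qed

text \<open>For \<open>\<bar>Im z\<bar> \<ge> 1 / real n\<close> one has
  \<open>\<bar>Re z\<bar> \<le> real n * \<bar>Im z * Re z\<bar>\<close>, and
  \<open>(Im z * Re z)\<^sup>2 \<le> level z < 4\<close>. Closer to the axis \<open>S_set_pm\<close>
  bounds the real part directly.\<close>

lemma bounded_level_region:
  assumes "z \<in> S_set n {-\<infinity>, \<infinity>}" "level z < 4" "n \<ge> 1"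
  shows "\<bar>Re z\<bar> \<le> 2 * real n" "\<bar>Im z\<bar> \<le> real n"
proof -
  note S = S_set_pm(2)[OF assms(1)]
  show "\<bar>Im z\<bar> \<le> real n" using S by simp
  show "\<bar>Re z\<bar> \<le> 2 * real n"
  proof (cases "1 / real n \<le> \<bar>Im z\<bar>")
    case True
    hence "1 \<le> real n * \<bar>Im z\<bar>" using assms(3) by (simp add: field_simps)
    hence "\<bar>Re z\<bar> * 1 \<le> \<bar>Re z\<bar> * (real n * \<bar>Im z\<bar>)" by (intro mult_left_mono) auto
    also have "\<dots> = real n * (\<bar>Im z\<bar> * \<bar>Re z\<bar>)" by simp
    also have "\<dots> \<le> real n * 2"
    proof (intro mult_left_mono)
      have "(Im z * Re z)\<^sup>2 \<le> level z" by (simp add: level_def power_mult_distrib algebra_simps)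
      hence "\<bar>Im z * Re z\<bar> \<le> 2" using assms(2) abs_le_square_iff[of "Im z * Re z" 2] by simp
      thus "\<bar>Im z\<bar> * \<bar>Re z\<bar> \<le> 2" by (simp add: abs_mult)
    qed simp
    finally show ?thesis by simp
  qed (use S in auto)
qed

text \<open>Every derivative belongs to the class again, hence is continuous and zero for
  \<open>level z \<ge> 4\<close>. On the bounded remainder compactness gives the estimate, whatever
  the growth of the original holomorphic function.\<close>

lemma bump_class_Eexp:
  assumes g: "g \<in> bump_class"
  shows "g \<in> Eexp sc p {-\<infinity>, \<infinity>}"
proof -
  have bd: "bdd_above ((\<lambda>z. p i (multi_deriv sc \<beta> g z) * growth (- (1 / real n)) z) ` S_set n {-\<infinity>, \<infinity>})"
    if n: "n \<ge> 1" for n i \<beta>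
  proof -
    define d where "d = multi_deriv sc \<beta> g"
    have d: "d \<in> bump_class" unfolding d_def by (rule bump_class_multi_deriv[OF g])
    let ?K = "{z. \<bar>Re z\<bar> \<le> 2 * real n \<and> \<bar>Im z\<bar> \<le> real n}"
    have "compact ((\<lambda>z. p i (d z)) ` ?K)"
      by (intro compact_continuous_image continuous_on_seminorm continuous_on_subset[OF bump_class_continuous[OF d]] compact_box) simp
    hence "bdd_above ((\<lambda>z. p i (d z)) ` ?K)" by (intro bounded_imp_bdd_above compact_imp_bounded)
    then obtain M where "\<And>r. r \<in> (\<lambda>z. p i (d z)) ` ?K \<Longrightarrow> r \<le> M" by (rule bdd_above.E) blast
    hence M: "p i (d z) \<le> M" if "z \<in> ?K" for z using that by simp
    have "p i (d z) \<le> max M 0 * growth (1 / real n) z" if z: "z \<in> S_set n {-\<infinity>, \<infinity>}" for z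
    proof (cases "level z < 4")
      case True
      have "p i (d z) \<le> max M 0 * 1" using M bounded_level_region[OF z True n] by (simp add: le_max_iff_disj)
      also have "\<dots> \<le> max M 0 * growth (1 / real n) z" by (intro mult_left_mono) auto
      finally show ?thesis .
    qed (simp add: bump_class_vanishes[OF d] seminorm_zero)
    thus ?thesis unfolding bdd_above_growth_iff d_def[symmetric] by (intro exI[of _ "max M 0"]) auto
  qed
  have fin: "finite {\<beta>::nat \<times> nat. fst \<beta> + snd \<beta> \<le> m}" for m by (rule finite_subset[of _ "{..m} \<times> {..m}"]) auto
  have "bdd_above ((\<lambda>(z, \<beta>). p i (multi_deriv sc \<beta> g z) * growth (- (1 / real n)) z) ` (S_set n {-\<infinity>, \<infinity>} \<times> {\<beta>. fst \<beta> + snd \<beta> \<le> m}))"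
    if n: "n \<ge> 1" for n m i
  proof -
    have "(\<lambda>(z, \<beta>). p i (multi_deriv sc \<beta> g z) * growth (- (1 / real n)) z) ` (S_set n {-\<infinity>, \<infinity>} \<times> {\<beta>. fst \<beta> + snd \<beta> \<le> m})
      = (\<Union>\<beta>\<in>{\<beta>. fst \<beta> + snd \<beta> \<le> m}. (\<lambda>z. p i (multi_deriv sc \<beta> g z) * growth (- (1 / real n)) z) ` S_set n {-\<infinity>, \<infinity>})"
      by (auto simp: image_iff)
    thus ?thesis using bd[OF n] fin by simp
  qed
  thus ?thesis using bump_class_Ck[OF g] by (simp add: Eexp_def smooth_space_def finite_part_simps)
qed

text \<open>Smoothness is given by partial derivatives, whereas complex differentiability needs the
  total derivative; continuity of one partial derivative provides it.\<close>

lemma dual_partials_differentiable: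
  assumes y: "y \<in> lcs_dual sc" and D1: "has_partial_deriv sc 1 u z a"
    and D2: "\<And>w. has_partial_deriv sc \<i> u w (b w)" and cont: "continuous_on UNIV b"
  shows "((\<lambda>w. y (u w)) has_derivative (\<lambda>h. cor (Re h) * y a + cor (Im h) * y (b z))) (at z)"
proof -
  have vd: "((\<lambda>h::real. (y (u (w + cor h * v)) - y (u w)) / cor h) \<longlongrightarrow> y D) (at 0)"
    if D: "has_partial_deriv sc v u w D" for v w D
    using dual_tendsto[OF y D[unfolded has_partial_deriv_def]] by (simp add: dual_scale[OF y] dual_diff[OF y])
  define U where "U s t = y (u (Complex s t))" for s t
  have "((\<lambda>s. U s (Im z)) has_vector_derivative y a) (at (Re z))"
  proof (rule has_vector_derivativeI)
    have "z + cor h * 1 = Complex (Re z + h) (Im z)" for h by (simp add: complex_eq_iff)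
    thus "((\<lambda>h. (U (Re z + h) (Im z) - U (Re z) (Im z)) / cor h) \<longlongrightarrow> y a) (at 0)"
      using vd[OF D1] by (simp add: U_def)
  qed
  hence fx: "((\<lambda>s. U s (Im z)) has_derivative (\<lambda>h. h *\<^sub>R y a)) (at (Re z) within UNIV)"
    by (simp add: has_vector_derivative_def)
  have fy: "((\<lambda>t. U s t) has_derivative blinfun_apply (blinfun_scaleR_left (y (b (Complex s t))))) (at t within UNIV)" for s t
  proof -
    have "((\<lambda>t. U s t) has_vector_derivative y (b (Complex s t))) (at t)"
    proof (rule has_vector_derivativeI)
      have "Complex s t + cor h * \<i> = Complex s (t + h)" for h by (simp add: complex_eq_iff)
      thus "((\<lambda>h. (U s (t + h) - U s t) / cor h) \<longlongrightarrow> y (b (Complex s t))) (at 0)"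
        using vd[OF D2, of "Complex s t"] by (simp add: U_def)
    qed
    thus ?thesis by (simp add: has_vector_derivative_def)
  qed
  have "continuous_on UNIV (\<lambda>q. Complex (fst q) (snd q))" by (intro continuous_intros)
  hence "continuous_on UNIV (\<lambda>q. y (b (Complex (fst q) (snd q))))"
    by (intro continuous_on_compose2[OF dual_continuous_on[OF y cont]]) auto
  hence "continuous_on UNIV (\<lambda>q. blinfun_scaleR_left (y (b (Complex (fst q) (snd q)))))"
    by (rule bounded_linear.continuous_on[OF bounded_linear_blinfun_scaleR_left])
  hence fc: "continuous (at (Re z, Im z) within UNIV \<times> UNIV) (\<lambda>(s, t). blinfun_scaleR_left (y (b (Complex s t))))"
    by (simp add: continuous_on_eq_continuous_within case_prod_unfold)
  have "((\<lambda>(s, t). U s t) has_derivative (\<lambda>(tx, ty). tx *\<^sub>R y a + blinfun_apply (blinfun_scaleR_left (y (b (Complex (Re z) (Im z))))) ty)) (at (Re z, Im z) within UNIV \<times> UNIV)"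
    by (rule has_derivative_partialsI[OF fx fy fc]) auto
  hence g: "((\<lambda>(s, t). U s t) has_derivative (\<lambda>(tx, ty). tx *\<^sub>R y a + ty *\<^sub>R y (b z))) (at (Re z, Im z))" by simp
  have f: "((\<lambda>w. (Re w, Im w)) has_derivative (\<lambda>w. (Re w, Im w))) (at z)"
    by (intro bounded_linear_imp_has_derivative bounded_linear_Pair bounded_linear_Re bounded_linear_Im)
  from has_derivative_compose[OF f, OF g] show ?thesis by (simp add: U_def scaleR_conv_of_real)
qed

theorem slow_growth_representative:
  assumes adm: "admissible sc p" and f: "f \<in> hol_space sc off_real"
  shows "\<exists>F\<in>Oexp_R. f - F \<in> hol_entire sc"
proof -
  obtain \<psi> c where psi: "\<And>t. (\<psi> has_real_derivative c * flat 0 ((t - 2) * (4 - t))) (at t)"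
    "\<And>t. t \<le> 2 \<Longrightarrow> \<psi> t = 1" "\<And>t. 4 \<le> t \<Longrightarrow> \<psi> t = 0" by (rule smooth_cutoff_exists) blast
  have psi_cont: "continuous_on S (\<lambda>z. cor (\<psi> (level z)))" for S
  proof -
    have "continuous_on UNIV \<psi>" by (rule DERIV_continuous_on) (use psi(1) in blast)
    thus ?thesis by (intro continuous_on_of_real continuous_on_compose2[OF _ continuous_level(1)]) auto
  qed
  have f_cont: "continuous_on off_real f" by (rule hol_space_continuous_on[OF f open_Im(1)])
  \<comment> \<open>This is \<open>dbar\<close> of \<open>level\<close>, so that \<open>g\<close> is
    \<open>f\<close> times \<open>dbar\<close> of the cut-off.\<close>
  define q where "q z = cor (Im z) * (cor (Im z) * cor (Re z)) +
      \<i> * (cor (Im z) * (1 + cor (Re z) * cor (Re z)))" for z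
  define g where "g z = sc (q z) (sc (cor c) (sc (cor (flat 0 (bump_arg z))) (f z)))" for z
  have "multiplier q" unfolding q_def[abs_def] by (intro multiplier_intros)
  hence "g \<in> bump_class" unfolding g_def[abs_def] by (intro bump_class_multiply bump_class.scale bump_class.base f)
  hence gE: "g \<in> Eexp sc p {-\<infinity>, \<infinity>}" by (rule bump_class_Eexp)
  \<comment> \<open>A set without finite points: the solution \<open>u\<close> is smooth on the
    whole plane, and its growth is controlled except near the two ends of the axis.\<close>
  have "compact {-\<infinity>, \<infinity>::ereal}" by (intro finite_imp_compact) simp
  from adm[unfolded admissible_def, rule_format, OF this gE]
  obtain u where u1: "u \<in> Eexp sc p {-\<infinity>, \<infinity>}" and u2: "\<forall>z\<in>- finite_part {-\<infinity>, \<infinity>}. dbar sc u z = g z"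
    by (rule bexE)
  have u: "u \<in> Eexp sc p {-\<infinity>, \<infinity>}" "\<And>z. dbar sc u z = g z" using u1 u2 by (simp_all add: finite_part_simps)
  have Ck: "Ck_on sc k UNIV u" for k using u(1) by (simp add: Eexp_def smooth_space_def finite_part_simps)
  have u_cont: "continuous_on UNIV u" using Ck[of 0] by simp
  have part: "has_partial_deriv sc v u z (partial_deriv sc v u z)" if "v \<in> {1, \<i>}" for v z
  proof -
    obtain D where D: "has_partial_deriv sc v u z D" using Ck[of "Suc 0"] \<open>v \<in> {1, \<i>}\<close> by (auto; metis)
    thus ?thesis using partial_deriv_eq[OF D] by simp
  qed
  have b_cont: "continuous_on UNIV (partial_deriv sc \<i> u)" using Ck[of "Suc 0"] by simp
  \<comment> \<open>Off the axis \<open>dbar V = g - g = 0\<close>; near the axis \<open>V\<close>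
    is \<open>u\<close>, which continues it across the singularities of \<open>f\<close>.\<close>
  define V where "V z = u z + sc (cor (1 - \<psi> (level z))) (f z)" for z
  have V_u: "V z = u z" if "level z < 2" for z using psi(2)[of "level z"] that by (simp add: V_def)
  have "continuous_on (off_real \<union> {z. level z < 2}) V"
  proof (rule continuous_on_open_Un[OF open_Im(1) open_bump_arg(2)])
    show "continuous_on off_real V" unfolding V_def[abs_def] of_real_diff
      by (intro continuous_on_add continuous_on_scale_lcs continuous_on_diff psi_cont continuous_on_const f_cont
          continuous_on_subset[OF u_cont]) auto
    show "continuous_on {z. level z < 2} V" by (rule continuous_on_eq[OF continuous_on_subset[OF u_cont]]) (auto simp: V_u)
  qed
  moreover have "off_real \<union> {z. level z < 2} = UNIV" by (auto simp: level_def)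
  ultimately have V_cont: "continuous_on UNIV V" by simp
  have V_hol: "V \<in> hol_space sc UNIV"
  proof (rule hol_space_weakI[OF open_UNIV])
    fix y assume y: "y \<in> lcs_dual sc"
    have "\<exists>D. ((\<lambda>z. y (V z)) has_field_derivative D) (at z)" for z
    proof -
      define a b where "a = y (partial_deriv sc 1 u z)" and "b = y (partial_deriv sc \<i> u z)"
      have dU: "((\<lambda>w. y (u w)) has_derivative (\<lambda>h. cor (Re h) * a + cor (Im h) * b)) (at z)"
        unfolding a_def b_def by (rule dual_partials_differentiable[OF y part part b_cont]) auto
      define P where "P = cor (c * flat 0 (bump_arg z)) * y (f z)"
      have "y (dbar sc u z) = (a + \<i> * b) / 2" by (simp add: dbar_def dual_scale[OF y] dual_add[OF y] a_def b_def)
      moreover have "y (g z) = q z * P" by (simp add: g_def dual_scale[OF y] P_def)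
      ultimately have "a + \<i> * b = 2 * (q z * P)" using u(2)[of z] by (simp add: field_simps)
      hence ab: "a = 2 * (q z * P) - \<i> * b" by (simp add: eq_diff_eq)
      have h_eq: "h = cor (Re h) + \<i> * cor (Im h)" for h by (simp add: complex_eq_iff)
      have ii: "\<i> * (\<i> * x) = - x" for x by (simp flip: mult.assoc)
      show ?thesis
      proof (cases "level z < 2")
        case True
        \<comment> \<open>Where \<open>level z < 2\<close> the right-hand side vanishes and
          \<open>u\<close> itself satisfies the Cauchy-Riemann equations.\<close>
        have "P = 0" using bump_arg_outside[of z] True by (simp add: P_def flat_def)
        hence "cor (Re h) * a + cor (Im h) * b = - \<i> * b * h" for h by (subst (3) h_eq) (simp add: ab algebra_simps ii)
        hence "(\<lambda>h. cor (Re h) * a + cor (Im h) * b) = (*) (- \<i> * b)" by (rule ext)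
        with dU have "((\<lambda>w. y (u w)) has_field_derivative - \<i> * b) (at z)" by (simp only: has_field_derivative_def)
        hence "((\<lambda>w. y (V w)) has_field_derivative - \<i> * b) (at z)"
          by (rule has_field_derivative_transform_within_open[OF _ open_bump_arg(2)]) (use True in \<open>auto simp: V_u\<close>)
        thus ?thesis by blast
      next
        case False
        hence z: "z \<in> off_real" by (auto simp: level_def)
        obtain d where "((\<lambda>w. y (f w)) has_field_derivative d) (at z)"
          using hol_space_dual[OF f open_Im(1) y] z open_Im(1) by (metis holomorphic_on_open)
        hence df: "((\<lambda>w. y (f w)) has_derivative (*) d) (at z)" by (simp add: has_field_derivative_def)
        have "((\<lambda>w. \<psi> (level w)) has_derivative (\<lambda>h. c * flat 0 (bump_arg z) * level_deriv h z)) (at z)"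
          using has_derivative_compose[OF level_has_derivative has_field_derivative_imp_has_derivative[OF psi(1)]] by (simp add: bump_arg_def)
        hence "((\<lambda>w. 1 - cor (\<psi> (level w))) has_derivative
            (\<lambda>h. 0 - cor (c * flat 0 (bump_arg z) * level_deriv h z))) (at z)"
          by (intro has_derivative_diff has_derivative_const has_derivative_of_real)
        from has_derivative_add[OF dU has_derivative_mult[OF this df]]
        have dV: "((\<lambda>w. y (V w)) has_derivative (\<lambda>h. cor (Re h) * a + cor (Im h) * b +
            ((1 - cor (\<psi> (level z))) * (d * h) + (0 - cor (c * flat 0 (bump_arg z) * level_deriv h z)) * y (f z)))) (at z)"
          by (simp add: V_def dual_add[OF y] dual_scale[OF y])
        \<comment> \<open>The complex derivative, computed as \<open>- \<i>\<close> times the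
          derivative of \<open>y (V w)\<close> in the direction \<open>\<i>\<close>.\<close>
        let ?D = "- \<i> * b + 2 * (\<i> * (P * (cor (Im z) * (1 + cor (Re z) * cor (Re z))))) +
            (1 - cor (\<psi> (level z))) * d"
        have "cor (Re h) * a + cor (Im h) * b +
            ((1 - cor (\<psi> (level z))) * (d * h) + (0 - cor (c * flat 0 (bump_arg z) * level_deriv h z)) * y (f z)) = ?D * h" for h
        proof -
          define x1 x2 where "x1 = cor (Re h)" and "x2 = cor (Im h)"
          have h: "h = x1 + \<i> * x2" unfolding x1_def x2_def by (rule h_eq)
          have l: "cor (c * flat 0 (bump_arg z) * level_deriv h z) * y (f z) =
              P * (2 * (cor (Im z) * (x2 * (1 + cor (Re z) * cor (Re z)))) + 2 * (cor (Im z) * (cor (Im z) * (cor (Re z) * x1))))"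
            by (simp add: P_def level_deriv_def x1_def x2_def mult_ac)
          show ?thesis unfolding left_diff_distrib[of 0] l x1_def[symmetric] x2_def[symmetric] ab q_def unfolding h by (simp add: algebra_simps ii)
        qed
        hence "(\<lambda>h. cor (Re h) * a + cor (Im h) * b +
            ((1 - cor (\<psi> (level z))) * (d * h) + (0 - cor (c * flat 0 (bump_arg z) * level_deriv h z)) * y (f z))) = (*) ?D"
          by (rule ext)
        with dV have "((\<lambda>w. y (V w)) has_field_derivative ?D) (at z)" by (simp only: has_field_derivative_def)
        thus ?thesis by blast
      qed
    qed
    thus "(\<lambda>z. y (V z)) holomorphic_on UNIV" by (simp add: holomorphic_on_open)
  qed (use locally_bounded_if_continuous[OF open_UNIV V_cont] in auto)
  define F where "F = f - restr off_real V"
  have F_hol: "F \<in> hol_space sc off_real"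
    unfolding F_def by (intro fun_subspace_diff[OF fun_subspace_hol_space] f hol_space_restr[OF V_hol] open_Im) simp
  have F_eq: "F z = sc (cor (\<psi> (level z))) (f z) - u z" if "Im z \<noteq> 0" for z
    using that by (simp add: F_def restr_def V_def scale_left_diff_distrib)
  have "\<exists>C\<ge>0. \<forall>z\<in>S_set n UNIV. p i (F z) \<le> C * growth (1 / real n) z" if n: "n \<ge> 1" for n i
  proof -
    have "bdd_above ((\<lambda>(z, \<beta>). p i (multi_deriv sc \<beta> u z) * growth (- (1 / real n)) z) ` (S_set n {-\<infinity>, \<infinity>} \<times> {\<beta>. fst \<beta> + snd \<beta> \<le> 0}))"
      by (rule u(1)[unfolded Eexp_def mem_Collect_eq, THEN conjunct2, rule_format, OF n])
    hence "bdd_above ((\<lambda>z. p i (u z) * growth (- (1 / real n)) z) ` S_set n {-\<infinity>, \<infinity>})"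
    proof (rule bdd_above_mono, intro image_subsetI)
      fix z assume "z \<in> S_set n {-\<infinity>, \<infinity>}"
      thus "p i (u z) * growth (- (1 / real n)) z \<in> (\<lambda>(z, \<beta>). p i (multi_deriv sc \<beta> u z) * growth (- (1 / real n)) z) `
          (S_set n {-\<infinity>, \<infinity>} \<times> {\<beta>. fst \<beta> + snd \<beta> \<le> 0})"
        by (intro image_eqI[of _ _ "(z, (0, 0))"]) (simp_all add: multi_deriv_def)
    qed
    then obtain C where C: "C \<ge> 0" "\<And>z. z \<in> S_set n {-\<infinity>, \<infinity>} \<Longrightarrow> p i (u z) \<le> C * growth (1 / real n) z"
      unfolding bdd_above_growth_iff by metis
    \<comment> \<open>The part of \<open>S_set n UNIV\<close> on which the cut-off is nonzero lies
      in this compact set off the axis, so \<open>f\<close> is bounded there.\<close>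
    let ?K = "{z. \<bar>Re z\<bar> \<le> 2 * real n \<and> \<bar>Im z\<bar> \<le> real n} \<inter> {z. 1 / real n \<le> \<bar>Im z\<bar>}"
    have "compact ?K" by (intro compact_Int_closed compact_box closed_Collect_le continuous_intros)
    moreover have "?K \<subseteq> off_real" using n by auto
    ultimately have "compact ((\<lambda>z. p i (sc (cor (\<psi> (level z))) (f z))) ` ?K)"
      by (intro compact_continuous_image continuous_on_seminorm continuous_on_scale_lcs psi_cont
          continuous_on_subset[OF f_cont])
    hence "bdd_above ((\<lambda>z. p i (sc (cor (\<psi> (level z))) (f z))) ` ?K)"
      by (intro bounded_imp_bdd_above compact_imp_bounded)
    then obtain M where "\<And>r. r \<in> (\<lambda>z. p i (sc (cor (\<psi> (level z))) (f z))) ` ?K \<Longrightarrow> r \<le> M"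
      by (rule bdd_above.E) blast
    hence M: "p i (sc (cor (\<psi> (level z))) (f z)) \<le> M" if "z \<in> ?K" for z using that by (blast intro: imageI)
    have "p i (F z) \<le> (max M 0 + C) * growth (1 / real n) z" if z: "z \<in> S_set n UNIV" for z
    proof -
      have z': "z \<in> S_set n {-\<infinity>, \<infinity>}" using z S_set_pm(1) by blast
      have im: "1 / real n < \<bar>Im z\<bar>" using z n by (simp add: S_set_UNIV)
      have "p i (sc (cor (\<psi> (level z))) (f z)) \<le> max M 0"
      proof (cases "level z < 4")
        case True
        thus ?thesis using M[of z] bounded_level_region[OF z' True n] im by (simp add: le_max_iff_disj)
      qed (simp add: psi(3) seminorm_zero)
      moreover have "max M 0 * 1 \<le> max M 0 * growth (1 / real n) z" by (intro mult_left_mono) auto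
      moreover have "Im z \<noteq> 0" using im by auto
      ultimately show ?thesis unfolding F_eq[OF \<open>Im z \<noteq> 0\<close>] distrib_right
        using C(2)[OF z'] seminorm_diff[of i "sc (cor (\<psi> (level z))) (f z)" "u z"] by linarith
    qed
    thus ?thesis using C(1) by (intro exI[of _ "max M 0 + C"]) auto
  qed
  hence "F \<in> Oexp_R" using F_hol unfolding Oexp_def bdd_above_growth_iff finite_part_simps(1) mem_Collect_eq by simp
  moreover have "f - F \<in> hol_entire sc" using V_hol by (simp add: F_def hol_entire_def finite_part_simps(1))
  ultimately show ?thesis by blast
qed

end

section \<open>The isomorphisms\<close>

context lcs
begin

section \<open>Linear maps between quotients\<close>

lemma coset_plus_coset:
  assumes W: "fun_subspace sc W"
  shows "(f +o W) + (g +o W) = (f + g) +o W"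
proof -
  have "W \<subseteq> W + W"
  proof
    fix w assume "w \<in> W"
    hence "w + 0 \<in> W + W" using fun_subspace_zero[OF W] by (rule set_plus_intro)
    thus "w \<in> W + W" by simp
  qed
  moreover have "W + W \<subseteq> W" using fun_subspace_add[OF W] by (auto elim!: set_plus_elim)
  ultimately have "W + W = W" by blast
  thus ?thesis by (simp add: set_plus_rearrange)
qed

lemma coset_scale_coset:
  assumes W: "fun_subspace sc W"
  shows "coset_scale sc W c (f +o W) = (\<lambda>z. sc c (f z)) +o W"
proof
  show "coset_scale sc W c (f +o W) \<subseteq> (\<lambda>z. sc c (f z)) +o W"
  proof
    fix x assume "x \<in> coset_scale sc W c (f +o W)"
    then obtain w w' where w: "w \<in> W" "w' \<in> W" "x = (\<lambda>z. sc c ((f + w) z)) + w'"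
      by (auto simp: coset_scale_def elt_set_plus_def elim!: set_plus_elim)
    have "x = (\<lambda>z. sc c (f z)) + ((\<lambda>z. sc c (w z)) + w')" by (simp add: w(3) fun_eq_iff scale_right_distrib add.assoc)
    moreover have "(\<lambda>z. sc c (w z)) + w' \<in> W" using fun_subspace_add[OF W fun_subspace_scale[OF W w(1)] w(2)] .
    ultimately show "x \<in> (\<lambda>z. sc c (f z)) +o W" by (simp add: set_plus_intro2)
  qed
  show "(\<lambda>z. sc c (f z)) +o W \<subseteq> coset_scale sc W c (f +o W)"
  proof
    fix x assume "x \<in> (\<lambda>z. sc c (f z)) +o W"
    then obtain w where w: "w \<in> W" "x = (\<lambda>z. sc c (f z)) + w" by (auto simp: elt_set_plus_def)
    have "f \<in> f +o W" using set_plus_intro2[OF fun_subspace_zero[OF W], of f] by simp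
    thus "x \<in> coset_scale sc W c (f +o W)" unfolding w(2) coset_scale_def by (intro set_plus_intro w(1) imageI)
  qed
qed

text \<open>\<open>T\<close> acts on representatives and is linear only modulo \<open>W'\<close>.
  The space \<open>V\<close> of representatives may be smaller than the space \<open>V0\<close>
  defining the quotient, provided the cosets are the same; this serves hyperfunctions, which are
  represented by functions of slow growth.\<close>

lemma quot_lin_isoI:
  assumes V: "fun_subspace sc V" and W: "fun_subspace sc W" and W': "fun_subspace sc W'"
    and reps: "quot_space V0 W = quot_space V W"
    and \<Phi>: "\<And>f. f \<in> V \<Longrightarrow> \<Phi> (f +o W) = T f +o W'" and T: "\<And>f. f \<in> V \<Longrightarrow> T f \<in> V'"
    and add: "\<And>f g. f \<in> V \<Longrightarrow> g \<in> V \<Longrightarrow> (T f + T g) - T (f + g) \<in> W'"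
    and scale: "\<And>c f. f \<in> V \<Longrightarrow> (\<lambda>z. sc c (T f z)) - T (\<lambda>z. sc c (f z)) \<in> W'"
    and inj: "\<And>f. f \<in> V \<Longrightarrow> T f \<in> W' \<Longrightarrow> f \<in> W"
    and surj: "\<And>h. h \<in> V' \<Longrightarrow> \<exists>f\<in>V. h - T f \<in> W'"
  shows "quot_lin_iso sc V0 W V' W' \<Phi>" unfolding quot_lin_iso_def reps
proof (intro conjI ballI allI)
  have "inj_on \<Phi> (quot_space V W)"
  proof (rule inj_onI)
    fix X Y assume "X \<in> quot_space V W" "Y \<in> quot_space V W" and eq: "\<Phi> X = \<Phi> Y"
    then obtain f g where fg: "f \<in> V" "g \<in> V" "X = f +o W" "Y = g +o W" by (auto simp: quot_space_def)
    hence "T f - T g \<in> W'" using eq \<Phi> by (simp add: coset_eq_iff[OF W'])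
    moreover have fgV: "f - g \<in> V" using fun_subspace_diff[OF V fg(1,2)] .
    moreover have "(T g + T (f - g)) - T f \<in> W'" using add[OF fg(2) fgV] by simp
    ultimately have "((T g + T (f - g)) - T f) + (T f - T g) \<in> W'" by (intro fun_subspace_add[OF W'])
    hence "f - g \<in> W" using inj[OF fgV] by simp
    thus "X = Y" by (simp add: fg(3,4) coset_eq_iff[OF W])
  qed
  moreover have "\<Phi> ` quot_space V W = quot_space V' W'"
  proof
    show "\<Phi> ` quot_space V W \<subseteq> quot_space V' W'" by (auto simp: quot_space_def \<Phi> T)
    show "quot_space V' W' \<subseteq> \<Phi> ` quot_space V W"
    proof
      fix Z assume "Z \<in> quot_space V' W'"
      then obtain h where h: "h \<in> V'" "Z = h +o W'" by (auto simp: quot_space_def)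
      then obtain f where f: "f \<in> V" "h - T f \<in> W'" using surj by blast
      hence "Z = \<Phi> (f +o W)" using \<Phi>[OF f(1)] by (simp add: h(2) coset_eq_iff[OF W'])
      thus "Z \<in> \<Phi> ` quot_space V W" using f(1) by (auto simp: quot_space_def)
    qed
  qed
  ultimately show "bij_betw \<Phi> (quot_space V W) (quot_space V' W')" by (simp add: bij_betw_def)
next
  fix X Y assume "X \<in> quot_space V W" "Y \<in> quot_space V W"
  then obtain f g where fg: "f \<in> V" "g \<in> V" "X = f +o W" "Y = g +o W" by (auto simp: quot_space_def)
  have "T (f + g) +o W' = (T f + T g) +o W'" using add[OF fg(1,2)] coset_eq_iff[OF W'] by metis
  thus "\<Phi> (X + Y) = \<Phi> X + \<Phi> Y"
    by (simp add: fg(3,4) coset_plus_coset[OF W] coset_plus_coset[OF W'] \<Phi> fg(1,2) fun_subspace_add[OF V])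
next
  fix c X assume "X \<in> quot_space V W"
  then obtain f where f: "f \<in> V" "X = f +o W" by (auto simp: quot_space_def)
  have "T (\<lambda>z. sc c (f z)) +o W' = (\<lambda>z. sc c (T f z)) +o W'" using scale[OF f(1)] coset_eq_iff[OF W'] by metis
  thus "\<Phi> (coset_scale sc W c X) = coset_scale sc W' c (\<Phi> X)"
    by (simp add: f(2) coset_scale_coset[OF W] coset_scale_coset[OF W'] \<Phi> f(1) fun_subspace_scale[OF V])
qed

end

context sc_lcs
begin

section \<open>Kernel and range of the transform modulo \<open>FO\<close>\<close>

lemma Oexp_pm_entire: "Oexp_pm sc p \<subseteq> hol_entire sc" by (auto simp: Oexp_pm_def hol_entire_def Oexp_def finite_part_simps)

lemma Oexp_hol_entire:
  assumes "F \<in> Oexp_R" "F \<in> hol_entire sc"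
  shows "F \<in> Oexp_pm sc p" using assms entire_in_Oexp_pm(2) by (auto simp: hol_entire_def finite_part_simps)

lemma R_map_coset:
  "R_map sc (F +o Oexp_pm sc p) = F +o hol_entire sc"
proof -
  have "F' +o hol_entire sc = F +o hol_entire sc" if "F' \<in> F +o Oexp_pm sc p" for F' unfolding coset_eq_iff[OF fun_subspace_hol_entire]
    using that Oexp_pm_entire by (auto simp: elt_set_plus_def)
  moreover have "F \<in> F +o Oexp_pm sc p" using set_plus_intro2[OF fun_subspace_zero[OF fun_subspace_Oexp_pm], of F] by simp
  ultimately show ?thesis unfolding R_map_def by (intro SUP_eq_const) blast+
qed

text \<open>\<open>fourier_bv\<close> depends only on the class, so \<open>Phi e\<close> and
  \<open>Phi 0\<close> have the same class; scaling by the factor \<open>0\<close> shows that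
  \<open>Phi 0\<close> is in \<open>Oexp_0\<close>.\<close>

lemma Phi_Oexp_entire:
  assumes e: "e \<in> Oexp_0"
  shows "Phi e \<in> Oexp_0"
proof -
  note W = fun_subspace_Oexp_entire[of UNIV]
  have eA: "e \<in> Oexp_R" using e Oexp_entire_subset by blast
  have zA: "0 \<in> Oexp_R" by (rule fun_subspace_zero[OF fun_subspace_Oexp])
  have "0 - Phi 0 \<in> Oexp_0" using Phi_scale[OF zA, of 0] by (simp add: zero_fun_def)
  moreover have "Phi e - Phi 0 \<in> Oexp_0"
  proof -
    have "e +o Oexp_0 = 0 +o Oexp_0" unfolding coset_eq_iff[OF W] using e by simp
    hence "Phi e +o Oexp_0 = Phi 0 +o Oexp_0" using fourier_bv_eq[OF eA] fourier_bv_eq[OF zA] by metis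
    thus ?thesis unfolding coset_eq_iff[OF W] .
  qed
  ultimately have "(Phi e - Phi 0) - (0 - Phi 0) \<in> Oexp_0" by (rule fun_subspace_diff[OF W, rotated])
  thus ?thesis by simp
qed

text \<open>\<open>Phi\<close> maps \<open>Oexp_0\<close> and \<open>FO_pm\<close> into
  \<open>Oexp_pm\<close>, so \<open>Phi (Phi F)\<close> lies there; by inversion it is a nonzero
  multiple of \<open>reflect F\<close> modulo \<open>Oexp_0\<close>.\<close>

lemma Phi_kernel:
  assumes F: "F \<in> Oexp_R" and P: "Phi F \<in> Oexp_0 + FO_pm sc p"
  shows "F \<in> Oexp_pm sc p"
proof -
  note W = fun_subspace_Oexp_pm
  have sub: "x \<in> Oexp_pm sc p" if "x \<in> Oexp_0" for x using that Oexp_entire_subset_pm by blast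
  obtain e H where eH: "e \<in> Oexp_0" "H \<in> FO_pm sc p" "Phi F = e + H" using P by (auto elim!: set_plus_elim)
  have A: "e \<in> Oexp_R" "H \<in> Oexp_R" using eH Oexp_entire_subset FO_pm_subset by auto
  have "(Phi e + Phi H) - ((Phi e + Phi H) - Phi (e + H)) \<in> Oexp_pm sc p"
    by (intro fun_subspace_diff[OF W] fun_subspace_add[OF W] sub Phi_Oexp_entire eH Phi_FO_pm Phi_add A)
  hence "((\<lambda>z. sc (- \<i> * kappa) (reflect F z)) - Phi (Phi F)) + Phi (Phi F) \<in> Oexp_pm sc p"
    by (intro fun_subspace_add[OF W sub[OF Phi_Phi[OF F]]]) (simp add: eH(3))
  hence "(\<lambda>z. sc (- \<i> * kappa) (reflect F z)) \<in> Oexp_pm sc p" by simp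
  from fun_subspace_scale[OF W this, of "1 / (- \<i> * kappa)"]
  have "reflect F \<in> Oexp_pm sc p" using kappa_nonzero by simp
  from reflect_Oexp_pm[OF this] show ?thesis by simp
qed

text \<open>The preimage is a multiple of \<open>Phi (reflect H)\<close>, by the inversion formula
  for \<open>reflect H\<close>.\<close>

lemma Phi_surjective:
  assumes H: "H \<in> Oexp_R"
  shows "\<exists>F\<in>Oexp_R. H - Phi F \<in> Oexp_0"
proof -
  note W = fun_subspace_Oexp_entire[of UNIV]
  define P where "P = Phi (reflect H)"
  have P: "P \<in> Oexp_R" unfolding P_def by (intro Phi_Oexp reflect_Oexp H)
  define a where "a = - \<i> * kappa"
  have a: "a \<noteq> 0" using kappa_nonzero by (simp add: a_def)
  have "(\<lambda>z. sc a (H z)) - Phi P \<in> Oexp_0" using Phi_Phi[OF reflect_Oexp[OF H]] by (simp add: P_def a_def)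
  from fun_subspace_scale[OF W this, of "1 / a"]
  have "H - (\<lambda>z. sc (1 / a) (Phi P z)) \<in> Oexp_0" using a by (simp add: fun_diff_def scale_right_diff_distrib)
  from fun_subspace_add[OF W this Phi_scale[OF P, of "1 / a"]]
  have "H - Phi (\<lambda>z. sc (1 / a) (P z)) \<in> Oexp_0" by simp
  thus ?thesis using fun_subspace_scale[OF fun_subspace_Oexp P] by blast
qed

lemma in_sum_left: "fun_subspace sc V' \<Longrightarrow> x \<in> V \<Longrightarrow> x \<in> V + V'"
  and in_sum_right: "fun_subspace sc V \<Longrightarrow> y \<in> V' \<Longrightarrow> y \<in> V + V'"
  using set_plus_intro[of x V 0 V'] set_plus_intro[of 0 V y V'] fun_subspace_zero by auto

text \<open>Changing \<open>G\<close> by \<open>w\<close> in \<open>Oexp_pm\<close> changes the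
  transform by \<open>Phi w\<close>, which is in \<open>FO_pm\<close> modulo
  \<open>Oexp_0\<close>.\<close>

lemma fourier_representatives:
  assumes G: "G \<in> Oexp_R" and G': "G' \<in> G +o Oexp_pm sc p"
    and H: "H \<in> fourier_bv sc p (G' +o Oexp_0)"
  shows "H - Phi G \<in> Oexp_0 + FO_pm sc p"
proof -
  note W0 = fun_subspace_Oexp_entire[of UNIV]
  note W1 = fun_subspace_plus[OF W0 fun_subspace_FO_pm]
  note left = in_sum_left[OF fun_subspace_FO_pm] and right = in_sum_right[OF W0]
  obtain w where w: "w \<in> Oexp_pm sc p" "G' = G + w" using G' by (auto simp: elt_set_plus_def)
  have wA: "w \<in> Oexp_R" using w(1) Oexp_pm_subset by blast
  have G'A: "G' \<in> Oexp_R" unfolding w(2) by (rule fun_subspace_add[OF fun_subspace_Oexp G wA])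
  obtain e where e: "e \<in> Oexp_0" "H = Phi G' + e" using H unfolding fourier_bv_eq[OF G'A] by (auto simp: elt_set_plus_def)
  obtain h where h: "h \<in> FO_pm sc p" "h - Phi w \<in> Oexp_0" using Phi_Oexp_pm[OF w(1)] by blast
  have "(e - ((Phi G + Phi w) - Phi (G + w))) + (h - (h - Phi w)) \<in> Oexp_0 + FO_pm sc p"
    by (intro fun_subspace_add[OF W1] fun_subspace_diff[OF W1] left[OF e(1)] left[OF h(2)] right[OF h(1)] left[OF Phi_add[OF G wA]])
  thus ?thesis by (simp add: e(2) w(2) algebra_simps)
qed

text \<open>Admissibility enters through \<open>slow_growth_representative\<close>, here and in the
  surjectivity of \<open>R_map\<close>.\<close>

lemma hol_quot_space_eq:
  assumes "admissible sc p"
  shows "quot_space (hol_space sc off_real) (hol_entire sc) = quot_space (Oexp_R) (hol_entire sc)"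
proof -
  have "\<exists>F\<in>Oexp_R. f +o hol_entire sc = F +o hol_entire sc" if "f \<in> hol_space sc off_real" for f
    using slow_growth_representative[OF assms that] by (simp add: coset_eq_iff[OF fun_subspace_hol_entire])
  thus ?thesis by (auto simp: quot_space_def OexpD(1))
qed

lemma R_map_iso:
  assumes adm: "admissible sc p"
  shows "quot_lin_iso sc (Oexp_R) (Oexp_pm sc p) (hol_space sc off_real) (hol_entire sc) (R_map sc)"
proof (rule quot_lin_isoI[where V = "Oexp_R" and T = "\<lambda>F. F"])
  show "\<exists>f\<in>Oexp_R. h - f \<in> hol_entire sc" if "h \<in> hol_space sc off_real" for h
    using slow_growth_representative[OF adm that] .
qed (auto simp: R_map_coset OexpD(1) fun_subspace_Oexp fun_subspace_Oexp_pm fun_subspace_hol_entire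
    fun_subspace_zero[OF fun_subspace_hol_entire] Oexp_hol_entire)

lemma R_inv_coset:
  assumes adm: "admissible sc p" and G: "G \<in> Oexp_R"
  shows "R_inv sc p (G +o hol_entire sc) = G +o Oexp_pm sc p"
proof -
  have "inj_on (R_map sc) (quot_space (Oexp_R) (Oexp_pm sc p))" using R_map_iso[OF adm] by (simp add: quot_lin_iso_def bij_betw_def)
  from the_inv_into_f_f[OF this, of "G +o Oexp_pm sc p"] show ?thesis using G by (auto simp: R_inv_def R_map_coset quot_space_def)
qed

text \<open>Both unions in \<open>fourier_B\<close> run over nonempty sets and over coinciding
  classes, so they collapse to one class.\<close>

lemma fourier_B_coset:
  assumes adm: "admissible sc p" and G: "G \<in> Oexp_R"
  shows "fourier_B sc p (G +o hol_entire sc) = Phi G +o (Oexp_0 + FO_pm sc p)"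
proof -
  note W0 = fun_subspace_Oexp_entire[of UNIV]
  note W1 = fun_subspace_plus[OF W0 fun_subspace_FO_pm]
  have "H +o (Oexp_0 + FO_pm sc p) = Phi G +o (Oexp_0 + FO_pm sc p)"
    if "G' \<in> G +o Oexp_pm sc p" "H \<in> fourier_bv sc p (G' +o Oexp_0)" for G' H
    using fourier_representatives[OF G that] by (simp add: coset_eq_iff[OF W1])
  note eq = this
  have G_in: "G \<in> G +o Oexp_pm sc p" using set_plus_intro2[OF fun_subspace_zero[OF fun_subspace_Oexp_pm], of G] by simp
  show ?thesis unfolding fourier_B_def R_inv_coset[OF adm G]
  proof (rule SUP_eq_const)
    show "G +o Oexp_pm sc p \<noteq> {}" using G_in by (metis empty_iff)
    fix G' assume G': "G' \<in> G +o Oexp_pm sc p"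
    then obtain w where "w \<in> Oexp_pm sc p" "G' = G + w" by (auto simp: elt_set_plus_def)
    hence G'A: "G' \<in> Oexp_R" using fun_subspace_add[OF fun_subspace_Oexp G] Oexp_pm_subset by auto
    have "Phi G' \<in> fourier_bv sc p (G' +o Oexp_0)"
      unfolding fourier_bv_eq[OF G'A] using set_plus_intro2[OF fun_subspace_zero[OF W0], of "Phi G'"] by simp
    hence "fourier_bv sc p (G' +o Oexp_0) \<noteq> {}" by (metis empty_iff)
    thus "(\<Union>H\<in>fourier_bv sc p (G' +o Oexp_0). H +o (Oexp_0 + FO_pm sc p)) =
        Phi G +o (Oexp_0 + FO_pm sc p)" by (rule SUP_eq_const) (rule eq[OF G'])
  qed
qed

lemma fourier_B_iso:
  assumes adm: "admissible sc p"
  shows "quot_lin_iso sc (hol_space sc off_real) (hol_entire sc)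
    (Oexp_R) (Oexp_0 + FO_pm sc p) (fourier_B sc p)"
proof (rule quot_lin_isoI[where V = "Oexp_R" and T = Phi])
  note W0 = fun_subspace_Oexp_entire[of UNIV]
  note left = in_sum_left[OF fun_subspace_FO_pm]
  show "fun_subspace sc (Oexp_0 + FO_pm sc p)" by (rule fun_subspace_plus[OF W0 fun_subspace_FO_pm])
  show "\<exists>f\<in>Oexp_R. h - Phi f \<in> Oexp_0 + FO_pm sc p" if "h \<in> Oexp_R" for h
    using Phi_surjective[OF that] left by blast
  show "f \<in> hol_entire sc" if "f \<in> Oexp_R" "Phi f \<in> Oexp_0 + FO_pm sc p" for f
    using Phi_kernel[OF that] Oexp_pm_entire by blast
  show "(Phi f + Phi g) - Phi (f + g) \<in> Oexp_0 + FO_pm sc p"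
    if "f \<in> Oexp_R" "g \<in> Oexp_R" for f g by (rule left[OF Phi_add[OF that]])
  show "(\<lambda>z. sc c (Phi f z)) - Phi (\<lambda>z. sc c (f z)) \<in> Oexp_0 + FO_pm sc p"
    if "f \<in> Oexp_R" for c f by (rule left[OF Phi_scale[OF that]])
qed (simp_all add: fun_subspace_Oexp fun_subspace_hol_entire hol_quot_space_eq[OF adm] fourier_B_coset[OF adm] Phi_Oexp)

end

theorem theorem5p6:
  fixes sc :: "complex \<Rightarrow> 'e::{t2_space,topological_ab_group_add} \<Rightarrow> 'e"
    and p :: "'i \<Rightarrow> 'e \<Rightarrow> real"
  assumes "lcs sc p" and "seq_complete_lcs p" and "admissible sc p"
  shows "(\<forall>F\<in>Oexp sc p UNIV. R_map sc (F +o Oexp_pm sc p) = F +o hol_entire sc) \<and>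
    quot_lin_iso sc (Oexp sc p UNIV) (Oexp_pm sc p)
      (hol_space sc (- finite_part UNIV)) (hol_entire sc) (R_map sc) \<and>
    (\<forall>f\<in>quot_space (hol_space sc (- finite_part UNIV)) (hol_entire sc).
       \<forall>G\<in>R_inv sc p f. \<forall>H\<in>fourier_bv sc p (G +o Oexp_entire sc p UNIV).
         fourier_B sc p f = H +o (Oexp_entire sc p UNIV + FO_pm sc p)) \<and>
    quot_lin_iso sc (hol_space sc (- finite_part UNIV)) (hol_entire sc)
      (Oexp sc p UNIV) (Oexp_entire sc p UNIV + FO_pm sc p) (fourier_B sc p)"
proof -
  interpret sc_lcs sc p using assms(1,2) by (simp add: sc_lcs_def sc_lcs_axioms_def)
  note adm = assms(3)
  note W1 = fun_subspace_plus[OF fun_subspace_Oexp_entire[of UNIV] fun_subspace_FO_pm]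
  \<comment> \<open>Independence of the choices: whichever representatives \<open>G\<close> and
    \<open>H\<close> are taken, the union defining \<open>fourier_B\<close> is the class of
    \<open>H\<close>.\<close>
  have "fourier_B sc p f = H +o (Oexp_entire sc p UNIV + FO_pm sc p)"
    if f: "f \<in> quot_space (hol_space sc off_real) (hol_entire sc)"
      and GH: "G \<in> R_inv sc p f" "H \<in> fourier_bv sc p (G +o Oexp_entire sc p UNIV)" for f G H
  proof -
    obtain F where F: "F \<in> Oexp sc p UNIV" "f = F +o hol_entire sc" using f unfolding hol_quot_space_eq[OF adm] by (auto simp: quot_space_def)
    have "G \<in> F +o Oexp_pm sc p" using GH(1) by (simp add: F(2) R_inv_coset[OF adm F(1)])
    from fourier_representatives[OF F(1) this GH(2)]
    show ?thesis unfolding F(2) fourier_B_coset[OF adm F(1)] coset_eq_iff[OF W1] using fun_subspace_minus[OF W1] by fastforce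
  qed
  thus ?thesis unfolding finite_part_simps(1) using R_map_coset R_map_iso[OF adm] fourier_B_iso[OF adm] by blast
qed
end
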